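(* There is a function $f$ and an algorithm that, given a graph $G$, finds a $d$-box representation of $G$ with $d\le \mathrm{box}(G)+1$ in time $f(\mathrm{pw}(G))\cdot|V(G)|$, where $\mathrm{pw}(G)$ is the pathwidth of $G$.
   Context: A $d$-box is a Cartesian product of $d$ closed real intervals. A $d$-box representation of a graph $G$ assigns to each vertex $v$ a $d$-box $B_v$ such that distinct vertices $u,v$ are adjacent iff $B_u\cap B_v\neq\emptyset$. The boxicity $\mathrm{box}(G)$ is the least $d$ such that $G$ has a $d$-box representation. A path decomposition of $G$ is a sequence of vertex subsets (bags) $W_1,\dots,W_t$ whose union is $V(G)$, such that every edge lies in some bag, and such that if $v\in W_i\cap W_j$ then $v\in W_k$ for all $i\le k\le j$; its width is $\max_i|W_i|-1$, and $\mathrm{pw}(G)$ is the minimum width of a path decomposition of $G$. *)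

theory Defs
  imports Complex_Main "HOL-Library.FuncSet" "Graph_Theory.Pair_Digraph"
begin

section \<open>Boxicity\<close>

text \<open>
  Finite simple graphs are the \<open>pair_graph\<close>s of the library: finite, loop-free, symmetric
  digraphs without parallel arcs. So \<open>{u, v}\<close> is an edge of \<open>G\<close> iff \<open>(u, v) \<in> parcs G\<close>.

  A point of \<open>d\<close>-dimensional real space is an extensional function on \<open>{..<d}\<close>. Closed intervals
  are nonempty. For \<open>d = 0\<close> the space is a single point, which is then the only box, so exactly the
  complete graphs have boxicity \<open>0\<close>.
\<close>

definition is_box :: "nat \<Rightarrow> (nat \<Rightarrow> real) set \<Rightarrow> bool" where
  "is_box d B \<longleftrightarrow> (\<exists>l u. (\<forall>i<d. l i \<le> u i) \<and> B = (\<Pi>\<^sub>E i\<in>{..<d}. {l i..u i}))"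

definition box_representation ::
  "'a pair_pre_digraph \<Rightarrow> nat \<Rightarrow> ('a \<Rightarrow> (nat \<Rightarrow> real) set) \<Rightarrow> bool" where
  "box_representation G d B \<longleftrightarrow>
     (\<forall>v\<in>pverts G. is_box d (B v)) \<and>
     (\<forall>u\<in>pverts G. \<forall>v\<in>pverts G. u \<noteq> v \<longrightarrow> ((u, v) \<in> parcs G \<longleftrightarrow> B u \<inter> B v \<noteq> {}))"

definition boxicity :: "'a pair_pre_digraph \<Rightarrow> nat" where
  "boxicity G = (LEAST d. \<exists>B. box_representation G d B)"

section \<open>Pathwidth\<close>

definition path_decomposition :: "'a pair_pre_digraph \<Rightarrow> 'a set list \<Rightarrow> bool" where
  "path_decomposition G Ws \<longleftrightarrow>
     \<Union> (set Ws) = pverts G \<and>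
     (\<forall>(u, v)\<in>parcs G. \<exists>W\<in>set Ws. u \<in> W \<and> v \<in> W) \<and>
     (\<forall>i j k v. i \<le> k \<and> k \<le> j \<and> j < length Ws \<and> v \<in> Ws ! i \<and> v \<in> Ws ! j \<longrightarrow> v \<in> Ws ! k)"

text \<open>
  For a graph with at least one vertex, some bag is nonempty, so the subtraction does not truncate.
\<close>

definition pd_width :: "'a set list \<Rightarrow> nat" where
  "pd_width Ws = Max (card ` set Ws) - 1"

definition pathwidth :: "'a pair_pre_digraph \<Rightarrow> nat" where
  "pathwidth G = (LEAST k. \<exists>Ws. path_decomposition G Ws \<and> pd_width Ws = k)"

section \<open>Algorithms and running time\<close>

text \<open>
  Algorithms are programs for a word RAM, written as structured programs. A state consists of
  registers, which the program addresses directly (so each program uses finitely many of them), and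
  a memory, which is addressed only through registers. All cells hold natural numbers.

  Every basic operation and every test of a condition costs one time step. The parameter \<open>W\<close> of the
  semantics is the largest number that fits into a machine word, that is, the word length is about
  \<open>log W\<close> bits. An execution that would exceed \<open>W\<close> has no derivation. Without this restriction, unit
  cost for addition would permit arithmetic on numbers of linearly many bits in a single step. The
  program itself does not depend on \<open>W\<close>.
\<close>

datatype prog =
    Skip
  | Const nat nat         \<comment> \<open>\<open>Const r k\<close>: \<open>r := k\<close>\<close>
  | Add nat nat nat       \<comment> \<open>\<open>Add r p q\<close>: \<open>r := p + q\<close>\<close>
  | Sub nat nat nat       \<comment> \<open>\<open>Sub r p q\<close>: \<open>r := max 0 (p - q)\<close>\<close>
  | Load nat nat          \<comment> \<open>\<open>Load r p\<close>: \<open>r := memory[p]\<close>\<close>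
  | Store nat nat         \<comment> \<open>\<open>Store p r\<close>: \<open>memory[p] := r\<close>\<close>
  | Seq prog prog
  | If nat prog prog      \<comment> \<open>tests whether the register is nonzero\<close>
  | While nat prog        \<comment> \<open>repeats as long as the register is nonzero\<close>

type_synonym state = "(nat \<Rightarrow> nat) \<times> (nat \<Rightarrow> nat)"

text \<open>\<open>exec W c s t s'\<close>: started in \<open>s\<close>, program \<open>c\<close> halts in \<open>s'\<close> after exactly \<open>t\<close> steps.\<close>

inductive exec :: "nat \<Rightarrow> prog \<Rightarrow> state \<Rightarrow> nat \<Rightarrow> state \<Rightarrow> bool" for W :: nat where
  Skip: "exec W Skip s 1 s"
| Const: "k \<le> W \<Longrightarrow> exec W (Const r k) (R, M) 1 (R(r := k), M)"
| Add: "R p + R q \<le> W \<Longrightarrow> exec W (Add r p q) (R, M) 1 (R(r := R p + R q), M)"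
| Sub: "exec W (Sub r p q) (R, M) 1 (R(r := R p - R q), M)"
| Load: "M (R p) \<le> W \<Longrightarrow> exec W (Load r p) (R, M) 1 (R(r := M (R p)), M)"
| Store: "exec W (Store p r) (R, M) 1 (R, M(R p := R r))"
| Seq: "exec W c\<^sub>1 s t\<^sub>1 s' \<Longrightarrow> exec W c\<^sub>2 s' t\<^sub>2 s'' \<Longrightarrow> exec W (Seq c\<^sub>1 c\<^sub>2) s (t\<^sub>1 + t\<^sub>2) s''"
| IfTrue: "fst s r \<noteq> 0 \<Longrightarrow> exec W c\<^sub>1 s t s' \<Longrightarrow> exec W (If r c\<^sub>1 c\<^sub>2) s (Suc t) s'"
| IfFalse: "fst s r = 0 \<Longrightarrow> exec W c\<^sub>2 s t s' \<Longrightarrow> exec W (If r c\<^sub>1 c\<^sub>2) s (Suc t) s'"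
| WhileFalse: "fst s r = 0 \<Longrightarrow> exec W (While r c) s 1 s"
| WhileTrue: "fst s r \<noteq> 0 \<Longrightarrow> exec W c s t\<^sub>1 s' \<Longrightarrow> exec W (While r c) s' t\<^sub>2 s'' \<Longrightarrow>
    exec W (While r c) s (Suc (t\<^sub>1 + t\<^sub>2)) s''"

subsection \<open>Input and output conventions\<close>

text \<open>
  The vertices of an input graph are \<open>0, \<dots>, n - 1\<close>, and the graph is given by adjacency lists, in
  which the neighbours of a vertex may appear in any order.
\<close>

definition adjacency_lists :: "nat pair_pre_digraph \<Rightarrow> nat list list \<Rightarrow> bool" where
  "adjacency_lists G adj \<longleftrightarrow>
     pverts G = {..<length adj} \<and>
     (\<forall>v<length adj. distinct (adj ! v) \<and> set (adj ! v) = {w. (v, w) \<in> parcs G})"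

text \<open>
  The adjacency lists are laid out in memory one after the other, preceded by \<open>n\<close> and by
  \<open>n + 1\<close> pointers: the list of vertex \<open>v\<close> occupies the addresses from \<open>memory[1 + v]\<close> up to, but
  not including, \<open>memory[2 + v]\<close>. All other memory cells and all registers are initially \<open>0\<close>.
\<close>

definition input_words :: "nat list list \<Rightarrow> nat list" where
  "input_words adj =
     length adj #
     map (\<lambda>v. length adj + 2 + length (concat (take v adj))) [0..<length adj + 1] @
     concat adj"

definition initial_state :: "nat list list \<Rightarrow> state" where
  "initial_state adj =
     (\<lambda>_. 0, \<lambda>a. if a < length (input_words adj) then input_words adj ! a else 0)"

text \<open>
  The output consists of the dimension \<open>d\<close>, found in register \<open>0\<close>, and a block of \<open>2 * d * n\<close> memory
  cells starting at the address in register \<open>1\<close>. It lists, vertex by vertex and for each vertex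
  coordinate by coordinate, the lower and the upper interval endpoint. If some lower endpoint
  exceeds the upper one, the resulting set is empty and hence not a box.
\<close>

fun output_dim :: "state \<Rightarrow> nat" where
  "output_dim (R, M) = R 0"

fun output_box :: "state \<Rightarrow> nat \<Rightarrow> (nat \<Rightarrow> real) set" where
  "output_box (R, M) v =
     (\<Pi>\<^sub>E i\<in>{..<R 0}.
        {real (M (R 1 + 2 * (R 0 * v + i)))..real (M (R 1 + 2 * (R 0 * v + i) + 1))})"

section \<open>Well-definedness\<close>

inductive_cases exec_SkipE: "exec W Skip s t s'"
inductive_cases exec_ConstE: "exec W (Const r k) s t s'"
inductive_cases exec_AddE: "exec W (Add r p q) s t s'"
inductive_cases exec_SubE: "exec W (Sub r p q) s t s'"
inductive_cases exec_LoadE: "exec W (Load r p) s t s'"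
inductive_cases exec_StoreE: "exec W (Store p r) s t s'"
inductive_cases exec_SeqE: "exec W (Seq c\<^sub>1 c\<^sub>2) s t s'"
inductive_cases exec_IfE: "exec W (If r c\<^sub>1 c\<^sub>2) s t s'"
inductive_cases exec_WhileE: "exec W (While r c) s t s'"

lemma exec_deterministic:
  "exec W c s t s' \<Longrightarrow> exec W c s t' s'' \<Longrightarrow> t' = t \<and> s'' = s'"
proof (induction arbitrary: t' s'' rule: exec.induct)
  case Skip then show ?case by (auto elim: exec_SkipE)
next
  case Const then show ?case by (auto elim: exec_ConstE)
next
  case Add then show ?case by (auto elim: exec_AddE)
next
  case Sub then show ?case by (auto elim: exec_SubE)
next
  case Load then show ?case by (auto elim: exec_LoadE)
next
  case Store then show ?case by (auto elim: exec_StoreE)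
next
  case Seq
  from Seq.prems show ?case by (rule exec_SeqE) (use Seq.IH in metis)
next
  case IfTrue
  from IfTrue.prems show ?case by (rule exec_IfE) (use IfTrue.IH IfTrue.hyps in \<open>metis less_irrefl\<close>)+
next
  case IfFalse
  from IfFalse.prems show ?case by (rule exec_IfE) (use IfFalse.IH IfFalse.hyps in \<open>metis less_irrefl\<close>)+
next
  case WhileFalse
  from WhileFalse.prems show ?case by (rule exec_WhileE) (use WhileFalse.hyps in auto)
next
  case (WhileTrue s r c t\<^sub>1 s' t\<^sub>2 s\<^sub>2)
  from WhileTrue.prems show ?case
  proof (rule exec_WhileE)
    fix u\<^sub>1 r' u\<^sub>2
    assume "t' = Suc (u\<^sub>1 + u\<^sub>2)" "exec W c s u\<^sub>1 r'" "exec W (While r c) r' u\<^sub>2 s''"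
    then show ?thesis using WhileTrue.IH by metis
  qed (use WhileTrue.hyps in \<open>metis less_irrefl\<close>)
qed

lemma pathwidth_attained:
  assumes "pair_graph G"
  shows "\<exists>Ws. path_decomposition G Ws \<and> pd_width Ws = pathwidth G"
proof -
  interpret pair_graph G by fact
  have "path_decomposition G [pverts G]"
    by (auto simp: path_decomposition_def dest: wellformed')
  then have "\<exists>k Ws. path_decomposition G Ws \<and> pd_width Ws = k" by blast
  then show ?thesis unfolding pathwidth_def by (rule LeastI_ex)
qed

lemma boxicity_attained:
  assumes "pair_graph G"
  shows "\<exists>B. box_representation G (boxicity G) B"
proof -
  interpret pair_graph G by fact
  obtain zs where zs: "set zs = pverts G"
    using finite_list[OF pair_finite_verts] by blast
  define l where "l v i = (if v = zs ! i \<or> (v, zs ! i) \<in> parcs G then 0 else 1 :: real)" for v i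
  define u where "u v i = (if v = zs ! i then 0 else 1 :: real)" for v i
  define B where "B v = (\<Pi>\<^sub>E i\<in>{..<length zs}. {l v i..u v i})" for v
  have lu: "l v i \<le> u v i" for v i by (auto simp: l_def u_def)
  have sym: "(v, w) \<in> parcs G \<Longrightarrow> (w, v) \<in> parcs G" for v w
    using pair_sym_arcs by (auto simp: symmetric_def dest: symD)
  have box: "is_box (length zs) (B v)" for v
    unfolding is_box_def B_def using lu by blast
  have adj: "(v, w) \<in> parcs G \<longleftrightarrow> B v \<inter> B w \<noteq> {}" if "v \<in> pverts G" "w \<in> pverts G" "v \<noteq> w" for v w
  proof
    assume e: "(v, w) \<in> parcs G"
    define x where "x = restrict (\<lambda>i. max (l v i) (l w i)) {..<length zs}"
    have "x \<in> B v \<inter> B w"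
      using e sym[OF e] \<open>v \<noteq> w\<close> by (auto simp: x_def B_def l_def u_def)
    then show "B v \<inter> B w \<noteq> {}" by blast
  next
    assume "B v \<inter> B w \<noteq> {}"
    then obtain x where x: "x \<in> B v" "x \<in> B w" by blast
    obtain i where i: "i < length zs" "zs ! i = w"
      using \<open>w \<in> pverts G\<close> unfolding zs[symmetric] in_set_conv_nth by blast
    have "l v i \<le> x i" "x i \<le> u w i" using x i by (auto simp: B_def PiE_iff)
    then show "(v, w) \<in> parcs G" using i that by (auto simp: l_def u_def split: if_splits)
  qed
  have "box_representation G (length zs) B"
    unfolding box_representation_def using box adj by blast
  then have "\<exists>d B. box_representation G d B" by blast
  then show ?thesis unfolding boxicity_def by (rule LeastI_ex)
qed

end

theory Submission
  imports Defs "HOL-Library.Product_Lexorder"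
begin

text \<open>Following Cattell, Dinneen and Fellows, vertices are placed on a binary tree whose children are
  neighbours of their parents; a vertex is removed when all its neighbours have been placed. Connected
  branch sets exhibit the tree as a minor, so that its size is bounded in terms of the pathwidth, and
  its successive contents are the bags of a path decomposition with at most that width.

  On this decomposition, a dynamic program computes the least \<open>d\<close> for which every bag has a \<open>d\<close>-box
  representation, given by a linear order of the endpoints, such that successive bags agree on
  their common vertices. Then \<open>d\<close> is at most the boxicity. Linear orders that agree on the common
  vertices amalgamate: every new endpoint is inserted in one global list right after its
  predecessor in the order of the bag. The resulting intervals represent the adjacency of any two vertices
  that share a bag. In one further dimension, every vertex gets the interval of the bags
  that contain it, which separates all other pairs.\<close>

section \<open>A structured language on top of the RAM\<close>

text \<open>A width bounded in terms of the pathwidth is enough, since a state of the dynamic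
  program describes a single bag. Such a state cannot force apart two vertices without a common bag.
  Dropping this demand leaves a lower bound on the boxicity, and the extra dimension makes up for
  it: the intervals from the first to the last bag meet exactly for pairs with a common bag.

  Orders of endpoints replace coordinates because a bag has boundedly many of them and because
  inserting an endpoint never changes how older ones compare. The search for \<open>d\<close> is
  bounded since as many dimensions as slots always suffice locally.

  The constant behind all bounds comes from complete binary trees: every two levels force one more
  vertex into some bag of any path decomposition. If a decomposition with bags of at most
  \<open>k\<close> vertices exists, a tree whose least incomplete position is served first has
  positions up to \<open>2 ^ (2 * k + 1)\<close> only. The number \<open>k\<close> occurs in the
  analysis alone; the program never learns the pathwidth and measures its tree instead.\<close>

datatype exp =
    Num nat
  | Var nat
  | Idx nat
  | EAdd exp exp
  | ESub exp exp
  | Ite exp exp exp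
  | Arr nat exp
  | SumLt nat nat exp

type_synonym arrays = "nat \<Rightarrow> nat \<Rightarrow> nat"

text \<open>The bounded sum is the only binder. Quantifiers, least witnesses, products and division
  are all expressed by it, so a single loop in the expression compiler serves every local search of
  the program.\<close>

fun ev :: "(nat \<Rightarrow> nat) \<Rightarrow> arrays \<Rightarrow> (nat \<Rightarrow> nat) \<Rightarrow> exp \<Rightarrow> nat" where
  "ev R A l (Num c) = c"
| "ev R A l (Var x) = R x"
| "ev R A l (Idx j) = l j"
| "ev R A l (EAdd a b) = ev R A l a + ev R A l b"
| "ev R A l (ESub a b) = ev R A l a - ev R A l b"
| "ev R A l (Ite c a b) = (if ev R A l c \<noteq> 0 then ev R A l a else ev R A l b)"
| "ev R A l (Arr k a) = A k (ev R A l a)"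
| "ev R A l (SumLt j y a) = (\<Sum>i<R y. ev R A (l(j := i)) a)"

text \<open>The values of the small variables are bounded in terms of the pathwidth alone. Only they
  limit sums, so that an expression is evaluated in a time independent of the graph.\<close>

definition small :: "nat \<Rightarrow> bool" where
  "small x \<longleftrightarrow> 50 \<le> x \<and> x < 100"

fun wf_exp :: "nat set \<Rightarrow> exp \<Rightarrow> bool" where
  "wf_exp J (Num c) = True"
| "wf_exp J (Var x) = (x < 100)"
| "wf_exp J (Idx j) = (j \<in> J)"
| "wf_exp J (EAdd a b) = (wf_exp J a \<and> wf_exp J b)"
| "wf_exp J (ESub a b) = (wf_exp J a \<and> wf_exp J b)"
| "wf_exp J (Ite c a b) = (wf_exp J c \<and> wf_exp J a \<and> wf_exp J b)"
| "wf_exp J (Arr k a) = (k < 16 \<and> wf_exp J a)"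
| "wf_exp J (SumLt j y a) = (small y \<and> j < 50 \<and> j \<notin> J \<and> wf_exp (insert j J) a)"

text \<open>One function bounds both the running time and, relative to the largest stored number, all
  intermediate values; \<open>b\<close> bounds the upper limits of the sums.\<close>

fun exp_cost :: "nat \<Rightarrow> exp \<Rightarrow> nat" where
  "exp_cost b (Num c) = c + 1"
| "exp_cost b (Var x) = 2"
| "exp_cost b (Idx j) = 2"
| "exp_cost b (EAdd a c) = exp_cost b a + exp_cost b c + 1"
| "exp_cost b (ESub a c) = exp_cost b a + exp_cost b c + 1"
| "exp_cost b (Ite c d e) = exp_cost b c + exp_cost b d + exp_cost b e + 1"
| "exp_cost b (Arr k a) = 16 * exp_cost b a + k + 20"
| "exp_cost b (SumLt j y a) = (b + 1) * (exp_cost b a + 10)"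

text \<open>Registers: \<open>0, \<dots>, 99\<close> are the variables of the language, \<open>100\<close> holds the first free address,
  \<open>101, \<dots>, 150\<close> are the summation indices, and the others are scratch.\<close>

definition move :: "nat \<Rightarrow> nat \<Rightarrow> prog" where
  "move r p = Seq (Const r 0) (Add r r p)"

text \<open>Four doublings replace the multiplication by 16 that the machine does not offer; 16
  arrays are interleaved from the address in register 100 on.\<close>

definition array_address :: "nat \<Rightarrow> nat \<Rightarrow> prog" where
  "array_address a k = Seq (Add k k k) (Seq (Add k k k) (Seq (Add k k k) (Seq (Add k k k)
     (Seq (Add k k 100) (Seq (Const (Suc k) a) (Add k k (Suc k)))))))"

text \<open>The scratch registers form a stack with top \<open>k\<close>: the result is left in
  \<open>k\<close>, and operands evaluated later use higher registers. In a sum,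
  \<open>Suc k\<close> holds in turn the number of remaining rounds, the summand and the constant
  1.\<close>

fun compile_exp :: "nat \<Rightarrow> exp \<Rightarrow> prog" where
  "compile_exp k (Num c) = Const k c"
| "compile_exp k (Var x) = move k x"
| "compile_exp k (Idx j) = move k (101 + j)"
| "compile_exp k (EAdd a b) = Seq (compile_exp k a) (Seq (compile_exp (Suc k) b) (Add k k (Suc k)))"
| "compile_exp k (ESub a b) = Seq (compile_exp k a) (Seq (compile_exp (Suc k) b) (Sub k k (Suc k)))"
| "compile_exp k (Ite c a b) = Seq (compile_exp k c) (If k (compile_exp k a) (compile_exp k b))"
| "compile_exp k (Arr a e) = Seq (compile_exp k e) (Seq (array_address a k) (Load k k))"
| "compile_exp k (SumLt j y a) =
     Seq (Const k 0) (Seq (Const (101 + j) 0) (Seq (Sub (Suc k) y (101 + j))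
       (While (Suc k) (Seq (compile_exp (Suc k) a) (Seq (Add k k (Suc k)) (Seq (Const (Suc k) 1)
         (Seq (Add (101 + j) (101 + j) (Suc k)) (Sub (Suc k) y (101 + j)))))))))"

section \<open>Correctness of compiled expressions\<close>

lemma exec_Const': "k \<le> W \<Longrightarrow> exec W (Const r k) s 1 ((fst s)(r := k), snd s)"
  using exec.Const[of k W r "fst s" "snd s"] by simp
lemma exec_Add': "fst s p + fst s q \<le> W \<Longrightarrow>
    exec W (Add r p q) s 1 ((fst s)(r := fst s p + fst s q), snd s)"
  using exec.Add[of "fst s" p q W r "snd s"] by simp
lemma exec_Sub': "exec W (Sub r p q) s 1 ((fst s)(r := fst s p - fst s q), snd s)"
  using exec.Sub[of W r p q "fst s" "snd s"] by simp
lemma exec_Load': "snd s (fst s p) \<le> W \<Longrightarrow>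
    exec W (Load r p) s 1 ((fst s)(r := snd s (fst s p)), snd s)"
  using exec.Load[of "snd s" "fst s" p W r] by simp
lemma exec_Store': "exec W (Store p r) s 1 (fst s, (snd s)(fst s p := fst s r))"
  using exec.Store[of W p r "fst s" "snd s"] by simp

lemma exec_move:
  assumes "r \<noteq> p" "fst s p \<le> W"
  shows "exec W (move r p) s 2 ((fst s)(r := fst s p), snd s)"
proof -
  have "exec W (move r p) s (1 + 1) ((fst s)(r := fst s p), snd s)"
    unfolding move_def
    apply (rule exec.Seq, rule exec_Const', simp)
    apply (rule back_subst[of "exec W _ _ _"], rule exec_Add')
    using assms by auto
  then show ?thesis by (simp add: numeral_2_eq_2)
qed

lemma exec_array_address:
  assumes "k > 100" "fst s 100 + 16 * fst s k + a \<le> W"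
  shows "exec W (array_address a k) s 7
    ((fst s)(k := fst s 100 + 16 * fst s k + a, Suc k := a), snd s)"
proof -
  have "exec W (array_address a k) s (1 + (1 + (1 + (1 + (1 + (1 + 1))))))
    ((fst s)(k := fst s 100 + 16 * fst s k + a, Suc k := a), snd s)"
    unfolding array_address_def
    apply (rule exec.Seq, rule exec_Add', use assms in simp)
    apply (rule exec.Seq, rule exec_Add', use assms in simp)
    apply (rule exec.Seq, rule exec_Add', use assms in simp)
    apply (rule exec.Seq, rule exec_Add', use assms in simp)
    apply (rule exec.Seq, rule exec_Add', use assms in simp)
    apply (rule exec.Seq, rule exec_Const', use assms in simp)
    apply (rule back_subst[of "exec W _ _ _"], rule exec_Add', use assms in simp)
    using assms by (auto simp: fun_eq_iff)
  then show ?thesis by (simp add: numeral_eq_Suc)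
qed

text \<open>Array \<open>a\<close> occupies the addresses \<open>F + a, F + 16 + a, F + 32 + a, \<dots>\<close>, so that
  all arrays can grow without bound.\<close>

definition array_view :: "nat \<Rightarrow> (nat \<Rightarrow> nat) \<Rightarrow> arrays" where
  "array_view F M a i = M (F + 16 * i + a)"

text \<open>\<open>F\<close> is the first address behind the input, \<open>m\<close> bounds all
  stored numbers and \<open>b\<close> the small variables. In the application, \<open>m\<close> is
  linear in the number of vertices, while \<open>b\<close> depends on the pathwidth only.\<close>

locale machine =
  fixes F m b :: nat and inp :: "nat \<Rightarrow> nat"
  assumes F_le: "F \<le> m" and b_le: "b \<le> m" and m_pos: "1 \<le> m"
begin

text \<open>The frame carries the induction: registers below \<open>k\<close> keep the first operand
  while the second is evaluated, and the indices in \<open>J\<close> survive because well-formed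
  inner sums bind other ones. As one factor bounds both steps and values, the hypothesis on
  \<open>W\<close> passes to subexpressions.\<close>

lemma compile_exp_correct:
  assumes "wf_exp J e" "k \<ge> 151" "exp_cost b e * m \<le> W"
    and "\<forall>x<100. Rr x = R x \<and> R x \<le> m" "\<forall>y. small y \<longrightarrow> R y \<le> b" "Rr 100 = F"
    and "\<forall>a<16. \<forall>i. array_view F M a i = A a i \<and> A a i \<le> m"
    and "\<forall>j\<in>J. j < 50 \<and> Rr (101 + j) = l j \<and> l j \<le> m"
  shows "\<exists>t Rr'. exec W (compile_exp k e) (Rr, M) t (Rr', M) \<and> t \<le> exp_cost b e \<and>
    Rr' k = ev R A l e \<and> ev R A l e \<le> exp_cost b e * m \<and>
    (\<forall>r. r < 101 \<or> (151 \<le> r \<and> r < k) \<or> (\<exists>j\<in>J. r = 101 + j) \<longrightarrow> Rr' r = Rr r)"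
  using assms
proof (induction e arbitrary: J k Rr l)
  case (Num c)
  have "c \<le> W" using Num.prems(3) m_pos
    by (metis add_leD1 exp_cost.simps(1) le_trans mult.right_neutral mult_le_mono2)
  then have "exec W (compile_exp k (Num c)) (Rr, M) 1 (Rr(k := c), M)"
    using exec_Const'[of c W k "(Rr,M)"] by simp
  moreover have "c \<le> (c+1) * m" using m_pos by (cases m) auto
  ultimately show ?case using Num.prems
    apply (intro exI conjI)
    apply assumption
    apply auto
    done
next
  case (Var x)
  have "exec W (compile_exp k (Var x)) (Rr, M) 2 (Rr(k := R x), M)"
    using exec_move[of k x "(Rr,M)" W] Var.prems by (auto simp: le_trans)
  moreover have "R x \<le> 2 * m" using Var.prems by (auto simp: trans_le_add1)
  ultimately show ?case using Var.prems
    apply (intro exI conjI)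
    apply assumption
    apply auto
    done
next
  case (Idx j)
  have *: "Rr (101 + j) = l j" "l j \<le> m" "j < 50" using Idx.prems by auto
  have "exec W (compile_exp k (Idx j)) (Rr, M) 2 (Rr(k := l j), M)"
    using exec_move[of k "101+j" "(Rr,M)" W] Idx.prems * by (auto simp: le_trans)
  then show ?case using Idx.prems *
    apply (intro exI conjI)
    apply assumption
    apply auto
    done
next
  case (EAdd e1 e2)
  have W1: "exp_cost b e1 * m \<le> W" "exp_cost b e2 * m \<le> W"
    using EAdd.prems(3) by (auto simp: algebra_simps)
  obtain t1 R1 where 1: "exec W (compile_exp k e1) (Rr, M) t1 (R1, M)" "t1 \<le> exp_cost b e1"
    "R1 k = ev R A l e1" "ev R A l e1 \<le> exp_cost b e1 * m"
    "\<forall>r. r < 101 \<or> (151 \<le> r \<and> r < k) \<or> (\<exists>j\<in>J. r = 101 + j) \<longrightarrow> R1 r = Rr r"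
    using EAdd.IH(1)[of J k Rr l] EAdd.prems W1 by auto
  have "\<exists>t Rr'. exec W (compile_exp (Suc k) e2) (R1, M) t (Rr', M) \<and> t \<le> exp_cost b e2 \<and>
    Rr' (Suc k) = ev R A l e2 \<and> ev R A l e2 \<le> exp_cost b e2 * m \<and>
    (\<forall>r. r < 101 \<or> (151 \<le> r \<and> r < Suc k) \<or> (\<exists>j\<in>J. r = 101 + j) \<longrightarrow> Rr' r = R1 r)"
    by (rule EAdd.IH(2)) (use EAdd.prems W1 1 in auto)
  then obtain t2 R2 where 2: "exec W (compile_exp (Suc k) e2) (R1, M) t2 (R2, M)" "t2 \<le> exp_cost b e2"
    "R2 (Suc k) = ev R A l e2" "ev R A l e2 \<le> exp_cost b e2 * m"
    "\<forall>r. r < 101 \<or> (151 \<le> r \<and> r < Suc k) \<or> (\<exists>j\<in>J. r = 101 + j) \<longrightarrow> R2 r = R1 r" by blast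
  have k2: "R2 k = ev R A l e1" using 2(5) 1(3) EAdd.prems by auto
  have v: "ev R A l e1 + ev R A l e2 \<le> exp_cost b (EAdd e1 e2) * m"
    using 1(4) 2(4) by (simp add: algebra_simps)
  have "exec W (compile_exp k (EAdd e1 e2)) (Rr, M) (t1 + (t2 + 1))
    (R2(k := ev R A l e1 + ev R A l e2), M)"
    unfolding compile_exp.simps
    apply (rule exec.Seq[OF 1(1)], rule exec.Seq[OF 2(1)])
    using exec_Add'[of "(R2,M)" k "Suc k" W k] k2 2(3) v EAdd.prems(3) by simp
  then show ?case
    using 1 2 v EAdd.prems apply (intro exI conjI) apply assumption apply auto done
next
  case (ESub e1 e2)
  have W1: "exp_cost b e1 * m \<le> W" "exp_cost b e2 * m \<le> W"
    using ESub.prems(3) by (auto simp: algebra_simps)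
  obtain t1 R1 where 1: "exec W (compile_exp k e1) (Rr, M) t1 (R1, M)" "t1 \<le> exp_cost b e1"
    "R1 k = ev R A l e1" "ev R A l e1 \<le> exp_cost b e1 * m"
    "\<forall>r. r < 101 \<or> (151 \<le> r \<and> r < k) \<or> (\<exists>j\<in>J. r = 101 + j) \<longrightarrow> R1 r = Rr r"
    using ESub.IH(1)[of J k Rr l] ESub.prems W1 by auto
  have "\<exists>t Rr'. exec W (compile_exp (Suc k) e2) (R1, M) t (Rr', M) \<and> t \<le> exp_cost b e2 \<and>
    Rr' (Suc k) = ev R A l e2 \<and> ev R A l e2 \<le> exp_cost b e2 * m \<and>
    (\<forall>r. r < 101 \<or> (151 \<le> r \<and> r < Suc k) \<or> (\<exists>j\<in>J. r = 101 + j) \<longrightarrow> Rr' r = R1 r)"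
    by (rule ESub.IH(2)) (use ESub.prems W1 1 in auto)
  then obtain t2 R2 where 2: "exec W (compile_exp (Suc k) e2) (R1, M) t2 (R2, M)" "t2 \<le> exp_cost b e2"
    "R2 (Suc k) = ev R A l e2" "ev R A l e2 \<le> exp_cost b e2 * m"
    "\<forall>r. r < 101 \<or> (151 \<le> r \<and> r < Suc k) \<or> (\<exists>j\<in>J. r = 101 + j) \<longrightarrow> R2 r = R1 r" by blast
  have k2: "R2 k = ev R A l e1" using 2(5) 1(3) ESub.prems by auto
  have v: "ev R A l e1 - ev R A l e2 \<le> exp_cost b (ESub e1 e2) * m"
    using 1(4) 2(4) by (simp add: algebra_simps)
  have "exec W (compile_exp k (ESub e1 e2)) (Rr, M) (t1 + (t2 + 1))
    (R2(k := ev R A l e1 - ev R A l e2), M)"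
    unfolding compile_exp.simps
    apply (rule exec.Seq[OF 1(1)], rule exec.Seq[OF 2(1)])
    using exec_Sub'[of W k k "Suc k" "(R2,M)"] k2 2(3) by simp
  then show ?case
    using 1 2 v ESub.prems apply (intro exI conjI) apply assumption apply auto done
next
  case (Ite c e1 e2)
  have W1: "exp_cost b c * m \<le> W" "exp_cost b e1 * m \<le> W" "exp_cost b e2 * m \<le> W"
    using Ite.prems(3) by (auto simp: algebra_simps)
  obtain t1 R1 where 1: "exec W (compile_exp k c) (Rr, M) t1 (R1, M)" "t1 \<le> exp_cost b c"
    "R1 k = ev R A l c"
    "\<forall>r. r < 101 \<or> (151 \<le> r \<and> r < k) \<or> (\<exists>j\<in>J. r = 101 + j) \<longrightarrow> R1 r = Rr r"
    using Ite.IH(1)[of J k Rr l] Ite.prems W1 by auto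
  show ?case
  proof (cases "ev R A l c = 0")
    case False
    have "\<exists>t Rr'. exec W (compile_exp k e1) (R1, M) t (Rr', M) \<and> t \<le> exp_cost b e1 \<and>
      Rr' k = ev R A l e1 \<and> ev R A l e1 \<le> exp_cost b e1 * m \<and>
      (\<forall>r. r < 101 \<or> (151 \<le> r \<and> r < k) \<or> (\<exists>j\<in>J. r = 101 + j) \<longrightarrow> Rr' r = R1 r)"
      by (rule Ite.IH(2)) (use Ite.prems W1 1 in auto)
    then obtain t2 R2 where 2: "exec W (compile_exp k e1) (R1, M) t2 (R2, M)" "t2 \<le> exp_cost b e1"
      "R2 k = ev R A l e1" "ev R A l e1 \<le> exp_cost b e1 * m"
      "\<forall>r. r < 101 \<or> (151 \<le> r \<and> r < k) \<or> (\<exists>j\<in>J. r = 101 + j) \<longrightarrow> R2 r = R1 r" by blast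
    have "exec W (compile_exp k (Ite c e1 e2)) (Rr, M) (t1 + Suc t2) (R2, M)"
      unfolding compile_exp.simps
      by (rule exec.Seq[OF 1(1)], rule exec.IfTrue[OF _ 2(1)]) (use False 1(3) in auto)
    moreover have "ev R A l e1 \<le> exp_cost b (Ite c e1 e2) * m" using 2(4) by (simp add: algebra_simps)
    ultimately show ?thesis using 1 2 False
      by (intro exI[of _ "t1 + Suc t2"] exI[of _ R2]) auto
  next
    case True
    have "\<exists>t Rr'. exec W (compile_exp k e2) (R1, M) t (Rr', M) \<and> t \<le> exp_cost b e2 \<and>
      Rr' k = ev R A l e2 \<and> ev R A l e2 \<le> exp_cost b e2 * m \<and>
      (\<forall>r. r < 101 \<or> (151 \<le> r \<and> r < k) \<or> (\<exists>j\<in>J. r = 101 + j) \<longrightarrow> Rr' r = R1 r)"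
      by (rule Ite.IH(3)) (use Ite.prems W1 1 in auto)
    then obtain t2 R2 where 2: "exec W (compile_exp k e2) (R1, M) t2 (R2, M)" "t2 \<le> exp_cost b e2"
      "R2 k = ev R A l e2" "ev R A l e2 \<le> exp_cost b e2 * m"
      "\<forall>r. r < 101 \<or> (151 \<le> r \<and> r < k) \<or> (\<exists>j\<in>J. r = 101 + j) \<longrightarrow> R2 r = R1 r" by blast
    have "exec W (compile_exp k (Ite c e1 e2)) (Rr, M) (t1 + Suc t2) (R2, M)"
      unfolding compile_exp.simps
      by (rule exec.Seq[OF 1(1)], rule exec.IfFalse[OF _ 2(1)]) (use True 1(3) in auto)
    moreover have "ev R A l e2 \<le> exp_cost b (Ite c e1 e2) * m" using 2(4) by (simp add: algebra_simps)
    ultimately show ?thesis using 1 2 True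
      by (intro exI[of _ "t1 + Suc t2"] exI[of _ R2]) auto
  qed
next
  case (Arr a e)
  \<comment> \<open>An address is \<open>F\<close> plus 16 times the index plus the array number;
    the clause for arrays in \<open>exp_cost\<close> leaves room for all three.\<close>
  have W1: "exp_cost b e * m \<le> W" "m + 16 * (exp_cost b e * m) + a \<le> W"
  proof -
    have "a \<le> a * m" using m_pos by (cases m) auto
    then have "m + 16 * (exp_cost b e * m) + a \<le> exp_cost b (Arr a e) * m"
      unfolding exp_cost.simps add_mult_distrib by linarith
    then show "m + 16 * (exp_cost b e * m) + a \<le> W" using Arr.prems(3) by linarith
    then show "exp_cost b e * m \<le> W" by linarith
  qed
  obtain t1 R1 where 1: "exec W (compile_exp k e) (Rr, M) t1 (R1, M)" "t1 \<le> exp_cost b e"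
    "R1 k = ev R A l e" "ev R A l e \<le> exp_cost b e * m"
    "\<forall>r. r < 101 \<or> (151 \<le> r \<and> r < k) \<or> (\<exists>j\<in>J. r = 101 + j) \<longrightarrow> R1 r = Rr r"
    using Arr.IH[of J k Rr l] Arr.prems W1 by auto
  have R100: "R1 100 = F" using 1(5) Arr.prems by auto
  have addr: "F + 16 * ev R A l e + a \<le> W" using W1(2) 1(4) F_le by linarith
  have val: "M (F + 16 * ev R A l e + a) = A a (ev R A l e)" "A a (ev R A l e) \<le> m"
    using Arr.prems by (auto simp: array_view_def)
  have "exec W (compile_exp k (Arr a e)) (Rr, M) (t1 + (7 + 1))
    (R1(k := A a (ev R A l e), Suc k := a), M)"
    unfolding compile_exp.simps
    apply (rule exec.Seq[OF 1(1)], rule exec.Seq[OF exec_array_address])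
    using Arr.prems addr R100 1(3) apply (simp_all)[2]
    apply (rule back_subst[of "exec W _ _ _"], rule exec_Load')
    using R100 1(3) val W1 apply (auto simp: fun_eq_iff)
    done
  moreover have "A a (ev R A l e) \<le> exp_cost b (Arr a e) * m"
    using val(2) by (simp add: algebra_simps)
  ultimately show ?case using 1 Arr.prems
    apply (intro exI conjI) apply assumption apply auto done
next
  case (SumLt j y e)
  let ?c = "exp_cost b e"
  define n where "n = R y"
  have n: "n \<le> b" "y < 100" "Rr y = n" using SumLt.prems by (auto simp: n_def small_def)
  have j: "j < 50" "j \<notin> J" using SumLt.prems by auto
  have big: "b * (?c * m) + 10 * m + ?c * m \<le> W"
    using SumLt.prems(3) by (simp add: algebra_simps)
  have m1: "1 \<le> W" "m \<le> W" "?c * m \<le> W" using big m_pos by auto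
  define f where "f i = ev R A (l(j := i)) e" for i
  let ?body = "Seq (compile_exp (Suc k) e) (Seq (Add k k (Suc k)) (Seq (Const (Suc k) 1)
         (Seq (Add (101 + j) (101 + j) (Suc k)) (Sub (Suc k) y (101 + j)))))"
  define frame where "frame R' \<longleftrightarrow> (\<forall>r. r < 101 \<or> (151 \<le> r \<and> r < k) \<or> (\<exists>j\<in>J. r = 101 + j) \<longrightarrow> R' r = Rr r)" for R'
  \<comment> \<open>Only the value bound of the induction hypothesis is used here, to control the
    partial sums before the loop is run.\<close>
  have f_le: "f i \<le> ?c * m" if "i < n" for i
  proof -
    have "\<exists>t Rr'. exec W (compile_exp k e) (Rr(101+j := i), M) t (Rr', M) \<and> t \<le> ?c \<and>
      Rr' k = f i \<and> f i \<le> ?c * m \<and>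
      (\<forall>r. r < 101 \<or> (151 \<le> r \<and> r < k) \<or> (\<exists>j\<in>insert j J. r = 101 + j) \<longrightarrow> Rr' r = (Rr(101+j := i)) r)"
      unfolding f_def
      apply (rule SumLt.IH) using SumLt.prems m1 that n j b_le by (auto)
    then show ?thesis by blast
  qed
  have sum_le: "(\<Sum>i<q. f i) \<le> q * (?c * m)" if "q \<le> n" for q
    using sum_bounded_above[of "{..<q}" f "?c * m"] f_le that by auto
  \<comment> \<open>The induction is on the number \<open>p\<close> of remaining rounds, which is
    what the test register \<open>Suc k\<close> contains at the start of a round.\<close>
  have loop: "\<exists>t R'. exec W (While (Suc k) ?body) (R1, M) t (R', M) \<and> t \<le> p * (?c + 5) + 1 \<and>
      R' k = (\<Sum>i<n. f i) \<and> frame R'"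
    if "frame R1" "R1 (101 + j) = n - p" "p \<le> n" "R1 k = (\<Sum>i<n-p. f i)" "R1 (Suc k) = p" for p R1
    using that
  proof (induction p arbitrary: R1)
    case 0
    have "exec W (While (Suc k) ?body) (R1, M) 1 (R1, M)" by (rule exec.WhileFalse) (use 0 in simp)
    then show ?case using 0 by (intro exI[of _ "1::nat"] exI[of _ R1]) simp
  next
    case (Suc p)
    define i where "i = n - Suc p"
    have i: "i < n" "n - p = Suc i" using Suc.prems by (auto simp: i_def)
    have fr: "\<forall>r. r < 101 \<or> (151 \<le> r \<and> r < k) \<or> (\<exists>j\<in>J. r = 101 + j) \<longrightarrow> R1 r = Rr r"
      using Suc.prems(1) by (simp add: frame_def)
    have "\<exists>t Rr'. exec W (compile_exp (Suc k) e) (R1, M) t (Rr', M) \<and> t \<le> ?c \<and>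
      Rr' (Suc k) = f i \<and> f i \<le> ?c * m \<and>
      (\<forall>r. r < 101 \<or> (151 \<le> r \<and> r < Suc k) \<or> (\<exists>j\<in>insert j J. r = 101 + j) \<longrightarrow> Rr' r = R1 r)"
      unfolding f_def
      by (rule SumLt.IH) (use SumLt.prems m1 n j b_le i fr Suc.prems i_def in auto)
    then obtain t1 R2 where 1: "exec W (compile_exp (Suc k) e) (R1, M) t1 (R2, M)" "t1 \<le> ?c"
      "R2 (Suc k) = f i"
      and fr2: "\<forall>r. r < 101 \<or> (151 \<le> r \<and> r < Suc k) \<or> (\<exists>j\<in>insert j J. r = 101 + j) \<longrightarrow> R2 r = R1 r"
      by blast
    have R2: "R2 k = (\<Sum>i<i. f i)" "R2 (101 + j) = i" "R2 y = n"
      using fr2 Suc.prems i_def n fr SumLt.prems by auto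
    define R3 where "R3 = R2(k := (\<Sum>i<Suc i. f i), Suc k := p, 101 + j := Suc i)"
    have s1: "(\<Sum>i<Suc i. f i) \<le> W"
    proof -
      have "(\<Sum>i<Suc i. f i) \<le> Suc i * (?c * m)" by (rule sum_le) (use i in simp)
      also have "\<dots> \<le> b * (?c * m)" using i n by (intro mult_right_mono) auto
      finally show ?thesis using big by linarith
    qed
    have step: "exec W ?body (R1, M) (t1 + (1 + (1 + (1 + 1)))) (R3, M)"
      apply (rule exec.Seq[OF 1(1)])
      apply (rule exec.Seq, rule exec_Add')
      using s1 R2 1(3) apply (simp add: add.commute)
      apply (rule exec.Seq, rule exec_Const', use m1 in simp)
      apply (rule exec.Seq, rule exec_Add')
      using R2 j SumLt.prems(2) i n b_le m1 apply simp
      apply (rule back_subst[of "exec W _ _ _"], rule exec_Sub')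
      using R2 j SumLt.prems(2) i n 1(3)
      by (auto simp: R3_def fun_eq_iff)
    have "\<exists>t R'. exec W (While (Suc k) ?body) (R3, M) t (R', M) \<and> t \<le> p * (?c + 5) + 1 \<and>
      R' k = (\<Sum>i<n. f i) \<and> frame R'"
    proof (rule Suc.IH)
      show "frame R3" unfolding frame_def R3_def using fr fr2 SumLt.prems(2) j SumLt.prems(8) by auto
      show "R3 (101 + j) = n - p" using i by (simp add: R3_def)
      show "p \<le> n" using Suc.prems by simp
      show "R3 k = (\<Sum>i<n-p. f i)" using i SumLt.prems(2) j by (simp add: R3_def)
      show "R3 (Suc k) = p" using SumLt.prems(2) j by (simp add: R3_def)
    qed
    then obtain t' R' where 3: "exec W (While (Suc k) ?body) (R3, M) t' (R', M)" "t' \<le> p * (?c + 5) + 1"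
      "R' k = (\<Sum>i<n. f i)" "frame R'" by blast
    have "exec W (While (Suc k) ?body) (R1, M) (Suc ((t1 + (1 + (1 + (1 + 1)))) + t')) (R', M)"
      by (rule exec.WhileTrue[OF _ step 3(1)]) (use Suc.prems in simp)
    then show ?case using 3 1(2)
      apply (intro exI conjI) apply assumption apply auto done
  qed
  define R1 where "R1 = Rr(k := 0, 101 + j := 0, Suc k := n)"
  have "\<exists>t R'. exec W (While (Suc k) ?body) (R1, M) t (R', M) \<and> t \<le> n * (?c + 5) + 1 \<and>
      R' k = (\<Sum>i<n. f i) \<and> frame R'"
    by (rule loop) (use SumLt.prems(2,8) j in \<open>auto simp: R1_def frame_def\<close>)
  then obtain t R' where 4: "exec W (While (Suc k) ?body) (R1, M) t (R', M)" "t \<le> n * (?c + 5) + 1"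
      "R' k = (\<Sum>i<n. f i)" "frame R'" by blast
  have ex: "exec W (compile_exp k (SumLt j y e)) (Rr, M) (1 + (1 + (1 + t))) (R', M)"
    unfolding compile_exp.simps
    apply (rule exec.Seq, rule exec_Const', use m1 in simp)
    apply (rule exec.Seq, rule exec_Const', use m1 in simp)
    apply (rule exec.Seq, rule exec_Sub')
    apply (rule back_subst[of "\<lambda>s. exec W _ s _ _", OF 4(1)])
    using n j SumLt.prems(2) by (auto simp: R1_def fun_eq_iff)
  have "n * (?c + 5) \<le> b * (?c + 5)" using n by (intro mult_right_mono) auto
  also have "\<dots> \<le> b * (?c + 10)" by simp
  finally have "t + 3 \<le> exp_cost b (SumLt j y e)" using 4(2) by simp
  moreover have "(\<Sum>i<n. f i) \<le> exp_cost b (SumLt j y e) * m"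
  proof -
    have "(\<Sum>i<n. f i) \<le> n * (?c * m)" by (rule sum_le) simp
    also have "\<dots> \<le> b * (?c * m)" using n by (intro mult_right_mono) auto
    also have "\<dots> \<le> exp_cost b (SumLt j y e) * m" by (simp add: algebra_simps)
    finally show ?thesis .
  qed
  ultimately show ?case using 4 ex unfolding frame_def f_def n_def
    by (intro exI[of _ "1 + (1 + (1 + t))"] exI[of _ R']) auto
qed

end

section \<open>Commands, their iteration count and their compilation\<close>

datatype com =
    Nop
  | Asg nat exp
  | Put nat exp exp
  | Get nat exp
  | Sq com com
  | Cond exp com com
  | Loop exp com

text \<open>The number counts the loop iterations. \<open>Get\<close> reads the input, which lies below
  the arrays.\<close>

inductive (in machine) bs :: "com \<Rightarrow> (nat \<Rightarrow> nat) \<times> arrays \<Rightarrow> nat \<Rightarrow> (nat \<Rightarrow> nat) \<times> arrays \<Rightarrow> bool" where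
  bs_Nop: "bs Nop s 0 s"
| bs_Asg: "v = ev R A (\<lambda>_. 0) e \<Longrightarrow> v \<le> (if small x then b else m) \<Longrightarrow> bs (Asg x e) (R, A) 0 (R(x := v), A)"
| bs_Put: "i = ev R A (\<lambda>_. 0) e\<^sub>1 \<Longrightarrow> v = ev R A (\<lambda>_. 0) e\<^sub>2 \<Longrightarrow> v \<le> m \<Longrightarrow>
    bs (Put a e\<^sub>1 e\<^sub>2) (R, A) 0 (R, A(a := (A a)(i := v)))"
| bs_Get: "i = ev R A (\<lambda>_. 0) e \<Longrightarrow> i < F \<Longrightarrow> inp i \<le> m \<Longrightarrow> bs (Get x e) (R, A) 0 (R(x := inp i), A)"
| bs_Sq: "bs c\<^sub>1 s n\<^sub>1 s' \<Longrightarrow> bs c\<^sub>2 s' n\<^sub>2 s'' \<Longrightarrow> bs (Sq c\<^sub>1 c\<^sub>2) s (n\<^sub>1 + n\<^sub>2) s''"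
| bs_CondT: "ev R A (\<lambda>_. 0) e \<noteq> 0 \<Longrightarrow> bs c\<^sub>1 (R, A) n s' \<Longrightarrow> bs (Cond e c\<^sub>1 c\<^sub>2) (R, A) n s'"
| bs_CondF: "ev R A (\<lambda>_. 0) e = 0 \<Longrightarrow> bs c\<^sub>2 (R, A) n s' \<Longrightarrow> bs (Cond e c\<^sub>1 c\<^sub>2) (R, A) n s'"
| bs_LoopF: "ev R A (\<lambda>_. 0) e = 0 \<Longrightarrow> bs (Loop e c) (R, A) 0 (R, A)"
| bs_LoopT: "ev R A (\<lambda>_. 0) e \<noteq> 0 \<Longrightarrow> bs c (R, A) n\<^sub>1 s' \<Longrightarrow> bs (Loop e c) s' n\<^sub>2 s'' \<Longrightarrow>
    bs (Loop e c) (R, A) (Suc (n\<^sub>1 + n\<^sub>2)) s''"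

fun wf_com :: "com \<Rightarrow> bool" where
  "wf_com Nop = True"
| "wf_com (Asg x e) = (x < 100 \<and> wf_exp {} e)"
| "wf_com (Put a e\<^sub>1 e\<^sub>2) = (a < 16 \<and> wf_exp {} e\<^sub>1 \<and> wf_exp {} e\<^sub>2)"
| "wf_com (Get x e) = (x < 50 \<and> wf_exp {} e)"
| "wf_com (Sq c\<^sub>1 c\<^sub>2) = (wf_com c\<^sub>1 \<and> wf_com c\<^sub>2)"
| "wf_com (Cond e c\<^sub>1 c\<^sub>2) = (wf_exp {} e \<and> wf_com c\<^sub>1 \<and> wf_com c\<^sub>2)"
| "wf_com (Loop e c) = (wf_exp {} e \<and> wf_com c)"

fun compile :: "com \<Rightarrow> prog" where
  "compile Nop = Skip"
| "compile (Asg x e) = Seq (compile_exp 151 e) (move x 151)"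
| "compile (Put a e\<^sub>1 e\<^sub>2) = Seq (compile_exp 151 e\<^sub>2) (Seq (compile_exp 152 e\<^sub>1)
     (Seq (array_address a 152) (Store 152 151)))"
| "compile (Get x e) = Seq (compile_exp 151 e) (Load x 151)"
| "compile (Sq c\<^sub>1 c\<^sub>2) = Seq (compile c\<^sub>1) (compile c\<^sub>2)"
| "compile (Cond e c\<^sub>1 c\<^sub>2) = Seq (compile_exp 151 e) (If 151 (compile c\<^sub>1) (compile c\<^sub>2))"
| "compile (Loop e c) = Seq (compile_exp 151 e) (While 151 (Seq (compile c) (compile_exp 151 e)))"

text \<open>Iterations are accounted for separately, which is why a loop is charged for a single
  round.\<close>

fun cost :: "nat \<Rightarrow> com \<Rightarrow> nat" where
  "cost b Nop = 1"
| "cost b (Asg x e) = exp_cost b e + 2"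
| "cost b (Put a e\<^sub>1 e\<^sub>2) = 16 * exp_cost b e\<^sub>1 + exp_cost b e\<^sub>2 + a + 20"
| "cost b (Get x e) = exp_cost b e + 1"
| "cost b (Sq c\<^sub>1 c\<^sub>2) = cost b c\<^sub>1 + cost b c\<^sub>2"
| "cost b (Cond e c\<^sub>1 c\<^sub>2) = exp_cost b e + cost b c\<^sub>1 + cost b c\<^sub>2 + 1"
| "cost b (Loop e c) = exp_cost b e + cost b c + 2"

lemma div_mod_16_unique: "16 * i + a = 16 * j + c \<Longrightarrow> a < 16 \<Longrightarrow> c < 16 \<Longrightarrow> i = j \<and> a = (c::nat)"
  by presburger

context machine
begin

definition rel :: "(nat \<Rightarrow> nat) \<times> arrays \<Rightarrow> state \<Rightarrow> bool" where
  "rel = (\<lambda>(R, A) (Rr, M).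
     (\<forall>x<100. Rr x = R x \<and> R x \<le> m) \<and> (\<forall>y. small y \<longrightarrow> R y \<le> b) \<and> Rr 100 = F \<and>
     (\<forall>a<16. \<forall>i. array_view F M a i = A a i \<and> A a i \<le> m) \<and> (\<forall>a<F. M a = inp a))"

lemma compile_exp_rel:
  assumes "wf_exp {} e" "k \<ge> 151" "exp_cost b e * m \<le> W" "rel (R, A) (Rr, M)"
  shows "\<exists>t Rr'. exec W (compile_exp k e) (Rr, M) t (Rr', M) \<and> t \<le> exp_cost b e \<and>
    Rr' k = ev R A (\<lambda>_. 0) e \<and> ev R A (\<lambda>_. 0) e \<le> exp_cost b e * m \<and> rel (R, A) (Rr', M) \<and>
    (\<forall>r. 151 \<le> r \<and> r < k \<longrightarrow> Rr' r = Rr r)"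
proof -
  have "\<exists>t Rr'. exec W (compile_exp k e) (Rr, M) t (Rr', M) \<and> t \<le> exp_cost b e \<and>
    Rr' k = ev R A (\<lambda>_. 0) e \<and> ev R A (\<lambda>_. 0) e \<le> exp_cost b e * m \<and>
    (\<forall>r. r < 101 \<or> (151 \<le> r \<and> r < k) \<or> (\<exists>j\<in>{}. r = 101 + j) \<longrightarrow> Rr' r = Rr r)"
    by (rule compile_exp_correct) (use assms in \<open>auto simp: rel_def\<close>)
  then obtain t Rr' where 1: "exec W (compile_exp k e) (Rr, M) t (Rr', M)" "t \<le> exp_cost b e"
    "Rr' k = ev R A (\<lambda>_. 0) e" "ev R A (\<lambda>_. 0) e \<le> exp_cost b e * m"
    "\<forall>r. r < 101 \<or> (151 \<le> r \<and> r < k) \<longrightarrow> Rr' r = Rr r" by blast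
  then have "rel (R, A) (Rr', M)" using assms(4) by (auto simp: rel_def)
  then show ?thesis using 1 by blast
qed

text \<open>Time is charged to loop iterations: up to the constant factor \<open>cost b c\<close>,
  each of them takes one unit, and one more unit pays for the rest. A linear bound on the iterations
  is thus a linear bound on the time.\<close>

lemma compile_correct:
  assumes "bs c s \<tau> s'" "wf_com c" "cost b c * m \<le> W" "rel s \<sigma>"
  shows "\<exists>t \<sigma>'. exec W (compile c) \<sigma> t \<sigma>' \<and> t \<le> cost b c * (1 + \<tau>) \<and> rel s' \<sigma>'"
  using assms
proof (induction arbitrary: \<sigma> rule: bs.induct)
  case (bs_Nop s)
  then show ?case by (intro exI[of _ 1] exI[of _ \<sigma>]) (auto intro: exec.Skip[simplified])
next
  case (bs_Asg v R A e x)
  obtain Rr M where [simp]: "\<sigma> = (Rr, M)" by (cases \<sigma>)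
  have c: "exp_cost b e * m \<le> W" using bs_Asg.prems(2) by (simp add: algebra_simps)
  obtain t R1 where 1: "exec W (compile_exp 151 e) (Rr, M) t (R1, M)" "t \<le> exp_cost b e"
    "R1 151 = v" "v \<le> exp_cost b e * m" "rel (R, A) (R1, M)"
    using compile_exp_rel[OF _ _ c, of 151 R A Rr M] bs_Asg by auto
  have x: "x < 100" using bs_Asg.prems by simp
  have "v \<le> m" using bs_Asg b_le by (auto split: if_splits)
  then have "rel (R(x := v), A) (R1(x := v), M)"
    using 1(5) x bs_Asg by (auto simp: rel_def)
  moreover have "exec W (compile (Asg x e)) \<sigma> (t + 2) (R1(x := v), M)"
    using exec.Seq[OF 1(1) exec_move[of x 151 "(R1, M)" W]] 1 c x by simp
  moreover have "t + 2 \<le> cost b (Asg x e) * (1 + 0)" using 1(2) by simp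
  ultimately show ?case by blast
next
  case (bs_Put i R A e1 v e2 a)
  obtain Rr M where [simp]: "\<sigma> = (Rr, M)" by (cases \<sigma>)
  have "a \<le> a * m" using m_pos by (cases m) auto
  then have "m + 16 * (exp_cost b e1 * m) + a + exp_cost b e2 * m \<le> cost b (Put a e1 e2) * m"
    unfolding cost.simps add_mult_distrib by linarith
  then have c: "exp_cost b e1 * m \<le> W" "exp_cost b e2 * m \<le> W" "m + 16 * (exp_cost b e1 * m) + a \<le> W"
    using bs_Put.prems(2) by linarith+
  obtain t1 R1 where 1: "exec W (compile_exp 151 e2) (Rr, M) t1 (R1, M)" "t1 \<le> exp_cost b e2"
    "R1 151 = v" "rel (R, A) (R1, M)"
    using compile_exp_rel[OF _ _ c(2), of 151 R A Rr M] bs_Put by auto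
  obtain t2 R2 where 2: "exec W (compile_exp 152 e1) (R1, M) t2 (R2, M)" "t2 \<le> exp_cost b e1"
    "R2 152 = i" "i \<le> exp_cost b e1 * m" "rel (R, A) (R2, M)" "R2 151 = R1 151"
    using compile_exp_rel[OF _ _ c(1), of 152 R A R1 M] bs_Put 1 by auto
  have a: "a < 16" using bs_Put.prems by simp
  have R100: "R2 100 = F" using 2(5) by (simp add: rel_def)
  define R3 where "R3 = R2(152 := F + 16 * i + a, 153 := a)"
  have "exec W (array_address a 152) (R2, M) 7 (R3, M)"
    using exec_array_address[of 152 "(R2, M)" a W] 2(3,4) R100 c(3) F_le by (simp add: R3_def)
  moreover have "exec W (Store 152 151) (R3, M) 1 (R3, M(F + 16 * i + a := v))"
    using exec_Store'[of W 152 151 "(R3, M)"] 2(6) 1(3) by (simp add: R3_def)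
  ultimately have "exec W (compile (Put a e1 e2)) \<sigma> (t1 + (t2 + (7 + 1))) (R3, M(F + 16 * i + a := v))"
    using 1(1) 2(1) unfolding compile.simps \<open>\<sigma> = (Rr, M)\<close> by (blast intro: exec.Seq)
  moreover have "rel (R, A(a := (A a)(i := v))) (R3, M(F + 16 * i + a := v))"
    using 2(5) a bs_Put.hyps(3) unfolding rel_def R3_def array_view_def
    by (auto dest: div_mod_16_unique simp: add.assoc)
  ultimately show ?case using 1(2) 2(2) apply (intro exI conjI) apply assumption apply auto done
next
  case (bs_Get i R A e x)
  obtain Rr M where [simp]: "\<sigma> = (Rr, M)" by (cases \<sigma>)
  have c: "exp_cost b e * m \<le> W" using bs_Get.prems(2) by (simp add: algebra_simps)
  have "m \<le> W" using bs_Get.prems(2) by (simp add: algebra_simps)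
  obtain t R1 where 1: "exec W (compile_exp 151 e) (Rr, M) t (R1, M)" "t \<le> exp_cost b e"
    "R1 151 = i" "rel (R, A) (R1, M)"
    using compile_exp_rel[OF _ _ c, of 151 R A Rr M] bs_Get by auto
  have x: "x < 50" using bs_Get.prems by simp
  have M: "M i = inp i" using 1(4) bs_Get.hyps by (simp add: rel_def)
  have "rel (R(x := inp i), A) (R1(x := inp i), M)"
    using 1(4) x bs_Get.hyps by (auto simp: rel_def small_def)
  moreover have "exec W (compile (Get x e)) \<sigma> (t + 1) (R1(x := inp i), M)"
    using exec.Seq[OF 1(1) exec_Load'[of "(R1, M)" 151 W x]] 1(3) M bs_Get.hyps \<open>m \<le> W\<close> by simp
  ultimately show ?case using 1(2) apply (intro exI conjI) apply assumption apply auto done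
next
  case (bs_Sq c1 s n1 s' c2 n2 s'')
  have wf: "wf_com c1" "wf_com c2" using bs_Sq.prems(1) by simp_all
  have W: "cost b c1 * m \<le> W" "cost b c2 * m \<le> W" using bs_Sq.prems(2) by (auto simp: algebra_simps)
  obtain t1 \<sigma>1 where 1: "exec W (compile c1) \<sigma> t1 \<sigma>1" "t1 \<le> cost b c1 * (1 + n1)" "rel s' \<sigma>1"
    using bs_Sq.IH(1)[OF wf(1) W(1) bs_Sq.prems(3)] by blast
  obtain t2 \<sigma>2 where 2: "exec W (compile c2) \<sigma>1 t2 \<sigma>2" "t2 \<le> cost b c2 * (1 + n2)" "rel s'' \<sigma>2"
    using bs_Sq.IH(2)[OF wf(2) W(2) 1(3)] by blast
  have "exec W (compile (Sq c1 c2)) \<sigma> (t1 + t2) \<sigma>2" using 1 2 by (auto intro: exec.Seq)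
  moreover have "t1 + t2 \<le> cost b (Sq c1 c2) * (1 + (n1 + n2))" using 1(2) 2(2) by (simp add: algebra_simps)
  ultimately show ?case using 2(3) by blast
next
  case (bs_CondT R A e c1 n s' c2)
  obtain Rr M where [simp]: "\<sigma> = (Rr, M)" by (cases \<sigma>)
  have wf: "wf_com c1" "wf_exp {} e" using bs_CondT.prems(1) by simp_all
  have W: "cost b c1 * m \<le> W" "exp_cost b e * m \<le> W" using bs_CondT.prems(2) by (auto simp: algebra_simps)
  obtain t R1 where 1: "exec W (compile_exp 151 e) (Rr, M) t (R1, M)" "t \<le> exp_cost b e"
    "R1 151 \<noteq> 0" "rel (R, A) (R1, M)"
    using compile_exp_rel[OF _ _ W(2), of 151 R A Rr M] bs_CondT by auto
  obtain t2 \<sigma>2 where 2: "exec W (compile c1) (R1, M) t2 \<sigma>2" "t2 \<le> cost b c1 * (1 + n)" "rel s' \<sigma>2"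
    using bs_CondT.IH[OF wf(1) W(1) 1(4)] by blast
  have "exec W (compile (Cond e c1 c2)) \<sigma> (t + Suc t2) \<sigma>2"
    using exec.Seq[OF 1(1) exec.IfTrue[OF _ 2(1), of 151]] 1(3) by simp
  moreover have "t + Suc t2 \<le> cost b (Cond e c1 c2) * (1 + n)" using 1(2) 2(2) by (simp add: algebra_simps)
  ultimately show ?case using 2(3) by blast
next
  case (bs_CondF R A e c2 n s' c1)
  obtain Rr M where [simp]: "\<sigma> = (Rr, M)" by (cases \<sigma>)
  have wf: "wf_com c2" "wf_exp {} e" using bs_CondF.prems(1) by simp_all
  have W: "cost b c2 * m \<le> W" "exp_cost b e * m \<le> W" using bs_CondF.prems(2) by (auto simp: algebra_simps)
  obtain t R1 where 1: "exec W (compile_exp 151 e) (Rr, M) t (R1, M)" "t \<le> exp_cost b e"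
    "R1 151 = 0" "rel (R, A) (R1, M)"
    using compile_exp_rel[OF _ _ W(2), of 151 R A Rr M] bs_CondF by auto
  obtain t2 \<sigma>2 where 2: "exec W (compile c2) (R1, M) t2 \<sigma>2" "t2 \<le> cost b c2 * (1 + n)" "rel s' \<sigma>2"
    using bs_CondF.IH[OF wf(1) W(1) 1(4)] by blast
  have "exec W (compile (Cond e c1 c2)) \<sigma> (t + Suc t2) \<sigma>2"
    using exec.Seq[OF 1(1) exec.IfFalse[OF _ 2(1), of 151]] 1(3) by simp
  moreover have "t + Suc t2 \<le> cost b (Cond e c1 c2) * (1 + n)" using 1(2) 2(2) by (simp add: algebra_simps)
  ultimately show ?case using 2(3) by blast
next
  case (bs_LoopF R A e c)
  obtain Rr M where [simp]: "\<sigma> = (Rr, M)" by (cases \<sigma>)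
  have W: "exp_cost b e * m \<le> W" using bs_LoopF.prems(2) by (auto simp: algebra_simps)
  obtain t R1 where 1: "exec W (compile_exp 151 e) (Rr, M) t (R1, M)" "t \<le> exp_cost b e"
    "R1 151 = 0" "rel (R, A) (R1, M)"
    using compile_exp_rel[OF _ _ W, of 151 R A Rr M] bs_LoopF by auto
  have "exec W (compile (Loop e c)) \<sigma> (t + 1) (R1, M)"
    using exec.Seq[OF 1(1) exec.WhileFalse[of "(R1, M)" 151]] 1(3) by simp
  then show ?case using 1 apply (intro exI conjI) apply assumption apply auto done
next
  case (bs_LoopT R A e c n1 s' n2 s'')
  obtain Rr M where [simp]: "\<sigma> = (Rr, M)" by (cases \<sigma>)
  have wf: "wf_com c" "wf_exp {} e" using bs_LoopT.prems(1) by simp_all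
  have W: "exp_cost b e * m \<le> W" "cost b c * m \<le> W" using bs_LoopT.prems(2) by (auto simp: algebra_simps)
  obtain t R1 where 1: "exec W (compile_exp 151 e) (Rr, M) t (R1, M)" "t \<le> exp_cost b e"
    "R1 151 \<noteq> 0" "rel (R, A) (R1, M)"
    using compile_exp_rel[OF _ _ W(1), of 151 R A Rr M] bs_LoopT by auto
  obtain t2 \<sigma>2 where 2: "exec W (compile c) (R1, M) t2 \<sigma>2" "t2 \<le> cost b c * (1 + n1)" "rel s' \<sigma>2"
    using bs_LoopT.IH(1)[OF wf(1) W(2) 1(4)] by blast
  obtain t3 \<sigma>3 where 3: "exec W (compile (Loop e c)) \<sigma>2 t3 \<sigma>3" "t3 \<le> cost b (Loop e c) * (1 + n2)" "rel s'' \<sigma>3"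
    using bs_LoopT.IH(2)[OF bs_LoopT.prems(1,2) 2(3)] by blast
  \<comment> \<open>The compiled rest of the loop begins with a test; this test becomes the end of
    the body of the first round.\<close>
  obtain t4 t5 \<sigma>4 where 4: "exec W (compile_exp 151 e) \<sigma>2 t4 \<sigma>4"
      "exec W (While 151 (Seq (compile c) (compile_exp 151 e))) \<sigma>4 t5 \<sigma>3" "t3 = t4 + t5"
    using 3(1) by (auto elim: exec_SeqE)
  have "exec W (While 151 (Seq (compile c) (compile_exp 151 e))) (R1, M) (Suc ((t2 + t4) + t5)) \<sigma>3"
    using exec.WhileTrue[OF _ exec.Seq[OF 2(1) 4(1)] 4(2)] 1(3) by simp
  then have "exec W (compile (Loop e c)) \<sigma> (t + Suc ((t2 + t4) + t5)) \<sigma>3"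
    unfolding compile.simps \<open>\<sigma> = (Rr, M)\<close> by (rule exec.Seq[OF 1(1)])
  moreover have "t + Suc ((t2 + t4) + t5) \<le> cost b (Loop e c) * (1 + Suc (n1 + n2))"
    using 1(2) 2(2) 3(2) 4(3) by (simp add: algebra_simps)
  ultimately show ?case using 3(3) by blast
qed

end

text \<open>The limit \<open>n\<close> itself stands for the absence of a witness. The table of the
  dynamic program marks unreachable states in this way.\<close>

definition least_below :: "nat \<Rightarrow> (nat \<Rightarrow> bool) \<Rightarrow> nat" where
  "least_below n P = (if \<exists>i<n. P i then LEAST i. P i else n)"

lemma least_below_le: "least_below n P \<le> n"
proof (cases "\<exists>i<n. P i")
  case True
  then obtain i where "i < n" "P i" by blast
  then have "(LEAST i. P i) \<le> i" by (intro Least_le)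
  then show ?thesis using \<open>i < n\<close> by (simp add: least_below_def)
qed (auto simp: least_below_def)

lemma least_below_less_iff: "least_below n P < n \<longleftrightarrow> (\<exists>i<n. P i)"
proof
  assume "\<exists>i<n. P i"
  then obtain i where "i < n" "P i" by blast
  then have "(LEAST i. P i) \<le> i" by (intro Least_le)
  then show "least_below n P < n" using \<open>i < n\<close> \<open>P i\<close> by (auto simp: least_below_def)
qed (auto simp: least_below_def split: if_splits)

lemma least_below_sat: "least_below n P < n \<Longrightarrow> P (least_below n P)"
  by (auto simp: least_below_def split: if_splits intro: LeastI)

lemma not_less_least_below: "i < least_below n P \<Longrightarrow> \<not> P i"
  using not_less_Least[of i P] by (auto simp: least_below_def split: if_splits)

lemma least_below_cong: "(\<And>i. i < n \<Longrightarrow> P i = Q i) \<Longrightarrow> least_below n P = least_below n Q"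
proof -
  assume eq: "\<And>i. i < n \<Longrightarrow> P i = Q i"
  have *: "\<not> least_below n P < least_below n Q" if "\<And>i. i < n \<Longrightarrow> P i = Q i" for P Q
  proof
    assume less: "least_below n P < least_below n Q"
    then have "least_below n P < n" using least_below_le[of n Q] by linarith
    then have "Q (least_below n P)" using least_below_sat that by blast
    then show False using not_less_least_below[OF less] by blast
  qed
  show ?thesis using *[of P Q] *[of Q P] eq by force
qed

text \<open>The indices up to which no witness occurs form the initial segment below the least
  witness, so a minimum can be found by counting.\<close>

lemma sum_eq_least_below:
  "(\<Sum>i<n. if \<forall>k\<le>i. \<not> P k then 1 else 0) = least_below n P"
proof -
  have "{i \<in> {..<n}. \<forall>k\<le>i. \<not> P k} = {..<least_below n P}"
  proof (intro set_eqI iffI)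
    fix i assume "i \<in> {i \<in> {..<n}. \<forall>k\<le>i. \<not> P k}"
    then have i: "i < n" "\<And>k. k \<le> i \<Longrightarrow> \<not> P k" by auto
    have "\<not> least_below n P \<le> i"
    proof
      assume "least_below n P \<le> i"
      then show False using i least_below_sat[of n P] by simp
    qed
    then show "i \<in> {..<least_below n P}" by simp
  next
    fix i assume "i \<in> {..<least_below n P}"
    then show "i \<in> {i \<in> {..<n}. \<forall>k\<le>i. \<not> P k}"
      using least_below_le[of n P] not_less_least_below[of _ n P] by auto
  qed
  then show ?thesis by (simp add: sum.If_cases Int_def)
qed

section \<open>Logic and arithmetic as bounded sums\<close>

definition Neg :: "exp \<Rightarrow> exp" where "Neg a = Ite a (Num 0) (Num 1)"
definition Conj :: "exp \<Rightarrow> exp \<Rightarrow> exp" where "Conj a c = Ite a c (Num 0)"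
definition Less :: "exp \<Rightarrow> exp \<Rightarrow> exp" where "Less a c = Ite (ESub c a) (Num 1) (Num 0)"
definition Leq :: "exp \<Rightarrow> exp \<Rightarrow> exp" where "Leq a c = Ite (ESub a c) (Num 0) (Num 1)"
definition Eq :: "exp \<Rightarrow> exp \<Rightarrow> exp" where "Eq a c = Ite (EAdd (ESub a c) (ESub c a)) (Num 0) (Num 1)"
definition Imp :: "exp \<Rightarrow> exp \<Rightarrow> exp" where "Imp a c = Ite a c (Num 1)"
definition Iff :: "exp \<Rightarrow> exp \<Rightarrow> exp" where "Iff a c = Ite a c (Neg c)"
definition AllLt :: "nat \<Rightarrow> nat \<Rightarrow> exp \<Rightarrow> exp" where "AllLt j y a = Neg (SumLt j y (Neg a))"
definition LeastLt :: "nat \<Rightarrow> nat \<Rightarrow> nat \<Rightarrow> exp \<Rightarrow> exp" where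
  "LeastLt j k y a = SumLt j y (AllLt k y (Neg (Conj (Leq (Idx k) (Idx j)) a)))"
text \<open>A product is a sum with a constant summand. One factor is therefore the limit of a sum,
  which well-formed expressions take from a small variable.\<close>

definition Mul :: "nat \<Rightarrow> nat \<Rightarrow> exp \<Rightarrow> exp" where "Mul j y a = SumLt j y a"

lemmas exp_defs = Neg_def Conj_def Less_def Leq_def Eq_def Imp_def Iff_def AllLt_def LeastLt_def Mul_def

lemma ev_Neg [simp]: "ev R A l (Neg a) = (if ev R A l a = 0 then 1 else 0)" by (simp add: Neg_def)
lemma ev_Conj [simp]: "ev R A l (Conj a c) = (if ev R A l a = 0 then 0 else ev R A l c)" by (simp add: Conj_def)
lemma ev_Less [simp]: "ev R A l (Less a c) = (if ev R A l a < ev R A l c then 1 else 0)" by (simp add: Less_def)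
lemma ev_Leq [simp]: "ev R A l (Leq a c) = (if ev R A l a \<le> ev R A l c then 1 else 0)" by (simp add: Leq_def)
lemma ev_Eq [simp]: "ev R A l (Eq a c) = (if ev R A l a = ev R A l c then 1 else 0)" by (auto simp: Eq_def)
lemma ev_Imp [simp]: "ev R A l (Imp a c) = (if ev R A l a = 0 then 1 else ev R A l c)" by (simp add: Imp_def)
lemma ev_Iff [simp]: "ev R A l (Iff a c) =
    (if ev R A l a = 0 then if ev R A l c = 0 then 1 else 0 else ev R A l c)" by (simp add: Iff_def)
lemma ev_AllLt [simp]: "ev R A l (AllLt j y a) = (if \<forall>i<R y. ev R A (l(j := i)) a \<noteq> 0 then 1 else 0)"
  by (auto simp: AllLt_def sum_eq_0_iff)

lemma ev_LeastLt:
  assumes "j \<noteq> k" "\<And>i i'. i < R y \<Longrightarrow> i' < R y \<Longrightarrow> ev R A (l(j := i, k := i')) a \<noteq> 0 \<longleftrightarrow> P i'"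
  shows "ev R A l (LeastLt j k y a) = least_below (R y) P"
proof -
  have "ev R A l (LeastLt j k y a) = (\<Sum>i<R y. if \<forall>i'\<le>i. \<not> P i' then 1 else 0)"
    unfolding LeastLt_def ev.simps
    by (rule sum.cong) (use assms in \<open>auto split: if_splits\<close>)
  then show ?thesis by (simp add: sum_eq_least_below)
qed

lemma ev_Mul [simp]: "(\<And>i. ev R A (l(j := i)) a = ev R A l a) \<Longrightarrow> ev R A l (Mul j y a) = R y * ev R A l a"
  by (simp add: Mul_def)

section \<open>A program logic with an iteration count\<close>

definition For :: "nat \<Rightarrow> exp \<Rightarrow> com \<Rightarrow> com" where
  "For x e c = Sq (Asg x (Num 0)) (Loop (Less (Var x) e) (Sq c (Asg x (EAdd (Var x) (Num 1)))))"

context machine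
begin

text \<open>Total correctness: a run has to exist, so termination and the bounds \<open>m\<close>
  and \<open>b\<close> on stored numbers are included. The postcondition also receives the number of
  loop iterations, counted on from \<tau>.\<close>

definition wp :: "com \<Rightarrow> (nat \<Rightarrow> (nat \<Rightarrow> nat) \<Rightarrow> arrays \<Rightarrow> bool) \<Rightarrow> nat \<Rightarrow> (nat \<Rightarrow> nat) \<Rightarrow> arrays \<Rightarrow> bool" where
  "wp c Q \<tau> R A \<longleftrightarrow> (\<exists>n R' A'. bs c (R, A) n (R', A') \<and> Q (\<tau> + n) R' A')"

lemma wp_Nop: "Q \<tau> R A \<Longrightarrow> wp Nop Q \<tau> R A"
  unfolding wp_def using bs_Nop[of "(R, A)"] by force

lemma wp_Asg: "ev R A (\<lambda>_. 0) e \<le> (if small x then b else m) \<Longrightarrow> Q \<tau> (R(x := ev R A (\<lambda>_. 0) e)) A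
    \<Longrightarrow> wp (Asg x e) Q \<tau> R A"
  unfolding wp_def using bs_Asg[OF refl, of R A e x] by force

lemma wp_Put: "ev R A (\<lambda>_. 0) e\<^sub>2 \<le> m \<Longrightarrow>
    Q \<tau> R (A(a := (A a)(ev R A (\<lambda>_. 0) e\<^sub>1 := ev R A (\<lambda>_. 0) e\<^sub>2))) \<Longrightarrow> wp (Put a e\<^sub>1 e\<^sub>2) Q \<tau> R A"
  unfolding wp_def using bs_Put[OF refl refl, of R A e\<^sub>2 a e\<^sub>1] by force

lemma wp_Get: "ev R A (\<lambda>_. 0) e < F \<Longrightarrow> inp (ev R A (\<lambda>_. 0) e) \<le> m \<Longrightarrow>
    Q \<tau> (R(x := inp (ev R A (\<lambda>_. 0) e))) A \<Longrightarrow> wp (Get x e) Q \<tau> R A"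
  unfolding wp_def using bs_Get[OF refl, of R A e x] by force

lemma wp_Sq: "wp c\<^sub>1 (wp c\<^sub>2 Q) \<tau> R A \<Longrightarrow> wp (Sq c\<^sub>1 c\<^sub>2) Q \<tau> R A"
  unfolding wp_def
  apply (elim exE conjE)
  subgoal for n R' A' n' R'' A''
    using bs_Sq[of c\<^sub>1 "(R, A)" n "(R', A')" c\<^sub>2 n' "(R'', A'')"]
    by (auto intro!: exI[of _ "n + n'"] exI[of _ R''] exI[of _ A''] simp: add.assoc)
  done

lemma wp_Cond: "(ev R A (\<lambda>_. 0) e \<noteq> 0 \<Longrightarrow> wp c\<^sub>1 Q \<tau> R A) \<Longrightarrow>
    (ev R A (\<lambda>_. 0) e = 0 \<Longrightarrow> wp c\<^sub>2 Q \<tau> R A) \<Longrightarrow> wp (Cond e c\<^sub>1 c\<^sub>2) Q \<tau> R A"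
proof (cases "ev R A (\<lambda>_. 0) e = 0")
  case True
  assume "ev R A (\<lambda>_. 0) e = 0 \<Longrightarrow> wp c\<^sub>2 Q \<tau> R A"
  with True have "wp c\<^sub>2 Q \<tau> R A" by blast
  then show ?thesis using bs_CondF[OF True] unfolding wp_def by blast
next
  case False
  assume "ev R A (\<lambda>_. 0) e \<noteq> 0 \<Longrightarrow> wp c\<^sub>1 Q \<tau> R A"
  with False have "wp c\<^sub>1 Q \<tau> R A" by blast
  then show ?thesis using bs_CondT[OF False] unfolding wp_def by blast
qed

lemma wp_mono: "wp c P \<tau> R A \<Longrightarrow> (\<And>\<tau> R A. P \<tau> R A \<Longrightarrow> Q \<tau> R A) \<Longrightarrow> wp c Q \<tau> R A"
  unfolding wp_def by blast

lemma wp_LoopF: "ev R A (\<lambda>_. 0) e = 0 \<Longrightarrow> Q \<tau> R A \<Longrightarrow> wp (Loop e c) Q \<tau> R A"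
  unfolding wp_def using bs_LoopF[of R A e c] by force

lemma wp_LoopT: "ev R A (\<lambda>_. 0) e \<noteq> 0 \<Longrightarrow> wp c (\<lambda>\<tau>. wp (Loop e c) Q (Suc \<tau>)) \<tau> R A \<Longrightarrow>
    wp (Loop e c) Q \<tau> R A"
  unfolding wp_def
  apply (elim exE conjE)
  subgoal for n R' A' n' R'' A''
    using bs_LoopT[of R A e c n "(R', A')" n' "(R'', A'')"]
    by (auto intro!: exI[of _ "Suc (n + n')"] exI[of _ R''] exI[of _ A''] simp: add.assoc)
  done

text \<open>Invariant and variant have separate tasks: \<open>f\<close> only ensures termination,
  while the invariant may bound \<tau> by a finer measure of the work done.\<close>

lemma wp_Loop:
  fixes f :: "(nat \<Rightarrow> nat) \<Rightarrow> arrays \<Rightarrow> nat"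
  assumes "I \<tau> R A"
    and "\<And>\<tau> R A. I \<tau> R A \<Longrightarrow> ev R A (\<lambda>_. 0) e = 0 \<Longrightarrow> Q \<tau> R A"
    and "\<And>\<tau> R A. I \<tau> R A \<Longrightarrow> ev R A (\<lambda>_. 0) e \<noteq> 0 \<Longrightarrow>
      wp c (\<lambda>\<tau>' R' A'. I (Suc \<tau>') R' A' \<and> f R' A' < f R A) \<tau> R A"
  shows "wp (Loop e c) Q \<tau> R A"
  using assms(1)
proof (induction "f R A" arbitrary: \<tau> R A rule: nat_less_induct)
  case 1
  show ?case
  proof (cases "ev R A (\<lambda>_. 0) e = 0")
    case True
    then show ?thesis using assms(2) 1 by (auto intro: wp_LoopF)
  next
    case False
    show ?thesis
      apply (rule wp_LoopT[where A = A, OF False], rule wp_mono[OF assms(3)[OF 1(2) False]])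
      using 1(1) by blast
  qed
qed


text \<open>The limit is evaluated anew in each round and has to remain \<open>N\<close> under the
  invariant. Each round adds one to the iterations of its body.\<close>

lemma wp_For:
  assumes init: "I 0 \<tau> (R(x := 0)) A"
    and bound: "N \<le> (if small x then b else m)"
    and limit: "\<And>i \<tau> R A. i \<le> N \<Longrightarrow> R x = i \<Longrightarrow> I i \<tau> R A \<Longrightarrow> ev R A (\<lambda>_. 0) e = N"
    and step: "\<And>i \<tau> R A. i < N \<Longrightarrow> R x = i \<Longrightarrow> I i \<tau> R A \<Longrightarrow>
      wp c (\<lambda>\<tau> R A. R x = i \<and> I (Suc i) (Suc \<tau>) (R(x := Suc i)) A) \<tau> R A"
    and final: "\<And>\<tau> R A. R x = N \<Longrightarrow> I N \<tau> R A \<Longrightarrow> Q \<tau> R A"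
  shows "wp (For x e c) Q \<tau> R A"
  unfolding For_def
proof (intro wp_Sq wp_Asg)
  show "ev R A (\<lambda>_. 0) (Num 0) \<le> (if small x then b else m)" by simp
  have "wp (Loop (Less (Var x) e) (Sq c (Asg x (EAdd (Var x) (Num 1))))) Q \<tau> (R(x := 0)) A"
  proof (rule wp_Loop[where I = "\<lambda>\<tau> R A. R x \<le> N \<and> I (R x) \<tau> R A" and f = "\<lambda>R A. N - R x"])
    show "(R(x := 0)) x \<le> N \<and> I ((R(x := 0)) x) \<tau> (R(x := 0)) A" using init by simp
  next
    fix \<tau> R A assume *: "R x \<le> N \<and> I (R x) \<tau> R A" "ev R A (\<lambda>_. 0) (Less (Var x) e) = 0"
    then have "R x = N" using limit[of "R x" R \<tau> A] by (simp split: if_splits)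
    then show "Q \<tau> R A" using * final by auto
  next
    fix \<tau> R A assume *: "R x \<le> N \<and> I (R x) \<tau> R A" "ev R A (\<lambda>_. 0) (Less (Var x) e) \<noteq> 0"
    then have less: "R x < N" using limit[of "R x" R \<tau> A] by (simp split: if_splits)
    show "wp (Sq c (Asg x (EAdd (Var x) (Num 1)))) (\<lambda>\<tau>' R' A'.
        (R' x \<le> N \<and> I (R' x) (Suc \<tau>') R' A') \<and> N - R' x < N - R x) \<tau> R A"
      apply (rule wp_Sq, rule wp_mono[OF step[of "R x" R \<tau> A]])
      apply (use less * in simp_all)[3]
      apply (rule wp_Asg)
      using less bound by (auto split: if_splits)
  qed
  then show "wp (Loop (Less (Var x) e) (Sq c (Asg x (EAdd (Var x) (Num 1))))) Q \<tau>
     (R(x := ev R A (\<lambda>_. 0) (Num 0))) A" by simp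
qed

end

section \<open>Pathwidth and binary tree models\<close>

locale sym_rel =
  fixes E :: "nat \<Rightarrow> nat \<Rightarrow> bool"
  assumes E_sym: "E u v \<Longrightarrow> E v u"
begin

text \<open>Connectedness without paths: no proper nonempty part is closed under adjacency.
  Separation arguments can apply this directly to the vertices on one side. The empty set counts as
  connected.\<close>

definition conn :: "nat set \<Rightarrow> bool" where
  "conn A \<longleftrightarrow> (\<forall>X\<subseteq>A. X \<noteq> {} \<and> (\<forall>x\<in>X. \<forall>y\<in>A. E x y \<longrightarrow> y \<in> X) \<longrightarrow> X = A)"

definition link :: "nat set \<Rightarrow> nat set \<Rightarrow> bool" where
  "link A B \<longleftrightarrow> (\<exists>a\<in>A. \<exists>b\<in>B. E a b)"

lemma link_mono: "link A B \<Longrightarrow> A \<subseteq> A' \<Longrightarrow> B \<subseteq> B' \<Longrightarrow> link A' B'"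
  unfolding link_def by blast

lemma conn_singleton: "conn {x}"
  unfolding conn_def by blast

lemma conn_Un:
  assumes "conn A" "conn B" "link A B"
  shows "conn (A \<union> B)"
  unfolding conn_def
proof (intro allI impI)
  fix X assume X: "X \<subseteq> A \<union> B" "X \<noteq> {} \<and> (\<forall>x\<in>X. \<forall>y\<in>A \<union> B. E x y \<longrightarrow> y \<in> X)"
  have A: "A \<subseteq> X" if "X \<inter> A \<noteq> {}"
  proof -
    have "X \<inter> A = A" using assms(1)[unfolded conn_def, rule_format, of "X \<inter> A"] X that by blast
    then show ?thesis by blast
  qed
  have B: "B \<subseteq> X" if "X \<inter> B \<noteq> {}"
  proof -
    have "X \<inter> B = B" using assms(2)[unfolded conn_def, rule_format, of "X \<inter> B"] X that by blast
    then show ?thesis by blast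
  qed
  obtain a c where ab: "a \<in> A" "c \<in> B" "E a c" using assms(3) unfolding link_def by blast
  have "E c a" using ab E_sym by blast
  have "X \<inter> A \<noteq> {} \<or> X \<inter> B \<noteq> {}" using X by blast
  then have "A \<subseteq> X \<and> B \<subseteq> X"
  proof
    assume "X \<inter> A \<noteq> {}"
    then have "A \<subseteq> X" by (rule A)
    then have "c \<in> X" using X ab by blast
    then show ?thesis using \<open>A \<subseteq> X\<close> B ab by blast
  next
    assume "X \<inter> B \<noteq> {}"
    then have "B \<subseteq> X" by (rule B)
    then have "a \<in> X" using X ab \<open>E c a\<close> by blast
    then show ?thesis using \<open>B \<subseteq> X\<close> A ab by blast
  qed
  then show "X = A \<union> B" using X by blast
qed

fun subtree :: "(nat \<Rightarrow> nat set) \<Rightarrow> nat \<Rightarrow> nat \<Rightarrow> nat set" where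
  "subtree Br p 0 = Br p"
| "subtree Br p (Suc j) = Br p \<union> subtree Br (2 * p) j \<union> subtree Br (2 * p + 1) j"

fun complete_tree :: "(nat \<Rightarrow> nat) \<Rightarrow> nat \<Rightarrow> nat \<Rightarrow> bool" where
  "complete_tree T p 0 = (T p \<noteq> 0)"
| "complete_tree T p (Suc j) = (T p \<noteq> 0 \<and> complete_tree T (2 * p) j \<and> complete_tree T (2 * p + 1) j)"

text \<open>A binary tree is stored like a heap: the children of position \<open>p\<close> are \<open>2 p\<close> and \<open>2 p + 1\<close>, and
  \<open>T p = v + 1\<close> means that \<open>v\<close> sits at \<open>p\<close>. The branch sets \<open>Br p\<close> exhibit it as a minor.\<close>

definition tree_model :: "(nat \<Rightarrow> nat) \<Rightarrow> nat set \<Rightarrow> (nat \<Rightarrow> nat set) \<Rightarrow> bool" where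
  "tree_model T V Br \<longleftrightarrow>
     (\<forall>p. T p \<noteq> 0 \<longrightarrow> T p - 1 \<in> Br p \<and> Br p \<subseteq> V \<and> conn (Br p)) \<and>
     (\<forall>p q. T p \<noteq> 0 \<longrightarrow> T q \<noteq> 0 \<longrightarrow> p \<noteq> q \<longrightarrow> Br p \<inter> Br q = {}) \<and>
     (\<forall>p q. p \<ge> 1 \<longrightarrow> q = 2 * p \<or> q = 2 * p + 1 \<longrightarrow> T p \<noteq> 0 \<longrightarrow> T q \<noteq> 0 \<longrightarrow> link (Br p) (Br q))"

lemma complete_tree_root: "complete_tree T p j \<Longrightarrow> T p \<noteq> 0"
  by (cases j) auto

lemma subtree_root: "Br p \<subseteq> subtree Br p j"
  by (cases j) auto

lemma conn_subtree:
  assumes "tree_model T V Br" "complete_tree T p j" "p \<ge> 1"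
  shows "conn (subtree Br p j)"
  using assms(2,3)
proof (induction j arbitrary: p)
  case 0
  then show ?case using assms(1) by (simp add: tree_model_def)
next
  case (Suc j)
  have T: "T p \<noteq> 0" "T (2 * p) \<noteq> 0" "T (2 * p + 1) \<noteq> 0"
    using Suc.prems complete_tree_root by auto
  have l: "link (Br p) (Br (2 * p))" "link (Br p) (Br (2 * p + 1))" "conn (Br p)"
    using assms(1) T Suc.prems unfolding tree_model_def by blast+
  have c: "conn (subtree Br (2 * p) j)" "conn (subtree Br (2 * p + 1) j)"
    using Suc by auto
  have "conn (Br p \<union> subtree Br (2 * p) j)"
    by (rule conn_Un[OF l(3) c(1)], rule link_mono[OF l(1)], rule order_refl, rule subtree_root)
  then show ?case
    unfolding subtree.simps
    using link_mono[OF l(2) _ subtree_root[of Br "2 * p + 1" j], of "Br p \<union> subtree Br (2 * p) j"] c(2) by - (rule conn_Un, auto)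
qed

text \<open>Division by \<open>2 ^ i\<close> climbs \<open>i\<close> levels in the heap numbering,
  so the disjointness of subtrees reduces to arithmetic with ancestors.\<close>

lemma subtree_elem:
  assumes "x \<in> subtree Br p j" "complete_tree T p j"
  shows "\<exists>q i. i \<le> j \<and> q div 2 ^ i = p \<and> x \<in> Br q \<and> T q \<noteq> 0"
  using assms
proof (induction j arbitrary: p)
  case 0
  then show ?case by (intro exI[of _ p] exI[of _ 0]) auto
next
  case (Suc j)
  consider "x \<in> Br p" | r where "x \<in> subtree Br r j" "complete_tree T r j" "r div 2 = p"
    using Suc.prems by fastforce
  then show ?case
  proof cases
    case 1
    then show ?thesis using Suc.prems by (intro exI[of _ p] exI[of _ 0]) auto
  next
    case 2
    then obtain q i where "i \<le> j" "q div 2 ^ i = r" "x \<in> Br q" "T q \<noteq> 0" using Suc.IH by blast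
    moreover have "q div 2 ^ Suc i = q div 2 ^ i div 2" by (simp add: div_mult2_eq[symmetric] mult.commute)
    ultimately show ?thesis using 2 by (intro exI[of _ q] exI[of _ "Suc i"]) auto
  qed
qed

text \<open>A common vertex would give \<open>p\<close> and \<open>q\<close> a common descendant and
  make one of them an ancestor of the other. But proper ancestors of \<open>q\<close> are at most
  \<open>q div 2\<close>, which is less than \<open>p\<close>, and ancestors of \<open>p\<close> are
  less than \<open>q\<close>.\<close>

lemma subtree_disjoint:
  assumes "tree_model T V Br" "complete_tree T p j" "complete_tree T q j" "p < q" "q < 2 * p"
  shows "subtree Br p j \<inter> subtree Br q j = {}"
proof (rule ccontr)
  assume "subtree Br p j \<inter> subtree Br q j \<noteq> {}"
  then obtain x where x: "x \<in> subtree Br p j" "x \<in> subtree Br q j" by blast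
  obtain p' i where 1: "p' div 2 ^ i = p" "x \<in> Br p'" "T p' \<noteq> 0" using subtree_elem[OF x(1) assms(2)] by blast
  obtain q' i' where 2: "q' div 2 ^ i' = q" "x \<in> Br q'" "T q' \<noteq> 0" using subtree_elem[OF x(2) assms(3)] by blast
  have eq: "p' = q'" using assms(1) 1 2 unfolding tree_model_def by blast
  consider "i = i'" | d where "i = i' + Suc d" | d where "i' = i + Suc d"
    by (metis less_imp_Suc_add linorder_neqE_nat add_Suc_right)
  then show False
  proof cases
    case 1
    then show False using \<open>p' div 2 ^ i = p\<close> 2(1) eq assms by simp
  next
    case (2 d)
    then have "p = q div (2 ^ Suc d)"
      using \<open>p' div 2 ^ i = p\<close> \<open>q' div 2 ^ i' = q\<close> eq by (simp only: power_add div_mult2_eq)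
    then have "p = q div 2 div 2 ^ d" by (simp add: div_mult2_eq)
    also have "\<dots> \<le> q div 2" by (rule div_le_dividend)
    finally show False using assms by linarith
  next
    case (3 d)
    then have "q = p div (2 ^ Suc d)"
      using \<open>p' div 2 ^ i = p\<close> \<open>q' div 2 ^ i' = q\<close> eq by (simp only: power_add div_mult2_eq)
    also have "\<dots> \<le> p" by (rule div_le_dividend)
    finally show False using assms by linarith
  qed
qed

lemma subtree_root_disjoint:
  assumes "tree_model T V Br" "complete_tree T p j" "T q \<noteq> 0" "q < p"
  shows "Br q \<inter> subtree Br p j = {}"
proof (rule ccontr)
  assume "Br q \<inter> subtree Br p j \<noteq> {}"
  then obtain x where x: "x \<in> Br q" "x \<in> subtree Br p j" by blast
  obtain p' i where 1: "p' div 2 ^ i = p" "x \<in> Br p'" "T p' \<noteq> 0" using subtree_elem[OF x(2) assms(2)] by blast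
  have "p' = q" using assms(1,3) 1 x unfolding tree_model_def by blast
  then have "p \<le> q" using 1 div_le_dividend by metis
  then show False using assms by simp
qed

end

section \<open>Complete binary trees in a path decomposition\<close>

locale path_dec = sym_rel E for E +
  fixes n k :: nat and Ws :: "nat set list"
  assumes Ws_card: "i < length Ws \<Longrightarrow> finite (Ws ! i) \<and> card (Ws ! i) \<le> k"
    and Ws_cover: "v < n \<longleftrightarrow> (\<exists>i<length Ws. v \<in> Ws ! i)"
    and Ws_edge: "E u v \<Longrightarrow> \<exists>i<length Ws. u \<in> Ws ! i \<and> v \<in> Ws ! i"
    and Ws_conv: "i \<le> j \<Longrightarrow> j \<le> l \<Longrightarrow> l < length Ws \<Longrightarrow> v \<in> Ws ! i \<Longrightarrow> v \<in> Ws ! l \<Longrightarrow> v \<in> Ws ! j"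
begin

text \<open>If \<open>A\<close> avoided bag \<open>j\<close>, the vertices of \<open>A\<close> that
  occur before \<open>j\<close> would occur nowhere later. They would be closed under adjacency in
  \<open>A\<close>, hence all of \<open>A\<close>, against the choice of \<open>y\<close>.\<close>

lemma conn_hits:
  assumes "conn A" "x \<in> A" "y \<in> A" "x \<in> Ws ! i" "y \<in> Ws ! l" "i \<le> j" "j \<le> l" "l < length Ws"
  shows "A \<inter> Ws ! j \<noteq> {}"
proof
  assume e: "A \<inter> Ws ! j = {}"
  define X where "X = {a \<in> A. \<exists>i<j. a \<in> Ws ! i}"
  have below: "i < j" if a: "a \<in> X" "a \<in> Ws ! i" "i < length Ws" for a i
  proof (rule ccontr)
    assume "\<not> i < j"
    then obtain i' where "i' < j" "a \<in> Ws ! i'" "a \<in> A" using a unfolding X_def by blast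
    then have "a \<in> Ws ! j" using Ws_conv[of i' j i a] a \<open>\<not> i < j\<close> by simp
    then show False using e \<open>a \<in> A\<close> by blast
  qed
  have "i \<noteq> j" using e assms by blast
  then have "x \<in> X" using assms unfolding X_def by force
  moreover have "v \<in> X" if uv: "u \<in> X" "v \<in> A" "E u v" for u v
  proof -
    obtain i where i: "i < length Ws" "u \<in> Ws ! i" "v \<in> Ws ! i" using Ws_edge[OF uv(3)] by blast
    then have "i < j" using below uv by blast
    then show ?thesis using i uv unfolding X_def by blast
  qed
  ultimately have "X = A" using assms(1)[unfolded conn_def, rule_format, of X] X_def by blast
  then have "l < j" using below[of y l] assms by blast
  then show False using assms by simp
qed

text \<open>The connected set crosses bag \<open>j\<close> on its way from bag \<open>i\<close> to
  bag \<open>l\<close> and, being disjoint from \<open>B\<close>, adds a vertex to those that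
  \<open>B\<close> already has there.\<close>

lemma card_middle:
  assumes "conn (K \<union> A \<union> C)" "B \<inter> (K \<union> A \<union> C) = {}"
    "i \<le> j" "j \<le> l" "l < length Ws"
    "A \<inter> Ws ! i \<noteq> {}" "C \<inter> Ws ! l \<noteq> {}" "c \<le> card (Ws ! j \<inter> B)"
  shows "c + 1 \<le> card (Ws ! j \<inter> (K \<union> A \<union> B \<union> C))"
proof -
  obtain x y where "x \<in> A" "x \<in> Ws ! i" "y \<in> C" "y \<in> Ws ! l" using assms by blast
  then have "(K \<union> A \<union> C) \<inter> Ws ! j \<noteq> {}" using conn_hits[OF assms(1), of x y i l j] assms by blast
  then obtain z where z: "z \<in> K \<union> A \<union> C" "z \<in> Ws ! j" by blast
  have fin: "finite (Ws ! j)" using Ws_card assms by simp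
  have "c + 1 \<le> card (insert z (Ws ! j \<inter> B))" using z assms fin by (subst card_insert_disjoint) auto
  also have "\<dots> \<le> card (Ws ! j \<inter> (K \<union> A \<union> B \<union> C))"
    using z fin by (intro card_mono) auto
  finally show ?thesis .
qed

text \<open>Of three bags, one lies between the other two, and the two sets belonging to the outer
  bags, joined through \<open>K\<close>, cross it. This step makes the pathwidth of a tree grow with
  its depth. The cases are the six orders of the bags.\<close>

lemma card_three:
  assumes K: "conn K" "conn A" "conn B" "conn C" "link K A" "link K B" "link K C"
    and d: "K \<inter> A = {}" "K \<inter> B = {}" "K \<inter> C = {}" "A \<inter> B = {}" "A \<inter> C = {}" "B \<inter> C = {}"
    and i: "i < length Ws" "c + 1 \<le> card (Ws ! i \<inter> A)"
    and j: "j < length Ws" "c + 1 \<le> card (Ws ! j \<inter> B)"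
    and l: "l < length Ws" "c + 1 \<le> card (Ws ! l \<inter> C)"
  shows "\<exists>i<length Ws. c + 2 \<le> card (Ws ! i \<inter> (K \<union> A \<union> B \<union> C))"
proof -
  have KK: "conn (K \<union> A \<union> B)" "conn (K \<union> A \<union> C)" "conn (K \<union> B \<union> C)"
    by (rule conn_Un conn_Un[OF K(1)] K link_mono[OF K(5)] link_mono[OF K(6)] link_mono[OF K(7)] order_refl Un_upper1)+
  then have KK': "conn (K \<union> B \<union> A)" "conn (K \<union> C \<union> A)" "conn (K \<union> C \<union> B)"
    by (simp_all add: Un_ac)
  have ne: "A \<inter> Ws ! i \<noteq> {}" "B \<inter> Ws ! j \<noteq> {}" "C \<inter> Ws ! l \<noteq> {}"
    using i j l by (auto simp: Int_commute)
  have perm: "K \<union> A \<union> B \<union> C = K \<union> A \<union> C \<union> B" "K \<union> A \<union> B \<union> C = K \<union> B \<union> A \<union> C"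
    "K \<union> A \<union> B \<union> C = K \<union> B \<union> C \<union> A" "K \<union> A \<union> B \<union> C = K \<union> C \<union> A \<union> B" "K \<union> A \<union> B \<union> C = K \<union> C \<union> B \<union> A"
    by blast+
  have dj: "A \<inter> (K \<union> B \<union> C) = {}" "A \<inter> (K \<union> C \<union> B) = {}" "B \<inter> (K \<union> A \<union> C) = {}"
    "B \<inter> (K \<union> C \<union> A) = {}" "C \<inter> (K \<union> A \<union> B) = {}" "C \<inter> (K \<union> B \<union> A) = {}"
    using d by blast+
  consider "i \<le> j" "j \<le> l" | "l \<le> j" "j \<le> i" | "j \<le> i" "i \<le> l" | "l \<le> i" "i \<le> j" | "i \<le> l" "l \<le> j" | "j \<le> l" "l \<le> i"
    by linarith
  then show ?thesis
  proof cases
    case 1 then show ?thesis using card_middle[OF KK(2) dj(3) 1 l(1) ne(1,3) j(2)] d j(1) by auto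
  next
    case 2 then show ?thesis using card_middle[OF KK'(2) dj(4) 2 i(1) ne(3,1) j(2)] d j(1) perm(5) by auto
  next
    case 3 then show ?thesis using card_middle[OF KK(3) dj(1) 3 l(1) ne(2,3) i(2)] d i(1) perm(2) by auto
  next
    case 4 then show ?thesis using card_middle[OF KK'(3) dj(2) 4 j(1) ne(3,2) i(2)] d i(1) perm(4) by auto
  next
    case 5 then show ?thesis using card_middle[OF KK(1) dj(5) 5 j(1) ne(1,2) l(2)] d l(1) perm(1) by auto
  next
    case 6 then show ?thesis using card_middle[OF KK'(1) dj(6) 6 i(1) ne(2,1) l(2)] d l(1) perm(3) by auto
  qed
qed

text \<open>Two more levels force one more vertex: the subtrees at three grandchildren are the sets
  for \<open>card_three\<close>, and the root with its two children connects them.\<close>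

lemma complete_tree_bag:
  assumes "tree_model T {..<n} Br" "complete_tree T p (2 * j)" "p \<ge> 1"
  shows "\<exists>i<length Ws. j + 1 \<le> card (Ws ! i \<inter> subtree Br p (2 * j))"
  using assms(2,3)
proof (induction j arbitrary: p)
  case 0
  have "T p - 1 \<in> Br p" "T p - 1 < n" using assms(1) 0 unfolding tree_model_def by auto
  then obtain i where i: "i < length Ws" "T p - 1 \<in> Ws ! i" using Ws_cover by blast
  then have "card (Ws ! i \<inter> Br p) \<noteq> 0" using \<open>T p - 1 \<in> Br p\<close> Ws_card by auto
  then show ?case using i by auto
next
  case (Suc j)
  let ?S = "\<lambda>q. subtree Br q (2 * j)"
  let ?K = "Br p \<union> Br (2 * p) \<union> Br (2 * p + 1)"
  have c: "complete_tree T (4 * p) (2 * j)" "complete_tree T (4 * p + 1) (2 * j)" "complete_tree T (4 * p + 2) (2 * j)"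
    and T: "T p \<noteq> 0" "T (2 * p) \<noteq> 0" "T (2 * p + 1) \<noteq> 0"
    using Suc.prems(1) by auto
  obtain i1 where 1: "i1 < length Ws" "j + 1 \<le> card (Ws ! i1 \<inter> ?S (4 * p))"
    using Suc.IH[OF c(1)] Suc.prems by auto
  obtain i2 where 2: "i2 < length Ws" "j + 1 \<le> card (Ws ! i2 \<inter> ?S (4 * p + 1))"
    using Suc.IH[OF c(2)] Suc.prems by auto
  obtain i3 where 3: "i3 < length Ws" "j + 1 \<le> card (Ws ! i3 \<inter> ?S (4 * p + 2))"
    using Suc.IH[OF c(3)] Suc.prems by auto
  have lk: "link (Br a) (Br r)" if "a \<ge> 1" "r = 2 * a \<or> r = 2 * a + 1" "T a \<noteq> 0" "T r \<noteq> 0" for a r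
    using assms(1) that unfolding tree_model_def by blast
  have cn: "conn (Br a)" if "T a \<noteq> 0" for a
    using assms(1) that unfolding tree_model_def by blast
  have ST: "T (4 * p) \<noteq> 0" "T (4 * p + 1) \<noteq> 0" "T (4 * p + 2) \<noteq> 0"
    using c complete_tree_root by blast+
  have kc: "conn ?K"
    apply (rule conn_Un, rule conn_Un)
    apply (rule cn[OF T(1)], rule cn[OF T(2)], rule lk) apply (use T Suc.prems in auto)[4]
    apply (rule cn[OF T(3)], rule link_mono[OF lk[of p "2*p+1"]])
    using T Suc.prems by auto
  have l1: "link ?K (?S (4 * p))"
    by (rule link_mono[OF lk[of "2*p" "4*p"]], (use T ST Suc.prems in auto)[5], rule subtree_root)
  have l2: "link ?K (?S (4 * p + 1))"
    by (rule link_mono[OF lk[of "2*p" "4*p+1"]], (use T ST Suc.prems in auto)[5], rule subtree_root)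
  have l3: "link ?K (?S (4 * p + 2))"
    by (rule link_mono[OF lk[of "2*p+1" "4*p+2"]], (use T ST Suc.prems in auto)[5], rule subtree_root)
  have Kd: "?K \<inter> ?S q = {}" if "complete_tree T q (2 * j)" "q \<ge> 4 * p" for q
    using subtree_root_disjoint[OF assms(1) that(1) T(1)] subtree_root_disjoint[OF assms(1) that(1) T(2)]
      subtree_root_disjoint[OF assms(1) that(1) T(3)] that Suc.prems by (simp add: Int_Un_distrib2)
  have cS: "conn (?S q)" if "complete_tree T q (2 * j)" "q \<ge> 1" for q
    by (rule conn_subtree[OF assms(1) that])
  have dS: "?S q \<inter> ?S r = {}" if "complete_tree T q (2 * j)" "complete_tree T r (2 * j)" "q < r" "r < 2 * q" for q r
    by (rule subtree_disjoint[OF assms(1) that])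
  have "\<exists>i<length Ws. j + 2 \<le> card (Ws ! i \<inter> (?K \<union> ?S (4 * p) \<union> ?S (4 * p + 1) \<union> ?S (4 * p + 2)))"
    by (rule card_three[OF kc cS[OF c(1)] cS[OF c(2)] cS[OF c(3)] l1 l2 l3 Kd[OF c(1)] Kd[OF c(2)] Kd[OF c(3)]
      dS[OF c(1,2)] dS[OF c(1,3)] dS[OF c(2,3)] 1 2 3]) (use Suc.prems(2) in simp_all)
  then obtain i where i: "i < length Ws" "j + 2 \<le> card (Ws ! i \<inter> (?K \<union> ?S (4 * p) \<union> ?S (4 * p + 1) \<union> ?S (4 * p + 2)))" by blast
  have "Ws ! i \<inter> (?K \<union> ?S (4 * p) \<union> ?S (4 * p + 1) \<union> ?S (4 * p + 2)) \<subseteq> Ws ! i \<inter> subtree Br p (2 * Suc j)"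
    using subtree_root[of Br] by auto
  then have "card (Ws ! i \<inter> (?K \<union> ?S (4 * p) \<union> ?S (4 * p + 1) \<union> ?S (4 * p + 2))) \<le> card (Ws ! i \<inter> subtree Br p (2 * Suc j))"
    using Ws_card i by (intro card_mono) auto
  then show ?case using i by (intro exI[of _ i]) auto
qed

text \<open>The descendants of \<open>p\<close> at depth at most \<open>j\<close> all have positions
  below \<open>(p + 1) * 2 ^ j\<close>.\<close>

lemma complete_tree_range:
  assumes "p \<ge> 1" "\<And>q. q \<ge> 1 \<Longrightarrow> q < (p + 1) * 2 ^ j \<Longrightarrow> T q \<noteq> 0"
  shows "complete_tree T p j"
  using assms
proof (induction j arbitrary: p)
  case (Suc j)
  have "(p + 1) * 1 \<le> (p + 1) * 2 ^ Suc j" by (rule mult_le_mono2) simp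
  then have "p < (p + 1) * 2 ^ Suc j" by (rule less_le_trans[rotated]) simp
  moreover have "(2 * p + 1) * 2 ^ j \<le> (p + 1) * 2 ^ Suc j" "(2 * p + 1 + 1) * 2 ^ j \<le> (p + 1) * 2 ^ Suc j"
    by (simp_all add: algebra_simps)
  ultimately show ?case using Suc.prems by (auto intro!: Suc.IH)
qed auto

text \<open>Otherwise the tree would be complete to depth \<open>2 * k\<close> and some bag would
  contain \<open>k + 1\<close> vertices. The first position that lacks a child is hence always found
  within a bounded range.\<close>

lemma unsaturated_bound:
  assumes "tree_model T {..<n} Br" "T 1 \<noteq> 0" "\<And>q. q \<ge> 1 \<Longrightarrow> q < p \<Longrightarrow> T (2 * q) \<noteq> 0 \<and> T (2 * q + 1) \<noteq> 0"
  shows "p < 2 ^ (2 * k)"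
proof (rule ccontr)
  assume *: "\<not> p < 2 ^ (2 * k)"
  have "T q \<noteq> 0" if "q \<ge> 1" "q < (1 + 1) * 2 ^ (2 * k)" for q
  proof (cases "q = 1")
    case False
    have h: "q div 2 \<ge> 1" "q div 2 < p" using that * False by auto
    have "q = 2 * (q div 2) \<or> q = 2 * (q div 2) + 1" by presburger
    then show ?thesis using assms(3)[OF h] by metis
  qed (use assms in simp)
  then have "complete_tree T 1 (2 * k)" by (intro complete_tree_range) auto
  then obtain i where i: "i < length Ws" "k + 1 \<le> card (Ws ! i \<inter> subtree Br 1 (2 * k))"
    using complete_tree_bag[OF assms(1)] by auto
  have "card (Ws ! i \<inter> subtree Br 1 (2 * k)) \<le> card (Ws ! i)" using Ws_card i by (intro card_mono) auto
  then show False using i Ws_card[OF i(1)] by simp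
qed

text \<open>Charge an edge to the endpoint whose first bag is later; the other endpoint lies in that
  bag. Each vertex is charged for at most \<open>k\<close> edges, and the factor 2 counts both
  directions.\<close>

lemma arcs_bound: "card {(u, v). E u v} \<le> 2 * (k * n)"
proof -
  define fi where "fi v = (LEAST i. v \<in> Ws ! i)" for v
  have fi: "v \<in> Ws ! fi v" "fi v \<le> i" if "v \<in> Ws ! i" for v i
    unfolding fi_def using that by (auto intro: LeastI Least_le)
  have fil: "fi v < length Ws" if "v < n" for v
    using that Ws_cover fi(2) order_le_less_trans by blast
  define S where "S = (SIGMA v:{..<n}. Ws ! fi v)"
  have finS: "finite S" unfolding S_def using Ws_card fil by (auto intro!: finite_SigmaI)
  have "card S = (\<Sum>v<n. card (Ws ! fi v))" unfolding S_def using Ws_card fil by (subst card_SigmaI) auto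
  also have "\<dots> \<le> (\<Sum>v<n. k)" by (rule sum_mono) (use Ws_card fil in auto)
  finally have cS: "card S \<le> k * n" by (simp add: mult.commute)
  have "{(u, v). E u v} \<subseteq> S \<union> prod.swap ` S"
  proof clarify
    fix u v assume e: "E u v" "(u, v) \<notin> prod.swap ` S"
    obtain i where i: "i < length Ws" "u \<in> Ws ! i" "v \<in> Ws ! i" using Ws_edge[OF e(1)] by blast
    then have n: "u < n" "v < n" using Ws_cover by blast+
    show "(u, v) \<in> S"
    proof (cases "fi v \<le> fi u")
      case True
      then have "v \<in> Ws ! fi u" using Ws_conv[of "fi v" "fi u" i v] fi i by auto
      then show ?thesis using n by (simp add: S_def)
    next
      case False
      then have "u \<in> Ws ! fi v" using Ws_conv[of "fi u" "fi v" i u] fi i by auto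
      then have "(v, u) \<in> S" using n by (simp add: S_def)
      then show ?thesis using e(2) by force
    qed
  qed
  then have "card {(u, v). E u v} \<le> card (S \<union> prod.swap ` S)" using finS by (intro card_mono) auto
  also have "\<dots> \<le> card S + card (prod.swap ` S)" by (rule card_Un_le)
  also have "card (prod.swap ` S) \<le> card S" by (rule card_image_le[OF finS])
  finally show ?thesis using cS by linarith
qed

end

section \<open>Growing and contracting the token tree\<close>

text \<open>The source of position \<open>q\<close> when the vertex at \<open>p\<close> is deleted
  and the subtree at its child \<open>c\<close> moves up. Halving \<open>q\<close> until it reaches
  \<open>p\<close> or drops below it decides whether \<open>q\<close> descends from
  \<open>p\<close>. If so, \<open>c\<close> replaces \<open>p\<close> in the ancestry of
  \<open>q\<close>; otherwise \<open>q\<close> is unchanged.\<close>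

function lift_pos :: "nat \<Rightarrow> nat \<Rightarrow> nat \<Rightarrow> nat" where
  "lift_pos p c q = (if q < p then q else if q = p then c else 2 * lift_pos p c (q div 2) + q mod 2)"
  by auto
termination by (relation "measure (\<lambda>(p, c, q). q)") auto
declare lift_pos.simps [simp del]

text \<open>A left inverse that yields the injectivity of \<open>lift_pos\<close>. The alternative
  \<open>q = 0\<close> makes the recursion terminate for \<open>p = 0\<close>.\<close>

function lower_pos :: "nat \<Rightarrow> nat \<Rightarrow> nat \<Rightarrow> nat" where
  "lower_pos p c q = (if q < p then q else if q = c \<or> q = 0 then p else 2 * lower_pos p c (q div 2) + q mod 2)"
  by auto
termination by (relation "measure (\<lambda>(p, c, q). q)") auto
declare lower_pos.simps [simp del]

lemma lift_pos_less: "q < p \<Longrightarrow> lift_pos p c q = q"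
  and lift_pos_eq: "lift_pos p c p = c"
  and lift_pos_greater: "p < q \<Longrightarrow> lift_pos p c q = 2 * lift_pos p c (q div 2) + q mod 2"
  by (subst lift_pos.simps, simp)+

lemma lift_pos_ge: "c > p \<Longrightarrow> q \<le> lift_pos p c q"
proof (induction q rule: less_induct)
  case (less q)
  consider "q < p" | "q = p" | "p < q" by linarith
  then show ?case
  proof cases
    case 3
    then have "q div 2 \<le> lift_pos p c (q div 2)" using less by auto
    then show ?thesis using lift_pos_greater[OF 3, of c] div_mult_mod_eq[of q 2] by linarith
  qed (use less in \<open>auto simp: lift_pos_less lift_pos_eq\<close>)
qed

text \<open>This is why the vertex at \<open>p\<close> disappears: no position receives its
  content.\<close>

lemma lift_pos_neq: "c > p \<Longrightarrow> lift_pos p c q \<noteq> p"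
  using lift_pos_ge[of p c q] lift_pos_eq[of p c] lift_pos_less[of q p c]
  by (metis leD linorder_neqE_nat)

lemma lower_lift_pos:
  assumes "c div 2 = p" "p \<ge> 1"
  shows "lower_pos p c (lift_pos p c q) = q"
proof (induction q rule: less_induct)
  case (less q)
  have cp: "c > p" using assms by linarith
  consider "q < p" | "q = p" | "p < q" by linarith
  then show ?case
  proof cases
    case 1
    then show ?thesis by (subst lower_pos.simps) (simp add: lift_pos_less)
  next
    case 2
    then show ?thesis using cp by (subst lower_pos.simps) (simp add: lift_pos_eq)
  next
    case 3
    have e: "lift_pos p c q = 2 * lift_pos p c (q div 2) + q mod 2" by (rule lift_pos_greater[OF 3])
    then have d: "lift_pos p c q div 2 = lift_pos p c (q div 2)" "lift_pos p c q mod 2 = q mod 2" by auto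
    have "lift_pos p c q \<noteq> c" using d(1) assms lift_pos_neq[OF cp, of "q div 2"] by auto
    moreover have "lift_pos p c q > p" using lift_pos_ge[OF cp, of q] 3 by linarith
    ultimately have "lower_pos p c (lift_pos p c q) = 2 * lower_pos p c (lift_pos p c q div 2) + lift_pos p c q mod 2"
      by (subst lower_pos.simps) auto
    also have "lower_pos p c (lift_pos p c q div 2) = q div 2" unfolding d(1) using less.IH[of "q div 2"] 3 by simp
    finally show ?thesis using d(2) by simp
  qed
qed

lemma lift_pos_inj: "c div 2 = p \<Longrightarrow> p \<ge> 1 \<Longrightarrow> lift_pos p c q = lift_pos p c q' \<Longrightarrow> q = q'"
  by (metis lower_lift_pos)

text \<open>No other vertex gets lost: the climb from an occupied position either drops below
  \<open>p\<close> without meeting it or passes through \<open>p\<close>, and then through its only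
  occupied child \<open>c\<close>.\<close>

lemma lift_pos_surj:
  assumes T: "\<And>p. p \<ge> 1 \<Longrightarrow> T (2 * p) \<noteq> (0::nat) \<or> T (2 * p + 1) \<noteq> 0 \<Longrightarrow> T p \<noteq> 0" "p \<ge> 1"
    and c: "\<And>q. q = 2 * p \<or> q = 2 * p + 1 \<Longrightarrow> T q \<noteq> 0 \<Longrightarrow> q = c"
    and q: "T q \<noteq> 0" "q \<noteq> p"
  shows "\<exists>q'. lift_pos p c q' = q"
  using q
proof (induction q rule: less_induct)
  case (less q)
  show ?case
  proof (cases "q < p")
    case True
    then show ?thesis using lift_pos_less by blast
  next
    case False
    then have gt: "p < q" using less.prems by simp
    have q: "q = 2 * (q div 2) \<or> q = 2 * (q div 2) + 1" by presburger
    have h: "q div 2 \<ge> 1" using gt assms(2) by auto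
    have Th: "T (q div 2) \<noteq> 0" using T(1)[OF h] less.prems q by metis
    show ?thesis
    proof (cases "q div 2 = p")
      case True
      then have "q = c" using c q less.prems by metis
      then show ?thesis using lift_pos_eq by blast
    next
      case False
      then obtain h' where h': "lift_pos p c h' = q div 2" using less.IH[of "q div 2"] Th gt by auto
      define q' where "q' = 2 * h' + q mod 2"
      have d: "q' div 2 = h'" "q' mod 2 = q mod 2" by (auto simp: q'_def)
      have "p < q'"
      proof (rule ccontr)
        assume le: "\<not> p < q'"
        then have "h' < p" using d assms(2) by linarith
        then have "h' = q div 2" using h' lift_pos_less by simp
        then have "q' = q" using d by (metis div_mod_decomp)
        then show False using le gt by simp
      qed
      then have "lift_pos p c q' = 2 * lift_pos p c h' + q mod 2" using lift_pos_greater d by metis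
      also have "\<dots> = q" using h' by simp
      finally show ?thesis by blast
    qed
  qed
qed

section \<open>The invariant of the token tree\<close>

locale graph_input = path_dec E n k Ws for E n k Ws +
  fixes adj :: "nat list list"
  assumes n_pos: "n \<ge> 1" and length_adj: "length adj = n"
    and adj_set: "v < n \<Longrightarrow> set (adj ! v) = {w. E v w}"
    and adj_distinct: "v < n \<Longrightarrow> distinct (adj ! v)"
    and E_irrefl: "\<not> E v v"
begin

abbreviation "deg v \<equiv> length (adj ! v)"

lemma E_less: "E u v \<Longrightarrow> u < n \<and> v < n"
  using Ws_edge[of u v] Ws_cover by blast

lemma adj_nth: "v < n \<Longrightarrow> i < deg v \<Longrightarrow> E v (adj ! v ! i)"
  using adj_set[of v] nth_mem[of i "adj ! v"] by blast

lemma sum_deg: "(\<Sum>v<n. deg v) \<le> 2 * (k * n)"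
proof -
  have "{(u, v). E u v} = (SIGMA u:{..<n}. set (adj ! u))"
    using E_less adj_set by auto
  moreover have "card (SIGMA u:{..<n}. set (adj ! u)) = (\<Sum>v<n. deg v)"
    using adj_distinct by (subst card_SigmaI) (auto simp: distinct_card)
  ultimately show ?thesis using arcs_bound by simp
qed

definition alive :: "(nat \<Rightarrow> nat) \<Rightarrow> (nat \<Rightarrow> nat) \<Rightarrow> nat \<Rightarrow> nat set" where
  "alive inn out j = {v. v < n \<and> inn v \<noteq> 0 \<and> inn v \<le> j \<and> (out v = 0 \<or> j \<le> out v)}"

lemma finite_alive [simp]: "finite (alive inn out j)"
  by (auto simp: alive_def)

text \<open>\<open>inn v\<close> and \<open>out v\<close> are the numbers of the first and the last bag that contain \<open>v\<close>,
  where \<open>0\<close> means that the event has not happened yet; \<open>cur v\<close> counts the inspected neighbours of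
  \<open>v\<close>, and \<open>ord j\<close> is the vertex that enters in bag \<open>j\<close>.\<close>

definition token_inv :: "(nat \<Rightarrow> nat) \<Rightarrow> (nat \<Rightarrow> nat) \<Rightarrow> (nat \<Rightarrow> nat) \<Rightarrow> (nat \<Rightarrow> nat) \<Rightarrow> (nat \<Rightarrow> nat)
    \<Rightarrow> nat \<Rightarrow> nat \<Rightarrow> nat \<Rightarrow> bool" where
  "token_inv inn out cur T ord t r hi \<longleftrightarrow>
     t \<le> n \<and> r \<le> n \<and> 1 \<le> hi \<and> hi \<le> 2 ^ (2 * k + 1) \<and>
     (\<forall>j. 1 \<le> j \<and> j \<le> t \<longrightarrow> ord j < n \<and> inn (ord j) = j) \<and>
     (\<forall>v<n. inn v \<noteq> 0 \<longrightarrow> inn v \<le> t \<and> ord (inn v) = v) \<and>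
     (\<forall>v<r. inn v \<noteq> 0) \<and> (\<forall>v<n. out v \<le> n) \<and>
     T 0 = 0 \<and> (\<forall>p. T p \<noteq> 0 \<longrightarrow> p \<le> hi \<and> T p - 1 < n \<and> inn (T p - 1) \<noteq> 0 \<and> out (T p - 1) = 0) \<and>
     (\<forall>p q. T p \<noteq> 0 \<and> T p = T q \<longrightarrow> p = q) \<and>
     (\<forall>v<n. inn v \<noteq> 0 \<and> out v = 0 \<longrightarrow> (\<exists>p. T p = Suc v)) \<and>
     (\<forall>p\<ge>1. T (2 * p) \<noteq> 0 \<or> T (2 * p + 1) \<noteq> 0 \<longrightarrow> T p \<noteq> 0) \<and>
     (\<forall>v<n. out v \<noteq> 0 \<longrightarrow> inn v \<noteq> 0 \<and> inn v \<le> out v \<and> out v \<le> t \<and>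
        (\<forall>w. E v w \<longrightarrow> inn w \<noteq> 0 \<and> inn w \<le> out v)) \<and>
     (\<forall>v<n. cur v \<le> deg v \<and> (\<forall>j<cur v. inn (adj ! v ! j) \<noteq> 0)) \<and>
     (\<forall>j\<le>t. card (alive inn out j) \<le> hi) \<and>
     (\<exists>Br. tree_model T {v. v < n \<and> inn v \<noteq> 0} Br)"

lemma token_invD:
  assumes "token_inv inn out cur T ord t r hi"
  shows "t \<le> n" "r \<le> n" "1 \<le> hi" "hi \<le> 2 ^ (2 * k + 1)"
    "\<forall>j. 1 \<le> j \<and> j \<le> t \<longrightarrow> ord j < n \<and> inn (ord j) = j"
    "\<forall>v<n. inn v \<noteq> 0 \<longrightarrow> inn v \<le> t \<and> ord (inn v) = v"
    "\<forall>v<r. inn v \<noteq> 0" "\<forall>v<n. out v \<le> n" "T 0 = 0"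
    "\<forall>p. T p \<noteq> 0 \<longrightarrow> p \<le> hi \<and> T p - 1 < n \<and> inn (T p - 1) \<noteq> 0 \<and> out (T p - 1) = 0"
    "\<forall>p q. T p \<noteq> 0 \<and> T p = T q \<longrightarrow> p = q"
    "\<forall>v<n. inn v \<noteq> 0 \<and> out v = 0 \<longrightarrow> (\<exists>p. T p = Suc v)"
    "\<forall>p\<ge>1. T (2 * p) \<noteq> 0 \<or> T (2 * p + 1) \<noteq> 0 \<longrightarrow> T p \<noteq> 0"
    "\<forall>v<n. out v \<noteq> 0 \<longrightarrow> inn v \<noteq> 0 \<and> inn v \<le> out v \<and> out v \<le> t \<and>
        (\<forall>w. E v w \<longrightarrow> inn w \<noteq> 0 \<and> inn w \<le> out v)"
    "\<forall>v<n. cur v \<le> deg v \<and> (\<forall>j<cur v. inn (adj ! v ! j) \<noteq> 0)"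
    "\<forall>j\<le>t. card (alive inn out j) \<le> hi"
    "\<exists>Br. tree_model T {v. v < n \<and> inn v \<noteq> 0} Br"
  using assms unfolding token_inv_def by - (elim conjE, assumption)+

lemmas token_inv_ord = token_invD(5)[THEN spec, THEN mp, OF _ conjI]
  and token_inv_inn = token_invD(6)[THEN spec, THEN mp, THEN mp]
  and token_inv_root = token_invD(7)[THEN spec, THEN mp]
  and token_inv_out_le = token_invD(8)[THEN spec, THEN mp]
  and token_inv_0 = token_invD(9)
  and token_inv_T = token_invD(10)[THEN spec, THEN mp]
  and token_inv_inj = token_invD(11)[THEN spec, THEN spec, THEN mp, OF _ conjI]
  and token_inv_surj = token_invD(12)[THEN spec, THEN mp, THEN mp, OF _ _ conjI]
  and token_inv_parent = token_invD(13)[THEN spec, THEN mp, THEN mp]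
  and token_inv_out = token_invD(14)[THEN spec, THEN mp, THEN mp]
  and token_inv_deg = token_invD(15)[THEN spec, THEN mp]
  and token_inv_card = token_invD(16)[THEN spec, THEN mp]
  and token_inv_model = token_invD(17)

text \<open>The measure of progress: every round of the main loop inspects one list entry, removes
  one vertex or advances the root candidate, and so raises it by exactly one.\<close>

definition work :: "(nat \<Rightarrow> nat) \<Rightarrow> (nat \<Rightarrow> nat) \<Rightarrow> nat \<Rightarrow> nat" where
  "work out cur r = (\<Sum>v<n. cur v) + card {v. v < n \<and> out v \<noteq> 0} + r"

lemma token_inv_init: "token_inv (\<lambda>_. 0) (\<lambda>_. 0) (\<lambda>_. 0) (\<lambda>_. 0) (\<lambda>_. 0) 0 0 1"
  by (auto simp: token_inv_def alive_def tree_model_def)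

lemma work_bound:
  assumes "token_inv inn out cur T ord t r hi"
  shows "work out cur r \<le> 2 * (k * n) + 2 * n"
proof -
  have "(\<Sum>v<n. cur v) \<le> (\<Sum>v<n. deg v)" using token_inv_deg[OF assms] by (intro sum_mono) auto
  moreover have "card {v. v < n \<and> out v \<noteq> 0} \<le> card {..<n}" by (intro card_mono) auto
  moreover have "r \<le> n" using token_invD(2)[OF assms] .
  ultimately show ?thesis using sum_deg by (simp add: work_def)
qed

lemma work_cur: "v < n \<Longrightarrow> work out (cur(v := Suc (cur v))) r = Suc (work out cur r)"
proof -
  assume "v < n"
  then have "(\<Sum>u<n. (cur(v := Suc (cur v))) u) = Suc (\<Sum>u<n. cur u)"
    by (simp add: sum.remove[of "{..<n}" v])
  then show ?thesis by (simp add: work_def)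
qed

lemma work_out: "v < n \<Longrightarrow> out v = 0 \<Longrightarrow> t \<noteq> 0 \<Longrightarrow> work (out(v := t)) cur r = Suc (work out cur r)"
proof -
  assume a: "v < n" "out v = 0" "t \<noteq> 0"
  then have "{u. u < n \<and> (out(v := t)) u \<noteq> 0} = insert v {u. u < n \<and> out u \<noteq> 0}" by auto
  then have "card {u. u < n \<and> (out(v := t)) u \<noteq> 0} = Suc (card {u. u < n \<and> out u \<noteq> 0})" using a by simp
  then show ?thesis unfolding work_def by simp
qed

lemma work_root: "work out cur (Suc r) = Suc (work out cur r)"
  by (simp add: work_def)

text \<open>Parents of occupied positions are occupied, so an empty root leaves nothing.\<close>

lemma token_inv_tree_empty:
  assumes "token_inv inn out cur T ord t r hi" "T 1 = 0"
  shows "T p = 0"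
proof (induction p rule: less_induct)
  case (less p)
  show ?case
  proof (cases "p \<le> 1")
    case True
    then show ?thesis using assms(2) token_inv_0[OF assms(1)] by (auto simp: le_Suc_eq)
  next
    case False
    have "p = 2 * (p div 2) \<or> p = 2 * (p div 2) + 1" by presburger
    moreover have "T (p div 2) = 0" "p div 2 \<ge> 1" using less False by auto
    moreover have "T (2 * (p div 2)) = 0 \<and> T (2 * (p div 2) + 1) = 0"
      using token_inv_parent[OF assms(1), of "p div 2"] calculation by blast
    ultimately show ?thesis by metis
  qed
qed

lemma token_inv_all_visited:
  assumes "token_inv inn out cur T ord t r hi" "\<forall>v<n. inn v \<noteq> 0"
  shows "t = n"
proof -
  have "inj_on inn {..<n}" using token_inv_inn[OF assms(1)] assms(2) by (metis inj_onI lessThan_iff)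
  moreover have "inn ` {..<n} \<subseteq> {1..t}" using token_inv_inn[OF assms(1)] assms(2) by (auto simp: Suc_le_eq)
  ultimately have "card {..<n} \<le> card {1..t}" by (meson card_inj_on_le finite_atLeastAtMost)
  then show ?thesis using token_invD(1)[OF assms(1)] by auto
qed

text \<open>After \<open>n\<close> entrances, \<open>ord\<close> maps \<open>{1..n}\<close>
  injectively into \<open>n\<close> vertices and thus reaches all of them.\<close>

lemma token_inv_complete:
  assumes "token_inv inn out cur T ord n r hi" "v < n"
  shows "inn v \<noteq> 0"
proof -
  note o = token_inv_ord[OF assms(1)]
  have inj: "inj_on ord {1..n}" using o by (metis atLeastAtMost_iff inj_onI)
  have "ord ` {1..n} \<subseteq> {..<n}" using o by auto
  then have "ord ` {1..n} = {..<n}" using inj by (intro card_subset_eq) (auto simp: card_image)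
  then obtain j where "j \<in> {1..n}" "ord j = v" using assms by (metis imageE lessThan_iff)
  then show ?thesis using o[of j] by auto
qed

lemma alive_enter:
  assumes "inn w = 0" "j \<le> t"
  shows "alive (inn(w := Suc t)) out j = alive inn out j"
  using assms by (auto simp: alive_def)

text \<open>One lemma for both kinds of entrance, as a root and as a child of a neighbour. The
  branch set of the new position is \<open>{w}\<close>; it is linked to that of the parent because
  the vertex placed there is adjacent to \<open>w\<close>.\<close>

lemma token_inv_enter:
  assumes inv: "token_inv inn out cur T ord t r hi"
    and w: "w < n" "inn w = 0"
    and c: "T c = 0" "c \<ge> 1" "T (2 * c) = 0" "T (2 * c + 1) = 0" "c \<le> hi'" "hi \<le> hi'" "hi' \<le> 2 ^ (2 * k + 1)"
    and par: "c = 1 \<or> (\<exists>p\<ge>1. (c = 2 * p \<or> c = 2 * p + 1) \<and> T p \<noteq> 0 \<and> E (T p - 1) w)"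
    and r': "r' \<le> n" "\<forall>v<r'. v \<noteq> w \<longrightarrow> inn v \<noteq> 0"
    and cur': "\<forall>v<n. cur' v \<le> deg v \<and> (\<forall>j<cur' v. inn (adj ! v ! j) \<noteq> 0 \<or> adj ! v ! j = w)"
  shows "token_inv (inn(w := Suc t)) out cur' (T(c := Suc w)) (ord(Suc t := w)) (Suc t) r' hi'"
proof -
  let ?inn = "inn(w := Suc t)" and ?T = "T(c := Suc w)" and ?ord = "ord(Suc t := w)"
  have tn: "t < n"
  proof -
    note o = token_inv_ord[OF inv]
    have "ord ` {1..t} \<subseteq> {..<n} - {w}" using o w by force
    moreover have "inj_on ord {1..t}" using o by (metis atLeastAtMost_iff inj_onI)
    ultimately have "card {1..t} \<le> card ({..<n} - {w})" by (meson card_inj_on_le finite_Diff finite_lessThan)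
    then show ?thesis using w by auto
  qed
  have outw: "out w = 0" using token_inv_out[OF inv w(1)] w by auto
  have Tw: "T q \<noteq> Suc w" for q using token_inv_T[OF inv, of q] w by auto
  have ord: "\<forall>j. 1 \<le> j \<and> j \<le> Suc t \<longrightarrow> ?ord j < n \<and> ?inn (?ord j) = j"
    using token_inv_ord[OF inv] w by (auto simp: le_Suc_eq)
  have ord2: "\<forall>v<n. ?inn v \<noteq> 0 \<longrightarrow> ?inn v \<le> Suc t \<and> ?ord (?inn v) = v"
  proof (intro allI impI)
    fix v assume v: "v < n" "?inn v \<noteq> 0"
    show "?inn v \<le> Suc t \<and> ?ord (?inn v) = v"
    proof (cases "v = w")
      case False
      then have "inn v \<noteq> 0" using v by simp
      then have "inn v \<le> t" "ord (inn v) = v" using token_inv_inn[OF inv v(1)] by auto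
      then show ?thesis using False by auto
    qed simp
  qed
  have Tp: "\<forall>p. ?T p \<noteq> 0 \<longrightarrow> p \<le> hi' \<and> ?T p - 1 < n \<and> ?inn (?T p - 1) \<noteq> 0 \<and> out (?T p - 1) = 0"
  proof (intro allI impI)
    fix p assume "?T p \<noteq> 0"
    then show "p \<le> hi' \<and> ?T p - 1 < n \<and> ?inn (?T p - 1) \<noteq> 0 \<and> out (?T p - 1) = 0"
      using token_inv_T[OF inv, of p] w outw c by (cases "p = c") (auto intro: order_trans)
  qed
  have inj: "\<forall>p q. ?T p \<noteq> 0 \<and> ?T p = ?T q \<longrightarrow> p = q"
    using token_inv_inj[OF inv] Tw by (metis fun_upd_apply)
  have surj: "\<forall>v<n. ?inn v \<noteq> 0 \<and> out v = 0 \<longrightarrow> (\<exists>p. ?T p = Suc v)"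
  proof (intro allI impI)
    fix v assume v: "v < n" "?inn v \<noteq> 0 \<and> out v = 0"
    show "\<exists>p. ?T p = Suc v"
    proof (cases "v = w")
      case False
      then obtain p where "T p = Suc v" using token_inv_surj[OF inv v(1)] v by auto
      then show ?thesis using c by (intro exI[of _ p]) auto
    qed auto
  qed
  have pre: "\<forall>p\<ge>1. ?T (2 * p) \<noteq> 0 \<or> ?T (2 * p + 1) \<noteq> 0 \<longrightarrow> ?T p \<noteq> 0"
  proof (intro allI impI)
    fix p :: nat assume p: "p \<ge> 1" "?T (2 * p) \<noteq> 0 \<or> ?T (2 * p + 1) \<noteq> 0"
    show "?T p \<noteq> 0"
    proof (cases "c = 2 * p \<or> c = 2 * p + 1")
      case True
      have "c \<noteq> 1" using True p(1) by linarith
      then obtain p' where p': "c = 2 * p' \<or> c = 2 * p' + 1" "T p' \<noteq> 0" using par by blast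
      have "p' = p" using True p'(1) by presburger
      then show ?thesis using p'(2) by simp
    next
      case False
      then have "T (2 * p) \<noteq> 0 \<or> T (2 * p + 1) \<noteq> 0" using p by (auto split: if_splits)
      then show ?thesis using token_inv_parent[OF inv p(1)] by auto
    qed
  qed
  have outs: "\<forall>v<n. out v \<noteq> 0 \<longrightarrow> ?inn v \<noteq> 0 \<and> ?inn v \<le> out v \<and> out v \<le> Suc t \<and>
        (\<forall>u. E v u \<longrightarrow> ?inn u \<noteq> 0 \<and> ?inn u \<le> out v)"
  proof (intro allI impI)
    fix v assume v: "v < n" "out v \<noteq> 0"
    then have o: "inn v \<noteq> 0" "inn v \<le> out v" "out v \<le> t" "\<And>u. E v u \<Longrightarrow> inn u \<noteq> 0 \<and> inn u \<le> out v"
      using token_inv_out[OF inv v] by blast+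
    have "v \<noteq> w" using v outw by auto
    moreover have "u \<noteq> w" if "E v u" for u using o(4)[OF that] w by auto
    ultimately show "?inn v \<noteq> 0 \<and> ?inn v \<le> out v \<and> out v \<le> Suc t \<and>
        (\<forall>u. E v u \<longrightarrow> ?inn u \<noteq> 0 \<and> ?inn u \<le> out v)" using o by auto
  qed
  have curs: "\<forall>v<n. cur' v \<le> deg v \<and> (\<forall>j<cur' v. ?inn (adj ! v ! j) \<noteq> 0)"
    using cur' by auto
  have card: "\<forall>j\<le>Suc t. card (alive ?inn out j) \<le> hi'"
  proof (intro allI impI)
    fix j assume "j \<le> Suc t"
    show "card (alive ?inn out j) \<le> hi'"
    proof (cases "j = Suc t")
      case False
      then have "j \<le> t" using \<open>j \<le> Suc t\<close> by simp
      then have "card (alive inn out j) \<le> hi" by (rule token_inv_card[OF inv])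
      then show ?thesis using alive_enter[of inn w j t out] w(2) \<open>j \<le> t\<close> c by simp
    next
      case True
      \<comment> \<open>All vertices alive in the new bag sit on the tree, and their distinct
        positions in \<open>{1..hi'}\<close> bound the size of the bag.\<close>
      define pos where "pos v = (SOME p. ?T p = Suc v)" for v
      have pos: "?T (pos v) = Suc v" if "v \<in> alive ?inn out j" for v
      proof -
        have "out v = 0"
        proof (rule ccontr)
          assume "out v \<noteq> 0"
          then have "out v \<le> t" "Suc t \<le> out v" using that token_inv_out[OF inv, of v] True by (auto simp: alive_def)
          then show False by simp
        qed
        then have "\<exists>p. ?T p = Suc v" using surj that by (auto simp: alive_def)
        then show ?thesis unfolding pos_def by (rule someI_ex)
      qed
      have "inj_on pos (alive ?inn out j)" using pos by (metis inj_onI nat.inject)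
      moreover have "pos ` alive ?inn out j \<subseteq> {1..hi'}"
      proof clarify
        fix v assume "v \<in> alive ?inn out j"
        then have nz: "?T (pos v) \<noteq> 0" using pos by simp
        then have "pos v \<le> hi'" using Tp by blast
        moreover have "pos v \<noteq> 0" using nz token_inv_0[OF inv] c(2) by (cases "pos v = 0") auto
        ultimately show "pos v \<in> {1..hi'}" by simp
      qed
      ultimately have "card (alive ?inn out j) \<le> card {1..hi'}" by (meson card_inj_on_le finite_atLeastAtMost)
      then show ?thesis by simp
    qed
  qed
  obtain Br where Br: "tree_model T {v. v < n \<and> inn v \<noteq> 0} Br" using token_inv_model[OF inv] by blast
  have "tree_model ?T {v. v < n \<and> ?inn v \<noteq> 0} (Br(c := {w}))"
    unfolding tree_model_def
  proof (intro conjI allI impI)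
    fix p assume p: "?T p \<noteq> 0"
    have "p = c \<or> p \<noteq> c \<and> T p - 1 \<in> Br p \<and> Br p \<subseteq> {v. v < n \<and> inn v \<noteq> 0} \<and> conn (Br p)"
      using p Br unfolding tree_model_def by (cases "p = c") auto
    then show "?T p - 1 \<in> (Br(c := {w})) p" "(Br(c := {w})) p \<subseteq> {v. v < n \<and> ?inn v \<noteq> 0}" "conn ((Br(c := {w})) p)"
      using w conn_singleton by auto
  next
    fix p q assume p: "?T p \<noteq> 0" "?T q \<noteq> 0" "p \<noteq> q"
    have nw: "w \<notin> Br x" if "T x \<noteq> 0" for x
    proof -
      have "Br x \<subseteq> {v. v < n \<and> inn v \<noteq> 0}" using Br that unfolding tree_model_def by blast
      then show ?thesis using w by blast
    qed
    have "Br p \<inter> Br q = {}" if "T p \<noteq> 0" "T q \<noteq> 0" using Br that p unfolding tree_model_def by blast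
    then show "(Br(c := {w})) p \<inter> (Br(c := {w})) q = {}" using p nw by (auto split: if_splits)
  next
    fix p q assume p: "1 \<le> p" "q = 2 * p \<or> q = 2 * p + 1" "?T p \<noteq> 0" "?T q \<noteq> 0"
    have pc: "p \<noteq> c" using p c by auto
    have Tpp: "T p \<noteq> 0" using p pc by simp
    show "link ((Br(c := {w})) p) ((Br(c := {w})) q)"
    proof (cases "q = c")
      case True
      have "c \<noteq> 1" using True p(1,2) by linarith
      then obtain p' where p': "p' \<ge> 1" "c = 2 * p' \<or> c = 2 * p' + 1" "E (T p' - 1) w" using par by blast
      have "p' = p" using True p'(2) p(2) by presburger
      then have "E (T p - 1) w" using p'(3) by simp
      moreover have "T p - 1 \<in> Br p" using Br Tpp unfolding tree_model_def by blast
      ultimately have "link (Br p) {w}" unfolding link_def by blast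
      then show ?thesis using True pc by simp
    next
      case False
      then have "T q \<noteq> 0" using p by simp
      then have "link (Br p) (Br q)" using Br Tpp p(1,2) unfolding tree_model_def by blast
      then show ?thesis using False pc by simp
    qed
  qed
  then have model: "\<exists>Br. tree_model ?T {v. v < n \<and> ?inn v \<noteq> 0} Br" by blast
  have T0: "?T 0 = 0" using token_inv_0[OF inv] c by simp
  have hi: "1 \<le> hi'" using token_invD(3)[OF inv] c by linarith
  have rs: "\<forall>v<r'. ?inn v \<noteq> 0" using r' by auto
  have on: "\<forall>v<n. out v \<le> n" using token_inv_out_le[OF inv] by blast
  show ?thesis unfolding token_inv_def
    using tn r'(1) hi c(7) ord ord2 rs on T0 Tp inj surj pre outs curs card model
    by (intro conjI) (assumption | linarith)+
qed

text \<open>The subtree at the only possible child \<open>c\<close> of the position \<open>p\<close> moves up.\<close>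

lemma token_inv_leave:
  assumes inv: "token_inv inn out cur T ord t r hi"
    and p: "p \<ge> 1" "T p = Suc v" "cur v = deg v"
    and c: "c div 2 = p" "\<And>q. q = 2 * p \<or> q = 2 * p + 1 \<Longrightarrow> T q \<noteq> 0 \<Longrightarrow> q = c"
  shows "token_inv inn (out(v := t)) cur (\<lambda>q. T (lift_pos p c q)) ord t r hi"
proof -
  let ?out = "out(v := t)" and ?T = "\<lambda>q. T (lift_pos p c q)"
  have cp: "c > p" using c(1) p by linarith
  have v: "v < n" "inn v \<noteq> 0" "out v = 0" using token_inv_T[OF inv, of p] p by auto
  have t: "inn v \<le> t" "t \<noteq> 0" using token_inv_inn[OF inv v(1,2)] v by auto
  note ge = lift_pos_ge[OF cp] and lneq = lift_pos_neq[OF cp] and linj = lift_pos_inj[OF c(1) p(1)]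
  have lT: "T q \<noteq> Suc v" if "q \<noteq> p" for q using token_inv_inj[OF inv, of p q] p that by auto
  have Tp: "\<forall>q. ?T q \<noteq> 0 \<longrightarrow> q \<le> hi \<and> ?T q - 1 < n \<and> inn (?T q - 1) \<noteq> 0 \<and> ?out (?T q - 1) = 0"
  proof (intro allI impI)
    fix q assume q: "?T q \<noteq> 0"
    then have "lift_pos p c q \<le> hi" "?T q - 1 < n" "inn (?T q - 1) \<noteq> 0" "out (?T q - 1) = 0" using token_inv_T[OF inv] by blast+
    moreover have "?T q - 1 \<noteq> v" using lT[OF lneq[of q]] q by (metis Suc_diff_1 not_gr_zero)
    ultimately show "q \<le> hi \<and> ?T q - 1 < n \<and> inn (?T q - 1) \<noteq> 0 \<and> ?out (?T q - 1) = 0"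
      using ge[of q] by auto
  qed
  have inj: "\<forall>q q'. ?T q \<noteq> 0 \<and> ?T q = ?T q' \<longrightarrow> q = q'" using token_inv_inj[OF inv] linj by metis
  have T0: "?T 0 = 0" using p token_inv_0[OF inv] by (simp add: lift_pos_less)
  have preT: "\<And>q. q \<ge> 1 \<Longrightarrow> T (2 * q) \<noteq> 0 \<or> T (2 * q + 1) \<noteq> 0 \<Longrightarrow> T q \<noteq> 0" using token_inv_parent[OF inv] by blast
  have surj: "\<forall>u<n. inn u \<noteq> 0 \<and> ?out u = 0 \<longrightarrow> (\<exists>q. ?T q = Suc u)"
  proof (intro allI impI)
    fix u assume u: "u < n" "inn u \<noteq> 0 \<and> ?out u = 0"
    have uv: "u \<noteq> v" using u t by auto
    then obtain q where q: "T q = Suc u" using token_inv_surj[OF inv u(1)] u by auto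
    then have "q \<noteq> p" using p uv by auto
    then show "\<exists>q. ?T q = Suc u" using lift_pos_surj[of T p c q, OF preT p(1) c(2)] q by auto
  qed
  \<comment> \<open>Lifting respects the parent relation except at \<open>p\<close> itself, whose
    new occupant comes from one level deeper.\<close>
  have child: "lift_pos p c r = 2 * lift_pos p c q \<or> lift_pos p c r = 2 * lift_pos p c q + 1"
    if "r \<noteq> p" "r = 2 * q \<or> r = 2 * q + 1" for r q
  proof (cases "r < p")
    case True
    then have "q < p" using that by auto
    then show ?thesis using True that by (simp add: lift_pos_less)
  next
    case False
    then have "lift_pos p c r = 2 * lift_pos p c (r div 2) + r mod 2" using that by (intro lift_pos_greater) simp
    moreover have "r div 2 = q" using that by auto
    ultimately show ?thesis using that by auto
  qed
  have pre1: "?T q \<noteq> 0" if q: "q \<ge> 1" "r = 2 * q \<or> r = 2 * q + 1" "?T r \<noteq> 0" for q r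
  proof (cases "r = p")
    case True
    then have "q < p" using q p by auto
    have "T p \<noteq> 0" using p by simp
    then have "T q \<noteq> 0" using preT[of q] q True by auto
    then show ?thesis using \<open>q < p\<close> by (simp add: lift_pos_less)
  next
    case False
    have "lift_pos p c q \<ge> 1" using ge[of q] q by linarith
    then show ?thesis using preT[of "lift_pos p c q"] child[OF False q(2)] q(3) by metis
  qed
  have pre: "\<forall>q\<ge>1. ?T (2 * q) \<noteq> 0 \<or> ?T (2 * q + 1) \<noteq> 0 \<longrightarrow> ?T q \<noteq> 0"
    using pre1 by blast
  \<comment> \<open>The whole list of \<open>v\<close> has been inspected and inspected neighbours
    have entered, so the current bag may be the last one of \<open>v\<close>.\<close>
  have nbrs: "inn w \<noteq> 0" "inn w \<le> t" if "E v w" for w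
  proof -
    have "w \<in> set (adj ! v)" using adj_set[OF v(1)] that by simp
    then obtain j where "j < deg v" "adj ! v ! j = w" by (metis in_set_conv_nth)
    then show "inn w \<noteq> 0" using token_inv_deg[OF inv v(1)] p(3) by auto
    then show "inn w \<le> t" using token_inv_inn[OF inv] E_less[OF that] by blast
  qed
  have outs: "\<forall>u<n. ?out u \<noteq> 0 \<longrightarrow> inn u \<noteq> 0 \<and> inn u \<le> ?out u \<and> ?out u \<le> t \<and>
        (\<forall>w. E u w \<longrightarrow> inn w \<noteq> 0 \<and> inn w \<le> ?out u)"
  proof (intro allI impI)
    fix u assume u: "u < n" "?out u \<noteq> 0"
    show "inn u \<noteq> 0 \<and> inn u \<le> ?out u \<and> ?out u \<le> t \<and>
        (\<forall>w. E u w \<longrightarrow> inn w \<noteq> 0 \<and> inn w \<le> ?out u)"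
    proof (cases "u = v")
      case True then show ?thesis using nbrs v t by auto
    next
      case False then show ?thesis using token_inv_out[OF inv u(1)] u(2) by auto
    qed
  qed
  have card: "\<forall>j\<le>t. card (alive inn ?out j) \<le> hi"
  proof (intro allI impI)
    fix j assume j: "j \<le> t"
    have "alive inn ?out j \<subseteq> alive inn out j" using v j by (auto simp: alive_def)
    then have "card (alive inn ?out j) \<le> card (alive inn out j)" by (intro card_mono) auto
    also have "\<dots> \<le> hi" by (rule token_inv_card[OF inv j])
    finally show "card (alive inn ?out j) \<le> hi" .
  qed
  have on: "\<forall>u<n. ?out u \<le> n" using token_inv_out_le[OF inv] token_invD(1)[OF inv] by auto
  obtain Br where Br: "tree_model T {v. v < n \<and> inn v \<noteq> 0} Br" using token_inv_model[OF inv] by blast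
  have Br1: "\<And>q. T q \<noteq> 0 \<Longrightarrow> T q - 1 \<in> Br q \<and> Br q \<subseteq> {v. v < n \<and> inn v \<noteq> 0} \<and> conn (Br q)"
    and Br2: "\<And>q q'. T q \<noteq> 0 \<Longrightarrow> T q' \<noteq> 0 \<Longrightarrow> q \<noteq> q' \<Longrightarrow> Br q \<inter> Br q' = {}"
    and Br3: "\<And>q r. q \<ge> 1 \<Longrightarrow> r = 2 * q \<or> r = 2 * q + 1 \<Longrightarrow> T q \<noteq> 0 \<Longrightarrow> T r \<noteq> 0 \<Longrightarrow> link (Br q) (Br r)"
    using Br unfolding tree_model_def by blast+
  \<comment> \<open>The vertex leaves the tree but not the minor: its branch set is merged with that
    of the child that moves to \<open>p\<close>. This preserves the link to the parent of
    \<open>p\<close>.\<close>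
  define Br' where "Br' q = (if q = p then Br p \<union> Br c else Br (lift_pos p c q))" for q
  have Tpne: "T p \<noteq> 0" using p by simp
  have cch: "c = 2 * p \<or> c = 2 * p + 1" using c(1) by auto
  have up: "Br (lift_pos p c q) \<subseteq> Br' q" for q by (auto simp: Br'_def lift_pos_eq)
  have "tree_model ?T {v. v < n \<and> inn v \<noteq> 0} Br'"
    unfolding tree_model_def
  proof (intro conjI allI impI)
    fix q assume q: "?T q \<noteq> 0"
    show "?T q - 1 \<in> Br' q" using Br1[OF q] up by blast
    show "Br' q \<subseteq> {v. v < n \<and> inn v \<noteq> 0}"
      using Br1[OF q] Br1[OF Tpne] q by (auto simp: Br'_def lift_pos_eq)
    show "conn (Br' q)"
    proof (cases "q = p")
      case True
      then have "T c \<noteq> 0" using q by (simp add: lift_pos_eq)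
      then show ?thesis using True Br1[OF Tpne] Br1[of c] Br3[OF p(1) cch Tpne] by (simp add: Br'_def conn_Un)
    next
      case False then show ?thesis using Br1[OF q] by (simp add: Br'_def)
    qed
  next
    fix q q' assume q: "?T q \<noteq> 0" "?T q' \<noteq> 0" "q \<noteq> q'"
    have ne: "lift_pos p c q \<noteq> lift_pos p c q'" using linj q by blast
    have *: "Br p \<inter> Br (lift_pos p c x) = {}" if "?T x \<noteq> 0" for x
      using Br2[OF Tpne that] lneq[of x] by metis
    show "Br' q \<inter> Br' q' = {}"
      using Br2[OF q(1,2) ne] *[OF q(1)] *[OF q(2)] q(3)
      by (auto simp: Br'_def lift_pos_eq)
  next
    fix q s assume q: "1 \<le> q" "s = 2 * q \<or> s = 2 * q + 1" "?T q \<noteq> 0" "?T s \<noteq> 0"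
    show "link (Br' q) (Br' s)"
    proof (cases "s = p")
      case True
      then have qp: "q < p" using q p by auto
      then have "T q \<noteq> 0" using q(3) by (simp add: lift_pos_less)
      then have "link (Br q) (Br p)" using Br3[OF q(1), of p] q(2) True Tpne by blast
      moreover have "Br q \<subseteq> Br' q" using up[of q] by (simp add: lift_pos_less[OF qp])
      moreover have "Br p \<subseteq> Br' s" using True by (simp add: Br'_def)
      ultimately show ?thesis by (rule link_mono)
    next
      case False
      have "lift_pos p c q \<ge> 1" using ge[of q] q by linarith
      then have "link (Br (lift_pos p c q)) (Br (lift_pos p c s))"
        using Br3[OF _ child[OF False q(2)]] q by blast
      then show ?thesis by (rule link_mono[OF _ up up])
    qed
  qed
  then have model: "\<exists>Br. tree_model ?T {v. v < n \<and> inn v \<noteq> 0} Br" by blast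
  have rest: "t \<le> n" "r \<le> n" "1 \<le> hi" "hi \<le> 2 ^ (2 * k + 1)"
     "\<forall>j. 1 \<le> j \<and> j \<le> t \<longrightarrow> ord j < n \<and> inn (ord j) = j"
     "\<forall>v<n. inn v \<noteq> 0 \<longrightarrow> inn v \<le> t \<and> ord (inn v) = v"
     "\<forall>v<r. inn v \<noteq> 0" "\<forall>v<n. cur v \<le> deg v \<and> (\<forall>j<cur v. inn (adj ! v ! j) \<noteq> 0)"
    by (rule token_invD[OF inv])+
  show ?thesis unfolding token_inv_def
    using rest on T0 Tp inj surj pre outs card model by (intro conjI) assumption+
qed

lemma token_inv_cur:
  assumes "token_inv inn out cur T ord t r hi" "cur v < deg v" "inn (adj ! v ! cur v) \<noteq> 0" "v < n"
  shows "token_inv inn out (cur(v := Suc (cur v))) T ord t r hi"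
proof -
  note I = assms(1)[unfolded token_inv_def]
  have "\<forall>u<n. (cur(v := Suc (cur v))) u \<le> deg u \<and> (\<forall>j<(cur(v := Suc (cur v))) u. inn (adj ! u ! j) \<noteq> 0)"
    using token_inv_deg[OF assms(1)] assms(2-) by (auto simp: less_Suc_eq)
  then show ?thesis using I unfolding token_inv_def by (elim conjE, intro conjI) assumption+
qed

lemma token_inv_skip:
  assumes "token_inv inn out cur T ord t r hi" "inn r \<noteq> 0" "r < n"
  shows "token_inv inn out cur T ord t (Suc r) hi"
proof -
  note I = assms(1)[unfolded token_inv_def]
  have "\<forall>v<Suc r. inn v \<noteq> 0" using token_inv_root[OF assms(1)] assms(2) less_Suc_eq by metis
  moreover have "Suc r \<le> n" using assms(3) by simp
  ultimately show ?thesis using I unfolding token_inv_def by (elim conjE, intro conjI) assumption+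
qed

text \<open>A vertex may thus be placed at a free child of the least incomplete position without
  exceeding the bound on \<open>hi\<close>, which also bounds the bags.\<close>

lemma token_inv_position_bound:
  assumes "token_inv inn out cur T ord t r hi" "T 1 \<noteq> 0"
    "\<And>q. q \<ge> 1 \<Longrightarrow> q < p \<Longrightarrow> T (2 * q) \<noteq> 0 \<and> T (2 * q + 1) \<noteq> 0"
  shows "2 * p + 1 \<le> 2 ^ (2 * k + 1)"
proof -
  obtain Br where "tree_model T {v. v < n \<and> inn v \<noteq> 0} Br" using token_inv_model[OF assms(1)] by blast
  then have "tree_model T {..<n} Br" unfolding tree_model_def by blast
  then have "p < 2 ^ (2 * k)" by (rule unsaturated_bound[OF _ assms(2,3)])
  then show ?thesis by simp
qed

end

section \<open>Computing the path decomposition\<close>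

lemma lift_pos_le: "1 \<le> p \<Longrightarrow> c \<le> 2 * p + 1 \<Longrightarrow> lift_pos p c q \<le> 3 * q"
proof (induction q rule: less_induct)
  case (less q)
  consider "q < p" | "q = p" | "p < q" by linarith
  then show ?case
  proof cases
    case 3
    then have "lift_pos p c (q div 2) \<le> 3 * (q div 2)" using less by auto
    then show ?thesis using lift_pos_greater[OF 3, of c] div_mult_mod_eq[of q 2] by linarith
  qed (use less in \<open>auto simp: lift_pos_less lift_pos_eq\<close>)
qed

lemma sum_half: "q \<le> 2 * h + 1 \<Longrightarrow> (\<Sum>i<h. if 2 * i + 2 \<le> q then 1 else 0) = (q div 2 :: nat)"
proof -
  assume "q \<le> 2 * h + 1"
  then have "{i \<in> {..<h}. 2 * i + 2 \<le> q} = {..<q div 2}" by auto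
  then show ?thesis by (simp add: sum.If_cases Int_def)
qed

text \<open>Registers: 2 is \<open>n\<close>, 3 counts the entered vertices, 4 is the next candidate for a root,
  5 is the vertex at the least unsaturated position, 6 is a vertex about to enter, and 50 bounds
  all occupied positions. Arrays: 0 is \<open>inn\<close>, 1 is \<open>out\<close>, 2 is \<open>cur\<close>, 3 is the tree, 4 is \<open>ord\<close>,
  and 14 tabulates \<open>lift_pos\<close>.\<close>

definition enter_com :: com where
  "enter_com = Sq (Asg 3 (EAdd (Var 3) (Num 1))) (Sq (Put 0 (Var 6) (Var 3)) (Put 4 (Var 3) (Var 6)))"

definition root_com :: com where
  "root_com = Sq (Cond (Arr 0 (Var 4)) Nop
     (Sq (Asg 6 (Var 4)) (Sq enter_com (Put 3 (Num 1) (EAdd (Var 6) (Num 1))))))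
     (Asg 4 (EAdd (Var 4) (Num 1)))"

text \<open>A new neighbour takes the even child position if that is free. Otherwise the odd one is
  free, since the position in register 9 lacks a child.\<close>

definition neighbour_com :: com where
  "neighbour_com = Sq (Get 6 (Var 7)) (Sq (Put 2 (Var 5) (EAdd (Arr 2 (Var 5)) (Num 1)))
     (Cond (Arr 0 (Var 6)) Nop
       (Sq enter_com (Sq (Asg 10 (EAdd (Var 9) (Var 9)))
         (Sq (Cond (Arr 3 (Var 10)) (Asg 10 (EAdd (Var 10) (Num 1))) Nop)
           (Sq (Put 3 (Var 10) (EAdd (Var 6) (Num 1)))
             (Asg 50 (Ite (Less (Var 50) (Var 10)) (Var 10) (Var 50)))))))))"

text \<open>Positions are treated in increasing order. As \<open>lift_pos\<close> never decreases a
  position, each source is read before it is overwritten, and the value at half the position is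
  already tabulated when it is needed.\<close>

definition shift_com :: com where
  "shift_com = Loop (Leq (Var 10) (Var 50))
     (Sq (Asg 11 (SumLt 0 50 (Leq (EAdd (EAdd (Idx 0) (Idx 0)) (Num 2)) (Var 10))))
     (Sq (Put 14 (Var 10) (Ite (Less (Var 11) (Var 9)) (Var 10)
         (EAdd (EAdd (Arr 14 (Var 11)) (Arr 14 (Var 11))) (ESub (Var 10) (EAdd (Var 11) (Var 11))))))
     (Sq (Put 3 (Var 10) (Arr 3 (Arr 14 (Var 10))))
       (Asg 10 (EAdd (Var 10) (Num 1))))))"

definition leave_com :: com where
  "leave_com = Sq (Put 1 (Var 5) (Var 3))
     (Sq (Put 14 (Var 9) (Ite (Arr 3 (EAdd (Var 9) (Var 9))) (EAdd (Var 9) (Var 9))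
        (EAdd (EAdd (Var 9) (Var 9)) (Num 1))))
     (Sq (Put 3 (Var 9) (Arr 3 (Arr 14 (Var 9))))
     (Sq (Asg 10 (EAdd (Var 9) (Num 1))) shift_com)))"

text \<open>Summation indices start at 0 and positions at 1: index \<open>i\<close> stands for
  position \<open>i + 1\<close>, whose children are \<open>2 * i + 2\<close> and
  \<open>2 * i + 3\<close>.\<close>

definition tree_com :: com where
  "tree_com = Sq (Asg 9 (EAdd (LeastLt 0 1 50 (Neg (Conj
       (Arr 3 (EAdd (EAdd (Idx 1) (Idx 1)) (Num 2))) (Arr 3 (EAdd (EAdd (Idx 1) (Idx 1)) (Num 3)))))) (Num 1)))
     (Sq (Asg 5 (ESub (Arr 3 (Var 9)) (Num 1)))
     (Sq (Get 7 (EAdd (Var 5) (Num 1))) (Sq (Get 8 (EAdd (Var 5) (Num 2)))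
     (Sq (Asg 7 (EAdd (Var 7) (Arr 2 (Var 5))))
       (Cond (Less (Var 7) (Var 8)) neighbour_com leave_com)))))"

definition decompose_com :: com where
  "decompose_com = Sq (Get 2 (Num 0)) (Sq (Asg 50 (Num 1))
     (Loop (Less (Var 3) (Var 2)) (Cond (Arr 3 (Num 1)) tree_com root_com)))"

section \<open>Correctness of the decomposition program\<close>

locale algorithm = graph_input E n k Ws adj + machine F m b inp
  for E n k Ws adj F m b inp +
  assumes inp_n: "inp 0 = n"
    and inp_ptr: "v \<le> n \<Longrightarrow> inp (Suc v) = n + 2 + length (concat (take v adj))"
    and inp_adj: "i < length (concat adj) \<Longrightarrow> inp (n + 2 + i) = concat adj ! i"
    and F_eq: "F = n + 2 + length (concat adj)"
    and pow_le_b: "2 ^ (2 * k + 1) \<le> b"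
    and m_large: "F + (n + 2) * (2 * b + 8) \<le> m"
begin

text \<open>The product in \<open>m_large\<close> leaves room for tripled tree positions and, in the
  last phases, for the numbers of all interval endpoints.\<close>

lemma m_bounds: "n + 2 \<le> m" "F + 3 * b + n \<le> m" "b \<le> m"
proof -
  have "(n + 2) * (2 * b + 8) = 2 * b * n + 8 * n + 4 * b + 16" by (simp add: algebra_simps)
  then show "n + 2 \<le> m" "F + 3 * b + n \<le> m" "b \<le> m" using m_large by linarith+
qed

lemma concat_take_Suc: "v < n \<Longrightarrow> concat (take (Suc v) adj) = concat (take v adj) @ adj ! v"
  using length_adj by (simp add: take_Suc_conv_app_nth)

lemma concat_split: "v < n \<Longrightarrow> concat adj = concat (take v adj) @ adj ! v @ concat (drop (Suc v) adj)"
  using concat_take_Suc[of v] append_take_drop_id[of "Suc v" adj] by (metis append.assoc concat_append)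

lemma inp_ptr_Suc: "v < n \<Longrightarrow> inp (Suc (Suc v)) = inp (Suc v) + deg v"
  using inp_ptr[of v] inp_ptr[of "Suc v"] concat_take_Suc[of v] by simp

lemma inp_ptr_less: "v < n \<Longrightarrow> inp (Suc v) + deg v \<le> F"
  using inp_ptr[of v] F_eq concat_split[of v] by simp

lemma inp_neighbour:
  assumes "v < n" "i < deg v"
  shows "inp (inp (Suc v) + i) = adj ! v ! i"
proof -
  have e: "concat adj = concat (take v adj) @ adj ! v @ concat (drop (Suc v) adj)"
    by (rule concat_split[OF assms(1)])
  have "length (concat (take v adj)) + i < length (concat adj)" unfolding e using assms by simp
  then have "inp (n + 2 + (length (concat (take v adj)) + i)) = concat adj ! (length (concat (take v adj)) + i)"
    by (rule inp_adj)
  also have "\<dots> = adj ! v ! i" unfolding e using assms by (simp add: nth_append)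
  finally show ?thesis using inp_ptr[of v] assms by (simp add: add.assoc)
qed

lemma deg_le: "v < n \<Longrightarrow> deg v < m"
  using inp_ptr_less[of v] m_bounds n_pos inp_ptr[of v] by simp

abbreviation "H \<equiv> 2 ^ (2 * k + 1) :: nat"

text \<open>Arrays from 5 on, except the scratch array 14, are recorded as untouched because later
  phases rely on their initial zeros.\<close>

definition inv_decompose :: "nat \<Rightarrow> (nat \<Rightarrow> nat) \<Rightarrow> arrays \<Rightarrow> bool" where
  "inv_decompose w R A \<longleftrightarrow> R 2 = n \<and> token_inv (A 0) (A 1) (A 2) (A 3) (A 4) (R 3) (R 4) (R 50) \<and>
     work (A 1) (A 2) (R 4) = w \<and> (\<forall>a\<ge>5. a \<noteq> 14 \<longrightarrow> A a = (\<lambda>_. 0))"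

lemma wp_enter:
  assumes "R 3 < m" "R 6 \<le> m"
    "Q \<tau> (R(3 := Suc (R 3))) (A(0 := (A 0)(R 6 := Suc (R 3)), 4 := (A 4)(Suc (R 3) := R 6)))"
  shows "wp enter_com Q \<tau> R A"
  unfolding enter_com_def
  by (intro wp_Sq wp_Asg wp_Put) (use assms in \<open>auto simp: small_def\<close>)

lemma wp_root:
  assumes inv: "inv_decompose w R A" and T1: "A 3 1 = 0" and t: "R 3 < n"
  shows "wp root_com (\<lambda>\<tau>' R' A'. \<tau>' = \<tau> \<and> inv_decompose (Suc w) R' A') \<tau> R A"
proof -
  have I: "token_inv (A 0) (A 1) (A 2) (A 3) (A 4) (R 3) (R 4) (R 50)" "R 2 = n" "work (A 1) (A 2) (R 4) = w"
    "\<forall>a\<ge>5. a \<noteq> 14 \<longrightarrow> A a = (\<lambda>_. 0)"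
    using inv by (auto simp: inv_decompose_def)
  have r: "R 4 < n"
  proof (rule ccontr)
    assume "\<not> R 4 < n"
    then have "\<forall>v<n. A 0 v \<noteq> 0" using token_inv_root[OF I(1)] by auto
    then show False using token_inv_all_visited[OF I(1)] t by simp
  qed
  show ?thesis
    unfolding root_com_def
  proof (rule wp_Sq, rule wp_Cond)
    assume "ev R A (\<lambda>_. 0) (Arr 0 (Var 4)) \<noteq> 0"
    then have "A 0 (R 4) \<noteq> 0" by simp
    then have "token_inv (A 0) (A 1) (A 2) (A 3) (A 4) (R 3) (Suc (R 4)) (R 50)"
      using token_inv_skip[OF I(1)] r by simp
    then show "wp Nop (wp (Asg 4 (EAdd (Var 4) (Num 1))) (\<lambda>\<tau>' R' A'. \<tau>' = \<tau> \<and> inv_decompose (Suc w) R' A')) \<tau> R A"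
      by (intro wp_Nop wp_Asg) (use r m_bounds I in \<open>auto simp: small_def inv_decompose_def work_root\<close>)
  next
    assume "ev R A (\<lambda>_. 0) (Arr 0 (Var 4)) = 0"
    then have z: "A 0 (R 4) = 0" by simp
    have T0: "A 3 p = 0" for p by (rule token_inv_tree_empty[OF I(1) T1])
    have inv': "token_inv ((A 0)(R 4 := Suc (R 3))) (A 1) (A 2) ((A 3)(1 := Suc (R 4)))
        ((A 4)(Suc (R 3) := R 4)) (Suc (R 3)) (Suc (R 4)) (R 50)"
    proof (rule token_inv_enter[OF I(1) r z])
      show "\<forall>v<Suc (R 4). v \<noteq> R 4 \<longrightarrow> A 0 v \<noteq> 0" using token_inv_root[OF I(1)] less_Suc_eq by auto
      show "\<forall>v<n. A 2 v \<le> deg v \<and> (\<forall>j<A 2 v. A 0 (adj ! v ! j) \<noteq> 0 \<or> adj ! v ! j = R 4)"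
        using token_inv_deg[OF I(1)] by auto
    qed (use T0 r token_invD(3,4)[OF I(1)] in auto)
    show "wp (Sq (Asg 6 (Var 4)) (Sq enter_com (Put 3 (Num 1) (EAdd (Var 6) (Num 1)))))
       (wp (Asg 4 (EAdd (Var 4) (Num 1))) (\<lambda>\<tau>' R' A'. \<tau>' = \<tau> \<and> inv_decompose (Suc w) R' A')) \<tau> R A"
      by (intro wp_Sq wp_Asg wp_enter wp_Put)
        (use r t m_bounds I inv' in \<open>auto simp: small_def inv_decompose_def work_root\<close>)
  qed
qed

lemma wp_neighbour:
  assumes inv: "inv_decompose w R A" and v: "R 5 < n" "R 7 = inp (Suc (R 5)) + A 2 (R 5)" "A 2 (R 5) < deg (R 5)"
    and p: "1 \<le> R 9" "A 3 (R 9) = Suc (R 5)" "A 3 (2 * R 9) = 0 \<or> A 3 (2 * R 9 + 1) = 0" "2 * R 9 + 1 \<le> H"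
    and t: "R 3 < n"
  shows "wp neighbour_com (\<lambda>\<tau>' R' A'. \<tau>' = \<tau> \<and> inv_decompose (Suc w) R' A') \<tau> R A"
proof -
  have I: "token_inv (A 0) (A 1) (A 2) (A 3) (A 4) (R 3) (R 4) (R 50)" "R 2 = n" "work (A 1) (A 2) (R 4) = w"
    "\<forall>a\<ge>5. a \<noteq> 14 \<longrightarrow> A a = (\<lambda>_. 0)"
    using inv by (auto simp: inv_decompose_def)
  define v where "v = R 5"
  define x where "x = adj ! v ! A 2 v"
  have ix: "inp (R 7) = x" using inp_neighbour v by (simp add: x_def v_def)
  have Ex: "E v x" using adj_nth v by (simp add: x_def v_def)
  then have x: "x < n" using E_less by blast
  have R7: "R 7 < F" using inp_ptr_less[OF v(1)] v by linarith
  have degm: "deg v < m" using deg_le v by (simp add: v_def)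
  have wc: "work (A 1) ((A 2)(v := Suc (A 2 v))) (R 4) = Suc w" using work_cur I(3) v by (simp add: v_def)
  have cm: "A 2 v + 1 \<le> m" "x \<le> m" "R 3 < m" using v degm x t m_bounds by (auto simp: v_def)
  show ?thesis
    unfolding neighbour_com_def
  proof (intro wp_Sq wp_Get wp_Put, goal_cases)
    case 4
    let ?R = "R(6 := x)" and ?A = "A(2 := (A 2)(v := Suc (A 2 v)))"
    have eqR: "R(6 := inp (ev R A (\<lambda>_. 0) (Var 7))) = ?R" using ix by simp
    have eqA: "A(2 := (A 2)(ev ?R A (\<lambda>_. 0) (Var 5) := ev ?R A (\<lambda>_. 0) (EAdd (Arr 2 (Var 5)) (Num 1)))) = ?A"
      by (simp add: v_def)
    show ?case unfolding eqR eqA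
    proof (rule wp_Cond)
      assume "ev ?R ?A (\<lambda>_. 0) (Arr 0 (Var 6)) \<noteq> 0"
      then have "A 0 x \<noteq> 0" by simp
      then have "token_inv (A 0) (A 1) ((A 2)(v := Suc (A 2 v))) (A 3) (A 4) (R 3) (R 4) (R 50)"
        using token_inv_cur[OF I(1), of v] v by (simp add: x_def v_def)
      then show "wp Nop (\<lambda>\<tau>' R' A'. \<tau>' = \<tau> \<and> inv_decompose (Suc w) R' A') \<tau> ?R ?A"
        by (intro wp_Nop) (use I wc in \<open>auto simp: inv_decompose_def\<close>)
    next
      assume "ev ?R ?A (\<lambda>_. 0) (Arr 0 (Var 6)) = 0"
      then have z: "A 0 x = 0" by simp
      define c where "c = (if A 3 (2 * R 9) = 0 then 2 * R 9 else 2 * R 9 + 1)"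
      have c2: "c \<ge> 2" "c \<le> 2 * R 9 + 1" "c \<le> H" "c = 2 * R 9 \<or> c = 2 * R 9 + 1"
        using p by (auto simp: c_def)
      have Tc: "A 3 c = 0" using p by (auto simp: c_def)
      have Tc2: "A 3 (2 * c) = 0" "A 3 (2 * c + 1) = 0"
        using token_inv_parent[OF I(1), of c] c2(1) Tc by (blast dest: order_trans[OF one_le_numeral])+
      have inv': "token_inv ((A 0)(x := Suc (R 3))) (A 1) ((A 2)(v := Suc (A 2 v))) ((A 3)(c := Suc x))
          ((A 4)(Suc (R 3) := x)) (Suc (R 3)) (R 4) (max (R 50) c)"
      proof (rule token_inv_enter[OF I(1) x z Tc _ Tc2])
        show "c = 1 \<or> (\<exists>p\<ge>1. (c = 2 * p \<or> c = 2 * p + 1) \<and> A 3 p \<noteq> 0 \<and> E (A 3 p - 1) x)"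
          using p c2(4) Ex by (intro disjI2 exI[of _ "R 9"]) (auto simp: v_def)
        show "\<forall>u<R 4. u \<noteq> x \<longrightarrow> A 0 u \<noteq> 0" using token_inv_root[OF I(1)] by auto
        show "\<forall>u<n. ((A 2)(v := Suc (A 2 v))) u \<le> deg u \<and>
            (\<forall>j<((A 2)(v := Suc (A 2 v))) u. A 0 (adj ! u ! j) \<noteq> 0 \<or> adj ! u ! j = x)"
          using token_inv_deg[OF I(1)] v by (auto simp: less_Suc_eq x_def v_def)
      qed (use c2 token_invD(2-4)[OF I(1)] in auto)
      have cb: "c \<le> b" "c \<le> m" "Suc x \<le> m" "R 50 \<le> b" "R 9 + R 9 \<le> m"
        using c2 pow_le_b m_bounds x token_invD(4)[OF I(1)] p(4) by linarith+
      have cc: "ev (?R(3 := Suc (R 3), 10 := R 9 + R 9)) (?A(0 := (A 0)(x := Suc (R 3)), 4 := (A 4)(Suc (R 3) := x))) (\<lambda>_. 0) (Arr 3 (Var 10)) = A 3 (2 * R 9)"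
        by (simp add: mult_2)
      have fin: "wp (Sq (Put 3 (Var 10) (EAdd (Var 6) (Num 1)))
             (Asg 50 (Ite (Less (Var 50) (Var 10)) (Var 10) (Var 50))))
         (\<lambda>\<tau>' R' A'. \<tau>' = \<tau> \<and> inv_decompose (Suc w) R' A') \<tau>
         (?R(3 := Suc (R 3), 10 := c)) (?A(0 := (A 0)(x := Suc (R 3)), 4 := (A 4)(Suc (R 3) := x)))"
        by (intro wp_Sq wp_Put wp_Asg)
          (use cb I wc inv' in \<open>auto simp: small_def inv_decompose_def max_def not_less\<close>)
      show "wp (Sq enter_com (Sq (Asg 10 (EAdd (Var 9) (Var 9)))
         (Sq (Cond (Arr 3 (Var 10)) (Asg 10 (EAdd (Var 10) (Num 1))) Nop)
           (Sq (Put 3 (Var 10) (EAdd (Var 6) (Num 1)))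
             (Asg 50 (Ite (Less (Var 50) (Var 10)) (Var 10) (Var 50)))))))
         (\<lambda>\<tau>' R' A'. \<tau>' = \<tau> \<and> inv_decompose (Suc w) R' A') \<tau> ?R ?A"
        apply (intro wp_Sq wp_enter wp_Asg)
        using cm apply (simp, simp)
        using cb apply (simp add: small_def)
        apply (rule wp_Cond; (rule wp_Asg | rule wp_Nop))
        using fin cb c2 p by (auto simp: small_def c_def mult_2 fun_upd_twist split: if_splits)
    qed
  qed (use R7 ix cm in \<open>auto simp: v_def\<close>)
qed

lemma wp_shift:
  assumes p: "1 \<le> p" "c = 2 * p \<or> c = 2 * p + 1" "R 9 = p" "R 10 = p + 1" "p \<le> R 50" "R 50 \<le> H"
    and T: "\<And>q. q > R 50 \<Longrightarrow> T q = 0" "\<And>q. T q \<le> m"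
    and A: "A 14 p = c" "A 3 = (\<lambda>q. if q \<le> p then T (lift_pos p c q) else T q)"
    and Q: "\<And>\<tau>' R' A'. \<tau>' \<le> \<tau> + H \<Longrightarrow> (\<And>x. x \<noteq> 10 \<Longrightarrow> x \<noteq> 11 \<Longrightarrow> R' x = R x) \<Longrightarrow>
      A' 3 = (\<lambda>q. T (lift_pos p c q)) \<Longrightarrow> (\<And>a. a \<noteq> 3 \<Longrightarrow> a \<noteq> 14 \<Longrightarrow> A' a = A a) \<Longrightarrow> Q \<tau>' R' A'"
  shows "wp shift_com Q \<tau> R A"
  unfolding shift_com_def
proof (rule wp_Loop[where f = "\<lambda>R' A'. Suc (R 50) - R' 10" and
    I = "\<lambda>\<tau>' R' A'. (\<forall>x. x \<noteq> 10 \<longrightarrow> x \<noteq> 11 \<longrightarrow> R' x = R x) \<and> (\<forall>a. a \<noteq> 3 \<longrightarrow> a \<noteq> 14 \<longrightarrow> A' a = A a) \<and>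
      p < R' 10 \<and> R' 10 \<le> Suc (R 50) \<and> (\<forall>x. p \<le> x \<and> x < R' 10 \<longrightarrow> A' 14 x = lift_pos p c x) \<and>
      A' 3 = (\<lambda>x. if x < R' 10 then T (lift_pos p c x) else T x) \<and> \<tau>' + p + 1 = \<tau> + R' 10"], goal_cases)
  case 1
  show ?case using p A lift_pos_eq[of p c]
    by (auto simp: le_less_Suc_eq less_Suc_eq_le fun_eq_iff)
next
  case (2 \<tau>' R' A')
  then have R10: "R' 10 = Suc (R 50)" by (auto split: if_splits)
  have cp: "c > p" using p by auto
  show ?case
  proof (rule Q)
    show "\<tau>' \<le> \<tau> + H" using 2 R10 p by linarith
    \<comment> \<open>Beyond the last occupied position, source and target are both empty, so the
      shift may stop there.\<close>
    have "T (lift_pos p c x) = T x" if "x > R 50" for x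
      using lift_pos_ge[OF cp, of x] T(1) that by (metis leD le_less_trans not_le)
    then show "A' 3 = (\<lambda>q. T (lift_pos p c q))" using 2 R10 by (auto simp: fun_eq_iff)
  qed (use 2 in auto)
next
  case (3 \<tau>' R' A')
  define q where "q = R' 10"
  have q: "p < q" "q \<le> R 50" using 3 by (auto simp: q_def split: if_splits)
  have fr: "R' 50 = R 50" "R' 9 = p" using 3 p by auto
  have S: "A' 14 x = lift_pos p c x" if "p \<le> x" "x < q" for x using 3 that by (auto simp: q_def)
  have T3: "A' 3 = (\<lambda>x. if x < q then T (lift_pos p c x) else T x)" using 3 by (simp add: q_def)
  have cp: "c > p" using p by auto
  have half: "(\<Sum>i<R 50. if i + i + 2 \<le> q then 1 else 0) = q div 2"
    using sum_half[of q "R 50"] q by (simp add: mult_2)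
  have val: "(if q div 2 < p then q else A' 14 (q div 2) + A' 14 (q div 2) + (q - (q div 2 + q div 2))) = lift_pos p c q"
  proof -
    have m: "q - (q div 2 + q div 2) = q mod 2" by presburger
    have d: "q = 2 * (q div 2) + q mod 2" by simp
    have g: "lift_pos p c q = 2 * lift_pos p c (q div 2) + q mod 2" by (rule lift_pos_greater[OF q(1)])
    show ?thesis
    proof (cases "q div 2 < p")
      case True
      then show ?thesis using g d lift_pos_less[of "q div 2" p c] by simp
    next
      case False
      then show ?thesis using S[of "q div 2"] g m q by auto
    qed
  qed
  have lq: "lift_pos p c q \<le> m" "q \<le> lift_pos p c q"
  proof -
    have "lift_pos p c q \<le> 3 * q" using p by (intro lift_pos_le) auto
    then show "lift_pos p c q \<le> m" using q p(6) pow_le_b m_bounds by linarith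
    show "q \<le> lift_pos p c q" by (rule lift_pos_ge[OF cp])
  qed
  have qm: "Suc q \<le> m" "q div 2 \<le> m" using q p(6) pow_le_b m_bounds n_pos by linarith+
  have neq: "\<not> lift_pos p c q < q" using lq by simp
  have val': "(q div 2 < p \<longrightarrow> q = lift_pos p c q) \<and>
      (\<not> q div 2 < p \<longrightarrow> A' 14 (q div 2) + A' 14 (q div 2) + (q - (q div 2 + q div 2)) = lift_pos p c q)"
    using val by (auto split: if_splits)
  have inner: "wp (Sq (Put 3 (Var 10) (Arr 3 (Arr 14 (Var 10)))) (Asg 10 (EAdd (Var 10) (Num 1))))
      (\<lambda>\<tau>'' R'' A''. ((\<forall>x. x \<noteq> 10 \<longrightarrow> x \<noteq> 11 \<longrightarrow> R'' x = R x) \<and> (\<forall>a. a \<noteq> 3 \<longrightarrow> a \<noteq> 14 \<longrightarrow> A'' a = A a) \<and>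
      p < R'' 10 \<and> R'' 10 \<le> Suc (R 50) \<and> (\<forall>x. p \<le> x \<and> x < R'' 10 \<longrightarrow> A'' 14 x = lift_pos p c x) \<and>
      A'' 3 = (\<lambda>x. if x < R'' 10 then T (lift_pos p c x) else T x) \<and> Suc \<tau>'' + p + 1 = \<tau> + R'' 10) \<and>
      Suc (R 50) - R'' 10 < Suc (R 50) - R' 10) \<tau>' (R'(11 := q div 2)) (A'(14 := (A' 14)(q := lift_pos p c q)))"
    apply (intro wp_Sq wp_Put wp_Asg)
    using T(2) apply (simp add: q_def[symmetric] T3)
    using qm apply (simp add: q_def[symmetric] small_def)
    using 3 q S neq
    apply (simp add: q_def[symmetric] T3)
    by (auto simp: fun_eq_iff less_Suc_eq)
  have e1: "ev R' A' (\<lambda>_. 0) (SumLt 0 50 (Leq (EAdd (EAdd (Idx 0) (Idx 0)) (Num 2)) (Var 10))) = q div 2"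
    using half fr by (simp add: q_def)
  have e2: "ev (R'(11 := q div 2)) A' (\<lambda>_. 0) (Ite (Less (Var 11) (Var 9)) (Var 10)
         (EAdd (EAdd (Arr 14 (Var 11)) (Arr 14 (Var 11))) (ESub (Var 10) (EAdd (Var 11) (Var 11))))) = lift_pos p c q"
    using val' fr by (simp add: q_def[symmetric])
  show ?case
    apply (rule wp_Sq, rule wp_Asg, unfold e1)
    using qm apply (simp add: small_def)
    apply (rule wp_Sq, rule wp_Put, unfold e2)
    using lq apply simp
    using inner by (simp add: q_def[symmetric])
qed

lemma wp_leave:
  assumes inv: "inv_decompose w R A" and v: "R 5 < n" "A 2 (R 5) = deg (R 5)"
    and p: "1 \<le> R 9" "A 3 (R 9) = Suc (R 5)" "A 3 (2 * R 9) = 0 \<or> A 3 (2 * R 9 + 1) = 0"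
  shows "wp leave_com (\<lambda>\<tau>' R' A'. \<tau>' \<le> \<tau> + H \<and> inv_decompose (Suc w) R' A') \<tau> R A"
proof -
  have I: "token_inv (A 0) (A 1) (A 2) (A 3) (A 4) (R 3) (R 4) (R 50)" "R 2 = n" "work (A 1) (A 2) (R 4) = w"
    "\<forall>a\<ge>5. a \<noteq> 14 \<longrightarrow> A a = (\<lambda>_. 0)"
    using inv by (auto simp: inv_decompose_def)
  define v where "v = R 5"
  define p where "p = R 9"
  define c where "c = (if A 3 (2 * p) = 0 then 2 * p + 1 else 2 * p)"
  have Tp: "A 3 p = Suc v" "A 3 p \<noteq> 0" "1 \<le> p" using p by (simp_all add: p_def v_def)
  have po: "p \<le> R 50" "A 1 v = 0" "A 0 v \<noteq> 0" using token_inv_T[OF I(1) Tp(2)] Tp by auto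
  have t: "R 3 \<noteq> 0" using token_inv_inn[OF I(1), of v] po v by (auto simp: v_def)
  have hi: "R 50 \<le> H" using token_invD(4)[OF I(1)] .
  have c2: "c = 2 * p \<or> c = 2 * p + 1" "c div 2 = p" "c \<le> 2 * p + 1" by (auto simp: c_def)
  have inv': "token_inv (A 0) ((A 1)(v := R 3)) (A 2) (\<lambda>q. A 3 (lift_pos p c q)) (A 4) (R 3) (R 4) (R 50)"
    by (rule token_inv_leave[OF I(1) Tp(3,1) _ c2(2)])
      (use v p in \<open>auto simp: v_def p_def c_def split: if_splits\<close>)
  have wc: "work ((A 1)(v := R 3)) (A 2) (R 4) = Suc w"
    using work_out[of v "A 1" "R 3"] I(3) v po t by (simp add: v_def)
  have bounds: "R 3 \<le> m" "c \<le> m" "Suc p \<le> m" and Tm: "\<And>q. A 3 q \<le> m"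
  proof -
    show "R 3 \<le> m" using token_invD(1)[OF I(1)] m_bounds by linarith
    show "c \<le> m" "Suc p \<le> m" using c2(3) po hi pow_le_b m_bounds n_pos by linarith+
    show "A 3 q \<le> m" for q using token_inv_T[OF I(1), of q] m_bounds by (cases "A 3 q = 0") linarith+
  qed
  have T0: "A 3 q = 0" if "q > R 50" for q using token_inv_T[OF I(1), of q] that by (cases "A 3 q = 0") auto
  have e1: "ev R (A(1 := (A 1)(v := R 3))) (\<lambda>_. 0) (Ite (Arr 3 (EAdd (Var 9) (Var 9))) (EAdd (Var 9) (Var 9))
        (EAdd (EAdd (Var 9) (Var 9)) (Num 1))) = c"
    by (auto simp: c_def p_def mult_2)
  let ?A = "A(1 := (A 1)(v := R 3), 14 := (A 14)(p := c), 3 := (A 3)(p := A 3 c))"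
  have sh: "wp shift_com (\<lambda>\<tau>' R' A'. \<tau>' \<le> \<tau> + H \<and> inv_decompose (Suc w) R' A') \<tau> (R(10 := Suc p)) ?A"
  proof (rule wp_shift[where p = p and c = c and T = "A 3"])
    show "?A 3 = (\<lambda>q. if q \<le> p then A 3 (lift_pos p c q) else A 3 q)"
      by (auto simp: fun_eq_iff lift_pos_eq lift_pos_less)
  next
    fix \<tau>' R' A'
    assume "\<tau>' \<le> \<tau> + H" "\<And>x. x \<noteq> 10 \<Longrightarrow> x \<noteq> 11 \<Longrightarrow> R' x = (R(10 := Suc p)) x"
      "A' 3 = (\<lambda>q. A 3 (lift_pos p c q))" "\<And>a. a \<noteq> 3 \<Longrightarrow> a \<noteq> 14 \<Longrightarrow> A' a = ?A a"
    then show "\<tau>' \<le> \<tau> + H \<and> inv_decompose (Suc w) R' A'"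
      using inv' wc I by (simp add: inv_decompose_def)
  qed (use c2 Tp po hi T0 Tm in \<open>auto simp: p_def\<close>)
  show ?thesis
    unfolding leave_com_def
    apply (rule wp_Sq, rule wp_Put)
    using bounds apply simp
    apply (rule wp_Sq, rule wp_Put)
    using bounds e1 apply (simp add: v_def)
    apply (rule wp_Sq, rule wp_Put)
    using Tm apply simp
    apply (rule wp_Sq, rule wp_Asg)
    using bounds apply (simp add: p_def small_def)
    using sh e1 by (simp add: p_def v_def)
qed

text \<open>An incomplete position exists because the bound \<open>hi\<close> has no left child. The
  least one is occupied because it is the root or because its parent has both children.\<close>

lemma wp_tree:
  assumes inv: "inv_decompose w R A" and T1: "A 3 1 \<noteq> 0" and t: "R 3 < n"
  shows "wp tree_com (\<lambda>\<tau>' R' A'. \<tau>' \<le> \<tau> + H \<and> inv_decompose (Suc w) R' A') \<tau> R A"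
proof -
  have I: "token_inv (A 0) (A 1) (A 2) (A 3) (A 4) (R 3) (R 4) (R 50)"
    using inv by (auto simp: inv_decompose_def)
  define P where "P i \<longleftrightarrow> A 3 (i + i + 2) = 0 \<or> A 3 (i + i + 3) = 0" for i
  define p where "p = least_below (R 50) P + 1"
  have ep: "ev R A (\<lambda>_. 0) (EAdd (LeastLt 0 1 50 (Neg (Conj
       (Arr 3 (EAdd (EAdd (Idx 1) (Idx 1)) (Num 2))) (Arr 3 (EAdd (EAdd (Idx 1) (Idx 1)) (Num 3)))))) (Num 1)) = p"
  proof -
    have "ev R A (\<lambda>_. 0) (LeastLt 0 1 50 (Neg (Conj
       (Arr 3 (EAdd (EAdd (Idx 1) (Idx 1)) (Num 2))) (Arr 3 (EAdd (EAdd (Idx 1) (Idx 1)) (Num 3)))))) = least_below (R 50) P"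
      by (rule ev_LeastLt) (auto simp: P_def)
    then show ?thesis by (simp add: p_def)
  qed
  have hi: "R 50 \<le> H" "1 \<le> R 50" using token_invD(3,4)[OF I] by auto
  have sat: "A 3 (2 * q) \<noteq> 0 \<and> A 3 (2 * q + 1) \<noteq> 0" if "1 \<le> q" "q < p" for q
  proof -
    have "\<not> P (q - 1)" using not_less_least_below[of "q - 1" "R 50" P] that by (auto simp: p_def)
    moreover have "q - 1 + (q - 1) + 2 = 2 * q" "q - 1 + (q - 1) + 3 = 2 * q + 1" using that by auto
    ultimately show ?thesis unfolding P_def by metis
  qed
  have "P (R 50 - 1)"
  proof -
    have "A 3 (2 * R 50) = 0"
      using token_inv_T[OF I, of "2 * R 50"] hi by (cases "A 3 (2 * R 50) = 0") auto
    moreover have "R 50 - 1 + (R 50 - 1) + 2 = 2 * R 50" using hi by auto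
    ultimately show ?thesis unfolding P_def by metis
  qed
  then have "least_below (R 50) P < R 50"
    using hi by (auto simp: least_below_less_iff intro!: exI[of _ "R 50 - 1"])
  then have Pp: "P (p - 1)" using least_below_sat by (auto simp: p_def)
  have p1: "1 \<le> p" by (simp add: p_def)
  have unsat: "A 3 (2 * p) = 0 \<or> A 3 (2 * p + 1) = 0"
  proof -
    have "p - 1 + (p - 1) + 2 = 2 * p" "p - 1 + (p - 1) + 3 = 2 * p + 1" using p1 by auto
    then show ?thesis using Pp unfolding P_def by metis
  qed
  have Tp: "A 3 p \<noteq> 0"
  proof (cases "p = 1")
    case False
    then have h: "1 \<le> p div 2" "p div 2 < p" using p1 by auto
    have "p = 2 * (p div 2) \<or> p = 2 * (p div 2) + 1" by presburger
    then show ?thesis using sat[OF h] by metis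
  qed (use T1 in simp)
  define v where "v = A 3 p - 1"
  have v: "v < n" "A 3 p = Suc v" using token_inv_T[OF I Tp] Tp by (auto simp: v_def)
  have pb: "2 * p + 1 \<le> H" by (rule token_inv_position_bound[OF I T1 sat])
  have pm: "p \<le> m" using pb pow_le_b m_bounds by linarith
  have vm: "v \<le> m" "v + 2 < F" using v m_bounds F_eq by auto
  have ptrs: "inp (Suc v) \<le> m" "inp (Suc (Suc v)) = inp (Suc v) + deg v" "inp (Suc v) + deg v \<le> F"
    using inp_ptr_less[OF v(1)] inp_ptr_Suc[OF v(1)] F_le by auto
  have cv: "A 2 v \<le> deg v" using token_inv_deg[OF I v(1)] by blast
  let ?R = "R(9 := p, 5 := v, 7 := inp (Suc v) + A 2 v, 8 := inp (Suc v) + deg v)"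
  have inv': "inv_decompose w ?R A" using inv by (simp add: inv_decompose_def)
  have "wp (Cond (Less (Var 7) (Var 8)) neighbour_com leave_com)
      (\<lambda>\<tau>' R' A'. \<tau>' \<le> \<tau> + H \<and> inv_decompose (Suc w) R' A') \<tau> ?R A"
  proof (rule wp_Cond)
    assume "ev ?R A (\<lambda>_. 0) (Less (Var 7) (Var 8)) \<noteq> 0"
    then have l: "A 2 v < deg v" by (simp split: if_splits)
    show "wp neighbour_com (\<lambda>\<tau>' R' A'. \<tau>' \<le> \<tau> + H \<and> inv_decompose (Suc w) R' A') \<tau> ?R A"
      by (rule wp_mono[OF wp_neighbour[OF inv']]) (use v l p1 unsat pb t in auto)
  next
    assume "ev ?R A (\<lambda>_. 0) (Less (Var 7) (Var 8)) = 0"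
    then have l: "A 2 v = deg v" using cv by (simp split: if_splits)
    show "wp leave_com (\<lambda>\<tau>' R' A'. \<tau>' \<le> \<tau> + H \<and> inv_decompose (Suc w) R' A') \<tau> ?R A"
      by (rule wp_leave[OF inv']) (use v l p1 unsat in auto)
  qed
  moreover have "R(9 := p, 5 := v, 7 := inp (Suc v), 8 := inp (Suc v) + deg v, 7 := inp (Suc v) + A 2 v) = ?R"
    by (auto simp: fun_eq_iff)
  ultimately show ?thesis
    unfolding tree_com_def
    apply -
    apply (rule wp_Sq, rule wp_Asg, unfold ep)
    using pm apply (simp add: small_def)
    apply (rule wp_Sq, rule wp_Asg)
    using vm apply (simp add: small_def v_def)
    apply (rule wp_Sq, rule wp_Get)
    using vm apply (simp add: v_def)
    using ptrs apply (simp add: v_def)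
    apply (rule wp_Sq, rule wp_Get)
    using vm apply (simp add: v_def)
    using ptrs F_le apply (simp add: v_def)
    apply (rule wp_Sq, rule wp_Asg)
    using ptrs cv F_le apply (simp add: v_def small_def)
    using ptrs by (simp add: v_def)
qed

text \<open>A round has at most \<open>H\<close> inner iterations, those of a shift, and raises
  \<open>work\<close> by one; the bound on \<open>work\<close> then limits the total.\<close>

lemma wp_decompose:
  assumes "R 3 = 0" "R 4 = 0" "A = (\<lambda>_ _. 0)"
  shows "wp decompose_com (\<lambda>\<tau>' R' A'. \<tau>' \<le> \<tau> + (2 * (k * n) + 2 * n) * (H + 1) \<and>
    R' 2 = n \<and> token_inv (A' 0) (A' 1) (A' 2) (A' 3) (A' 4) n (R' 4) (R' 50) \<and>
    (\<forall>a\<ge>5. a \<noteq> 14 \<longrightarrow> A' a = (\<lambda>_. 0))) \<tau> R A"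
proof -
  let ?B = "2 * (k * n) + 2 * n"
  have wb: "w \<le> ?B" if "inv_decompose w R A" for w R A
    using that work_bound by (auto simp: inv_decompose_def)
  have init: "inv_decompose 0 (R(2 := n, 50 := 1)) A"
    using assms token_inv_init by (simp add: inv_decompose_def work_def)
  have loop: "wp (Loop (Less (Var 3) (Var 2)) (Cond (Arr 3 (Num 1)) tree_com root_com))
   (\<lambda>\<tau>' R' A'. \<tau>' \<le> \<tau> + ?B * (H + 1) \<and>
    R' 2 = n \<and> token_inv (A' 0) (A' 1) (A' 2) (A' 3) (A' 4) n (R' 4) (R' 50) \<and>
    (\<forall>a\<ge>5. a \<noteq> 14 \<longrightarrow> A' a = (\<lambda>_. 0))) \<tau> (R(2 := n, 50 := 1)) A"
  proof (rule wp_Loop[where f = "\<lambda>R A. ?B - work (A 1) (A 2) (R 4)" and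
      I = "\<lambda>\<tau>' R A. \<exists>w. inv_decompose w R A \<and> \<tau>' \<le> \<tau> + w * (H + 1)"], goal_cases)
    case 1
    then show ?case using init by (intro exI[of _ 0]) simp
  next
    case (2 \<tau>' R A)
    then obtain w where w: "inv_decompose w R A" "\<tau>' \<le> \<tau> + w * (H + 1)" by blast
    have I: "token_inv (A 0) (A 1) (A 2) (A 3) (A 4) (R 3) (R 4) (R 50)" "R 2 = n"
      using w(1) by (auto simp: inv_decompose_def)
    have "R 3 = n" using 2(2) I token_invD(1)[OF I(1)] by (simp split: if_splits)
    moreover have "w * (H + 1) \<le> ?B * (H + 1)" using wb[OF w(1)] by (rule mult_right_mono) simp
    ultimately show ?case using w I by (auto simp: inv_decompose_def)
  next
    case (3 \<tau>' R A)
    then obtain w where w: "inv_decompose w R A" "\<tau>' \<le> \<tau> + w * (H + 1)" by blast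
    have I: "work (A 1) (A 2) (R 4) = w" "R 2 = n" using w(1) by (auto simp: inv_decompose_def)
    have t: "R 3 < n" using 3(2) I by (simp split: if_splits)
    have post: "(\<exists>w. inv_decompose w R' A' \<and> Suc \<tau>'' \<le> \<tau> + w * (H + 1)) \<and>
        ?B - work (A' 1) (A' 2) (R' 4) < ?B - work (A 1) (A 2) (R 4)"
      if "\<tau>'' \<le> \<tau>' + H" "inv_decompose (Suc w) R' A'" for \<tau>'' R' A'
    proof
      have "Suc \<tau>'' \<le> \<tau> + Suc w * (H + 1)" using that(1) w(2) by simp
      then show "\<exists>w. inv_decompose w R' A' \<and> Suc \<tau>'' \<le> \<tau> + w * (H + 1)" using that(2) by blast
      have "work (A' 1) (A' 2) (R' 4) = Suc w" using that(2) by (simp add: inv_decompose_def)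
      then show "?B - work (A' 1) (A' 2) (R' 4) < ?B - work (A 1) (A 2) (R 4)"
        using wb[OF that(2)] I(1) by simp
    qed
    show ?case
    proof (rule wp_Cond)
      assume "ev R A (\<lambda>_. 0) (Arr 3 (Num 1)) \<noteq> 0"
      then show "wp tree_com (\<lambda>\<tau>' R' A'. (\<exists>w. inv_decompose w R' A' \<and> Suc \<tau>' \<le> \<tau> + w * (H + 1)) \<and>
        ?B - work (A' 1) (A' 2) (R' 4) < ?B - work (A 1) (A 2) (R 4)) \<tau>' R A"
        by (intro wp_mono[OF wp_tree[OF w(1) _ t]] post) auto
    next
      assume "ev R A (\<lambda>_. 0) (Arr 3 (Num 1)) = 0"
      then show "wp root_com (\<lambda>\<tau>' R' A'. (\<exists>w. inv_decompose w R' A' \<and> Suc \<tau>' \<le> \<tau> + w * (H + 1)) \<and>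
        ?B - work (A' 1) (A' 2) (R' 4) < ?B - work (A 1) (A 2) (R 4)) \<tau>' R A"
        by (intro wp_mono[OF wp_root[OF w(1) _ t]] post) auto
    qed
  qed
  have "1 \<le> b" using pow_le_b one_le_power[of "2::nat" "2 * k + 1"] by linarith
  then show ?thesis
    unfolding decompose_com_def
    apply (intro wp_Sq wp_Get wp_Asg)
    using loop inp_n m_bounds F_eq by (auto simp: small_def)
qed

end

section \<open>Assigning slots\<close>

text \<open>All that later phases need to know about the decomposition. The bags are numbered from 1
  to \<open>n\<close>, one per entrance, and \<open>out v = 0\<close> means that \<open>v\<close>
  stays to the end.\<close>

locale bags = sym_rel E for E +
  fixes n :: nat and inn out ord :: "nat \<Rightarrow> nat" and s :: nat
  assumes inn_ord: "1 \<le> j \<Longrightarrow> j \<le> n \<Longrightarrow> ord j < n \<and> inn (ord j) = j"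
    and ord_inn: "v < n \<Longrightarrow> 1 \<le> inn v \<and> inn v \<le> n \<and> ord (inn v) = v"
    and out_bounds: "v < n \<Longrightarrow> out v \<noteq> 0 \<Longrightarrow> inn v \<le> out v \<and> out v \<le> n"
    and edge_out: "E u v \<Longrightarrow> u < n \<and> v < n \<and> u \<noteq> v \<and> (out u = 0 \<or> inn v \<le> out u)"
    and s_pos: "1 \<le> s"
begin

definition bag :: "nat \<Rightarrow> nat set" where
  "bag j = {v. v < n \<and> inn v \<le> j \<and> (out v = 0 \<or> j \<le> out v)}"

lemma finite_bag [simp]: "finite (bag j)" by (simp add: bag_def)

lemma bag_0: "bag 0 = {}"
proof -
  have "v \<notin> bag 0" for v using ord_inn[of v] by (auto simp: bag_def)
  then show ?thesis by blast
qed

lemma bag_Suc: "j < n \<Longrightarrow> bag (Suc j) = insert (ord (Suc j)) {v \<in> bag j. out v = 0 \<or> Suc j \<le> out v}"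
proof (intro set_eqI iffI)
  fix v assume j: "j < n" and v: "v \<in> bag (Suc j)"
  show "v \<in> insert (ord (Suc j)) {v \<in> bag j. out v = 0 \<or> Suc j \<le> out v}"
  proof (cases "inn v = Suc j")
    case True
    then show ?thesis using ord_inn[of v] v by (auto simp: bag_def)
  next
    case False
    then show ?thesis using v by (auto simp: bag_def)
  qed
next
  fix v assume j: "j < n" and v: "v \<in> insert (ord (Suc j)) {v \<in> bag j. out v = 0 \<or> Suc j \<le> out v}"
  then consider "v = ord (Suc j)" | "v \<in> bag j" "out v = 0 \<or> Suc j \<le> out v" by blast
  then show "v \<in> bag (Suc j)"
  proof cases
    case 1
    then have "v < n" "inn v = Suc j" using inn_ord[of "Suc j"] j by auto
    then show ?thesis using out_bounds[of v] by (auto simp: bag_def)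
  qed (auto simp: bag_def)
qed

lemma ord_notin_bag: "j < n \<Longrightarrow> ord (Suc j) \<notin> bag j"
  using inn_ord[of "Suc j"] by (auto simp: bag_def)

lemma edge_bag: "E u v \<Longrightarrow> inn u \<le> inn v \<Longrightarrow> u \<in> bag (inn v) \<and> v \<in> bag (inn v)"
  using edge_out[of u v] edge_out[of v u] E_sym[of u v] out_bounds by (auto simp: bag_def)

text \<open>Two vertices that share any bag share the one in which the later of them enters.
  Adjacency therefore has to be tested for entering vertices only.\<close>

lemma in_bag_inn: "u \<in> bag j \<Longrightarrow> v \<in> bag j \<Longrightarrow> inn u \<le> inn v \<Longrightarrow> u \<in> bag (inn v) \<and> v \<in> bag (inn v)"
  using out_bounds by (auto simp: bag_def)

text \<open>A vertex keeps its slot in all its bags, so that persistence from one bag to the next is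
  an equality of entries in one column. The marks behind row \<open>t\<close> are still 0, as
  marking only writes ones.\<close>

definition slot_inv :: "nat \<Rightarrow> arrays \<Rightarrow> bool" where
  "slot_inv t A \<longleftrightarrow> (\<forall>v<n. A 8 v < s) \<and> (\<forall>j\<le>t. \<forall>v\<in>bag j. A 5 (j * s + A 8 v) = Suc v) \<and>
     (\<forall>j\<le>t. \<forall>x<s. A 5 (j * s + x) \<noteq> 0 \<longrightarrow> A 5 (j * s + x) - 1 \<in> bag j \<and> A 8 (A 5 (j * s + x) - 1) = x) \<and>
     (\<forall>j x. 1 \<le> j \<and> j \<le> t \<and> x < s \<longrightarrow> A 6 (j * s + x) =
        (if A 5 (j * s + x) \<noteq> 0 \<and> E (ord j) (A 5 (j * s + x) - 1) then 1 else 0)) \<and>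
     (\<forall>i\<ge>Suc t * s. A 6 i = 0)"

lemma slot_invD:
  assumes "slot_inv t A"
  shows "\<forall>v<n. A 8 v < s" "\<forall>j\<le>t. \<forall>v\<in>bag j. A 5 (j * s + A 8 v) = Suc v"
     "\<forall>j\<le>t. \<forall>x<s. A 5 (j * s + x) \<noteq> 0 \<longrightarrow> A 5 (j * s + x) - 1 \<in> bag j \<and> A 8 (A 5 (j * s + x) - 1) = x"
     "\<forall>j x. 1 \<le> j \<and> j \<le> t \<and> x < s \<longrightarrow> A 6 (j * s + x) =
        (if A 5 (j * s + x) \<noteq> 0 \<and> E (ord j) (A 5 (j * s + x) - 1) then 1 else 0)"
     "\<forall>i\<ge>Suc t * s. A 6 i = 0"
  using assms unfolding slot_inv_def by - (elim conjE, assumption)+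

lemma index_unique: "x < s \<Longrightarrow> y < s \<Longrightarrow> i * s + x = j * s + y \<Longrightarrow> i = j \<and> x = (y::nat)"
proof -
  assume a: "x < s" "y < s" "i * s + x = j * s + y"
  have "(i * s + x) div s = i" "(j * s + y) div s = j" using a(1,2) by simp_all
  then have "i = j" using a(3) by metis
  then show ?thesis using a(3) by simp
qed

lemma row_less: "j < Suc t \<Longrightarrow> x < s \<Longrightarrow> j * s + x < Suc t * s"
proof -
  assume "j < Suc t" "x < s"
  then have "j * s + x < Suc j * s" by simp
  also have "\<dots> \<le> Suc t * s" using \<open>j < Suc t\<close> by (intro mult_right_mono) auto
  finally show ?thesis .
qed

text \<open>The content of slot \<open>x\<close> after the departures and before the next
  entrance.\<close>

definition kept :: "arrays \<Rightarrow> nat \<Rightarrow> nat \<Rightarrow> nat" where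
  "kept A t x = (let p = A 5 (t * s + x) in if p \<noteq> 0 \<and> (out (p - 1) = 0 \<or> Suc t \<le> out (p - 1)) then p else 0)"

lemma kept_iff:
  assumes "slot_inv t A" "x < s" "t < n"
  shows "kept A t x \<noteq> 0 \<longleftrightarrow> (\<exists>v\<in>bag (Suc t) - {ord (Suc t)}. A 8 v = x)"
    and "kept A t x \<noteq> 0 \<Longrightarrow> kept A t x - 1 \<in> bag (Suc t) - {ord (Suc t)} \<and> A 8 (kept A t x - 1) = x"
    and "v \<in> bag (Suc t) - {ord (Suc t)} \<Longrightarrow> kept A t (A 8 v) = Suc v"
proof -
  note D = slot_invD[OF assms(1)]
  have w: "ord (Suc t) \<notin> bag t" using ord_notin_bag assms by blast
  show 2: "kept A t x - 1 \<in> bag (Suc t) - {ord (Suc t)} \<and> A 8 (kept A t x - 1) = x" if "kept A t x \<noteq> 0"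
  proof -
    define p where "p = A 5 (t * s + x)"
    have k: "kept A t x = p" "p \<noteq> 0" "out (p - 1) = 0 \<or> Suc t \<le> out (p - 1)"
      using that by (auto simp: kept_def p_def Let_def split: if_splits)
    have "p - 1 \<in> bag t" "A 8 (p - 1) = x" using D(3) assms(2) k(2) unfolding p_def by blast+
    then show ?thesis using k bag_Suc[OF assms(3)] w by auto
  qed
  show 3: "kept A t (A 8 v) = Suc v" if "v \<in> bag (Suc t) - {ord (Suc t)}" for v
  proof -
    have "v \<in> bag t" "out v = 0 \<or> Suc t \<le> out v" using that bag_Suc[OF assms(3)] by auto
    moreover from this have "A 5 (t * s + A 8 v) = Suc v" using D(2) by blast
    ultimately show ?thesis by (simp add: kept_def)
  qed
  show "kept A t x \<noteq> 0 \<longleftrightarrow> (\<exists>v\<in>bag (Suc t) - {ord (Suc t)}. A 8 v = x)"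
  proof
    assume "kept A t x \<noteq> 0"
    from 2[OF this] show "\<exists>v\<in>bag (Suc t) - {ord (Suc t)}. A 8 v = x" by blast
  next
    assume "\<exists>v\<in>bag (Suc t) - {ord (Suc t)}. A 8 v = x"
    then obtain v where v: "v \<in> bag (Suc t) - {ord (Suc t)}" "A 8 v = x" by blast
    from 3[OF v(1)] v(2) show "kept A t x \<noteq> 0" by simp
  qed
qed

text \<open>If all \<open>s\<close> slots were kept, the next bag would have more than
  \<open>s\<close> vertices.\<close>

lemma free_slot:
  assumes "slot_inv t A" "t < n" "card (bag (Suc t)) \<le> s"
  shows "\<exists>x<s. kept A t x = 0"
proof (rule ccontr)
  assume "\<not> ?thesis"
  then have k: "kept A t x \<noteq> 0" if "x < s" for x using that by auto
  let ?f = "\<lambda>x. kept A t x - 1"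
  have f: "?f x \<in> bag (Suc t) - {ord (Suc t)}" "A 8 (?f x) = x" if "x < s" for x
    using kept_iff(2)[OF assms(1) that assms(2) k[OF that]] by blast+
  have "inj_on ?f {..<s}" by (rule inj_on_inverseI[of _ "A 8"]) (use f(2) in simp)
  moreover have "?f ` {..<s} \<subseteq> bag (Suc t) - {ord (Suc t)}"
    by (rule image_subsetI, rule f(1)) simp
  ultimately have "card {..<s} \<le> card (bag (Suc t) - {ord (Suc t)})"
    by (meson card_inj_on_le finite_bag finite_Diff)
  moreover have "card (bag (Suc t) - {ord (Suc t)}) < card (bag (Suc t))"
    using bag_Suc[OF assms(2)] by (intro card_Diff1_less) auto
  ultimately show False using assms(3) by simp
qed

lemma slot_inv_Suc:
  assumes inv: "slot_inv t A" and t: "t < n" and w: "w = ord (Suc t)" and z: "z < s" "kept A t z = 0"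
    and A8: "A' 8 = (A 8)(w := z)"
    and A5: "\<And>j x. j \<le> t \<Longrightarrow> x < s \<Longrightarrow> A' 5 (j * s + x) = A 5 (j * s + x)"
      "\<And>x. x < s \<Longrightarrow> x \<noteq> z \<Longrightarrow> A' 5 (Suc t * s + x) = kept A t x" "A' 5 (Suc t * s + z) = Suc w"
    and A6: "\<And>i. i < Suc t * s \<Longrightarrow> A' 6 i = A 6 i"
      "\<And>x. x < s \<Longrightarrow> A' 6 (Suc t * s + x) =
        (if A' 5 (Suc t * s + x) \<noteq> 0 \<and> E w (A' 5 (Suc t * s + x) - 1) then 1 else 0)"
      "\<And>i. i \<ge> Suc (Suc t) * s \<Longrightarrow> A' 6 i = 0"
  shows "slot_inv (Suc t) A'"
proof -
  note D = slot_invD[OF inv]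
  have wb: "w \<notin> bag j" if "j \<le> t" for j using that inn_ord[of "Suc t"] t w by (auto simp: bag_def)
  have 1: "\<forall>v<n. A' 8 v < s" using D(1) z A8 by auto
  have 2: "\<forall>j\<le>Suc t. \<forall>v\<in>bag j. A' 5 (j * s + A' 8 v) = Suc v"
  proof (intro allI impI ballI)
    fix j v assume j: "j \<le> Suc t" and v: "v \<in> bag j"
    have vn: "v < n" using v by (simp add: bag_def)
    show "A' 5 (j * s + A' 8 v) = Suc v"
    proof (cases "j = Suc t")
      case False
      then have "j \<le> t" using j by simp
      moreover from this have "v \<noteq> w" using wb v by blast
      ultimately show ?thesis using A5(1)[of j "A 8 v"] D(1,2) vn v A8 by simp
    next
      case True
      show ?thesis
      proof (cases "v = w")
        case True
        then show ?thesis using A5(3) A8 \<open>j = Suc t\<close> by simp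
      next
        case False
        then have "v \<in> bag (Suc t) - {ord (Suc t)}" using v True w by simp
        then have k: "kept A t (A 8 v) = Suc v" using kept_iff(3)[OF inv z(1) t] by blast
        then have "A 8 v \<noteq> z" using z by auto
        then show ?thesis using A5(2)[of "A 8 v"] D(1) vn k A8 True False by simp
      qed
    qed
  qed
  have 3: "\<forall>j\<le>Suc t. \<forall>x<s. A' 5 (j * s + x) \<noteq> 0 \<longrightarrow>
      A' 5 (j * s + x) - 1 \<in> bag j \<and> A' 8 (A' 5 (j * s + x) - 1) = x"
  proof (intro allI impI)
    fix j x assume j: "j \<le> Suc t" and x: "x < s" and nz: "A' 5 (j * s + x) \<noteq> 0"
    show "A' 5 (j * s + x) - 1 \<in> bag j \<and> A' 8 (A' 5 (j * s + x) - 1) = x"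
    proof (cases "j = Suc t")
      case False
      then have jt: "j \<le> t" using j by simp
      then have e: "A' 5 (j * s + x) = A 5 (j * s + x)" using A5(1) x by blast
      then have "A 5 (j * s + x) - 1 \<in> bag j \<and> A 8 (A 5 (j * s + x) - 1) = x" using D(3) jt x nz by auto
      then show ?thesis using e A8 wb[OF jt] by auto
    next
      case True
      show ?thesis
      proof (cases "x = z")
        case True
        then show ?thesis using A5(3) A8 \<open>j = Suc t\<close> bag_Suc[OF t] w by simp
      next
        case False
        then have e: "A' 5 (j * s + x) = kept A t x" using A5(2) x True by simp
        then have "kept A t x - 1 \<in> bag (Suc t) - {ord (Suc t)} \<and> A 8 (kept A t x - 1) = x"
          using kept_iff(2)[OF inv x t] nz by simp
        then show ?thesis using e True w A8 by auto
      qed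
    qed
  qed
  have 4: "\<forall>j x. 1 \<le> j \<and> j \<le> Suc t \<and> x < s \<longrightarrow> A' 6 (j * s + x) =
        (if A' 5 (j * s + x) \<noteq> 0 \<and> E (ord j) (A' 5 (j * s + x) - 1) then 1 else 0)"
  proof (intro allI impI)
    fix j x assume j: "1 \<le> j \<and> j \<le> Suc t \<and> x < s"
    show "A' 6 (j * s + x) = (if A' 5 (j * s + x) \<noteq> 0 \<and> E (ord j) (A' 5 (j * s + x) - 1) then 1 else 0)"
    proof (cases "j = Suc t")
      case True
      then show ?thesis using A6(2)[of x] j w by simp
    next
      case False
      then have jt: "j \<le> t" using j by simp
      then have "A' 6 (j * s + x) = A 6 (j * s + x)" "A' 5 (j * s + x) = A 5 (j * s + x)"
        using A5(1) A6(1) row_less[of j t x] j by auto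
      then show ?thesis using D(4) j jt by simp
    qed
  qed
  show ?thesis unfolding slot_inv_def using 1 2 3 4 A6(3) by blast
qed

end

section \<open>Computing the table of slots\<close>

definition row :: "nat \<Rightarrow> exp \<Rightarrow> exp" where
  "row t x = EAdd (Mul 0 50 (Var t)) x"

lemma ev_row [simp]: "ev R A l (row t x) = R t * R 50 + ev R A l x"
  by (simp add: row_def mult.commute)

text \<open>Registers: 12 and 3 are \<open>t\<close> and \<open>t + 1\<close>, 50 is the number of slots. Arrays: 5 is the table of
  the slots of all bags, 6 marks the slots with neighbours of the entering vertex, and 8 contains the
  slot of each vertex.\<close>

definition copy_com :: com where
  "copy_com = For 51 (Var 50) (Put 5 (row 3 (Var 51))
     (Ite (Conj (Arr 5 (row 12 (Var 51)))
       (Ite (Arr 1 (ESub (Arr 5 (row 12 (Var 51))) (Num 1)))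
         (Leq (Var 3) (Arr 1 (ESub (Arr 5 (row 12 (Var 51))) (Num 1)))) (Num 1)))
       (Arr 5 (row 12 (Var 51))) (Num 0)))"

text \<open>A neighbour outside the bag may have the slot number of a vertex inside: a departed
  vertex retains its number, and one that has not entered still has 0. Hence the comparison with the
  vertex found in the slot.\<close>

definition scan_com :: com where
  "scan_com = Loop (Less (Var 7) (Var 8))
     (Sq (Get 10 (Var 7)) (Sq (Asg 11 (Arr 8 (Var 10)))
     (Sq (Cond (Eq (Arr 5 (row 3 (Var 11))) (EAdd (Var 10) (Num 1))) (Put 6 (row 3 (Var 11)) (Num 1)) Nop)
       (Asg 7 (EAdd (Var 7) (Num 1))))))"

definition slots_com :: com where
  "slots_com = For 12 (Var 2)
     (Sq (Asg 3 (EAdd (Var 12) (Num 1))) (Sq (Asg 6 (Arr 4 (Var 3))) (Sq copy_com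
     (Sq (Asg 9 (LeastLt 1 2 50 (Neg (Arr 5 (row 3 (Idx 2))))))
     (Sq (Put 5 (row 3 (Var 9)) (EAdd (Var 6) (Num 1))) (Sq (Put 8 (Var 6) (Var 9))
     (Sq (Get 7 (EAdd (Var 6) (Num 1))) (Sq (Get 8 (EAdd (Var 6) (Num 2))) scan_com))))))))"

locale bag_algorithm = algorithm E n k Ws adj F m b inp + bags E n inn out ord s
  for E n k Ws adj F m b inp inn out ord s +
  assumes s_le: "s \<le> b" and card_bag: "j \<le> n \<Longrightarrow> card (bag j) \<le> s"
begin

lemma wp_copy:
  assumes R: "R 3 = Suc t" "R 12 = t" "R 50 = s" "A 1 = out" and t: "t < n" and inv: "slot_inv t A"
    and Q: "\<And>R' A'. (\<And>x. x \<noteq> 51 \<Longrightarrow> R' x = R x) \<Longrightarrow> (\<And>a. a \<noteq> 5 \<Longrightarrow> A' a = A a) \<Longrightarrow>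
      (\<And>j x. j \<le> t \<Longrightarrow> x < s \<Longrightarrow> A' 5 (j * s + x) = A 5 (j * s + x)) \<Longrightarrow>
      (\<And>x. x < s \<Longrightarrow> A' 5 (Suc t * s + x) = kept A t x) \<Longrightarrow> Q (\<tau> + s) R' A'"
  shows "wp copy_com Q \<tau> R A"
  unfolding copy_com_def
proof (rule wp_For[where N = s and I = "\<lambda>i \<tau>' R' A'. \<tau>' = \<tau> + i \<and> (\<forall>x. x \<noteq> 51 \<longrightarrow> R' x = R x) \<and>
    (\<forall>a. a \<noteq> 5 \<longrightarrow> A' a = A a) \<and> (\<forall>j x. j \<le> t \<longrightarrow> x < s \<longrightarrow> A' 5 (j * s + x) = A 5 (j * s + x)) \<and>
    (\<forall>x<i. A' 5 (Suc t * s + x) = kept A t x)"], goal_cases)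
  case (4 i \<tau>' R' A')
  have fr: "R' 3 = Suc t" "R' 12 = t" "R' 50 = s" "R' 51 = i" "A' 1 = out" using 4 R by auto
  have Ai: "A' 5 (t * s + i) = A 5 (t * s + i)" using 4 by blast
  have kb: "kept A t i \<le> m"
  proof (cases "kept A t i = 0")
    case False
    then have "kept A t i - 1 \<in> bag (Suc t)" using kept_iff(2)[OF inv] 4(1) t by blast
    then show ?thesis using m_bounds by (auto simp: bag_def)
  qed simp
  have e: "ev R' A' (\<lambda>_. 0) (Ite (Conj (Arr 5 (row 12 (Var 51)))
       (Ite (Arr 1 (ESub (Arr 5 (row 12 (Var 51))) (Num 1)))
         (Leq (Var 3) (Arr 1 (ESub (Arr 5 (row 12 (Var 51))) (Num 1)))) (Num 1)))
       (Arr 5 (row 12 (Var 51))) (Num 0)) = kept A t i"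
    using fr Ai by (simp add: kept_def Let_def)
  have e': "ev R' A' (\<lambda>_. 0) (row 3 (Var 51)) = Suc t * s + i" using fr by simp
  have ne: "j * s + x \<noteq> Suc t * s + i" if "j \<le> t" "x < s" for j x
    using index_unique[of x i j "Suc t"] that 4(1) by auto
  show ?case
    apply (rule wp_Put)
    apply (simp only: e kb)
    unfolding e e'
    using 4 ne by (auto simp: less_Suc_eq simp del: mult_Suc)
qed (use R s_le b_le Q in \<open>auto simp: small_def\<close>)

lemma wp_scan:
  assumes w: "w < n" and R: "R 7 = inp (Suc w)" "R 8 = inp (Suc w) + deg w" "R 3 = j" "R 50 = s"
    and A: "\<And>v. v < n \<Longrightarrow> A 8 v < s" "\<And>x. x < s \<Longrightarrow> A 6 (j * s + x) = 0"
      "\<And>u. E w u \<Longrightarrow> u \<in> B \<Longrightarrow> A 5 (j * s + A 8 u) = Suc u"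
      "\<And>x. x < s \<Longrightarrow> A 5 (j * s + x) \<noteq> 0 \<Longrightarrow> A 5 (j * s + x) - 1 \<in> B \<and> A 8 (A 5 (j * s + x) - 1) = x"
    and Q: "\<And>R' A'. (\<And>x. x \<noteq> 7 \<Longrightarrow> x \<noteq> 10 \<Longrightarrow> x \<noteq> 11 \<Longrightarrow> R' x = R x) \<Longrightarrow> (\<And>a. a \<noteq> 6 \<Longrightarrow> A' a = A a) \<Longrightarrow>
      (\<And>i. \<not> (j * s \<le> i \<and> i < Suc j * s) \<Longrightarrow> A' 6 i = A 6 i) \<Longrightarrow>
      (\<And>x. x < s \<Longrightarrow> A' 6 (j * s + x) =
        (if A 5 (j * s + x) \<noteq> 0 \<and> E w (A 5 (j * s + x) - 1) then 1 else 0)) \<Longrightarrow> Q (\<tau> + deg w) R' A'"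
  shows "wp scan_com Q \<tau> R A"
proof -
  define I where "I \<tau>' R' A' \<longleftrightarrow> (\<exists>i\<le>deg w. \<tau>' = \<tau> + i \<and>
    R' 7 = inp (Suc w) + i \<and> (\<forall>x. x \<noteq> 7 \<longrightarrow> x \<noteq> 10 \<longrightarrow> x \<noteq> 11 \<longrightarrow> R' x = R x) \<and>
    (\<forall>a. a \<noteq> 6 \<longrightarrow> A' a = A a) \<and> (\<forall>i. \<not> (j * s \<le> i \<and> i < Suc j * s) \<longrightarrow> A' 6 i = A 6 i) \<and>
    (\<forall>x<s. A' 6 (j * s + x) = (if A 5 (j * s + x) \<noteq> 0 \<and> (\<exists>l<i. adj ! w ! l = A 5 (j * s + x) - 1) then 1 else 0)))"
    for \<tau>' :: nat and R' :: "nat \<Rightarrow> nat" and A' :: arrays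
  show ?thesis
  unfolding scan_com_def
proof (rule wp_Loop[where f = "\<lambda>R' A'. R 8 - R' 7" and I = I], goal_cases)
  case 1
  show ?case unfolding I_def using R A by (intro exI[of _ 0]) auto
next
  case (2 \<tau>' R' A')
  then obtain i where i: "i \<le> deg w" "\<tau>' = \<tau> + i" "R' 7 = inp (Suc w) + i"
    and fr: "\<forall>x. x \<noteq> 7 \<longrightarrow> x \<noteq> 10 \<longrightarrow> x \<noteq> 11 \<longrightarrow> R' x = R x" "\<forall>a. a \<noteq> 6 \<longrightarrow> A' a = A a"
    and o: "\<forall>i. \<not> (j * s \<le> i \<and> i < Suc j * s) \<longrightarrow> A' 6 i = A 6 i"
    and m: "\<forall>x<s. A' 6 (j * s + x) = (if A 5 (j * s + x) \<noteq> 0 \<and> (\<exists>l<i. adj ! w ! l = A 5 (j * s + x) - 1) then 1 else 0)"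
    unfolding I_def by blast
  have "\<not> R' 7 < R' 8" using 2(2) by (simp split: if_splits)
  moreover have "R' 8 = inp (Suc w) + deg w" using fr(1) R(2) by simp
  ultimately have id: "i = deg w" using i by simp
  have "(\<exists>l<deg w. adj ! w ! l = u) \<longleftrightarrow> E w u" for u
    using adj_set[OF w] by (metis in_set_conv_nth mem_Collect_eq)
  then show ?case using Q[of R' A'] i fr o m id by simp
next
  case (3 \<tau>' R' A')
  then obtain i where i: "i \<le> deg w" "\<tau>' = \<tau> + i" "R' 7 = inp (Suc w) + i"
    and fr: "\<forall>x. x \<noteq> 7 \<longrightarrow> x \<noteq> 10 \<longrightarrow> x \<noteq> 11 \<longrightarrow> R' x = R x" "\<forall>a. a \<noteq> 6 \<longrightarrow> A' a = A a"
    and o: "\<forall>i. \<not> (j * s \<le> i \<and> i < Suc j * s) \<longrightarrow> A' 6 i = A 6 i"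
    and m: "\<forall>x<s. A' 6 (j * s + x) = (if A 5 (j * s + x) \<noteq> 0 \<and> (\<exists>l<i. adj ! w ! l = A 5 (j * s + x) - 1) then 1 else 0)"
    unfolding I_def by blast
  have R': "R' 8 = inp (Suc w) + deg w" "R' 3 = j" "R' 50 = s" and A': "A' 8 = A 8" "A' 5 = A 5"
    using fr R by auto
  have "R' 7 < R' 8" using 3(2) by (simp split: if_splits)
  then have il: "i < deg w" using i R' by simp
  define u where "u = adj ! w ! i"
  have u: "E w u" "u < n" using adj_nth[OF w il] E_less by (auto simp: u_def)
  have iu: "inp (R' 7) = u" using inp_neighbour[OF w il] i by (simp add: u_def)
  have F7: "R' 7 < F" using inp_ptr_less[OF w] i il by linarith
  have su: "A 8 u < s" using A(1) u by blast
  let ?c = "A 5 (j * s + A 8 u) = Suc u"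
  have step: "(\<exists>l<Suc i. adj ! w ! l = A 5 (j * s + x) - 1) \<and> A 5 (j * s + x) \<noteq> 0 \<longleftrightarrow>
      ((\<exists>l<i. adj ! w ! l = A 5 (j * s + x) - 1) \<and> A 5 (j * s + x) \<noteq> 0) \<or> (?c \<and> x = A 8 u)" if "x < s" for x
  proof
    assume a: "(\<exists>l<Suc i. adj ! w ! l = A 5 (j * s + x) - 1) \<and> A 5 (j * s + x) \<noteq> 0"
    then consider "\<exists>l<i. adj ! w ! l = A 5 (j * s + x) - 1" | "u = A 5 (j * s + x) - 1"
      by (auto simp: less_Suc_eq u_def)
    then show "((\<exists>l<i. adj ! w ! l = A 5 (j * s + x) - 1) \<and> A 5 (j * s + x) \<noteq> 0) \<or> (?c \<and> x = A 8 u)"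
    proof cases
      case 2
      then have "A 8 u = x" "A 5 (j * s + x) = Suc u" using A(4)[OF that] a by auto
      then show ?thesis by blast
    qed (use a in blast)
  qed (auto simp: u_def less_Suc_eq)
  let ?A = "if ?c then A'(6 := (A' 6)(j * s + A 8 u := 1)) else A'"
  have m': "\<forall>x<s. ?A 6 (j * s + x) = (if A 5 (j * s + x) \<noteq> 0 \<and> (\<exists>l<Suc i. adj ! w ! l = A 5 (j * s + x) - 1) then 1 else 0)"
  proof (intro allI impI)
    fix x assume x: "x < s"
    show "?A 6 (j * s + x) = (if A 5 (j * s + x) \<noteq> 0 \<and> (\<exists>l<Suc i. adj ! w ! l = A 5 (j * s + x) - 1) then 1 else 0)"
      using step[OF x] m x by (cases ?c; cases "x = A 8 u") auto
  qed
  have o': "\<forall>i. \<not> (j * s \<le> i \<and> i < Suc j * s) \<longrightarrow> ?A 6 i = A 6 i"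
    using o su by auto
  have b': "A 8 u \<le> m" "Suc (inp (Suc w) + i) \<le> m" "u \<le> m" "1 \<le> m"
    using su s_le b_le F7 F_le i u m_bounds by auto
  have "I (Suc \<tau>') (R'(10 := u, 11 := A 8 u, 7 := Suc (inp (Suc w) + i))) ?A"
    unfolding I_def
  proof (intro exI[of _ "Suc i"] conjI)
    show "\<forall>a. a \<noteq> 6 \<longrightarrow> ?A a = A a" using fr by simp
  qed (use il i fr o' m' in simp_all)
  then have asg: "wp (Asg 7 (EAdd (Var 7) (Num 1))) (\<lambda>\<tau>' R'' A''. I (Suc \<tau>') R'' A'' \<and>
      R 8 - R'' 7 < R 8 - R' 7) \<tau>' (R'(10 := u, 11 := A 8 u)) ?A"
    by (intro wp_Asg) (use i il b' R in \<open>auto simp: small_def\<close>)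
  have cond: "wp (Cond (Eq (Arr 5 (row 3 (Var 11))) (EAdd (Var 10) (Num 1))) (Put 6 (row 3 (Var 11)) (Num 1)) Nop)
      (wp (Asg 7 (EAdd (Var 7) (Num 1))) (\<lambda>\<tau>' R'' A''. I (Suc \<tau>') R'' A'' \<and>
        R 8 - R'' 7 < R 8 - R' 7)) \<tau>' (R'(10 := u, 11 := A 8 u)) A'"
  proof (rule wp_Cond)
    assume "ev (R'(10 := u, 11 := A 8 u)) A' (\<lambda>_. 0) (Eq (Arr 5 (row 3 (Var 11))) (EAdd (Var 10) (Num 1))) \<noteq> 0"
    then have "?c" using A' R' by (simp split: if_splits)
    then show "wp (Put 6 (row 3 (Var 11)) (Num 1)) (wp (Asg 7 (EAdd (Var 7) (Num 1))) (\<lambda>\<tau>' R'' A''. I (Suc \<tau>') R'' A'' \<and>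
        R 8 - R'' 7 < R 8 - R' 7)) \<tau>' (R'(10 := u, 11 := A 8 u)) A'"
      by (intro wp_Put) (use asg b' R' in simp_all)
  next
    assume "ev (R'(10 := u, 11 := A 8 u)) A' (\<lambda>_. 0) (Eq (Arr 5 (row 3 (Var 11))) (EAdd (Var 10) (Num 1))) = 0"
    then have "\<not> ?c" using A' R' by (simp split: if_splits)
    then show "wp Nop (wp (Asg 7 (EAdd (Var 7) (Num 1))) (\<lambda>\<tau>' R'' A''. I (Suc \<tau>') R'' A'' \<and>
        R 8 - R'' 7 < R 8 - R' 7)) \<tau>' (R'(10 := u, 11 := A 8 u)) A'"
      using asg by (intro wp_Nop) simp
  qed
  show ?case
    apply (rule wp_Sq, rule wp_Get)
    using F7 apply simp
    using iu b' apply simp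
    apply (rule wp_Sq, rule wp_Asg)
    using iu b' A' apply (simp add: small_def)
    apply (rule wp_Sq)
    using cond by (simp only: iu A' ev.simps fun_upd_same fun_upd_other)
qed
qed

lemma wp_slots:
  assumes R: "R 2 = n" "R 50 = s" and A: "A 0 = inn" "A 1 = out" "A 4 = ord"
    "A 5 = (\<lambda>_. 0)" "A 6 = (\<lambda>_. 0)" "A 8 = (\<lambda>_. 0)"
    and Q: "\<And>\<tau>' R' A'. \<tau>' \<le> \<tau> + n * (s + 1) + 2 * (k * n) \<Longrightarrow> R' 2 = n \<Longrightarrow> R' 50 = s \<Longrightarrow> A' 0 = inn \<Longrightarrow> A' 1 = out \<Longrightarrow>
      A' 4 = ord \<Longrightarrow> slot_inv n A' \<Longrightarrow> Q \<tau>' R' A'"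
  shows "wp slots_com Q \<tau> R A"
  unfolding slots_com_def
proof (rule wp_For[where N = n and I = "\<lambda>t \<tau>' R' A'. \<tau>' = \<tau> + t * (s + 1) + (\<Sum>j<t. deg (ord (Suc j))) \<and>
    R' 2 = n \<and> R' 50 = s \<and> A' 0 = inn \<and> A' 1 = out \<and> A' 4 = ord \<and> slot_inv t A'"], goal_cases)
  case 1
  show ?case using R A s_pos by (auto simp: slot_inv_def bag_0)
next
  case 2 then show ?case using m_bounds by (simp add: small_def)
next
  case 3 then show ?case by simp
next
  case (5 \<tau>' R')
  \<comment> \<open>The entrance order is a permutation of the vertices, so all scans together cost
    the sum of the degrees.\<close>
  have "(\<Sum>j<n. deg (ord (Suc j))) = (\<Sum>v<n. deg v)"
  proof (rule sum.reindex_bij_betw)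
    show "bij_betw (\<lambda>j. ord (Suc j)) {..<n} {..<n}"
      by (rule bij_betw_byWitness[where f' = "\<lambda>v. inn v - 1"])
        (use inn_ord ord_inn in \<open>force simp: Suc_le_eq\<close>)+
  qed
  then show ?case using 5 sum_deg Q by auto
next
  case (4 t \<tau>' R' A')
  define w where "w = ord (Suc t)"
  have w: "w < n" "inn w = Suc t" using inn_ord[of "Suc t"] 4(1) by (auto simp: w_def)
  have fr: "R' 2 = n" "R' 50 = s" "A' 0 = inn" "A' 1 = out" "A' 4 = ord" and inv: "slot_inv t A'"
    and tau: "\<tau>' = \<tau> + t * (s + 1) + (\<Sum>j<t. deg (ord (Suc j)))"
    using 4 by auto
  note D = slot_invD[OF inv]
  have b': "Suc t \<le> m" "w \<le> m" "Suc w \<le> m" "w + 2 < F" using w 4(1) m_bounds F_eq by auto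
  have ptr: "inp (Suc w) \<le> m" "inp (Suc (Suc w)) = inp (Suc w) + deg w" "inp (Suc w) + deg w \<le> m"
    using inp_ptr_less[OF w(1)] inp_ptr_Suc[OF w(1)] F_le by auto
  show ?case
    apply (rule wp_Sq, rule wp_Asg)
    using b' 4 apply (simp add: small_def)
    apply (rule wp_Sq, rule wp_Asg)
    using b' 4 apply (simp add: small_def w_def)
    apply (rule wp_Sq, rule wp_copy[where t = t])
    using 4 inv apply (simp, simp, simp, simp, simp, simp)
  proof (goal_cases)
    case (1 R1 A1)
    have R1: "R1 2 = n" "R1 3 = Suc t" "R1 6 = w" "R1 12 = t" "R1 50 = s" using 1(1) 4(2) fr by (simp_all add: w_def)
    have A1: "A1 0 = inn" "A1 1 = out" "A1 4 = ord" "A1 6 = A' 6" "A1 8 = A' 8" using 1(2) fr by simp_all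
    define z where "z = least_below s (\<lambda>x. kept A' t x = 0)"
    have ex: "\<exists>x<s. kept A' t x = 0" using free_slot[OF inv 4(1)] card_bag 4(1) by simp
    then have z: "z < s" "kept A' t z = 0"
      using least_below_less_iff[of s "\<lambda>x. kept A' t x = 0"] least_below_sat[of s "\<lambda>x. kept A' t x = 0"]
      unfolding z_def by blast+
    have ez: "ev R1 A1 (\<lambda>_. 0) (LeastLt 1 2 50 (Neg (Arr 5 (row 3 (Idx 2))))) = z"
      unfolding z_def R1(5)[symmetric] by (rule ev_LeastLt) (use R1 1(4) in auto)
    have zm: "z \<le> m" using z s_le b_le by simp
    let ?A2 = "A1(5 := (A1 5)(Suc t * s + z := Suc w), 8 := (A' 8)(w := z))"
    let ?R2 = "R1(9 := z, 7 := inp (Suc w), 8 := inp (Suc w) + deg w)"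
    have A2old: "?A2 5 (j * s + x) = A' 5 (j * s + x)" if "j \<le> t" "x < s" for j x
      using 1(3)[OF that] index_unique[of x z j "Suc t"] that z by auto
    have A2new: "?A2 5 (Suc t * s + x) = kept A' t x" if "x < s" "x \<noteq> z" for x
      using 1(4)[OF that(1)] that by auto
    have kinv: "kept A' t x \<noteq> 0 \<Longrightarrow> kept A' t x - 1 \<in> bag (Suc t) - {w} \<and> A' 8 (kept A' t x - 1) = x" if "x < s" for x
      using kept_iff(2)[OF inv that 4(1)] by (simp add: w_def)
    have wp2: "wp scan_com (\<lambda>\<tau>'' R'' A''. R'' 12 = t \<and> Suc \<tau>'' = \<tau> + Suc t * (s + 1) + (\<Sum>j<Suc t. deg (ord (Suc j))) \<and>
        (R''(12 := Suc t)) 2 = n \<and> (R''(12 := Suc t)) 50 = s \<and> A'' 0 = inn \<and> A'' 1 = out \<and> A'' 4 = ord \<and>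
        slot_inv (Suc t) A'') (\<tau>' + s) ?R2 ?A2"
    proof (rule wp_scan[where w = w and j = "Suc t" and B = "bag (Suc t)"], goal_cases)
      case (6 v) then show ?case using D(1) z by auto
    next
      case (7 x) then show ?case using D(5) A1 by simp
    next
      case (8 u)
      have uw: "u \<noteq> w" using 8 E_irrefl by blast
      then have "u \<in> bag (Suc t) - {ord (Suc t)}" using 8 by (simp add: w_def)
      then have k: "kept A' t (A' 8 u) = Suc u" using kept_iff(3)[OF inv z(1) 4(1)] by blast
      then have "A' 8 u \<noteq> z" using z by auto
      moreover have "A' 8 u < s" using D(1) 8 by (simp add: bag_def)
      ultimately show ?case using A2new[of "A' 8 u"] k uw by simp
    next
      case (9 x)
      show ?case
      proof (cases "x = z")
        case True
        then show ?thesis using bag_Suc[OF 4(1)] by (simp add: w_def)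
      next
        case False
        have e: "?A2 5 (Suc t * s + x) = kept A' t x" using A2new 9 False by blast
        then have "kept A' t x \<noteq> 0" using 9(2) by simp
        then show ?thesis unfolding e using kinv[OF 9(1)] by auto
      qed
    next
      case (10 R3 A3)
      have A3: "A3 0 = inn" "A3 1 = out" "A3 4 = ord" "A3 5 = ?A2 5" "A3 8 = ?A2 8" using 10(2) A1 by simp_all
      have "slot_inv (Suc t) A3"
      proof (rule slot_inv_Suc[OF inv 4(1) w_def z])
        show "A3 8 = (A' 8)(w := z)" using A3(5) by simp
        show "A3 5 (j * s + x) = A' 5 (j * s + x)" if "j \<le> t" "x < s" for j x using A2old[OF that] A3(4) by simp
        show "A3 5 (Suc t * s + x) = kept A' t x" if "x < s" "x \<noteq> z" for x using A2new[OF that] A3(4) by simp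
        show "A3 5 (Suc t * s + z) = Suc w" using A3(4) by simp
        show "A3 6 i = A' 6 i" if "i < Suc t * s" for i using 10(3)[of i] that A1(4) by simp
        show "A3 6 (Suc t * s + x) = (if A3 5 (Suc t * s + x) \<noteq> 0 \<and> E w (A3 5 (Suc t * s + x) - 1) then 1 else 0)"
          if "x < s" for x using 10(4)[OF that] A3(4) by simp
        show "A3 6 i = 0" if "i \<ge> Suc (Suc t) * s" for i
        proof -
          have "Suc t * s \<le> i" using that by simp
          then show ?thesis using 10(3)[of i] that A1(4) D(5) by simp
        qed
      qed
      then show ?case using 10(1) R1 A3 tau by (simp add: w_def)
    qed (use w R1 in auto)
    show ?case
      apply (rule wp_Sq, rule wp_Asg, unfold ez)
      using zm apply (simp add: small_def)
      apply (rule wp_Sq, rule wp_Put)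
      using R1 b' apply simp
      apply (rule wp_Sq, rule wp_Put)
      using zm apply simp
      apply (rule wp_Sq, rule wp_Get)
      using b' R1 apply simp
      using ptr R1 apply simp
      apply (rule wp_Sq, rule wp_Get)
      using b' R1 apply simp
      using ptr R1 apply simp
      using wp2 ptr R1 A1 by simp
  qed
qed

end

section \<open>Local box representations\<close>

text \<open>Packs an assignment of positions to endpoints into one number, so that states can be
  enumerated by a bounded sum.\<close>

lemma digits_exist:
  assumes "\<And>y. y < N \<Longrightarrow> a y < (B::nat)"
  shows "\<exists>c<B ^ N. \<forall>y<N. c div B ^ y mod B = a y"
  using assms
proof (induction N arbitrary: a)
  case (Suc N)
  obtain c where c: "c < B ^ N" "\<And>y. y < N \<Longrightarrow> c div B ^ y mod B = a (Suc y)"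
    using Suc.IH[of "\<lambda>y. a (Suc y)"] Suc.prems by auto
  have a0: "a 0 < B" using Suc.prems by simp
  have "c * B + a 0 < B ^ Suc N"
  proof -
    have "c * B + a 0 < Suc c * B" using a0 by simp
    also have "\<dots> \<le> B ^ N * B" using c(1) by (intro mult_right_mono) auto
    finally show ?thesis by (simp add: mult.commute)
  qed
  moreover have "(c * B + a 0) div B ^ y mod B = a y" if "y < Suc N" for y
  proof (cases y)
    case 0
    then show ?thesis using a0 by simp
  next
    case (Suc y')
    have "(c * B + a 0) div B ^ y = (c * B + a 0) div B div B ^ y'"
      unfolding Suc by (simp only: power_Suc div_mult2_eq)
    also have "(c * B + a 0) div B = c" using a0 by simp
    finally show ?thesis using c(2)[of y'] that Suc by simp
  qed
  ultimately show ?case by blast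
qed auto

lemma rank_less_iff:
  fixes f :: "'a \<Rightarrow> 'b :: linorder"
  assumes "finite S" "a \<in> S" "c \<in> S"
  shows "card {x \<in> S. f x < f a} < card {x \<in> S. f x < f c} \<longleftrightarrow> f a < f c"
proof
  assume "f a < f c"
  then have "{x \<in> S. f x < f a} \<subset> {x \<in> S. f x < f c}" using assms by force
  then show "card {x \<in> S. f x < f a} < card {x \<in> S. f x < f c}"
    using assms by (intro psubset_card_mono) auto
next
  assume *: "card {x \<in> S. f x < f a} < card {x \<in> S. f x < f c}"
  show "f a < f c"
  proof (rule ccontr)
    assume "\<not> f a < f c"
    then have "{x \<in> S. f x < f c} \<subseteq> {x \<in> S. f x < f a}" by auto
    then have "card {x \<in> S. f x < f c} \<le> card {x \<in> S. f x < f a}" using assms by (intro card_mono) auto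
    then show False using * by simp
  qed
qed

lemma rank_less_card:
  fixes f :: "'a \<Rightarrow> 'b :: linorder"
  assumes "finite S" "a \<in> S"
  shows "card {x \<in> S. f x < f a} < card S"
  using assms by (intro psubset_card_mono) auto

text \<open>A state of the dynamic program is a number \<open>c\<close> whose digits in base \<open>D = 2 s d\<close> are the
  positions of the interval endpoints of the current bag, in one linear order for all dimensions.
  In slot \<open>x\<close>, the digits with the offsets \<open>2 i\<close> and \<open>2 i + 1\<close> belong to the lower and the upper endpoint
  in dimension \<open>i\<close>.\<close>

definition pos :: "nat \<Rightarrow> nat \<Rightarrow> nat \<Rightarrow> nat \<Rightarrow> nat \<Rightarrow> nat" where
  "pos s d c x e = c div (2 * s * d) ^ (x * (2 * d) + e) mod (2 * s * d)"

definition persists :: "(nat \<Rightarrow> nat) \<Rightarrow> (nat \<Rightarrow> nat) \<Rightarrow> nat \<Rightarrow> bool" where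
  "persists sn sn' x \<longleftrightarrow> sn x \<noteq> 0 \<and> sn' x = sn x"

definition consistent :: "nat \<Rightarrow> nat \<Rightarrow> (nat \<Rightarrow> nat) \<Rightarrow> (nat \<Rightarrow> nat) \<Rightarrow> nat \<Rightarrow> nat \<Rightarrow> bool" where
  "consistent s d sn sn' c c' \<longleftrightarrow>
     (\<forall>x<s. \<forall>e<2*d. \<forall>x'<s. \<forall>e'<2*d. persists sn sn' x \<and> persists sn sn' x' \<longrightarrow>
        (pos s d c x e < pos s d c x' e' \<longleftrightarrow> pos s d c' x e < pos s d c' x' e'))"

definition separate :: "nat \<Rightarrow> nat \<Rightarrow> (nat \<Rightarrow> nat) \<Rightarrow> nat \<Rightarrow> nat \<Rightarrow> bool" where
  "separate s d sn' z c' \<longleftrightarrow>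
     (\<forall>e<2*d. \<forall>x<s. \<forall>e'<2*d. sn' x \<noteq> 0 \<and> (x \<noteq> z \<or> e' \<noteq> e) \<longrightarrow> pos s d c' x e' \<noteq> pos s d c' z e)"

text \<open>The strict comparison expresses that closed intervals meet: positions result from
  breaking ties between equal coordinates in favour of lower endpoints.\<close>

definition overlap :: "nat \<Rightarrow> nat \<Rightarrow> nat \<Rightarrow> nat \<Rightarrow> nat \<Rightarrow> bool" where
  "overlap s d c x y \<longleftrightarrow> (\<forall>i<d. pos s d c x (2 * i) < pos s d c y (2 * i + 1))"

definition adjacent_ok :: "nat \<Rightarrow> nat \<Rightarrow> (nat \<Rightarrow> nat) \<Rightarrow> (nat \<Rightarrow> nat) \<Rightarrow> nat \<Rightarrow> nat \<Rightarrow> bool" where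
  "adjacent_ok s d sn' ar z c' \<longleftrightarrow>
     (\<forall>x<s. x \<noteq> z \<and> sn' x \<noteq> 0 \<longrightarrow> (ar x \<noteq> 0 \<longleftrightarrow> overlap s d c' z x \<and> overlap s d c' x z))"

text \<open>Only the entering vertex, in slot \<open>z\<close>, is examined. Older pairs were
  examined when the later of them entered, and \<open>consistent\<close> transports the order of
  their endpoints.\<close>

definition step_ok :: "nat \<Rightarrow> nat \<Rightarrow> (nat \<Rightarrow> nat) \<Rightarrow> (nat \<Rightarrow> nat) \<Rightarrow> (nat \<Rightarrow> nat) \<Rightarrow> nat \<Rightarrow> nat \<Rightarrow> nat \<Rightarrow> bool" where
  "step_ok s d sn sn' ar z c c' \<longleftrightarrow> consistent s d sn sn' c c' \<and> separate s d sn' z c' \<and>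
     overlap s d c' z z \<and> adjacent_ok s d sn' ar z c'"

context bags
begin

definition slots_at :: "arrays \<Rightarrow> nat \<Rightarrow> nat \<Rightarrow> nat" where "slots_at A j x = A 5 (j * s + x)"
definition marks_at :: "arrays \<Rightarrow> nat \<Rightarrow> nat \<Rightarrow> nat" where "marks_at A j x = A 6 (j * s + x)"

definition transition :: "arrays \<Rightarrow> nat \<Rightarrow> nat \<Rightarrow> nat \<Rightarrow> nat \<Rightarrow> bool" where
  "transition A d j c c' =
     step_ok s d (slots_at A j) (slots_at A (Suc j)) (marks_at A (Suc j)) (A 8 (ord (Suc j))) c c'"

text \<open>The intervals of vertices that share no bag are not related to each other.\<close>

definition local_rep :: "nat \<Rightarrow> (nat \<Rightarrow> nat \<Rightarrow> real) \<Rightarrow> (nat \<Rightarrow> nat \<Rightarrow> real) \<Rightarrow> bool" where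
  "local_rep d lo hi \<longleftrightarrow> (\<forall>v<n. \<forall>i<d. lo v i \<le> hi v i) \<and>
     (\<forall>j\<le>n. \<forall>u\<in>bag j. \<forall>v\<in>bag j. u \<noteq> v \<longrightarrow> (E u v \<longleftrightarrow> (\<forall>i<d. lo u i \<le> hi v i \<and> lo v i \<le> hi u i)))"

lemma slots_at_bag:
  assumes "slot_inv n A" "j \<le> n" "x < s" "slots_at A j x \<noteq> 0"
  shows "slots_at A j x - 1 \<in> bag j" "A 8 (slots_at A j x - 1) = x"
  using slot_invD(3)[OF assms(1)] assms(2-4) by (simp_all add: slots_at_def)

lemma slots_at_slot:
  assumes "slot_inv n A" "j \<le> n" "v \<in> bag j"
  shows "slots_at A j (A 8 v) = Suc v" "A 8 v < s"
  using slot_invD(1,2)[OF assms(1)] assms(2,3) by (auto simp: slots_at_def bag_def)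

lemma marks_at_iff:
  assumes "slot_inv n A" "j < n" "x < s" "slots_at A (Suc j) x \<noteq> 0"
  shows "marks_at A (Suc j) x \<noteq> 0 \<longleftrightarrow> E (ord (Suc j)) (slots_at A (Suc j) x - 1)"
proof -
  have "1 \<le> Suc j \<and> Suc j \<le> n \<and> x < s" using assms by simp
  then have "A 6 (Suc j * s + x) =
     (if A 5 (Suc j * s + x) \<noteq> 0 \<and> E (ord (Suc j)) (A 5 (Suc j * s + x) - 1) then 1 else 0)"
    using slot_invD(4)[OF assms(1)] by blast
  then show ?thesis using assms(4) unfolding slots_at_def marks_at_def by (simp split: if_splits)
qed

text \<open>Coordinates may be replaced by ranks of endpoints within each bag. Applied to a box
  representation of the whole graph, this makes the least feasible \<open>d\<close> a lower bound on
  the boxicity.\<close>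

lemma local_rep_states:
  assumes inv: "slot_inv n A" and rep: "local_rep d lo hi" and cb: "\<And>j. j \<le> n \<Longrightarrow> card (bag j) \<le> s"
  shows "\<exists>cs. (\<forall>j\<le>n. cs j < (2 * s * d) ^ (2 * s * d)) \<and> (\<forall>j<n. transition A d j (cs j) (cs (Suc j)))"
proof -
  define D where "D = 2 * s * d"
  define K where "K = n * (2 * d) + 2 * d"
  \<comment> \<open>Ties are broken first by parity, so that a lower endpoint precedes an upper one
    with the same coordinate, and then by the number of the endpoint, so that all keys differ.
    \<open>K\<close> exceeds these numbers, so parity dominates.\<close>
  define key :: "nat \<times> nat \<Rightarrow> real \<times> nat" where
    "key = (\<lambda>(v, e). (if even e then lo v (e div 2) else hi v (e div 2), (e mod 2) * K + (v * (2 * d) + e)))"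
  define S where "S j = bag j \<times> {..<2 * d}" for j
  have finS: "finite (S j)" for j by (simp add: S_def)
  define rank where "rank j a = card {x \<in> S j. key x < key a}" for j a
  have rank_iff: "rank j a < rank j a' \<longleftrightarrow> key a < key a'" if "a \<in> S j" "a' \<in> S j" for j a a'
    unfolding rank_def by (rule rank_less_iff[OF finS that])
  have rank_D: "rank j a < D" if "j \<le> n" "a \<in> S j" for j a
  proof -
    have "rank j a < card (S j)" unfolding rank_def by (rule rank_less_card[OF finS that(2)])
    also have "\<dots> = card (bag j) * (2 * d)" by (simp add: S_def card_cartesian_product)
    also have "\<dots> \<le> s * (2 * d)" using cb[OF that(1)] by (rule mult_right_mono) simp
    finally show ?thesis by (simp add: D_def mult_ac)
  qed
  have less_K: "v * (2 * d) + e < K" if "v < n" "e < 2 * d" for v e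
    unfolding K_def using row_less[of v n] index_unique mult_right_mono[of v n "2 * d"] that by linarith
  have key_inj: "key (v, e) \<noteq> key (v', e')" if "(v, e) \<noteq> (v', e')" "v < n" "v' < n" "e < 2 * d" "e' < 2 * d" for v e v' e'
  proof
    assume "key (v, e) = key (v', e')"
    then have eq: "(e mod 2) * K + (v * (2 * d) + e) = (e' mod 2) * K + (v' * (2 * d) + e')" by (simp add: key_def)
    have l: "v * (2 * d) + e < K" "v' * (2 * d) + e' < K" using less_K that by auto
    have "(v * (2 * d) + e) = (v' * (2 * d) + e')"
    proof -
      have "((e mod 2) * K + (v * (2 * d) + e)) mod K = v * (2 * d) + e" using l(1) by simp
      moreover have "((e' mod 2) * K + (v' * (2 * d) + e')) mod K = v' * (2 * d) + e'" using l(2) by simp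
      ultimately show ?thesis using eq by metis
    qed
    moreover have "(v * (2 * d) + e) div (2 * d) = v" "(v' * (2 * d) + e') div (2 * d) = v'"
      using that(4,5) by simp_all
    ultimately have "v = v'" by metis
    then show False using that \<open>v * (2 * d) + e = v' * (2 * d) + e'\<close> by simp
  qed
  have key_LU: "key (v, 2 * i) < key (v', 2 * i + 1) \<longleftrightarrow> lo v i \<le> hi v' i" if "v < n" "i < d" for v v' i
  proof -
    have "v * (2 * d) + 2 * i < K" using less_K that by simp
    then show ?thesis by (auto simp: key_def less_prod_def)
  qed
  \<comment> \<open>Empty slots get the arbitrary digit 0; transitions constrain occupied slots
    only.\<close>
  define dig where "dig j y = (let x = y div (2 * d); e = y mod (2 * d) in
     if slots_at A j x = 0 then 0 else rank j (slots_at A j x - 1, e))" for j y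
  have "\<exists>c<D ^ D. \<forall>y<D. c div D ^ y mod D = dig j y" if j: "j \<le> n" for j
  proof (rule digits_exist)
    fix y assume y: "y < D"
    then have "d \<noteq> 0" by (cases "d = 0") (auto simp: D_def)
    moreover have "y < s * (2 * d)" using y by (simp add: D_def mult_ac)
    ultimately have x: "y div (2 * d) < s" "y mod (2 * d) < 2 * d" "0 < D"
      using y by (simp_all add: less_mult_imp_div_less)
    show "dig j y < D"
    proof (cases "slots_at A j (y div (2 * d)) = 0")
      case False
      have "(slots_at A j (y div (2 * d)) - 1, y mod (2 * d)) \<in> S j"
        using slots_at_bag(1)[OF inv j x(1) False] x(2) by (simp add: S_def)
      then show ?thesis using rank_D[OF j] False by (simp add: dig_def Let_def)
    qed (use x in \<open>simp add: dig_def Let_def\<close>)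
  qed
  then obtain cs where cs: "\<And>j. j \<le> n \<Longrightarrow> cs j < D ^ D \<and> (\<forall>y<D. cs j div D ^ y mod D = dig j y)" by metis
  have p: "pos s d (cs j) x e = rank j (slots_at A j x - 1, e)"
    if "j \<le> n" "x < s" "e < 2 * d" "slots_at A j x \<noteq> 0" for j x e
  proof -
    have "x * (2 * d) + e < Suc x * (2 * d)" using that by simp
    also have "\<dots> \<le> s * (2 * d)" using that by (intro mult_right_mono) auto
    finally have y: "x * (2 * d) + e < D" by (simp add: D_def mult_ac)
    have dm: "(x * (2 * d) + e) div (2 * d) = x" "(x * (2 * d) + e) mod (2 * d) = e" using that(3) by simp_all
    have "pos s d (cs j) x e = dig j (x * (2 * d) + e)"
      using cs[OF that(1)] y unfolding pos_def D_def[symmetric] by blast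
    then show ?thesis unfolding dig_def dm Let_def using that(4) by simp
  qed
  have mem: "(slots_at A j x - 1, e) \<in> S j" if "j \<le> n" "x < s" "e < 2 * d" "slots_at A j x \<noteq> 0" for j x e
    using slots_at_bag(1)[OF inv that(1,2,4)] that(3) by (simp add: S_def)
  have S_less: "v < n" if "(v, e) \<in> S j" for v e j using that by (simp add: S_def bag_def)
  have "transition A d j (cs j) (cs (Suc j))" if j: "j < n" for j
    unfolding transition_def step_ok_def
  proof (intro conjI)
    let ?w = "ord (Suc j)" and ?z = "A 8 (ord (Suc j))"
    have jn: "j \<le> n" "Suc j \<le> n" using j by auto
    have w: "?w \<in> bag (Suc j)" using bag_Suc[OF j] by simp
    have z: "slots_at A (Suc j) ?z = Suc ?w" "?z < s" using slots_at_slot[OF inv jn(2) w] by auto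
    have wn: "?w < n" using w by (simp add: bag_def)
    show "consistent s d (slots_at A j) (slots_at A (Suc j)) (cs j) (cs (Suc j))"
      unfolding consistent_def
    proof (intro allI impI)
      fix x e x' e' assume a: "x < s" "e < 2 * d" "x' < s" "e' < 2 * d"
        "persists (slots_at A j) (slots_at A (Suc j)) x \<and> persists (slots_at A j) (slots_at A (Suc j)) x'"
      then have e: "slots_at A j x \<noteq> 0" "slots_at A (Suc j) x = slots_at A j x"
        "slots_at A j x' \<noteq> 0" "slots_at A (Suc j) x' = slots_at A j x'" by (auto simp: persists_def)
      have m: "(slots_at A j x - 1, e) \<in> S j" "(slots_at A j x' - 1, e') \<in> S j"
        "(slots_at A j x - 1, e) \<in> S (Suc j)" "(slots_at A j x' - 1, e') \<in> S (Suc j)"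
        using mem[OF jn(1), of x e] mem[OF jn(1), of x' e'] mem[OF jn(2), of x e] mem[OF jn(2), of x' e'] a e by auto
      show "(pos s d (cs j) x e < pos s d (cs j) x' e') = (pos s d (cs (Suc j)) x e < pos s d (cs (Suc j)) x' e')"
        using p[OF jn(1), of x e] p[OF jn(1), of x' e'] p[OF jn(2), of x e] p[OF jn(2), of x' e'] a e
          rank_iff[OF m(1,2)] rank_iff[OF m(3,4)] by simp
    qed
    show "separate s d (slots_at A (Suc j)) ?z (cs (Suc j))"
      unfolding separate_def
    proof (intro allI impI notI)
      fix e x e' assume a: "e < 2 * d" "x < s" "e' < 2 * d" "slots_at A (Suc j) x \<noteq> 0 \<and> (x \<noteq> ?z \<or> e' \<noteq> e)"
        and eq: "pos s d (cs (Suc j)) x e' = pos s d (cs (Suc j)) ?z e"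
      let ?v = "slots_at A (Suc j) x - 1"
      have m: "(?v, e') \<in> S (Suc j)" "(?w, e) \<in> S (Suc j)"
        using mem[OF jn(2) a(2,3)] mem[OF jn(2) z(2) a(1)] a z by auto
      have "rank (Suc j) (?v, e') = rank (Suc j) (?w, e)"
        using p[OF jn(2) a(2,3)] p[OF jn(2) z(2) a(1)] a(4) z(1) eq by simp
      then have "key (?v, e') = key (?w, e)" using rank_iff[OF m] rank_iff[OF m(2,1)] by (metis less_irrefl linorder_neqE)
      moreover have "(?v, e') \<noteq> (?w, e)"
        using a(4) slots_at_bag(2)[OF inv jn(2) a(2)] by auto
      ultimately show False using key_inj[of ?v e' ?w e] S_less[OF m(1)] wn a by blast
    qed
    have ov: "overlap s d (cs (Suc j)) x x' \<longleftrightarrow> (\<forall>i<d. lo (slots_at A (Suc j) x - 1) i \<le> hi (slots_at A (Suc j) x' - 1) i)"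
      if o: "x < s" "x' < s" "slots_at A (Suc j) x \<noteq> 0" "slots_at A (Suc j) x' \<noteq> 0" for x x'
    proof -
      have "pos s d (cs (Suc j)) x (2 * i) < pos s d (cs (Suc j)) x' (2 * i + 1) \<longleftrightarrow>
          lo (slots_at A (Suc j) x - 1) i \<le> hi (slots_at A (Suc j) x' - 1) i" if i: "i < d" for i
      proof -
        have e: "2 * i < 2 * d" "2 * i + 1 < 2 * d" using i by auto
        have m: "(slots_at A (Suc j) x - 1, 2 * i) \<in> S (Suc j)" "(slots_at A (Suc j) x' - 1, 2 * i + 1) \<in> S (Suc j)"
          using mem[OF jn(2) o(1) e(1) o(3)] mem[OF jn(2) o(2) e(2) o(4)] by blast+
        show ?thesis
          unfolding p[OF jn(2) o(1) e(1) o(3)] p[OF jn(2) o(2) e(2) o(4)] rank_iff[OF m]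
          using key_LU[OF S_less[OF m(1)] i] by blast
      qed
      then show ?thesis unfolding overlap_def by blast
    qed
    have "slots_at A (Suc j) ?z \<noteq> 0" using z by simp
    then show "overlap s d (cs (Suc j)) ?z ?z"
      using ov[OF z(2,2)] z(1) rep wn unfolding local_rep_def by simp
    show "adjacent_ok s d (slots_at A (Suc j)) (marks_at A (Suc j)) ?z (cs (Suc j))"
      unfolding adjacent_ok_def
    proof (intro allI impI)
      fix x assume a: "x < s" "x \<noteq> ?z \<and> slots_at A (Suc j) x \<noteq> 0"
      let ?v = "slots_at A (Suc j) x - 1"
      have v: "?v \<in> bag (Suc j)" "A 8 ?v = x" using slots_at_bag[OF inv jn(2) a(1)] a by auto
      then have "?w \<noteq> ?v" using a by auto
      then have "E ?w ?v \<longleftrightarrow> (\<forall>i<d. lo ?w i \<le> hi ?v i \<and> lo ?v i \<le> hi ?w i)"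
        using rep jn(2) w v(1) unfolding local_rep_def by blast
      then show "(marks_at A (Suc j) x \<noteq> 0) = (overlap s d (cs (Suc j)) ?z x \<and> overlap s d (cs (Suc j)) x ?z)"
        using marks_at_iff[OF inv j a(1)] a ov[OF z(2) a(1)] ov[OF a(1) z(2)] z(1) by auto
    qed
  qed
  then show ?thesis using cs unfolding D_def by blast
qed

text \<open>In dimension \<open>i\<close>, the vertices of slot \<open>i\<close> are points at their entrance times, and every other
  vertex starts just before or just after the point of the vertex that holds slot \<open>i\<close> when it enters.\<close>

lemma local_rep_slots:
  assumes inv: "slot_inv n A"
  shows "\<exists>lo hi. local_rep s lo hi"
proof -
  define sl where "sl = A 8"
  define hold where "hold v i = slots_at A (inn v) i" for v i
  define lo :: "nat \<Rightarrow> nat \<Rightarrow> real" where "lo v i = (if sl v = i then inn v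
     else if hold v i = 0 then inn v
     else if E v (hold v i - 1) then inn (hold v i - 1) else inn (hold v i - 1) + 1)" for v i
  define hi :: "nat \<Rightarrow> nat \<Rightarrow> real" where "hi v i = (if sl v = i then inn v else n + 1)" for v i
  have slot: "slots_at A j (sl v) = Suc v" "sl v < s" if "j \<le> n" "v \<in> bag j" for j v
    using slots_at_slot[OF inv that] by (auto simp: sl_def)
  have own: "v \<in> bag (inn v)" "inn v \<le> n" if "v < n" for v
    using ord_inn[OF that] out_bounds[OF that] that by (auto simp: bag_def)
  have inj: "inn u \<noteq> inn v" if "u < n" "v < n" "u \<noteq> v" for u v
    using ord_inn that by metis
  have lo_le: "lo v i \<le> inn v" if v: "v < n" and i: "i < s" for v i
  proof (cases "sl v = i \<or> hold v i = 0")
    case False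
    let ?z = "hold v i - 1"
    have z: "?z \<in> bag (inn v)" "sl ?z = i"
      using slots_at_bag[OF inv own(2)[OF v] i] False by (auto simp: hold_def sl_def)
    then have "?z \<noteq> v" using False by auto
    moreover have "?z < n" "inn ?z \<le> inn v" using z(1) by (auto simp: bag_def)
    ultimately have "inn ?z < inn v" using inj[of ?z v] v by linarith
    then show ?thesis using False by (auto simp: lo_def)
  qed (auto simp: lo_def)
  have lohi: "lo v i \<le> hi v i" if "v < n" "i < s" for v i
    using lo_le[OF that] own(2)[OF that(1)] by (auto simp: hi_def lo_def)
  have main: "E u v \<longleftrightarrow> (\<forall>i<s. lo u i \<le> hi v i \<and> lo v i \<le> hi u i)"
    if j: "j \<le> n" "u \<in> bag j" "v \<in> bag j" "inn u < inn v" for j u v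
  proof -
    have uv: "u < n" "v < n" "u \<noteq> v" using j by (auto simp: bag_def)
    have b: "u \<in> bag (inn v)" "v \<in> bag (inn v)" "inn v \<le> n" using in_bag_inn[of u j v] j own[OF uv(2)] by auto
    have sl: "sl u \<noteq> sl v" using slot(1)[OF b(3,1)] slot(1)[OF b(3,2)] uv(3) by (metis nat.inject)
    have h: "hold v (sl u) = Suc u" using slot(1)[OF b(3,1)] by (simp add: hold_def)
    have slu: "sl u < s" using slot(2)[OF b(3,1)] .
    \<comment> \<open>When \<open>v\<close> enters, \<open>u\<close> holds its slot, so the lower
      end of \<open>v\<close> in this dimension is \<open>inn u\<close> or \<open>inn u + 1\<close>,
      depending on adjacency, while \<open>u\<close> is the point \<open>inn u\<close>.\<close>
    have at_u: "lo u (sl u) \<le> hi v (sl u) \<and> lo v (sl u) \<le> hi u (sl u) \<longleftrightarrow> E v u"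
      using sl h own(2)[OF uv(1)] by (auto simp: lo_def hi_def)
    \<comment> \<open>In any other dimension, \<open>u\<close> extends up to \<open>n + 1\<close>
      and starts before \<open>v\<close> enters, whereas \<open>v\<close> starts no later than its
      entrance and ends no earlier. So the two intervals meet.\<close>
    have other: "lo u i \<le> hi v i \<and> lo v i \<le> hi u i" if i: "i < s" "i \<noteq> sl u" for i
    proof -
      have "lo u i \<le> inn u" "lo v i \<le> inn v" using lo_le[OF uv(1) i(1)] lo_le[OF uv(2) i(1)] .
      moreover have "hi u i = n + 1" using i by (simp add: hi_def)
      moreover have "real (inn v) \<le> hi v i" using b(3) by (simp add: hi_def)
      moreover have "real (inn u) < inn v" "real (inn v) \<le> n" using j(4) b(3) by auto
      ultimately show ?thesis by linarith
    qed
    show ?thesis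
    proof
      assume "E u v"
      then have "E v u" by (rule E_sym)
      then show "\<forall>i<s. lo u i \<le> hi v i \<and> lo v i \<le> hi u i" using at_u other by metis
    next
      assume "\<forall>i<s. lo u i \<le> hi v i \<and> lo v i \<le> hi u i"
      then have "E v u" using at_u slu by blast
      then show "E u v" by (rule E_sym)
    qed
  qed
  have "local_rep s lo hi"
    unfolding local_rep_def
  proof (intro conjI allI impI ballI)
    fix v i assume "v < n" "i < s" then show "lo v i \<le> hi v i" by (rule lohi)
  next
    fix j u v assume a: "j \<le> n" "u \<in> bag j" "v \<in> bag j" "u \<noteq> v"
    then have "inn u \<noteq> inn v" using inj[of u v] by (auto simp: bag_def)
    then consider "inn u < inn v" | "inn v < inn u" by linarith
    then show "E u v \<longleftrightarrow> (\<forall>i<s. lo u i \<le> hi v i \<and> lo v i \<le> hi u i)"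
    proof cases
      case 1 then show ?thesis using main a by blast
    next
      case 2
      have "E u v \<longleftrightarrow> E v u" using E_sym by blast
      then show ?thesis using main[OF a(1,3,2) 2] by blast
    qed
  qed
  then show ?thesis by blast
qed

end

section \<open>The dynamic program\<close>

text \<open>The quotient is the number of positive multiples of \<open>P\<close> up to
  \<open>c\<close>. Each multiple is itself a sum of copies of \<open>P\<close>: in its use for
  \<open>divE\<close>, \<open>P\<close> is an array entry and the other factor a summation index, so
  that neither is a variable.\<close>

lemma sum_div:
  assumes "P \<ge> 1" "c < (C::nat)"
  shows "(\<Sum>q<C. if (\<Sum>j<C. if j \<le> q then P else 0) \<le> c then 1 else 0) = c div P"
proof -
  have "(\<Sum>j<C. if j \<le> q then P else 0) = Suc q * P" if "q < C" for q
  proof -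
    have "{j \<in> {..<C}. j \<le> q} = {..q}" using that by auto
    then have "(\<Sum>j<C. if j \<le> q then P else 0) = card {..q} * P" by (simp add: sum.If_cases Int_def)
    then show ?thesis by simp
  qed
  then have "(\<Sum>q<C. if (\<Sum>j<C. if j \<le> q then P else 0) \<le> c then 1 else 0) = (\<Sum>q<C. if Suc q * P \<le> c then 1 else (0::nat))"
    by (intro sum.cong) auto
  also have "{q \<in> {..<C}. Suc q * P \<le> c} = {..<c div P}"
  proof (intro set_eqI)
    fix q
    have "Suc q * P \<le> c \<longleftrightarrow> q < c div P" using assms(1) by (simp only: less_eq_div_iff_mult_less_eq[symmetric] Suc_le_eq)
    moreover have "c div P < C" using assms(2) div_le_dividend[of c P] by linarith
    ultimately show "q \<in> {q \<in> {..<C}. Suc q * P \<le> c} \<longleftrightarrow> q \<in> {..<c div P}" by auto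
  qed
  then have "(\<Sum>q<C. if Suc q * P \<le> c then 1 else (0::nat)) = c div P" by (simp add: sum.If_cases Int_def)
  finally show ?thesis .
qed

text \<open>Here the divisor is the value of a small variable, so the multiples can be written as
  products.\<close>

lemma sum_div':
  assumes "D \<ge> 1" "v < (C::nat)"
  shows "(\<Sum>q<C. if D * (q + 1) \<le> v then 1 else 0) = v div D"
proof -
  have "{q \<in> {..<C}. D * (q + 1) \<le> v} = {..<v div D}"
  proof (intro set_eqI)
    fix q
    have "D * (q + 1) \<le> v \<longleftrightarrow> q < v div D"
      using less_eq_div_iff_mult_less_eq[of D "Suc q" v] assms(1) by (simp add: Suc_le_eq mult.commute)
    moreover have "v div D < C" using assms(2) div_le_dividend[of v D] by linarith
    ultimately show "q \<in> {q \<in> {..<C}. D * (q + 1) \<le> v} \<longleftrightarrow> q \<in> {..<v div D}" by auto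
  qed
  then show ?thesis by (simp add: sum.If_cases Int_def)
qed

lemma cell_less: "j < Suc t \<Longrightarrow> x < C \<Longrightarrow> j * C + x < Suc t * (C::nat)"
proof -
  assume "j < Suc t" "x < C"
  then have "j * C + x < Suc j * C" by simp
  also have "\<dots> \<le> Suc t * C" using \<open>j < Suc t\<close> by (intro mult_le_mono1) auto
  finally show ?thesis .
qed

section \<open>Digits and transitions as expressions\<close>

definition divE :: "exp \<Rightarrow> exp \<Rightarrow> exp" where
  "divE p c = SumLt 21 55 (Leq (SumLt 22 55 (Ite (Leq (Idx 22) (Idx 21)) p (Num 0))) c)"

definition modE :: "exp \<Rightarrow> exp" where
  "modE v = ESub v (Mul 23 54 (SumLt 24 55 (Leq (Mul 25 54 (EAdd (Idx 24) (Num 1))) v)))"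

definition posE :: "exp \<Rightarrow> exp \<Rightarrow> exp \<Rightarrow> exp" where
  "posE c x e = modE (divE (Arr 9 (EAdd (Mul 20 53 x) e)) c)"

text \<open>Summation indices from 20 on are reserved for the expressions above.\<close>

definition stable :: "(nat \<Rightarrow> nat) \<Rightarrow> arrays \<Rightarrow> exp \<Rightarrow> bool" where
  "stable R A a \<longleftrightarrow> (\<forall>l j i. 20 \<le> j \<longrightarrow> ev R A (l(j := i)) a = ev R A l a)"

lemma stableD: "stable R A a \<Longrightarrow> 20 \<le> j \<Longrightarrow> ev R A (l(j := i)) a = ev R A l a"
  by (simp add: stable_def)

lemma stable_simps [simp]: "stable R A (Var x)" "stable R A (Num i)" "j < 20 \<Longrightarrow> stable R A (Idx j)"
  "stable R A a \<Longrightarrow> stable R A c \<Longrightarrow> stable R A (EAdd a c)"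
  by (auto simp: stable_def)

definition dp_regs :: "nat \<Rightarrow> nat \<Rightarrow> (nat \<Rightarrow> nat) \<Rightarrow> bool" where
  "dp_regs s d R \<longleftrightarrow> R 50 = s \<and> R 52 = d \<and> R 53 = 2 * d \<and> R 54 = 2 * s * d \<and> R 55 = (2 * s * d) ^ (2 * s * d)"

definition powers :: "nat \<Rightarrow> nat \<Rightarrow> arrays \<Rightarrow> bool" where
  "powers s d A \<longleftrightarrow> (\<forall>y\<le>2 * s * d. A 9 y = (2 * s * d) ^ y)"

text \<open>The bound on the state ensures that \<open>D ^ D\<close>, the limit of the counting
  sums, exceeds both quotients.\<close>

lemma ev_posE:
  assumes R: "dp_regs s d R" "powers s d A" and st: "stable R A c" "stable R A x" "stable R A e"
    and b: "ev R A l c < (2 * s * d) ^ (2 * s * d)" "ev R A l x < s" "ev R A l e < 2 * d"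
  shows "ev R A l (posE c x e) = pos s d (ev R A l c) (ev R A l x) (ev R A l e)"
proof -
  let ?D = "2 * s * d" and ?x = "ev R A l x" and ?e = "ev R A l e" and ?c = "ev R A l c"
  let ?C = "?D ^ ?D"
  have y: "2 * d * ?x + ?e < ?D"
  proof -
    have "2 * d * ?x + ?e < 2 * d * Suc ?x" using b(3) by simp
    also have "\<dots> \<le> 2 * d * s" using b(2) by (intro mult_le_mono2) simp
    finally show ?thesis by (simp add: mult_ac)
  qed
  then have D1: "1 \<le> ?D" by linarith
  have P: "A 9 (2 * d * ?x + ?e) = ?D ^ (2 * d * ?x + ?e)" using R(2) y unfolding powers_def by simp
  have P1: "1 \<le> ?D ^ (2 * d * ?x + ?e)" using D1 by simp
  have pw: "ev R A l' (Arr 9 (EAdd (Mul 20 53 x) e)) = ?D ^ (2 * d * ?x + ?e)"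
    if "ev R A l' x = ?x" "ev R A l' e = ?e" for l'
    using that R(1) st P by (simp add: stableD dp_regs_def)
  have dv: "ev R A l' (divE (Arr 9 (EAdd (Mul 20 53 x) e)) c) = ?c div ?D ^ (2 * d * ?x + ?e)"
    if "ev R A l' x = ?x" "ev R A l' e = ?e" "ev R A l' c = ?c" for l'
  proof -
    have "ev R A l' (divE (Arr 9 (EAdd (Mul 20 53 x) e)) c) =
      (\<Sum>q<?C. if (\<Sum>j<?C. if j \<le> q then ?D ^ (2 * d * ?x + ?e) else 0) \<le> ?c then 1 else 0)"
    proof -
      have [simp]: "(0 < (if P then Suc 0 else (0::nat))) = P" for P by simp
      show ?thesis unfolding divE_def using R(1) that st pw
        by (simp add: stableD dp_regs_def del: ev.simps(7) ev_Mul cong: if_cong)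
    qed
    also have "\<dots> = ?c div ?D ^ (2 * d * ?x + ?e)" by (rule sum_div[OF P1 b(1)])
    finally show ?thesis .
  qed
  let ?v = "?c div ?D ^ (2 * d * ?x + ?e)"
  have vC: "?v < ?C" using b(1) div_le_dividend le_less_trans by blast
  have "ev R A l (posE c x e) = ?v - ?D * (\<Sum>q<?C. if ?D * (q + 1) \<le> ?v then 1 else 0)"
    unfolding posE_def modE_def using R(1) dv st
    by (simp add: stableD dp_regs_def)
  also have "\<dots> = ?v mod ?D" unfolding sum_div'[OF D1 vC] by (simp add: minus_mult_div_eq_mod)
  also have "\<dots> = pos s d ?c ?x ?e" by (simp add: pos_def mult.commute)
  finally show ?thesis .
qed

lemma truth_simps:
  "ev R A l (Neg a) \<noteq> 0 \<longleftrightarrow> \<not> ev R A l a \<noteq> 0"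
  "ev R A l (Conj a c) \<noteq> 0 \<longleftrightarrow> ev R A l a \<noteq> 0 \<and> ev R A l c \<noteq> 0"
  "ev R A l (Imp a c) \<noteq> 0 \<longleftrightarrow> (ev R A l a \<noteq> 0 \<longrightarrow> ev R A l c \<noteq> 0)"
  "ev R A l (Iff a c) \<noteq> 0 \<longleftrightarrow> (ev R A l a \<noteq> 0 \<longleftrightarrow> ev R A l c \<noteq> 0)"
  "ev R A l (Less a c) \<noteq> 0 \<longleftrightarrow> ev R A l a < ev R A l c"
  "ev R A l (Eq a c) \<noteq> 0 \<longleftrightarrow> ev R A l a = ev R A l c"
  by simp_all

lemma ev_AllLt_iff:
  assumes "R y = N" "\<And>i. i < N \<Longrightarrow> ev R A (l(j := i)) a \<noteq> 0 \<longleftrightarrow> P i"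
  shows "ev R A l (AllLt j y a) \<noteq> 0 \<longleftrightarrow> (\<forall>i<N. P i)"
  using assms by simp

definition persistsE :: "exp \<Rightarrow> exp" where
  "persistsE x = Conj (Arr 5 (row 12 x)) (Eq (Arr 5 (row 3 x)) (Arr 5 (row 12 x)))"

definition overlapE :: "exp \<Rightarrow> exp \<Rightarrow> exp" where
  "overlapE x y = AllLt 7 52 (Less (posE (Var 56) x (EAdd (Idx 7) (Idx 7)))
     (posE (Var 56) y (EAdd (EAdd (Idx 7) (Idx 7)) (Num 1))))"

definition consistentE :: exp where
  "consistentE = AllLt 3 50 (AllLt 4 53 (AllLt 5 50 (AllLt 6 53
     (Imp (Conj (persistsE (Idx 3)) (persistsE (Idx 5)))
       (Iff (Less (posE (Idx 2) (Idx 3) (Idx 4)) (posE (Idx 2) (Idx 5) (Idx 6)))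
         (Less (posE (Var 56) (Idx 3) (Idx 4)) (posE (Var 56) (Idx 5) (Idx 6))))))))"

definition separateE :: exp where
  "separateE = AllLt 3 53 (AllLt 4 50 (AllLt 5 53
     (Imp (Conj (Arr 5 (row 3 (Idx 4))) (Neg (Conj (Eq (Idx 4) (Var 9)) (Eq (Idx 5) (Idx 3)))))
       (Neg (Eq (posE (Var 56) (Idx 4) (Idx 5)) (posE (Var 56) (Var 9) (Idx 3)))))))"

definition adjacentE :: exp where
  "adjacentE = AllLt 3 50 (Imp (Conj (Neg (Eq (Idx 3) (Var 9))) (Arr 5 (row 3 (Idx 3))))
     (Iff (Arr 6 (row 3 (Idx 3))) (Conj (overlapE (Var 9) (Idx 3)) (overlapE (Idx 3) (Var 9)))))"

definition stepE :: exp where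
  "stepE = Conj consistentE (Conj separateE (Conj (overlapE (Var 9) (Var 9)) adjacentE))"

lemma ev_persistsE:
  assumes "R 3 = Suc t" "R 12 = t" "R 50 = s"
  shows "ev R A l (persistsE x) \<noteq> 0 \<longleftrightarrow>
    persists (\<lambda>x. A 5 (t * s + x)) (\<lambda>x. A 5 (Suc t * s + x)) (ev R A l x)"
  using assms by (simp add: persistsE_def persists_def)

lemma ev_overlapE:
  assumes R: "dp_regs s d R" "powers s d A" "R 56 = c'" "c' < (2 * s * d) ^ (2 * s * d)"
    and st: "stable R A x" "stable R A y" "\<And>i. ev R A (l(7 := i)) x = ev R A l x" "\<And>i. ev R A (l(7 := i)) y = ev R A l y"
    and b: "ev R A l x < s" "ev R A l y < s"
  shows "ev R A l (overlapE x y) \<noteq> 0 \<longleftrightarrow> overlap s d c' (ev R A l x) (ev R A l y)"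
proof -
  have "ev R A (l(7 := i)) (posE (Var 56) x (EAdd (Idx 7) (Idx 7))) = pos s d c' (ev R A l x) (2 * i)"
    if "i < d" for i
    by (subst ev_posE[OF R(1,2)]) (use R st b that in \<open>auto simp: mult_2\<close>)
  moreover have "ev R A (l(7 := i)) (posE (Var 56) y (EAdd (EAdd (Idx 7) (Idx 7)) (Num 1))) = pos s d c' (ev R A l y) (2 * i + 1)"
    if "i < d" for i
    by (subst ev_posE[OF R(1,2)]) (use R st b that in \<open>auto simp: mult_2\<close>)
  moreover have "R 52 = d" using R(1) by (simp add: dp_regs_def)
  ultimately show ?thesis unfolding overlapE_def overlap_def by (intro ev_AllLt_iff) auto
qed

context
  fixes s d t c' z :: nat and R :: "nat \<Rightarrow> nat" and A :: arrays
  assumes R: "dp_regs s d R" "powers s d A" "R 56 = c'" "c' < (2 * s * d) ^ (2 * s * d)"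
    and T: "R 3 = Suc t" "R 12 = t" "R 9 = z" "z < s"
begin

lemma regs: "R 50 = s" "R 52 = d" "R 53 = 2 * d"
  using R(1) by (simp_all add: dp_regs_def)

lemma ev_consistentE:
  assumes c: "l 2 < (2 * s * d) ^ (2 * s * d)"
  shows "ev R A l consistentE \<noteq> 0 \<longleftrightarrow>
    consistent s d (\<lambda>x. A 5 (t * s + x)) (\<lambda>x. A 5 (Suc t * s + x)) (l 2) c'"
proof -
  let ?sn = "\<lambda>x. A 5 (t * s + x)" and ?sn' = "\<lambda>x. A 5 (Suc t * s + x)"
  have "ev R A (l(3 := x, 4 := e, 5 := x', 6 := e'))
     (Imp (Conj (persistsE (Idx 3)) (persistsE (Idx 5)))
       (Iff (Less (posE (Idx 2) (Idx 3) (Idx 4)) (posE (Idx 2) (Idx 5) (Idx 6)))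
         (Less (posE (Var 56) (Idx 3) (Idx 4)) (posE (Var 56) (Idx 5) (Idx 6))))) \<noteq> 0 \<longleftrightarrow>
     (persists ?sn ?sn' x \<and> persists ?sn ?sn' x' \<longrightarrow>
        (pos s d (l 2) x e < pos s d (l 2) x' e' \<longleftrightarrow> pos s d c' x e < pos s d c' x' e'))"
    if a: "x < s" "e < 2 * d" "x' < s" "e' < 2 * d" for x e x' e'
  proof -
    let ?l = "l(3 := x, 4 := e, 5 := x', 6 := e')"
    have "ev R A ?l (posE (Idx 2) (Idx 3) (Idx 4)) = pos s d (l 2) x e"
      "ev R A ?l (posE (Idx 2) (Idx 5) (Idx 6)) = pos s d (l 2) x' e'"
      "ev R A ?l (posE (Var 56) (Idx 3) (Idx 4)) = pos s d c' x e"
      "ev R A ?l (posE (Var 56) (Idx 5) (Idx 6)) = pos s d c' x' e'"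
      by (subst ev_posE[OF R(1,2)]; use R c a in simp)+
    moreover have "ev R A ?l (persistsE (Idx 3)) \<noteq> 0 \<longleftrightarrow> persists ?sn ?sn' x"
      "ev R A ?l (persistsE (Idx 5)) \<noteq> 0 \<longleftrightarrow> persists ?sn ?sn' x'"
      using ev_persistsE[OF T(1,2) regs(1), of A ?l "Idx 3"] ev_persistsE[OF T(1,2) regs(1), of A ?l "Idx 5"]
      by simp_all
    ultimately show ?thesis by (simp only: truth_simps)
  qed
  then show ?thesis unfolding consistentE_def consistent_def by (intro ev_AllLt_iff regs)
qed

lemma ev_separateE:
  "ev R A l separateE \<noteq> 0 \<longleftrightarrow> separate s d (\<lambda>x. A 5 (Suc t * s + x)) z c'"
proof -
  let ?sn' = "\<lambda>x. A 5 (Suc t * s + x)"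
  have "ev R A (l(3 := e, 4 := x, 5 := e'))
     (Imp (Conj (Arr 5 (row 3 (Idx 4))) (Neg (Conj (Eq (Idx 4) (Var 9)) (Eq (Idx 5) (Idx 3)))))
       (Neg (Eq (posE (Var 56) (Idx 4) (Idx 5)) (posE (Var 56) (Var 9) (Idx 3))))) \<noteq> 0 \<longleftrightarrow>
     (?sn' x \<noteq> 0 \<and> (x \<noteq> z \<or> e' \<noteq> e) \<longrightarrow> pos s d c' x e' \<noteq> pos s d c' z e)"
    if a: "e < 2 * d" "x < s" "e' < 2 * d" for x e e'
  proof -
    let ?l = "l(3 := e, 4 := x, 5 := e')"
    have "ev R A ?l (posE (Var 56) (Idx 4) (Idx 5)) = pos s d c' x e'"
      "ev R A ?l (posE (Var 56) (Var 9) (Idx 3)) = pos s d c' z e"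
      by (subst ev_posE[OF R(1,2)]; use R T a in simp)+
    then show ?thesis using T regs by simp
  qed
  then show ?thesis unfolding separateE_def separate_def by (intro ev_AllLt_iff regs)
qed

lemma ev_adjacentE:
  "ev R A l adjacentE \<noteq> 0 \<longleftrightarrow>
    adjacent_ok s d (\<lambda>x. A 5 (Suc t * s + x)) (\<lambda>x. A 6 (Suc t * s + x)) z c'"
proof -
  let ?sn' = "\<lambda>x. A 5 (Suc t * s + x)" and ?ar = "\<lambda>x. A 6 (Suc t * s + x)"
  have "ev R A (l(3 := x)) (Imp (Conj (Neg (Eq (Idx 3) (Var 9))) (Arr 5 (row 3 (Idx 3))))
     (Iff (Arr 6 (row 3 (Idx 3))) (Conj (overlapE (Var 9) (Idx 3)) (overlapE (Idx 3) (Var 9))))) \<noteq> 0 \<longleftrightarrow>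
     (x \<noteq> z \<and> ?sn' x \<noteq> 0 \<longrightarrow> (?ar x \<noteq> 0 \<longleftrightarrow> overlap s d c' z x \<and> overlap s d c' x z))"
    if a: "x < s" for x
  proof -
    have "ev R A (l(3 := x)) (overlapE (Var 9) (Idx 3)) \<noteq> 0 \<longleftrightarrow> overlap s d c' z x"
      "ev R A (l(3 := x)) (overlapE (Idx 3) (Var 9)) \<noteq> 0 \<longleftrightarrow> overlap s d c' x z"
      by (subst ev_overlapE[OF R]; use T a in simp)+
    then show ?thesis by (simp only: truth_simps ev.simps ev_row T regs fun_upd_same)
  qed
  then show ?thesis unfolding adjacentE_def adjacent_ok_def by (intro ev_AllLt_iff regs)
qed

lemma ev_stepE:
  assumes "l 2 < (2 * s * d) ^ (2 * s * d)"
  shows "ev R A l stepE \<noteq> 0 \<longleftrightarrow> step_ok s d (\<lambda>x. A 5 (t * s + x)) (\<lambda>x. A 5 (Suc t * s + x))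
    (\<lambda>x. A 6 (Suc t * s + x)) z (l 2) c'"
proof -
  have conj: "ev R A l (Conj a e) \<noteq> 0 \<longleftrightarrow> ev R A l a \<noteq> 0 \<and> ev R A l e \<noteq> 0" for a e by simp
  have "ev R A l (overlapE (Var 9) (Var 9)) \<noteq> 0 \<longleftrightarrow> overlap s d c' z z"
    using ev_overlapE[OF R, of "Var 9" "Var 9" l] T by simp
  then show ?thesis
    unfolding stepE_def step_ok_def conj ev_consistentE[where l = l, OF assms] ev_separateE ev_adjacentE by simp
qed

end

text \<open>Registers: 52 is \<open>d\<close>, 53 is \<open>2 d\<close>, 54 is the base \<open>D = 2 s d\<close>, 55 is the number \<open>D ^ D\<close> of states,
  56 is a state and 57 the least reachable final state. Array 10 stores in row \<open>t\<close> for
  every state its least possible predecessor, or \<open>D ^ D\<close> if there is none. Array 9 contains the powers of \<open>D\<close>,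
  and array 11 the states that backtracking selects for the bags.\<close>

definition cell :: "nat \<Rightarrow> exp \<Rightarrow> exp" where
  "cell t c = EAdd (Mul 26 55 (Var t)) c"

lemma ev_cell [simp]: "ev R A l (cell t c) = R t * R 55 + ev R A l c"
  by (simp add: cell_def mult.commute)

text \<open>A predecessor has to be reachable itself, that is, its own entry must be smaller than
  the number of states. Storing it serves the reachability test and the backtracking alike.\<close>

definition reachE :: exp where
  "reachE = LeastLt 1 2 55 (Conj (Less (Arr 10 (cell 12 (Idx 2))) (Var 55)) stepE)"

definition powers_com :: com where
  "powers_com = Sq (Put 9 (Num 0) (Num 1))
     (Sq (For 51 (Var 54) (Put 9 (EAdd (Var 51) (Num 1)) (Mul 0 54 (Arr 9 (Var 51)))))
       (Asg 55 (Arr 9 (Var 54))))"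

definition table_com :: com where
  "table_com = Sq (For 56 (Var 55) (Put 10 (Var 56) (Num 0)))
     (Sq (For 12 (Var 2) (Sq (Asg 3 (EAdd (Var 12) (Num 1))) (Sq (Asg 9 (Arr 8 (Arr 4 (Var 3))))
       (For 56 (Var 55) (Put 10 (cell 3 (Var 56)) reachE)))))
       (Asg 57 (LeastLt 1 2 55 (Less (Arr 10 (cell 2 (Idx 2))) (Var 55)))))"

definition attempt_com :: com where
  "attempt_com = Sq (Asg 53 (EAdd (Var 52) (Var 52))) (Sq (Asg 54 (Mul 0 50 (Var 53)))
     (Sq powers_com table_com))"

definition search_com :: com where
  "search_com = Sq (Asg 52 (Num 0)) (Sq attempt_com
     (Loop (Leq (Var 55) (Var 57)) (Sq (Asg 52 (EAdd (Var 52) (Num 1))) attempt_com)))"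

definition backtrack_com :: com where
  "backtrack_com = Sq (Put 11 (Var 2) (Var 57)) (For 12 (Var 2)
     (Sq (Asg 3 (ESub (Var 2) (Var 12)))
       (Put 11 (ESub (Var 3) (Num 1)) (Arr 10 (cell 3 (Arr 11 (Var 3)))))))"

section \<open>Correctness of the search for the least dimension\<close>

locale dp_algorithm = bag_algorithm E n k Ws adj F m b inp inn out ord s
  for E n k Ws adj F m b inp inn out ord s +
  assumes b_large: "(2 * s * s + 1) ^ (2 * s * s) + 2 * s * s \<le> b"
begin

abbreviation "states d \<equiv> (2 * s * d) ^ (2 * s * d)"

lemma D_le: "d \<le> s \<Longrightarrow> 2 * s * d \<le> 2 * s * s" "d \<le> s \<Longrightarrow> 2 * s * d \<le> b"
proof -
  assume "d \<le> s"
  then show "2 * s * d \<le> 2 * s * s" by (rule mult_le_mono2)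
  then show "2 * s * d \<le> b" using b_large by linarith
qed

lemma power_le_b: "d \<le> s \<Longrightarrow> y \<le> 2 * s * d \<Longrightarrow> (2 * s * d) ^ y \<le> b"
proof -
  assume a: "d \<le> s" "y \<le> 2 * s * d"
  have "(2 * s * d) ^ y \<le> (2 * s * s + 1) ^ y" by (rule power_mono) (use D_le(1)[OF a(1)] in linarith)+
  also have "\<dots> \<le> (2 * s * s + 1) ^ (2 * s * s)" by (rule power_increasing) (use a(2) D_le(1)[OF a(1)] in linarith)+
  finally show ?thesis using b_large by linarith
qed

text \<open>For \<open>d = 0\<close> there is exactly one state, because \<open>0 ^ 0 = 1\<close>.
  The search can therefore start at 0 without a special case.\<close>

lemma states_pos: "1 \<le> states d"
proof (cases "2 * s * d = 0")
  case False
  then show ?thesis by (intro one_le_power) linarith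
next
  case True
  show ?thesis unfolding True by simp
qed

definition base :: "arrays \<Rightarrow> bool" where
  "base A \<longleftrightarrow> A 0 = inn \<and> A 1 = out \<and> A 4 = ord \<and> slot_inv n A"

lemma base_cong: "base A \<Longrightarrow> (\<And>a. a < 9 \<Longrightarrow> A' a = A a) \<Longrightarrow> base A'"
  by (simp add: base_def slot_inv_def)

lemma transition_cong: "(\<And>a. a < 9 \<Longrightarrow> A' a = A a) \<Longrightarrow> transition A' d j c c' = transition A d j c c'"
proof -
  assume a: "\<And>a. a < 9 \<Longrightarrow> A' a = A a"
  have "slots_at A' = slots_at A" "marks_at A' = marks_at A" using a by (simp_all add: slots_at_def marks_at_def fun_eq_iff)
  then show ?thesis using a by (simp add: transition_def)
qed

definition table :: "nat \<Rightarrow> nat \<Rightarrow> arrays \<Rightarrow> bool" where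
  "table d t A \<longleftrightarrow> (\<forall>c<states d. A 10 c = 0) \<and>
     (\<forall>j<t. \<forall>c'<states d. A 10 (Suc j * states d + c') =
        least_below (states d) (\<lambda>c. A 10 (j * states d + c) < states d \<and> transition A d j c c'))"

definition feasible :: "arrays \<Rightarrow> nat \<Rightarrow> bool" where
  "feasible A d \<longleftrightarrow> (\<exists>cs. (\<forall>j\<le>n. cs j < states d) \<and> (\<forall>j<n. transition A d j (cs j) (cs (Suc j))))"

lemma feasible_cong: "(\<And>a. a < 9 \<Longrightarrow> A' a = A a) \<Longrightarrow> feasible A' d = feasible A d"
  using transition_cong[of A' A] by (simp add: feasible_def)

text \<open>Reachability spreads along the given states, although the table may record other
  predecessors for them.\<close>

lemma feasible_final:
  assumes "table d n A" "feasible A d"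
  shows "\<exists>c<states d. A 10 (n * states d + c) < states d"
proof -
  obtain cs where cs: "\<And>j. j \<le> n \<Longrightarrow> cs j < states d" "\<And>j. j < n \<Longrightarrow> transition A d j (cs j) (cs (Suc j))"
    using assms(2) unfolding feasible_def by auto
  have "j \<le> n \<Longrightarrow> A 10 (j * states d + cs j) < states d" for j
  proof (induction j)
    case 0
    have "A 10 (cs 0) = 0" using assms(1) cs(1)[of 0] unfolding table_def by blast
    then show ?case using states_pos[of d] by (simp only: mult_0 add_0)
  next
    case (Suc j)
    then have "A 10 (Suc j * states d + cs (Suc j)) =
        least_below (states d) (\<lambda>c. A 10 (j * states d + c) < states d \<and> transition A d j c (cs (Suc j)))"
      using assms(1) cs(1)[of "Suc j"] unfolding table_def by simp
    moreover have "\<exists>c<states d. A 10 (j * states d + c) < states d \<and> transition A d j c (cs (Suc j))"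
      using Suc cs(1)[of j] cs(2)[of j] by (intro exI[of _ "cs j"]) auto
    ultimately show ?case by (simp only: least_below_less_iff)
  qed
  then show ?thesis using cs(1)[of n] by blast
qed

lemma wp_powers:
  assumes d: "d \<le> s" and R: "R 54 = 2 * s * d"
    and Q: "\<And>R' A'. (\<And>x. x \<noteq> 51 \<Longrightarrow> x \<noteq> 55 \<Longrightarrow> R' x = R x) \<Longrightarrow> (\<And>a. a \<noteq> 9 \<Longrightarrow> A' a = A a) \<Longrightarrow>
      R' 55 = states d \<Longrightarrow> powers s d A' \<Longrightarrow> Q (\<tau> + 2 * s * d) R' A'"
  shows "wp powers_com Q \<tau> R A"
proof -
  let ?A = "A(9 := (A 9)(0 := 1))"
  have "wp (For 51 (Var 54) (Put 9 (EAdd (Var 51) (Num 1)) (Mul 0 54 (Arr 9 (Var 51)))))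
     (wp (Asg 55 (Arr 9 (Var 54))) Q) \<tau> R ?A"
  proof (rule wp_For[where N = "2 * s * d" and I = "\<lambda>i \<tau>' R' A'. \<tau>' = \<tau> + i \<and> (\<forall>x. x \<noteq> 51 \<longrightarrow> R' x = R x) \<and>
    (\<forall>a. a \<noteq> 9 \<longrightarrow> A' a = A a) \<and> (\<forall>y\<le>i. A' 9 y = (2 * s * d) ^ y)"], goal_cases)
    case (4 i \<tau>' R' A')
    have i: "R' 51 = i" "A' 9 i = (2 * s * d) ^ i" "R' 54 = 2 * s * d" using 4 R by auto
    have "(2 * s * d) * (2 * s * d) ^ i \<le> b" using power_le_b[OF d, of "Suc i"] 4(1) by simp
    then have "(2 * s * d) * (2 * s * d) ^ i \<le> m" using b_le by (rule order_trans)
    then show ?case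
      by (intro wp_Put) (use 4 i in \<open>auto simp: le_Suc_eq\<close>)
  next
    case (5 \<tau>' R' A')
    have e: "R' 54 = 2 * s * d" "A' 9 (2 * s * d) = states d" using 5 R by auto
    show ?case
    proof (rule wp_Asg)
      show "ev R' A' (\<lambda>_. 0) (Arr 9 (Var 54)) \<le> (if small 55 then b else m)"
        using e power_le_b[OF d order_refl] by (simp add: small_def)
      have "Q (\<tau> + 2 * s * d) (R'(55 := states d)) A'"
        by (rule Q) (use 5 in \<open>auto simp: powers_def\<close>)
      then show "Q \<tau>' (R'(55 := ev R' A' (\<lambda>_. 0) (Arr 9 (Var 54)))) A'" using e 5 by simp
    qed
  qed (use R D_le(2)[OF d] in \<open>auto simp: small_def\<close>)
  then show ?thesis unfolding powers_com_def using m_pos by (intro wp_Sq wp_Put) auto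
qed

lemma wp_table:
  assumes d: "d \<le> s" and R: "dp_regs s d R" "R 2 = n" and A: "base A" "powers s d A"
    and Q: "\<And>R' A'. (\<And>x. x \<notin> {3, 9, 12, 56, 57} \<Longrightarrow> R' x = R x) \<Longrightarrow> (\<And>a. a \<noteq> 10 \<Longrightarrow> A' a = A a) \<Longrightarrow>
      table d n A' \<Longrightarrow> R' 57 = least_below (states d) (\<lambda>c. A' 10 (n * states d + c) < states d) \<Longrightarrow>
      Q (\<tau> + states d + n * (states d + 1)) R' A'"
  shows "wp table_com Q \<tau> R A"
  unfolding table_com_def
proof (rule wp_Sq, rule wp_For[where N = "states d" and I = "\<lambda>i \<tau>' R' A'. \<tau>' = \<tau> + i \<and> (\<forall>x. x \<noteq> 56 \<longrightarrow> R' x = R x) \<and>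
    (\<forall>a. a \<noteq> 10 \<longrightarrow> A' a = A a) \<and> (\<forall>c<i. A' 10 c = 0)"], goal_cases)
  case (5 \<tau>0 R0 A0)
  have R55: "R 55 = states d" "R 50 = s" using R(1) by (auto simp: dp_regs_def)
  have Cm: "states d \<le> b" by (rule power_le_b[OF d order_refl])
  show ?case
  proof (rule wp_Sq, rule wp_For[where N = n and I = "\<lambda>t \<tau>' R' A'. \<tau>' = \<tau> + states d + t * (states d + 1) \<and>
      (\<forall>x. x \<notin> {3, 9, 12, 56, 57} \<longrightarrow> R' x = R x) \<and> (\<forall>a. a \<noteq> 10 \<longrightarrow> A' a = A a) \<and> table d t A'"], goal_cases)
    case 1 then show ?case using 5 by (auto simp: table_def)
  next
    case 2 then show ?case using m_bounds by (simp add: small_def)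
  next
    case 3 then show ?case using R by simp
  next
    case (5 \<tau>' R' A')
    have e: "R' 55 = states d" "R' 2 = n" using 5 R R55 by auto
    have l: "ev R' A' (\<lambda>_. 0) (LeastLt 1 2 55 (Less (Arr 10 (cell 2 (Idx 2))) (Var 55))) =
        least_below (states d) (\<lambda>c. A' 10 (n * states d + c) < states d)"
      unfolding e(1)[symmetric] by (rule ev_LeastLt) (use e in auto)
    show ?case
    proof (rule wp_Asg, unfold l)
      show "least_below (states d) (\<lambda>c. A' 10 (n * states d + c) < states d) \<le> (if small 57 then b else m)"
        using order_trans[OF least_below_le Cm] by (simp add: small_def)
      have "Q (\<tau> + states d + n * (states d + 1)) (R'(57 := least_below (states d) (\<lambda>c. A' 10 (n * states d + c) < states d))) A'"
        by (rule Q) (use 5 in auto)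
      then show "Q \<tau>' (R'(57 := least_below (states d) (\<lambda>c. A' 10 (n * states d + c) < states d))) A'"
        using 5 by simp
    qed
  next
    case (4 t \<tau>1 R1 A1)
    let ?z = "A 8 (ord (Suc t))"
    have A14: "A1 4 = ord" "A1 8 = A 8" using 4 A(1) by (auto simp: base_def)
    have zs: "?z < s"
      using slot_invD(1) A(1) inn_ord[of "Suc t"] 4(1) unfolding base_def by auto
    have A1p: "powers s d A1" using A(2) 4 by (simp add: powers_def)
    let ?R2 = "R1(3 := Suc t, 9 := ?z)"
    have R2: "dp_regs s d ?R2" using R(1) 4 by (simp add: dp_regs_def)
    have tab: "table d t A1" and A1o: "\<forall>a. a \<noteq> 10 \<longrightarrow> A1 a = A a" using 4 by auto
    have wp2: "wp (For 56 (Var 55) (Put 10 (cell 3 (Var 56)) reachE))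
      (\<lambda>\<tau>' R' A'. R' 12 = t \<and> Suc \<tau>' = \<tau> + states d + Suc t * (states d + 1) \<and>
        (\<forall>x. x \<notin> {3, 9, 12, 56, 57} \<longrightarrow> (R'(12 := Suc t)) x = R x) \<and> (\<forall>a. a \<noteq> 10 \<longrightarrow> A' a = A a) \<and> table d (Suc t) A')
      \<tau>1 ?R2 A1"
    proof (rule wp_For[where N = "states d" and I = "\<lambda>i \<tau>' R' A'. \<tau>' = \<tau>1 + i \<and> (\<forall>x. x \<noteq> 56 \<longrightarrow> R' x = ?R2 x) \<and>
      (\<forall>a. a \<noteq> 10 \<longrightarrow> A' a = A a) \<and> (\<forall>j. j < Suc t * states d \<longrightarrow> A' 10 j = A1 10 j) \<and>
      (\<forall>c'<i. A' 10 (Suc t * states d + c') =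
        least_below (states d) (\<lambda>c. A1 10 (t * states d + c) < states d \<and> transition A1 d t c c'))"], goal_cases)
      case 1 then show ?case using 4 by auto
    next
      case 2 then show ?case using Cm by (simp add: small_def)
    next
      case (3 i \<tau>' R' A') then show ?case using 4(3) R55 by simp
    next
      case (5 \<tau>' R' A')
      have lw: "\<forall>j. j < Suc t * states d \<longrightarrow> A' 10 j = A1 10 j" using 5(2) by (elim conjE)
      have low: "A' 10 (j * states d + c) = A1 10 (j * states d + c)" if "j \<le> t" "c < states d" for j c
      proof -
        have "j * states d + c < Suc t * states d" using that by (intro cell_less) auto
        then show ?thesis by (rule lw[rule_format])
      qed
      have tr: "transition A' d j c c' = transition A1 d j c c'" for j c c'
        by (rule transition_cong) (use 5 A1o in simp)
      have "table d (Suc t) A'"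
        unfolding table_def
      proof (intro conjI allI impI)
        fix c assume c: "c < states d"
        show "A' 10 c = 0" using low[of 0 c] c tab unfolding table_def by simp
      next
        fix j c' assume j: "j < Suc t" and c': "c' < states d"
        have cong: "least_below (states d) (\<lambda>c. A1 10 (j * states d + c) < states d \<and> transition A1 d j c c') =
          least_below (states d) (\<lambda>c. A' 10 (j * states d + c) < states d \<and> transition A' d j c c')"
          by (rule least_below_cong) (use low[of j] j tr in simp)
        show "A' 10 (Suc j * states d + c') =
          least_below (states d) (\<lambda>c. A' 10 (j * states d + c) < states d \<and> transition A' d j c c')"
        proof (cases "j = t")
          case True
          then show ?thesis using 5 c' cong by simp
        next
          case False
          then have jt: "j < t" using j by simp
          then have "A' 10 (Suc j * states d + c') = A1 10 (Suc j * states d + c')" using low[of "Suc j" c'] c' by simp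
          then show ?thesis using tab jt c' cong unfolding table_def by simp
        qed
      qed
      then show ?case using 5 4 by auto
    next
      case (4 i \<tau>' R' A')
      have fr: "R' 56 = i" "R' 3 = Suc t" "R' 9 = ?z" "R' 12 = t" "R' 55 = states d" "R' 50 = s"
        using 4 \<open>R1 12 = t\<close> R55 \<open>_ \<and> _ \<and> _ \<and> table d t A1\<close> by auto
      have R': "dp_regs s d R'" using R2 4 by (simp add: dp_regs_def)
      have A'p: "powers s d A'" using A(2) 4 by (simp add: powers_def)
      have A'56: "A' 5 = A1 5" "A' 6 = A1 6" using 4 A1o by auto
      have lw: "\<forall>j. j < Suc t * states d \<longrightarrow> A' 10 j = A1 10 j" using 4(3) by (elim conjE)
      have low: "A' 10 (t * states d + c) = A1 10 (t * states d + c)" if "c < states d" for c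
      proof -
        have "t * states d + c < Suc t * states d" using that by simp
        then show ?thesis by (rule lw[rule_format])
      qed
      have st: "ev R' A' l stepE \<noteq> 0 \<longleftrightarrow> transition A1 d t (l 2) i" if "l 2 < states d" for l
        using ev_stepE[where l = l, OF R' A'p fr(1) 4(1) fr(2,4,3) zs that]
        unfolding transition_def slots_at_def[abs_def] marks_at_def[abs_def] A14 A'56 .
      have e: "ev R' A' (\<lambda>_. 0) reachE =
        least_below (states d) (\<lambda>c. A1 10 (t * states d + c) < states d \<and> transition A1 d t c i)"
        unfolding reachE_def fr(5)[symmetric]
        by (rule ev_LeastLt) (use st low fr in auto)
      have ec: "ev R' A' (\<lambda>_. 0) (cell 3 (Var 56)) = Suc t * states d + i" using fr by simp
      have lm: "least_below (states d) (\<lambda>c. A1 10 (t * states d + c) < states d \<and> transition A1 d t c i) \<le> m"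
        by (rule order_trans[OF least_below_le]) (use Cm b_le in linarith)
      show ?case
        apply (rule wp_Put, unfold e ec, rule lm)
        using 4 by (auto simp: less_Suc_eq simp del: mult_Suc)
    qed
    show ?case
      apply (rule wp_Sq, rule wp_Asg)
      using 4 m_bounds apply (simp add: small_def)
      apply (rule wp_Sq, rule wp_Asg)
      using zs s_le b_le 4 A14 apply (simp add: small_def)
      using wp2 4 A14 by simp
  qed
next
  case 2 then show ?case using power_le_b[OF d order_refl] by (simp add: small_def)
next
  case (3 i \<tau>' R' A') then show ?case using R(1) by (simp add: dp_regs_def)
next
  case (4 i \<tau>' R' A') then show ?case by (intro wp_Put) (auto simp: less_Suc_eq)
qed auto

definition tried :: "arrays \<Rightarrow> nat \<Rightarrow> (nat \<Rightarrow> nat) \<Rightarrow> arrays \<Rightarrow> bool" where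
  "tried A d R' A' \<longleftrightarrow> d \<le> s \<and> dp_regs s d R' \<and> R' 2 = n \<and> (\<forall>a<9. A' a = A a) \<and> powers s d A' \<and>
     table d n A' \<and> R' 57 = least_below (states d) (\<lambda>c. A' 10 (n * states d + c) < states d) \<and>
     (\<forall>d0<d. \<not> feasible A d0)"

lemma wp_attempt:
  assumes d: "d \<le> s" "R 52 = d" "R 50 = s" "R 2 = n" "base A" "\<forall>a<9. A1 a = A a" "\<forall>d0<d. \<not> feasible A d0"
  shows "wp attempt_com (\<lambda>\<tau>' R' A'. \<tau>' \<le> \<tau> + (n + 2) * (b + 1) \<and> tried A d R' A') \<tau> R A1"
proof -
  let ?R = "R(53 := 2 * d, 54 := 2 * s * d)"
  have b1: "base A1" using base_cong[OF d(5)] d(6) by simp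
  have "d + d \<le> b"
  proof -
    have "2 * d * 1 \<le> 2 * d * s" using s_pos by (intro mult_le_mono2)
    moreover have "2 * d * s = 2 * s * d" by simp
    ultimately show ?thesis using D_le(2)[OF d(1)] by linarith
  qed
  moreover have "wp powers_com (wp table_com (\<lambda>\<tau>' R' A'. \<tau>' \<le> \<tau> + (n + 2) * (b + 1) \<and> tried A d R' A')) \<tau> ?R A1"
  proof (rule wp_powers[OF d(1)], simp, goal_cases)
    case (1 R2 A2)
    show ?case
    proof (rule wp_table[OF d(1)], goal_cases)
      case 1 then show ?case using \<open>R2 55 = states d\<close> 1 d \<open>\<And>x. x \<noteq> 51 \<Longrightarrow> x \<noteq> 55 \<Longrightarrow> R2 x = _ x\<close> by (simp add: dp_regs_def)
    next
      case 2 then show ?case using d \<open>\<And>x. x \<noteq> 51 \<Longrightarrow> x \<noteq> 55 \<Longrightarrow> R2 x = _ x\<close> by simp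
    next
      case 3 then show ?case using base_cong[OF b1] \<open>\<And>a. a \<noteq> 9 \<Longrightarrow> A2 a = A1 a\<close> by simp
    next
      case 4 then show ?case using \<open>powers s d A2\<close> .
    next
      case (5 R3 A3)
      have C: "states d \<le> b" "2 * s * d \<le> b" using power_le_b[OF d(1) order_refl] D_le(2)[OF d(1)] .
      have "n * (states d + 1) \<le> n * (b + 1)" using C by (intro mult_le_mono2) simp
      then have "\<tau> + 2 * s * d + states d + n * (states d + 1) \<le> \<tau> + (n + 2) * (b + 1)"
      proof -
        have "(n + 2) * (b + 1) = n * (b + 1) + 2 * b + 2" by (simp add: algebra_simps)
        then show ?thesis using C \<open>n * (states d + 1) \<le> n * (b + 1)\<close> by linarith
      qed
      moreover have "dp_regs s d R3"
        using 5(1) \<open>R2 55 = states d\<close> \<open>\<And>x. x \<noteq> 51 \<Longrightarrow> x \<noteq> 55 \<Longrightarrow> R2 x = _ x\<close> d by (simp add: dp_regs_def)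
      moreover have "R3 2 = n" using 5(1) \<open>\<And>x. x \<noteq> 51 \<Longrightarrow> x \<noteq> 55 \<Longrightarrow> R2 x = _ x\<close> d by simp
      moreover have "\<forall>a<9. A3 a = A a" using 5(2) \<open>\<And>a. a \<noteq> 9 \<Longrightarrow> A2 a = A1 a\<close> d(6) by simp
      moreover have "powers s d A3" using \<open>powers s d A2\<close> 5(2) by (simp add: powers_def)
      ultimately show ?case using 5(3,4) d(1,7) by (simp add: tried_def)
    qed
  qed
  moreover have "ev R A1 (\<lambda>_. 0) (EAdd (Var 52) (Var 52)) = 2 * d"
      "ev (R(53 := 2 * d)) A1 (\<lambda>_. 0) (Mul 0 50 (Var 53)) = 2 * s * d"
    using d(2,3) by simp_all
  ultimately show ?thesis
    unfolding attempt_com_def using D_le(2)[OF d(1)]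
    by (intro wp_Sq wp_Asg) (simp_all only: small_def, simp_all)
qed

text \<open>The search stops at \<open>d = s\<close> at the latest, so the number of attempts is
  bounded in terms of the pathwidth.\<close>

lemma feasible_slots: "base A \<Longrightarrow> feasible A s"
  using local_rep_slots[of A] local_rep_states[of A s] card_bag unfolding base_def feasible_def by blast

lemma wp_search:
  assumes R: "R 50 = s" "R 2 = n" and A: "base A"
    and Q: "\<And>\<tau>' R' A' d. \<tau>' \<le> \<tau> + (s + 1) * ((n + 2) * (b + 1) + 1) \<Longrightarrow> tried A d R' A' \<Longrightarrow> R' 57 < states d \<Longrightarrow> Q \<tau>' R' A'"
  shows "wp search_com Q \<tau> R A"
proof -
  let ?K = "(n + 2) * (b + 1)"
  have loop: "wp (Loop (Leq (Var 55) (Var 57)) (Sq (Asg 52 (EAdd (Var 52) (Num 1))) attempt_com)) Q \<tau>1 R1 A1"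
    if i: "\<tau>1 \<le> \<tau> + ?K \<and> tried A 0 R1 A1" for \<tau>1 R1 A1
  proof (rule wp_Loop[where f = "\<lambda>R A. Suc s - R 52" and I = "\<lambda>\<tau>' R' A'. \<exists>d. \<tau>' \<le> \<tau> + (d + 1) * (?K + 1) \<and> tried A d R' A'"], goal_cases)
    case 1
    show ?case using i by (intro exI[of _ 0]) auto
  next
    case (2 \<tau>' R' A')
    then obtain d where d: "\<tau>' \<le> \<tau> + (d + 1) * (?K + 1)" "tried A d R' A'" by blast
    have ds: "d \<le> s" "R' 55 = states d" using d(2) by (auto simp: tried_def dp_regs_def)
    have "(d + 1) * (?K + 1) \<le> (s + 1) * (?K + 1)" using ds(1) by (intro mult_le_mono1) simp
    then show ?case using Q[OF _ d(2)] d(1) 2(2) ds(2) by (simp split: if_splits)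
  next
    case (3 \<tau>' R' A')
    then obtain d where d: "\<tau>' \<le> \<tau> + (d + 1) * (?K + 1)" "tried A d R' A'" by blast
    have dd: "d \<le> s" "R' 55 = states d" "R' 52 = d" "R' 50 = s" "R' 2 = n" "\<forall>a<9. A' a = A a" "table d n A'"
      "\<forall>d0<d. \<not> feasible A d0"
      "R' 57 = least_below (states d) (\<lambda>c. A' 10 (n * states d + c) < states d)"
      using d(2) by (auto simp: tried_def dp_regs_def)
    have "\<not> R' 57 < states d" using 3(2) dd(2) by (simp split: if_splits)
    then have "\<not> (\<exists>c<states d. A' 10 (n * states d + c) < states d)" unfolding dd(9) least_below_less_iff .
    then have "\<not> feasible A' d" using feasible_final[OF dd(7)] by blast
    then have nf: "\<not> feasible A d" using feasible_cong[of A' A] dd(6) by simp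
    then have "d \<noteq> s" using feasible_slots[OF A] by blast
    then have ds: "Suc d \<le> s" using dd(1) by simp
    have nfs: "\<forall>d0<Suc d. \<not> feasible A d0" using nf dd(8) less_Suc_eq by auto
    have "wp attempt_com (\<lambda>\<tau>'' R'' A''. \<tau>'' \<le> \<tau>' + ?K \<and> tried A (Suc d) R'' A'') \<tau>' (R'(52 := Suc d)) A'"
      by (rule wp_attempt[OF ds _ _ _ A dd(6) nfs]) (use dd in auto)
    then have "wp attempt_com (\<lambda>\<tau>'' R'' A''. (\<exists>d. Suc \<tau>'' \<le> \<tau> + (d + 1) * (?K + 1) \<and> tried A d R'' A'') \<and>
        Suc s - R'' 52 < Suc s - R' 52) \<tau>' (R'(52 := Suc d)) A'"
    proof (rule wp_mono, goal_cases)
      case (1 \<tau>2 R2 A2)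
      have "Suc \<tau>2 \<le> \<tau> + (Suc d + 1) * (?K + 1)" using 1 d(1) by simp
      moreover have "R2 52 = Suc d" using 1 by (simp add: tried_def dp_regs_def)
      ultimately show ?case using 1 dd(3) ds by (intro conjI exI[of _ "Suc d"]) auto
    qed
    then show ?case
      using dd ds s_le by (intro wp_Sq wp_Asg) (auto simp: small_def)
  qed
  have "wp attempt_com (\<lambda>\<tau>' R' A'. \<tau>' \<le> \<tau> + ?K \<and> tried A 0 R' A') \<tau> (R(52 := 0)) A"
    by (rule wp_attempt[OF _ _ _ _ A]) (use R in auto)
  then have "wp attempt_com (wp (Loop (Leq (Var 55) (Var 57)) (Sq (Asg 52 (EAdd (Var 52) (Num 1))) attempt_com)) Q) \<tau> (R(52 := 0)) A"
    by (rule wp_mono) (rule loop)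
  then show ?thesis unfolding search_com_def by (intro wp_Sq wp_Asg) auto
qed

lemma wp_backtrack:
  assumes tr: "tried A d R1 A1" and ok: "R1 57 < states d"
    and Q: "\<And>R' A'. (\<And>x. x \<notin> {3, 12} \<Longrightarrow> R' x = R1 x) \<Longrightarrow> (\<And>a. a \<noteq> 11 \<Longrightarrow> A' a = A1 a) \<Longrightarrow>
      (\<And>j. j \<le> n \<Longrightarrow> A' 11 j < states d) \<Longrightarrow> (\<And>j. j < n \<Longrightarrow> transition A d j (A' 11 j) (A' 11 (Suc j))) \<Longrightarrow>
      Q (\<tau> + n) R' A'"
  shows "wp backtrack_com Q \<tau> R1 A1"
proof -
  have T: "d \<le> s" "R1 55 = states d" "R1 2 = n" "\<forall>a<9. A1 a = A a" "table d n A1"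
    "R1 57 = least_below (states d) (\<lambda>c. A1 10 (n * states d + c) < states d)"
    using tr by (auto simp: tried_def dp_regs_def)
  have Cm: "states d \<le> m" using power_le_b[OF T(1) order_refl] b_le by linarith
  have tt: "transition A1 d j c c' = transition A d j c c'" for j c c'
    by (rule transition_cong) (use T(4) in simp)
  have fin: "A1 10 (n * states d + R1 57) < states d"
    unfolding T(6) by (rule least_below_sat) (use ok T(6) in simp)
  let ?A = "A1(11 := (A1 11)(n := R1 57))"
  have "wp (For 12 (Var 2) (Sq (Asg 3 (ESub (Var 2) (Var 12)))
       (Put 11 (ESub (Var 3) (Num 1)) (Arr 10 (cell 3 (Arr 11 (Var 3))))))) Q \<tau> R1 ?A"
  proof (rule wp_For[where N = n and I = "\<lambda>i \<tau>' R' A'. \<tau>' = \<tau> + i \<and> (\<forall>x. x \<notin> {3, 12} \<longrightarrow> R' x = R1 x) \<and>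
     (\<forall>a. a \<noteq> 11 \<longrightarrow> A' a = A1 a) \<and> (\<forall>j. n - i \<le> j \<and> j \<le> n \<longrightarrow> A' 11 j < states d \<and> A1 10 (j * states d + A' 11 j) < states d) \<and>
     (\<forall>j. n - i \<le> j \<and> j < n \<longrightarrow> transition A d j (A' 11 j) (A' 11 (Suc j)))"], goal_cases)
    case 1
    show ?case using ok fin by auto
  next
    case 2 then show ?case using m_bounds by (simp add: small_def)
  next
    case (3 i \<tau>' R' A') then show ?case using T(3) by simp
  next
    case (5 \<tau>' R' A') then show ?case using Q by auto
  next
    case (4 i \<tau>' R' A')
    define j where "j = n - Suc i"
    have j: "n - i = Suc j" "j < n" "n - Suc i = j" using 4(1) by (auto simp: j_def)
    have fr: "R' 2 = n" "R' 55 = states d" "R' 12 = i" "A' 10 = A1 10" using 4 T by auto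
    let ?c' = "A' 11 (Suc j)" and ?c = "A1 10 (Suc j * states d + A' 11 (Suc j))"
    have c': "?c' < states d" "?c < states d" using 4(3) j by auto
    have c: "?c = least_below (states d) (\<lambda>c. A1 10 (j * states d + c) < states d \<and> transition A1 d j c ?c')"
      using T(5) j(2) c'(1) unfolding table_def by blast
    \<comment> \<open>An entry below \<open>states d\<close> is a genuine least witness, hence a
      predecessor that is reachable in turn. This continues the chain down to bag 0.\<close>
    have sat: "A1 10 (j * states d + ?c) < states d \<and> transition A1 d j ?c ?c'"
      using least_below_sat[of "states d" "\<lambda>c. A1 10 (j * states d + c) < states d \<and> transition A1 d j c ?c'"] c' unfolding c by blast
    let ?A' = "A'(11 := (A' 11)(j := ?c))"
    have e: "ev (R'(3 := Suc j)) A' (\<lambda>_. 0) (Arr 10 (cell 3 (Arr 11 (Var 3)))) = ?c" using fr by simp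
    have 5: "\<forall>x. n - Suc i \<le> x \<and> x \<le> n \<longrightarrow> ?A' 11 x < states d \<and> A1 10 (x * states d + ?A' 11 x) < states d"
    proof (intro allI impI)
      fix x assume x: "n - Suc i \<le> x \<and> x \<le> n"
      show "?A' 11 x < states d \<and> A1 10 (x * states d + ?A' 11 x) < states d"
        using x j c'(2) sat 4(3) by (cases "x = j") auto
    qed
    have 6: "\<forall>x. n - Suc i \<le> x \<and> x < n \<longrightarrow> transition A d x (?A' 11 x) (?A' 11 (Suc x))"
    proof (intro allI impI)
      fix x assume x: "n - Suc i \<le> x \<and> x < n"
      show "transition A d x (?A' 11 x) (?A' 11 (Suc x))"
        using x j sat 4(3) tt by (cases "x = j") auto
    qed
    show ?case
      apply (rule wp_Sq, rule wp_Asg)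
      using fr m_bounds apply (simp add: small_def)
      apply (rule wp_Put)
      using e fr j c'(2) Cm apply simp
      using 4 5 6 e fr j by simp
  qed
  then show ?thesis
    unfolding backtrack_com_def using T(3) ok Cm by (intro wp_Sq wp_Put) auto
qed

end

section \<open>Amalgamating the local representations\<close>

fun linked :: "(nat \<Rightarrow> nat) \<Rightarrow> nat list \<Rightarrow> bool" where
  "linked nx [] = True"
| "linked nx [a] = (nx a = 0)"
| "linked nx (a # c # xs) = (nx a = c \<and> linked nx (c # xs))"

lemma linked_cong: "linked nx xs \<Longrightarrow> (\<And>a. a \<in> set xs \<Longrightarrow> nx' a = nx a) \<Longrightarrow> linked nx' xs"
  by (induction nx xs rule: linked.induct) auto

lemma linked_insert:
  "linked nx (as @ p # bs) \<Longrightarrow> distinct (as @ p # bs) \<Longrightarrow> x \<notin> set (as @ p # bs) \<Longrightarrow>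
    linked (nx(x := nx p, p := x)) (as @ p # x # bs)"
proof (induction as)
  case Nil
  show ?case
  proof (cases bs)
    case Nil
    then show ?thesis using \<open>linked nx ([] @ p # bs)\<close> Nil.prems(3) by auto
  next
    case (Cons c cs)
    define nx' where "nx' = nx(x := nx p, p := x)"
    have "linked nx' (c # cs)"
      by (rule linked_cong[of nx]) (use Nil.prems Cons in \<open>auto simp: nx'_def\<close>)
    moreover have "nx' p = x" "nx' x = nx p" "nx p = c" using Nil.prems Cons by (auto simp: nx'_def)
    ultimately show ?thesis using Cons unfolding nx'_def[symmetric] by simp
  qed
next
  case (Cons a as)
  have ap: "a \<noteq> p" "a \<noteq> x" using Cons.prems by auto
  define nx' where "nx' = nx(x := nx p, p := x)"
  have l: "linked nx (as @ p # bs)" using Cons.prems(1) by (cases as) auto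
  have IH: "linked nx' (as @ p # x # bs)"
    unfolding nx'_def by (rule Cons.IH[OF l]) (use Cons.prems in auto)
  have a: "nx' a = nx a" using ap by (simp add: nx'_def)
  show ?case
    unfolding nx'_def[symmetric] using IH a Cons.prems(1) by (cases as) auto
qed

lemma linked_nth:
  assumes "linked nx (as @ a # bs)"
  shows "nx a = (case bs of [] \<Rightarrow> 0 | c # _ \<Rightarrow> c)"
  using assms
proof (induction as)
  case Nil
  then show ?case by (cases bs) auto
next
  case (Cons a' as)
  then show ?case by (cases as) auto
qed

text \<open>Only members of \<open>K\<close> are compared: one list has to be sorted for all bags at
  once, with respect to the nodes and the ranks of each of them.\<close>

definition sorted_on :: "nat set \<Rightarrow> (nat \<Rightarrow> nat) \<Rightarrow> nat list \<Rightarrow> bool" where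
  "sorted_on K f xs = sorted_wrt (\<lambda>a c. a \<in> K \<longrightarrow> c \<in> K \<longrightarrow> f a < f c) xs"

lemma sorted_on_insert_other:
  "sorted_on K f (as @ p # bs) \<Longrightarrow> x \<notin> K \<Longrightarrow> sorted_on K f (as @ p # x # bs)"
  unfolding sorted_on_def by (auto simp: sorted_wrt_append)

text \<open>Either \<open>p\<close> has the largest value below that of \<open>x\<close> in
  \<open>K\<close>, or it is the head and \<open>K\<close> has no smaller value. In both cases,
  members of \<open>K\<close> behind \<open>p\<close> cannot have a value below that of
  \<open>x\<close>.\<close>

lemma sorted_on_insert:
  assumes s: "sorted_on K f (as @ p # bs)" "distinct (as @ p # bs)"
    and p: "p \<in> K \<and> f p < f x \<or> p \<notin> K \<and> as = []"
    and max: "\<And>a. a \<in> set (as @ p # bs) \<Longrightarrow> a \<in> K \<Longrightarrow> f a < f x \<Longrightarrow> p \<in> K \<and> f a \<le> f p"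
    and ne: "\<And>a. a \<in> set (as @ p # bs) \<Longrightarrow> a \<in> K \<Longrightarrow> f a \<noteq> f x"
  shows "sorted_on K f (as @ p # x # bs)"
proof -
  have "f x < f c" if "c \<in> set bs" "c \<in> K" for c
  proof (rule ccontr)
    assume "\<not> f x < f c"
    then have "f c < f x" using ne[of c] that by simp
    then have "p \<in> K" "f c \<le> f p" using max[of c] that by auto
    moreover have "f p < f c" if "p \<in> K"
      using s(1) that \<open>c \<in> set bs\<close> \<open>c \<in> K\<close> unfolding sorted_on_def by (auto simp: sorted_wrt_append)
    ultimately show False by simp
  qed
  moreover have "f a < f x" if "a \<in> set as" "a \<in> K" for a
  proof -
    have pk: "p \<in> K" "f p < f x" using p that by auto
    moreover have "f a < f p"
      using s(1) that pk unfolding sorted_on_def by (auto simp: sorted_wrt_append)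
    ultimately show ?thesis by simp
  qed
  ultimately show ?thesis using s(1) p unfolding sorted_on_def by (auto simp: sorted_wrt_append)
qed

lemma sorted_on_nth:
  assumes "sorted_on K f xs" "i < length xs" "j < length xs" "xs ! i \<in> K" "xs ! j \<in> K"
    "f (xs ! i) \<noteq> f (xs ! j) \<or> i = j"
  shows "f (xs ! i) < f (xs ! j) \<longleftrightarrow> i < j"
proof -
  have *: "f (xs ! i) < f (xs ! j)" if "i < j" "j < length xs" "xs ! i \<in> K" "xs ! j \<in> K" for i j
    using assms(1) that sorted_wrt_nth_less[of _ xs i j] unfolding sorted_on_def by blast
  consider "i < j" | "j < i" | "i = j" by linarith
  then show ?thesis
  proof cases
    case 1 then show ?thesis using * assms by blast
  next
    case 2 then show ?thesis using *[of j i] assms by force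
  qed simp
qed

definition nodeE :: "exp \<Rightarrow> exp \<Rightarrow> exp" where
  "nodeE v e = EAdd (EAdd (Mul 8 53 v) (EAdd v v)) (EAdd e (Num 1))"

text \<open>The endpoints of the entering vertex are inserted by increasing offset, so only those
  with a smaller offset are already in the list.\<close>

definition candidateE :: "exp \<Rightarrow> exp \<Rightarrow> exp" where
  "candidateE x e = Conj (Arr 5 (row 3 x)) (Conj (Imp (Eq x (Var 9)) (Less e (Var 51)))
     (Less (posE (Var 56) x e) (posE (Var 56) (Var 9) (Var 51))))"

definition bestE :: "exp \<Rightarrow> exp \<Rightarrow> exp" where
  "bestE x e = Conj (candidateE x e) (AllLt 5 50 (AllLt 6 53 (Imp (candidateE (Idx 5) (Idx 6))
     (Leq (posE (Var 56) (Idx 5) (Idx 6)) (posE (Var 56) x e)))))"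

text \<open>Array 12 links the endpoints in their order; the endpoint \<open>e\<close> of \<open>v\<close> is the node
  \<open>v * (2 * d + 2) + e + 1\<close>, and 0 is the head and the end of the list. The final coordinate of the node
  \<open>x\<close> is the entry \<open>x - 1\<close> of array 13.

  At most one term of the following sum is nonzero: the positions of the candidates are distinct.\<close>

definition predecessorE :: exp where
  "predecessorE = SumLt 3 50 (SumLt 4 53 (Ite (bestE (Idx 3) (Idx 4))
     (nodeE (ESub (Arr 5 (row 3 (Idx 3))) (Num 1)) (Idx 4)) (Num 0)))"

definition insert_com :: com where
  "insert_com = Sq (Put 12 (Num 0) (Num 0)) (For 12 (Var 2)
     (Sq (Asg 3 (EAdd (Var 12) (Num 1))) (Sq (Asg 6 (Arr 4 (Var 3))) (Sq (Asg 9 (Arr 8 (Var 6)))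
     (Sq (Asg 56 (Arr 11 (Var 3)))
       (For 51 (Var 53) (Sq (Asg 10 predecessorE) (Sq (Asg 11 (nodeE (Var 6) (Var 51)))
         (Sq (Put 12 (Var 11) (Arr 12 (Var 10))) (Put 12 (Var 10) (Var 11)))))))))))"

definition number_com :: com where
  "number_com = Sq (Asg 10 (Arr 12 (Num 0))) (Sq (Asg 11 (Num 0)) (Loop (Var 10)
     (Sq (Put 13 (ESub (Var 10) (Num 1)) (Var 11)) (Sq (Asg 11 (EAdd (Var 11) (Num 1)))
       (Asg 10 (Arr 12 (Var 10)))))))"

text \<open>The second cell is addressed by the node with offset \<open>2 * d\<close>, because this
  number is one less than the node with offset \<open>2 * d + 1\<close>. An \<open>out\<close> of 0
  is read as the last bag \<open>n\<close>.\<close>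

definition times_com :: com where
  "times_com = For 12 (Var 2)
     (Sq (Put 13 (ESub (nodeE (Var 12) (Var 53)) (Num 1)) (Arr 0 (Var 12)))
       (Put 13 (nodeE (Var 12) (Var 53)) (Ite (Arr 1 (Var 12)) (Arr 1 (Var 12)) (Var 2))))"

lemma sum_single:
  assumes "finite S" "a \<in> S" "P a" "\<And>c. c \<in> S \<Longrightarrow> P c \<Longrightarrow> c = a"
  shows "(\<Sum>c\<in>S. if P c then f c else (0::nat)) = f a"
proof -
  have "(if P c then f c else (0::nat)) = (if c = a then f c else 0)" if "c \<in> S" for c
    using assms(3) assms(4)[OF that] by (cases "c = a") auto
  then have "(\<Sum>c\<in>S. if P c then f c else (0::nat)) = (\<Sum>c\<in>S. if c = a then f c else 0)"
    by (intro sum.cong refl)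
  then show ?thesis using assms(1,2) by simp
qed

section \<open>Ranks of endpoints and their global order\<close>

locale solution = dp_algorithm E n k Ws adj F m b inp inn out ord s
  for E n k Ws adj F m b inp inn out ord s +
  fixes A0 :: arrays and d :: nat
  assumes base0: "base A0" and d_le: "d \<le> s" and powers0: "powers s d A0"
    and states0: "j \<le> n \<Longrightarrow> A0 11 j < states d"
    and trans0: "j < n \<Longrightarrow> transition A0 d j (A0 11 j) (A0 11 (Suc j))"
begin

definition node :: "nat \<Rightarrow> nat \<Rightarrow> nat" where "node v e = v * (2 * d + 2) + e + 1"
definition rank :: "nat \<Rightarrow> nat \<Rightarrow> nat \<Rightarrow> nat" where "rank j v e = pos s d (A0 11 j) (A0 8 v) e"
definition node_rank :: "nat \<Rightarrow> nat \<Rightarrow> nat" where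
  "node_rank j a = rank j ((a - 1) div (2 * d + 2)) ((a - 1) mod (2 * d + 2))"
definition nodes :: "nat \<Rightarrow> nat set" where "nodes j = {node v e | v e. v \<in> bag j \<and> e < 2 * d}"

lemma node_pos: "node v e \<noteq> 0" by (simp add: node_def)

lemma node_inj: "e < 2 * d + 2 \<Longrightarrow> e' < 2 * d + 2 \<Longrightarrow> node v e = node v' e' \<longleftrightarrow> v = v' \<and> e = e'"
proof
  assume a: "e < 2 * d + 2" "e' < 2 * d + 2" "node v e = node v' e'"
  then have eq: "v * (2 * d + 2) + e = v' * (2 * d + 2) + e'" by (simp only: node_def)
  have "(v * (2 * d + 2) + e) div (2 * d + 2) = v" "(v' * (2 * d + 2) + e') div (2 * d + 2) = v'"
    using a(1,2) by (simp_all only: div_mult_self3) simp_all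
  then have "v = v'" using eq by metis
  then show "v = v' \<and> e = e'" using eq by simp
qed simp

lemma node_rank_node: "e < 2 * d \<Longrightarrow> node_rank j (node v e) = rank j v e"
proof -
  assume "e < 2 * d"
  then have e: "e < 2 * d + 2" by simp
  have "node v e - 1 = v * (2 * d + 2) + e" by (simp only: node_def diff_add_inverse2)
  moreover have "(v * (2 * d + 2) + e) div (2 * d + 2) = v" "(v * (2 * d + 2) + e) mod (2 * d + 2) = e"
    using e by (simp_all only: mod_less div_less mod_mult_self3 div_mult_self3)
  ultimately show ?thesis by (simp only: node_rank_def)
qed

lemma node_le:
  assumes "v < n" "e < 2 * d + 2"
  shows "node v e \<le> n * (2 * d + 2)" "node v e \<le> m"
proof -
  have "node v e \<le> Suc v * (2 * d + 2)" using assms(2) by (simp add: node_def)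
  also have "\<dots> \<le> n * (2 * d + 2)" using assms(1) by (intro mult_le_mono1) simp
  finally show 1: "node v e \<le> n * (2 * d + 2)" .
  have "n * (2 * d + 2) \<le> (n + 2) * (2 * b + 8)" using d_le s_le by (intro mult_le_mono) auto
  then show "node v e \<le> m" using 1 m_large by linarith
qed

lemma inv0: "slot_inv n A0"
  using base0 by (simp add: base_def)

lemma bag_n: "v \<in> bag j \<Longrightarrow> v < n" by (simp add: bag_def)

lemma rank_consistent:
  assumes "j < n" "u \<in> bag j" "u \<in> bag (Suc j)" "v \<in> bag j" "v \<in> bag (Suc j)" "e < 2 * d" "e' < 2 * d"
  shows "rank j u e < rank j v e' \<longleftrightarrow> rank (Suc j) u e < rank (Suc j) v e'"
proof -
  have st: "slots_at A0 j (A0 8 x) = Suc x" "slots_at A0 (Suc j) (A0 8 x) = Suc x" "A0 8 x < s"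
    if "x \<in> bag j" "x \<in> bag (Suc j)" for x
    using slots_at_slot[OF inv0 _ that(1)] slots_at_slot[OF inv0 _ that(2)] assms(1) by auto
  have "persists (slots_at A0 j) (slots_at A0 (Suc j)) (A0 8 x)" if "x \<in> bag j" "x \<in> bag (Suc j)" for x
    using st[OF that] by (simp add: persists_def)
  then show ?thesis
    using trans0[OF assms(1)] st(3) assms unfolding transition_def step_ok_def consistent_def rank_def by blast
qed

lemma rank_separate:
  assumes "j < n" "v \<in> bag (Suc j)" "e < 2 * d" "e' < 2 * d" "v \<noteq> ord (Suc j) \<or> e' \<noteq> e"
  shows "rank (Suc j) v e' \<noteq> rank (Suc j) (ord (Suc j)) e"
proof -
  have w: "ord (Suc j) \<in> bag (Suc j)" using bag_Suc[OF assms(1)] by simp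
  have sv: "slots_at A0 (Suc j) (A0 8 v) = Suc v" "A0 8 v < s"
    using slots_at_slot[OF inv0 _ assms(2)] assms(1) by auto
  have sw: "slots_at A0 (Suc j) (A0 8 (ord (Suc j))) = Suc (ord (Suc j))"
    using slots_at_slot[OF inv0 _ w] assms(1) by auto
  have "A0 8 v \<noteq> A0 8 (ord (Suc j)) \<or> e' \<noteq> e" using assms(5) sv(1) sw by (metis nat.inject)
  moreover have "slots_at A0 (Suc j) (A0 8 v) \<noteq> 0" using sv by simp
  moreover have "separate s d (slots_at A0 (Suc j)) (A0 8 (ord (Suc j))) (A0 11 (Suc j))"
    using trans0[OF assms(1)] unfolding transition_def step_ok_def by blast
  ultimately show ?thesis using assms(3,4) sv(2) unfolding separate_def rank_def by blast
qed

text \<open>Distinctness spreads from bag to bag: new endpoints are separated on entrance, and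
  consistency keeps older ones strictly ordered.\<close>

lemma rank_inj:
  assumes "j \<le> n" "u \<in> bag j" "v \<in> bag j" "e < 2 * d" "e' < 2 * d" "(u, e) \<noteq> (v, e')"
  shows "rank j u e \<noteq> rank j v e'"
  using assms
proof (induction j arbitrary: u e v e')
  case 0
  then show ?case using bag_0 by simp
next
  case (Suc j)
  have j: "j < n" using Suc.prems by simp
  show ?case
  proof (cases "u = ord (Suc j) \<or> v = ord (Suc j)")
    case True
    then show ?thesis
      using rank_separate[OF j Suc.prems(3), of e e'] rank_separate[OF j Suc.prems(2), of e' e] Suc.prems by auto
  next
    case False
    then have b: "u \<in> bag j" "v \<in> bag j" using Suc.prems bag_Suc[OF j] by auto
    have "rank j u e \<noteq> rank j v e'" using Suc.IH[OF _ b] Suc.prems by simp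
    then have "rank j u e < rank j v e' \<or> rank j v e' < rank j u e" by linarith
    then have "rank (Suc j) u e < rank (Suc j) v e' \<or> rank (Suc j) v e' < rank (Suc j) u e"
      using rank_consistent[OF j b(1) Suc.prems(2) b(2) Suc.prems(3,4,5)]
        rank_consistent[OF j b(2) Suc.prems(3) b(1) Suc.prems(2) Suc.prems(5,4)] by blast
    then show ?thesis by linarith
  qed
qed

lemma rank_own: "j < n \<Longrightarrow> i < d \<Longrightarrow> rank (Suc j) (ord (Suc j)) (2 * i) < rank (Suc j) (ord (Suc j)) (2 * i + 1)"
  using trans0[of j] unfolding transition_def step_ok_def overlap_def rank_def by blast

lemma rank_adjacent:
  assumes "j < n" "v \<in> bag (Suc j)" "v \<noteq> ord (Suc j)"
  shows "E (ord (Suc j)) v \<longleftrightarrow> (\<forall>i<d. rank (Suc j) (ord (Suc j)) (2 * i) < rank (Suc j) v (2 * i + 1) \<and>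
     rank (Suc j) v (2 * i) < rank (Suc j) (ord (Suc j)) (2 * i + 1))"
proof -
  let ?z = "A0 8 (ord (Suc j))"
  have w: "ord (Suc j) \<in> bag (Suc j)" using bag_Suc[OF assms(1)] by simp
  have sv: "slots_at A0 (Suc j) (A0 8 v) = Suc v" "A0 8 v < s"
    using slots_at_slot[OF inv0 _ assms(2)] assms(1) by auto
  have sw: "slots_at A0 (Suc j) ?z = Suc (ord (Suc j))"
    using slots_at_slot[OF inv0 _ w] assms(1) by auto
  have "A0 8 v \<noteq> ?z" using assms(3) sv(1) sw by (metis nat.inject)
  moreover have nz: "slots_at A0 (Suc j) (A0 8 v) \<noteq> 0" using sv by simp
  moreover have "adjacent_ok s d (slots_at A0 (Suc j)) (marks_at A0 (Suc j)) ?z (A0 11 (Suc j))"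
    using trans0[OF assms(1)] unfolding transition_def step_ok_def by blast
  ultimately have "marks_at A0 (Suc j) (A0 8 v) \<noteq> 0 \<longleftrightarrow>
      overlap s d (A0 11 (Suc j)) ?z (A0 8 v) \<and> overlap s d (A0 11 (Suc j)) (A0 8 v) ?z"
    using sv(2) unfolding adjacent_ok_def by blast
  moreover have "marks_at A0 (Suc j) (A0 8 v) \<noteq> 0 \<longleftrightarrow> E (ord (Suc j)) v"
    using marks_at_iff[OF inv0 assms(1) sv(2) nz] sv(1) by simp
  ultimately show ?thesis unfolding overlap_def rank_def by blast
qed

lemma nodes_0: "0 \<notin> nodes j"
proof
  assume "0 \<in> nodes j"
  then obtain v e where "0 = node v e" unfolding nodes_def by blast
  then show False using node_pos[of v e] by simp
qed

lemma node_in_nodes: "e < 2 * d \<Longrightarrow> node v e \<in> nodes j \<longleftrightarrow> v \<in> bag j"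
  unfolding nodes_def using node_inj by fastforce

text \<open>The list after the complete insertion of the first \<open>t\<close> vertices and of
  \<open>e\<close> endpoints of the next one. Order for bag \<open>Suc t\<close> is included, as far
  as its nodes are present, because the next insertion depends on it.\<close>

definition list_inv :: "nat \<Rightarrow> nat \<Rightarrow> (nat \<Rightarrow> nat) \<Rightarrow> nat list \<Rightarrow> bool" where
  "list_inv t e nx xs \<longleftrightarrow> linked nx xs \<and> distinct xs \<and> xs \<noteq> [] \<and> hd xs = 0 \<and>
     set xs = insert 0 ({node v e' | v e'. v < n \<and> inn v \<le> t \<and> e' < 2 * d} \<union>
       {node (ord (Suc t)) e' | e'. e' < e}) \<and>
     (\<forall>j\<le>t. sorted_on (nodes j) (node_rank j) xs) \<and>
     (t < n \<longrightarrow> sorted_on (nodes (Suc t)) (node_rank (Suc t)) xs)"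

lemma list_inv_init: "nx 0 = 0 \<Longrightarrow> list_inv 0 0 nx [0]"
  unfolding list_inv_def sorted_on_def using ord_inn by (auto simp: Suc_le_eq) fastforce+

text \<open>A listed node of the next bag belongs to a vertex that is already in the current bag,
  and on such vertices the two orders agree.\<close>

lemma sorted_persist:
  assumes "t < n" "Suc t < n" "sorted_on (nodes (Suc t)) (node_rank (Suc t)) xs"
    "set xs = insert 0 {node v e' | v e'. v < n \<and> inn v \<le> Suc t \<and> e' < 2 * d}"
  shows "sorted_on (nodes (Suc (Suc t))) (node_rank (Suc (Suc t))) xs"
  unfolding sorted_on_def
proof (rule sorted_wrt_mono_rel[OF _ assms(3)[unfolded sorted_on_def]], intro impI)
  fix a c assume x: "a \<in> set xs" "c \<in> set xs"
    and h: "a \<in> nodes (Suc t) \<longrightarrow> c \<in> nodes (Suc t) \<longrightarrow> node_rank (Suc t) a < node_rank (Suc t) c"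
    and k: "a \<in> nodes (Suc (Suc t))" "c \<in> nodes (Suc (Suc t))"
  have *: "\<exists>v e. x = node v e \<and> e < 2 * d \<and> v \<in> bag (Suc t) \<and> v \<in> bag (Suc (Suc t))"
    if x: "x \<in> set xs" "x \<in> nodes (Suc (Suc t))" for x
  proof -
    obtain v e where v: "x = node v e" "e < 2 * d" "v \<in> bag (Suc (Suc t))" using x(2) unfolding nodes_def by blast
    have "x \<noteq> 0" using v(1) node_pos by simp
    then obtain v' e' where v': "x = node v' e'" "inn v' \<le> Suc t" "e' < 2 * d" using x(1) assms(4) by auto
    then have "v' = v" using node_inj[of e e' v v'] v by auto
    then have "v \<noteq> ord (Suc (Suc t))" using v'(2) inn_ord[of "Suc (Suc t)"] assms(2) by auto
    then have "v \<in> bag (Suc t)" using v(3) bag_Suc[OF assms(2)] by simp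
    then show ?thesis using v by blast
  qed
  obtain u e where u: "a = node u e" "e < 2 * d" "u \<in> bag (Suc t)" "u \<in> bag (Suc (Suc t))" using *[OF x(1) k(1)] by blast
  obtain v e' where v: "c = node v e'" "e' < 2 * d" "v \<in> bag (Suc t)" "v \<in> bag (Suc (Suc t))" using *[OF x(2) k(2)] by blast
  have "rank (Suc t) u e < rank (Suc t) v e'"
    using h u v node_in_nodes node_rank_node by simp
  then show "node_rank (Suc (Suc t)) a < node_rank (Suc (Suc t)) c"
    using rank_consistent[OF assms(2) u(3,4) v(3,4) u(2) v(2)] u v node_rank_node by simp
qed

lemma list_inv_Suc:
  assumes "list_inv t (2 * d) nx xs" "t < n"
  shows "list_inv (Suc t) 0 nx xs"
proof -
  have L: "linked nx xs" "distinct xs" "xs \<noteq> []" "hd xs = 0"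
    "set xs = insert 0 ({node v e' | v e'. v < n \<and> inn v \<le> t \<and> e' < 2 * d} \<union> {node (ord (Suc t)) e' | e'. e' < 2 * d})"
    "\<forall>j\<le>t. sorted_on (nodes j) (node_rank j) xs" "sorted_on (nodes (Suc t)) (node_rank (Suc t)) xs"
    using assms unfolding list_inv_def by auto
  have o: "ord (Suc t) < n" "inn (ord (Suc t)) = Suc t" using inn_ord[of "Suc t"] assms(2) by auto
  have iff: "v < n \<and> inn v \<le> Suc t \<longleftrightarrow> v < n \<and> inn v \<le> t \<or> v = ord (Suc t)" for v
    using ord_inn[of v] o by (auto simp: le_Suc_eq)
  have set': "set xs = insert 0 {node v e' | v e'. v < n \<and> inn v \<le> Suc t \<and> e' < 2 * d}"
    unfolding L(5) using iff by blast
  have "Suc t < n \<longrightarrow> sorted_on (nodes (Suc (Suc t))) (node_rank (Suc (Suc t))) xs"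
    using sorted_persist[OF assms(2) _ L(7) set'] by blast
  moreover have "\<forall>j\<le>Suc t. sorted_on (nodes j) (node_rank j) xs" using L(6,7) le_Suc_eq by auto
  ultimately show ?thesis unfolding list_inv_def using L(1-4) set' by auto
qed

definition candidate :: "nat \<Rightarrow> nat \<Rightarrow> nat \<Rightarrow> nat \<Rightarrow> bool" where
  "candidate t e v e' \<longleftrightarrow> v \<in> bag (Suc t) \<and> e' < 2 * d \<and> (v = ord (Suc t) \<longrightarrow> e' < e) \<and>
     rank (Suc t) v e' < rank (Suc t) (ord (Suc t)) e"

definition best :: "nat \<Rightarrow> nat \<Rightarrow> nat \<Rightarrow> nat \<Rightarrow> bool" where
  "best t e v e' \<longleftrightarrow> candidate t e v e' \<and> (\<forall>u e''. candidate t e u e'' \<longrightarrow> rank (Suc t) u e'' \<le> rank (Suc t) v e')"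

lemma best_unique: "t < n \<Longrightarrow> best t e v e' \<Longrightarrow> best t e u e'' \<Longrightarrow> v = u \<and> e' = e''"
proof (rule ccontr)
  assume a: "t < n" "best t e v e'" "best t e u e''" "\<not> (v = u \<and> e' = e'')"
  have "rank (Suc t) v e' = rank (Suc t) u e''" using a(2,3) unfolding best_def by (meson antisym)
  moreover have "rank (Suc t) v e' \<noteq> rank (Suc t) u e''"
    by (rule rank_inj) (use a in \<open>auto simp: best_def candidate_def\<close>)
  ultimately show False by simp
qed

lemma best_exists:
  assumes "candidate t e u e''"
  shows "\<exists>v e'. best t e v e'"
proof -
  let ?S = "{(v, e'). candidate t e v e'}"
  have "?S \<subseteq> bag (Suc t) \<times> {..<2 * d}" by (auto simp: candidate_def)
  then have fin: "finite ?S" by (rule finite_subset) simp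
  have ne: "?S \<noteq> {}" using assms by auto
  let ?f = "\<lambda>(v, e'). rank (Suc t) v e'"
  have "Max (?f ` ?S) \<in> ?f ` ?S" using fin ne by (intro Max_in) auto
  then obtain v e' where v: "candidate t e v e'" "rank (Suc t) v e' = Max (?f ` ?S)" by auto
  have "rank (Suc t) x y \<le> rank (Suc t) v e'" if "candidate t e x y" for x y
    unfolding v(2) using fin that by (intro Max_ge) force+
  then show ?thesis using v(1) unfolding best_def by blast
qed

text \<open>Without a candidate, the new endpoint goes directly behind the head 0, ahead of all
  others.\<close>

definition predecessor :: "nat \<Rightarrow> nat \<Rightarrow> nat" where
  "predecessor t e = (if \<exists>v e'. best t e v e' then (THE a. \<exists>v e'. best t e v e' \<and> a = node v e') else 0)"

lemma predecessor_best: "t < n \<Longrightarrow> best t e v e' \<Longrightarrow> predecessor t e = node v e'"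
  unfolding predecessor_def using best_unique by (auto intro!: the_equality) blast+

text \<open>Bags up to \<open>t\<close> do not contain the entering vertex, so their orders cannot
  be spoiled by its nodes. For bag \<open>Suc t\<close>, the place right behind the predecessor is
  correct. This is the amalgamation step.\<close>

lemma list_inv_insert:
  assumes inv: "list_inv t e nx xs" and t: "t < n" and e: "e < 2 * d"
  shows "\<exists>xs'. list_inv t (Suc e) (nx(node (ord (Suc t)) e := nx (predecessor t e), predecessor t e := node (ord (Suc t)) e)) xs'"
proof -
  let ?w = "ord (Suc t)"
  let ?x = "node ?w e" and ?p = "predecessor t e"
  have L: "linked nx xs" "distinct xs" "xs \<noteq> []" "hd xs = 0"
    "set xs = insert 0 ({node v e' | v e'. v < n \<and> inn v \<le> t \<and> e' < 2 * d} \<union> {node ?w e' | e'. e' < e})"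
    "\<forall>j\<le>t. sorted_on (nodes j) (node_rank j) xs" "sorted_on (nodes (Suc t)) (node_rank (Suc t)) xs"
    using inv t unfolding list_inv_def by auto
  have w: "?w \<in> bag (Suc t)" "?w < n" "inn ?w = Suc t" using bag_Suc[OF t] inn_ord[of "Suc t"] t by auto
  have x_new: "?x \<notin> set xs"
  proof
    assume "?x \<in> set xs"
    then consider v e' where "?x = node v e'" "inn v \<le> t" "e' < 2 * d" | e' where "?x = node ?w e'" "e' < e"
      using L(5) node_pos[of ?w e] by auto
    then show False
    proof cases
      case (1 v e')
      then have "v = ?w" using node_inj[of e e' ?w v] e by auto
      then show False using 1 w by simp
    next
      case (2 e')
      then show False using node_inj[of e e' ?w ?w] e by auto
    qed
  qed
  \<comment> \<open>The listed nodes of the new bag are the endpoints of older vertices and those of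
    the entering vertex with offset below \<open>e\<close>, as in \<open>candidate\<close>.\<close>
  have in_xs: "a \<in> set xs \<and> a \<in> nodes (Suc t) \<longleftrightarrow> (\<exists>v e'. a = node v e' \<and> v \<in> bag (Suc t) \<and> e' < 2 * d \<and> (v = ?w \<longrightarrow> e' < e))" for a
  proof
    assume a: "a \<in> set xs \<and> a \<in> nodes (Suc t)"
    then obtain v e' where v: "a = node v e'" "v \<in> bag (Suc t)" "e' < 2 * d" unfolding nodes_def by blast
    have "e' < e" if vw: "v = ?w"
    proof -
      have "a \<noteq> 0" using v node_pos by simp
      then consider u e'' where "a = node u e''" "inn u \<le> t" "e'' < 2 * d" | e'' where "a = node ?w e''" "e'' < e"
        using a L(5) by auto
      then show ?thesis
      proof cases
        case (1 u e'')
        then have "u = ?w" using node_inj[of e' e'' v u] v vw by auto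
        then show ?thesis using 1 w by simp
      next
        case (2 e'')
        then show ?thesis using node_inj[of e' e'' v ?w] v e by auto
      qed
    qed
    then show "\<exists>v e'. a = node v e' \<and> v \<in> bag (Suc t) \<and> e' < 2 * d \<and> (v = ?w \<longrightarrow> e' < e)" using v by blast
  next
    assume "\<exists>v e'. a = node v e' \<and> v \<in> bag (Suc t) \<and> e' < 2 * d \<and> (v = ?w \<longrightarrow> e' < e)"
    then obtain v e' where v: "a = node v e'" "v \<in> bag (Suc t)" "e' < 2 * d" "v = ?w \<longrightarrow> e' < e" by blast
    have "a \<in> set xs"
    proof (cases "v = ?w")
      case True
      then have "a \<in> {node ?w e' | e'. e' < e}" using v by blast
      then show ?thesis unfolding L(5) by blast
    next
      case False
      then have "inn v \<noteq> Suc t" using ord_inn[of v] v(2) bag_n by metis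
      then have "inn v \<le> t" using v(2) by (simp add: bag_def)
      then have "a \<in> {node v e' | v e'. v < n \<and> inn v \<le> t \<and> e' < 2 * d}" using v bag_n by blast
      then show ?thesis unfolding L(5) by blast
    qed
    then show "a \<in> set xs \<and> a \<in> nodes (Suc t)" using v node_in_nodes by simp
  qed
  have p_in: "?p \<in> set xs"
  proof (cases "\<exists>v e'. best t e v e'")
    case True
    then obtain v e' where v: "best t e v e'" by blast
    then have "\<exists>v' e''. ?p = node v' e'' \<and> v' \<in> bag (Suc t) \<and> e'' < 2 * d \<and> (v' = ?w \<longrightarrow> e'' < e)"
      using predecessor_best[OF t v] unfolding best_def candidate_def by blast
    then show ?thesis using in_xs by blast
  next
    case False
    then have "?p = 0" by (simp add: predecessor_def)
    then show ?thesis unfolding L(5) by blast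
  qed
  obtain as bs where xs: "xs = as @ ?p # bs" using split_list[OF p_in] by blast
  let ?ys = "as @ ?p # ?x # bs"
  let ?nx = "nx(?x := nx ?p, ?p := ?x)"
  have 1: "linked ?nx ?ys" using linked_insert[of nx as ?p bs ?x] L(1,2) x_new unfolding xs by blast
  have 2: "distinct ?ys" using L(2) x_new unfolding xs by auto
  have 3: "hd ?ys = 0" using L(4) unfolding xs by (cases as) auto
  have 4: "set ?ys = insert 0 ({node v e' | v e'. v < n \<and> inn v \<le> t \<and> e' < 2 * d} \<union> {node ?w e' | e'. e' < Suc e})"
  proof -
    have "set ?ys = insert ?x (set xs)" unfolding xs by auto
    moreover have "{node ?w e' | e'. e' < Suc e} = insert ?x {node ?w e' | e'. e' < e}" by (auto simp: less_Suc_eq)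
    ultimately show ?thesis unfolding L(5) by blast
  qed
  have 5: "\<forall>j\<le>t. sorted_on (nodes j) (node_rank j) ?ys"
  proof (intro allI impI)
    fix j assume j: "j \<le> t"
    have "?w \<notin> bag j" using w j by (simp add: bag_def)
    then have "?x \<notin> nodes j" using node_in_nodes e by simp
    then show "sorted_on (nodes j) (node_rank j) ?ys" using L(6) j sorted_on_insert_other unfolding xs by blast
  qed
  have cand: "candidate t e v e' \<longleftrightarrow> node v e' \<in> set xs \<and> node v e' \<in> nodes (Suc t) \<and> node_rank (Suc t) (node v e') < node_rank (Suc t) ?x"
    if "e' < 2 * d" for v e'
  proof -
    have "node v e' \<in> set xs \<and> node v e' \<in> nodes (Suc t) \<longleftrightarrow> v \<in> bag (Suc t) \<and> (v = ?w \<longrightarrow> e' < e)"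
    proof
      assume "node v e' \<in> set xs \<and> node v e' \<in> nodes (Suc t)"
      then obtain v' e'' where "node v e' = node v' e''" "v' \<in> bag (Suc t)" "e'' < 2 * d" "v' = ?w \<longrightarrow> e'' < e"
        using in_xs by blast
      then show "v \<in> bag (Suc t) \<and> (v = ?w \<longrightarrow> e' < e)" using node_inj[of e' e'' v v'] that by auto
    next
      assume "v \<in> bag (Suc t) \<and> (v = ?w \<longrightarrow> e' < e)"
      then show "node v e' \<in> set xs \<and> node v e' \<in> nodes (Suc t)" using in_xs that by blast
    qed
    then show ?thesis unfolding candidate_def using node_rank_node that e by auto
  qed
  have 6: "sorted_on (nodes (Suc t)) (node_rank (Suc t)) ?ys"
  proof (rule sorted_on_insert)
    show "sorted_on (nodes (Suc t)) (node_rank (Suc t)) (as @ ?p # bs)" "distinct (as @ ?p # bs)"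
      using L(2,7) xs by auto
    show "?p \<in> nodes (Suc t) \<and> node_rank (Suc t) ?p < node_rank (Suc t) ?x \<or> ?p \<notin> nodes (Suc t) \<and> as = []"
    proof (cases "\<exists>v e'. best t e v e'")
      case True
      then obtain v e' where v: "best t e v e'" by blast
      then have "candidate t e v e'" "e' < 2 * d" unfolding best_def candidate_def by auto
      then show ?thesis using cand[of e' v] predecessor_best[OF t v] by simp
    next
      case False
      then have p0: "?p = 0" by (simp add: predecessor_def)
      \<comment> \<open>The head 0 occurs only once in the list, so nothing precedes it.\<close>
      moreover have "as = []"
        using L(2,4) p0 unfolding xs by (cases as) auto
      ultimately show ?thesis using nodes_0 by simp
    qed
  next
    fix a assume a: "a \<in> set (as @ ?p # bs)" "a \<in> nodes (Suc t)"
    then have "a \<in> set xs \<and> a \<in> nodes (Suc t)" using xs by simp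
    then obtain v e' where v: "a = node v e'" "v \<in> bag (Suc t)" "e' < 2 * d" "v = ?w \<longrightarrow> e' < e"
      using in_xs by blast
    show "node_rank (Suc t) a \<noteq> node_rank (Suc t) ?x"
      using rank_separate[OF t v(2) e v(3)] v node_rank_node e by auto
    assume less: "node_rank (Suc t) a < node_rank (Suc t) ?x"
    then have c: "candidate t e v e'" using cand[OF v(3)] a v xs by simp
    obtain u e'' where u: "best t e u e''" using best_exists[OF c] by blast
    then have cu: "candidate t e u e''" "e'' < 2 * d" unfolding best_def candidate_def by auto
    have "rank (Suc t) v e' \<le> rank (Suc t) u e''" using u c unfolding best_def by blast
    then show "?p \<in> nodes (Suc t) \<and> node_rank (Suc t) a \<le> node_rank (Suc t) ?p"
      using predecessor_best[OF t u] cu cand[OF cu(2)] v node_rank_node by simp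
  qed
  have "list_inv t (Suc e) ?nx ?ys" unfolding list_inv_def using 1 2 3 4 5 6 by simp
  then show ?thesis by blast
qed

end

text \<open>Register 10 tells the epilogue how many cells to copy: two endpoints in each of
  \<open>d + 1\<close> dimensions for every vertex.\<close>

definition finish_com :: com where
  "finish_com = Sq (Asg 0 (EAdd (Var 52) (Num 1))) (Sq (Asg 1 (Num 0))
     (Asg 10 (EAdd (Mul 0 53 (Var 2)) (EAdd (Var 2) (Var 2)))))"

definition main_com :: com where
  "main_com = Sq decompose_com (Sq slots_com (Sq search_com (Sq backtrack_com
     (Sq insert_com (Sq number_com (Sq times_com finish_com))))))"

lemma wf_main: "wf_com main_com"
  by (simp add: main_com_def finish_com_def times_com_def number_com_def insert_com_def backtrack_com_def
      search_com_def slots_com_def decompose_com_def attempt_com_def table_com_def powers_com_def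
      copy_com_def scan_com_def tree_com_def leave_com_def shift_com_def neighbour_com_def root_com_def
      enter_com_def For_def exp_defs row_def cell_def reachE_def stepE_def consistentE_def separateE_def
      adjacentE_def overlapE_def persistsE_def posE_def modE_def divE_def nodeE_def candidateE_def
      bestE_def predecessorE_def small_def)

text \<open>The indices are the offsets of the output format for dimension \<open>d + 1\<close> and
  base address 0, so the property carries over to \<open>output_box\<close> directly.\<close>

definition output_ok :: "(nat \<Rightarrow> nat \<Rightarrow> bool) \<Rightarrow> nat \<Rightarrow> nat \<Rightarrow> (nat \<Rightarrow> nat) \<Rightarrow> bool" where
  "output_ok E n d X \<longleftrightarrow> (\<forall>v<n. \<forall>i<d+1. X (2 * ((d + 1) * v + i)) \<le> X (2 * ((d + 1) * v + i) + 1)) \<and>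
     (\<forall>u<n. \<forall>v<n. u \<noteq> v \<longrightarrow> (E u v \<longleftrightarrow> (\<forall>i<d+1. X (2 * ((d + 1) * u + i)) \<le> X (2 * ((d + 1) * v + i) + 1) \<and>
        X (2 * ((d + 1) * v + i)) \<le> X (2 * ((d + 1) * u + i) + 1))))"

section \<open>Correctness of insertion, numbering and output\<close>

context solution
begin

lemma ev_nodeE:
  assumes "R 53 = 2 * d" "\<And>i. ev R A (l(8 := i)) v = ev R A l v"
  shows "ev R A l (nodeE v e) = node (ev R A l v) (ev R A l e)"
  using assms by (simp add: nodeE_def node_def algebra_simps)

context
  fixes t e :: nat and R :: "nat \<Rightarrow> nat" and A :: arrays
  assumes t: "t < n" and e: "e < 2 * d"
    and R: "dp_regs s d R" "R 3 = Suc t" "R 9 = A0 8 (ord (Suc t))" "R 56 = A0 11 (Suc t)" "R 51 = e"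
    and A: "\<And>a. a < 12 \<Longrightarrow> A a = A0 a"
begin

lemma pre_regs: "R 50 = s" "R 53 = 2 * d"
  using R(1) by (simp_all add: dp_regs_def)

lemma powersA: "powers s d A"
  using powers0 A by (simp add: powers_def)

lemma z_less: "A0 8 (ord (Suc t)) < s"
  using slots_at_slot(2)[OF inv0, of "Suc t" "ord (Suc t)"] bag_Suc[OF t] t by simp

lemma ev_candidateE:
  assumes x: "ev R A l x < s" "ev R A l e' < 2 * d" "stable R A x" "stable R A e'"
  shows "ev R A l (candidateE x e') \<noteq> 0 \<longleftrightarrow> slots_at A0 (Suc t) (ev R A l x) \<noteq> 0 \<and>
    candidate t e (slots_at A0 (Suc t) (ev R A l x) - 1) (ev R A l e')"
proof -
  let ?x = "ev R A l x" and ?e = "ev R A l e'" and ?z = "A0 8 (ord (Suc t))"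
  have c: "A0 11 (Suc t) < states d" using states0[of "Suc t"] t by simp
  have p: "ev R A l (posE (Var 56) x e') = pos s d (A0 11 (Suc t)) ?x ?e"
    "ev R A l (posE (Var 56) (Var 9) (Var 51)) = pos s d (A0 11 (Suc t)) ?z e"
    using ev_posE[OF R(1) powersA, of "Var 56" x e' l] ev_posE[OF R(1) powersA, of "Var 56" "Var 9" "Var 51" l]
      x c R z_less \<open>e < 2 * d\<close> by simp_all
  have sl: "ev R A l (Arr 5 (row 3 x)) = slots_at A0 (Suc t) ?x"
    using R(2) pre_regs A by (simp add: slots_at_def)
  have "ev R A l (candidateE x e') \<noteq> 0 \<longleftrightarrow> slots_at A0 (Suc t) ?x \<noteq> 0 \<and> (?x = ?z \<longrightarrow> ?e < e) \<and>
      pos s d (A0 11 (Suc t)) ?x ?e < pos s d (A0 11 (Suc t)) ?z e"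
    unfolding candidateE_def truth_simps p sl using R by simp
  also have "\<dots> \<longleftrightarrow> slots_at A0 (Suc t) ?x \<noteq> 0 \<and> candidate t e (slots_at A0 (Suc t) ?x - 1) ?e"
  proof (rule conj_cong[OF refl])
    assume nz: "slots_at A0 (Suc t) ?x \<noteq> 0"
    let ?v = "slots_at A0 (Suc t) ?x - 1"
    have v: "?v \<in> bag (Suc t)" "A0 8 ?v = ?x" using slots_at_bag[OF inv0 _ x(1) nz] t by auto
    have "?v = ord (Suc t) \<longleftrightarrow> ?x = ?z"
    proof
      assume "?x = ?z"
      then have "slots_at A0 (Suc t) ?x = Suc (ord (Suc t))"
        using slots_at_slot(1)[OF inv0, of "Suc t" "ord (Suc t)"] bag_Suc[OF t] t by simp
      then show "?v = ord (Suc t)" by simp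
    qed (use v in simp)
    then show "(?x = ?z \<longrightarrow> ?e < e) \<and> pos s d (A0 11 (Suc t)) ?x ?e < pos s d (A0 11 (Suc t)) ?z e \<longleftrightarrow>
      candidate t e ?v ?e"
      using v x(2) unfolding candidate_def rank_def by simp
  qed
  finally show ?thesis .
qed

lemma ev_bestE:
  assumes x: "x < s" "e' < 2 * d"
  shows "ev R A (l(3 := x, 4 := e')) (bestE (Idx 3) (Idx 4)) \<noteq> 0 \<longleftrightarrow> slots_at A0 (Suc t) x \<noteq> 0 \<and>
    best t e (slots_at A0 (Suc t) x - 1) e'"
proof -
  let ?l = "l(3 := x, 4 := e')"
  have c: "A0 11 (Suc t) < states d" using states0[of "Suc t"] t by simp
  have 1: "ev R A ?l (candidateE (Idx 3) (Idx 4)) \<noteq> 0 \<longleftrightarrow> slots_at A0 (Suc t) x \<noteq> 0 \<and>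
    candidate t e (slots_at A0 (Suc t) x - 1) e'"
    using ev_candidateE[of ?l "Idx 3" "Idx 4"] x by simp
  have 2: "ev R A (?l(5 := y, 6 := e'')) (Imp (candidateE (Idx 5) (Idx 6)) (Leq (posE (Var 56) (Idx 5) (Idx 6))
      (posE (Var 56) (Idx 3) (Idx 4)))) \<noteq> 0 \<longleftrightarrow>
    (slots_at A0 (Suc t) y \<noteq> 0 \<and> candidate t e (slots_at A0 (Suc t) y - 1) e'' \<longrightarrow>
      pos s d (A0 11 (Suc t)) y e'' \<le> pos s d (A0 11 (Suc t)) x e')" if y: "y < s" "e'' < 2 * d" for y e''
  proof -
    have "ev R A (?l(5 := y, 6 := e'')) (posE (Var 56) (Idx 5) (Idx 6)) = pos s d (A0 11 (Suc t)) y e''"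
      "ev R A (?l(5 := y, 6 := e'')) (posE (Var 56) (Idx 3) (Idx 4)) = pos s d (A0 11 (Suc t)) x e'"
      using ev_posE[OF R(1) powersA, of "Var 56" "Idx 5" "Idx 6" "?l(5 := y, 6 := e'')"]
        ev_posE[OF R(1) powersA, of "Var 56" "Idx 3" "Idx 4" "?l(5 := y, 6 := e'')"] x y c R by simp_all
    moreover have "ev R A (?l(5 := y, 6 := e'')) (candidateE (Idx 5) (Idx 6)) \<noteq> 0 \<longleftrightarrow>
        slots_at A0 (Suc t) y \<noteq> 0 \<and> candidate t e (slots_at A0 (Suc t) y - 1) e''"
      using ev_candidateE[of "?l(5 := y, 6 := e'')" "Idx 5" "Idx 6"] y by simp
    ultimately show ?thesis by (simp only: truth_simps ev_Leq) simp
  qed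
  have 3: "ev R A ?l (AllLt 5 50 (AllLt 6 53 (Imp (candidateE (Idx 5) (Idx 6)) (Leq (posE (Var 56) (Idx 5) (Idx 6))
      (posE (Var 56) (Idx 3) (Idx 4)))))) \<noteq> 0 \<longleftrightarrow>
    (\<forall>y<s. \<forall>e''<2 * d. slots_at A0 (Suc t) y \<noteq> 0 \<and> candidate t e (slots_at A0 (Suc t) y - 1) e'' \<longrightarrow>
      pos s d (A0 11 (Suc t)) y e'' \<le> pos s d (A0 11 (Suc t)) x e')"
    by (intro ev_AllLt_iff pre_regs 2)
  have "ev R A ?l (bestE (Idx 3) (Idx 4)) \<noteq> 0 \<longleftrightarrow> (slots_at A0 (Suc t) x \<noteq> 0 \<and> candidate t e (slots_at A0 (Suc t) x - 1) e') \<and>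
    (\<forall>y<s. \<forall>e''<2 * d. slots_at A0 (Suc t) y \<noteq> 0 \<and> candidate t e (slots_at A0 (Suc t) y - 1) e'' \<longrightarrow>
      pos s d (A0 11 (Suc t)) y e'' \<le> pos s d (A0 11 (Suc t)) x e')"
    unfolding bestE_def truth_simps(2) 1 3 ..
  also have "\<dots> \<longleftrightarrow> slots_at A0 (Suc t) x \<noteq> 0 \<and> best t e (slots_at A0 (Suc t) x - 1) e'"
  proof (intro iffI; elim conjE)
    assume nz: "slots_at A0 (Suc t) x \<noteq> 0" and c: "candidate t e (slots_at A0 (Suc t) x - 1) e'"
      and max: "\<forall>y<s. \<forall>e''<2 * d. slots_at A0 (Suc t) y \<noteq> 0 \<and> candidate t e (slots_at A0 (Suc t) y - 1) e'' \<longrightarrow>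
        pos s d (A0 11 (Suc t)) y e'' \<le> pos s d (A0 11 (Suc t)) x e'"
    have vx: "A0 8 (slots_at A0 (Suc t) x - 1) = x" using slots_at_bag(2)[OF inv0 _ x(1) nz] t by simp
    have "rank (Suc t) u e'' \<le> rank (Suc t) (slots_at A0 (Suc t) x - 1) e'" if u: "candidate t e u e''" for u e''
    proof -
      have b: "u \<in> bag (Suc t)" "e'' < 2 * d" using u by (auto simp: candidate_def)
      have su: "slots_at A0 (Suc t) (A0 8 u) = Suc u" "A0 8 u < s" using slots_at_slot[OF inv0 _ b(1)] t by auto
      have "pos s d (A0 11 (Suc t)) (A0 8 u) e'' \<le> pos s d (A0 11 (Suc t)) x e'"
        using max su b(2) u by simp
      then show ?thesis using vx by (simp add: rank_def)
    qed
    then show "slots_at A0 (Suc t) x \<noteq> 0 \<and> best t e (slots_at A0 (Suc t) x - 1) e'"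
      using nz c unfolding best_def by blast
  next
    assume nz: "slots_at A0 (Suc t) x \<noteq> 0" and bst: "best t e (slots_at A0 (Suc t) x - 1) e'"
    have vx: "A0 8 (slots_at A0 (Suc t) x - 1) = x" using slots_at_bag(2)[OF inv0 _ x(1) nz] t by simp
    have "pos s d (A0 11 (Suc t)) y e'' \<le> pos s d (A0 11 (Suc t)) x e'"
      if y: "y < s" "slots_at A0 (Suc t) y \<noteq> 0" "candidate t e (slots_at A0 (Suc t) y - 1) e''" for y e''
    proof -
      have "A0 8 (slots_at A0 (Suc t) y - 1) = y" using slots_at_bag(2)[OF inv0 _ y(1,2)] t by simp
      moreover have "rank (Suc t) (slots_at A0 (Suc t) y - 1) e'' \<le> rank (Suc t) (slots_at A0 (Suc t) x - 1) e'"
        using bst y(3) unfolding best_def by blast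
      ultimately show ?thesis using vx by (simp add: rank_def)
    qed
    then show "(slots_at A0 (Suc t) x \<noteq> 0 \<and> candidate t e (slots_at A0 (Suc t) x - 1) e') \<and>
      (\<forall>y<s. \<forall>e''<2 * d. slots_at A0 (Suc t) y \<noteq> 0 \<and> candidate t e (slots_at A0 (Suc t) y - 1) e'' \<longrightarrow>
      pos s d (A0 11 (Suc t)) y e'' \<le> pos s d (A0 11 (Suc t)) x e')"
      using nz bst unfolding best_def by blast
  qed
  finally show ?thesis .
qed

lemma ev_predecessorE: "ev R A l predecessorE = predecessor t e"
proof -
  let ?P = "\<lambda>(x, e'). slots_at A0 (Suc t) x \<noteq> 0 \<and> best t e (slots_at A0 (Suc t) x - 1) e'"
  let ?f = "\<lambda>(x, e'). node (slots_at A0 (Suc t) x - 1) e'"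
  have "ev R A l predecessorE = (\<Sum>x<s. \<Sum>e'<2 * d. if ?P (x, e') then ?f (x, e') else 0)"
    unfolding predecessorE_def ev.simps(8) pre_regs
  proof (intro sum.cong refl)
    fix x e' assume "x \<in> {..<s}" "e' \<in> {..<2 * d}"
    then have x: "x < s" "e' < 2 * d" by auto
    have "ev R A (l(3 := x, 4 := e')) (nodeE (ESub (Arr 5 (row 3 (Idx 3))) (Num 1)) (Idx 4)) = ?f (x, e')"
      using pre_regs R(2) A by (subst ev_nodeE) (simp_all add: slots_at_def)
    then show "ev R A (l(3 := x, 4 := e')) (Ite (bestE (Idx 3) (Idx 4)) (nodeE (ESub (Arr 5 (row 3 (Idx 3))) (Num 1)) (Idx 4)) (Num 0)) =
      (if ?P (x, e') then ?f (x, e') else 0)"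
      unfolding ev.simps(6) using ev_bestE[OF x, of l] by simp
  qed
  also have "\<dots> = (\<Sum>a\<in>{..<s} \<times> {..<2 * d}. if ?P a then ?f a else 0)"
    by (simp only: sum.cartesian_product case_prod_unfold fst_conv snd_conv)
  also have "\<dots> = predecessor t e"
  proof (cases "\<exists>v e'. best t e v e'")
    case True
    then obtain v e' where v: "best t e v e'" by blast
    then have b: "v \<in> bag (Suc t)" "e' < 2 * d" by (auto simp: best_def candidate_def)
    have sv: "slots_at A0 (Suc t) (A0 8 v) = Suc v" "A0 8 v < s" using slots_at_slot[OF inv0 _ b(1)] t by auto
    have "(\<Sum>a\<in>{..<s} \<times> {..<2 * d}. if ?P a then ?f a else 0) = ?f (A0 8 v, e')"
    proof (rule sum_single)
      show "?P (A0 8 v, e')" using sv v by simp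
      show "c = (A0 8 v, e')" if "c \<in> {..<s} \<times> {..<2 * d}" "?P c" for c
      proof -
        obtain x y where c: "c = (x, y)" by (cases c)
        have xy: "x < s" "slots_at A0 (Suc t) x \<noteq> 0" "best t e (slots_at A0 (Suc t) x - 1) y" using that c by auto
        have "slots_at A0 (Suc t) x - 1 = v \<and> y = e'" using best_unique[OF t xy(3) v] .
        moreover have "A0 8 (slots_at A0 (Suc t) x - 1) = x" using slots_at_bag(2)[OF inv0 _ xy(1,2)] t by simp
        ultimately show ?thesis using c by simp
      qed
    qed (use sv b in auto)
    then show ?thesis using predecessor_best[OF t v] sv by simp
  next
    case False
    then show ?thesis by (simp add: predecessor_def)
  qed
  finally show ?thesis .
qed

end

lemma predecessor_le: "t < n \<Longrightarrow> predecessor t e \<le> m"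
proof (cases "\<exists>v e'. best t e v e'")
  case True
  assume t: "t < n"
  obtain v e' where v: "best t e v e'" using True by blast
  then have "v < n" "e' < 2 * d + 2" by (auto simp: best_def candidate_def bag_def)
  then show ?thesis using predecessor_best[OF t v] node_le(2) by simp
qed (simp add: predecessor_def)

lemma linked_le:
  assumes "list_inv t e nx xs" "a \<in> set xs" "t < n \<or> e = 0" "e \<le> 2 * d"
  shows "nx a \<le> m"
proof -
  have L: "linked nx xs" "set xs = insert 0 ({node v e' | v e'. v < n \<and> inn v \<le> t \<and> e' < 2 * d} \<union>
       {node (ord (Suc t)) e' | e'. e' < e})" using assms(1) unfolding list_inv_def by auto
  have le: "x \<le> m" if x: "x \<in> set xs" for x
  proof -
    consider "x = 0" | v e' where "x = node v e'" "v < n" "e' < 2 * d" | e' where "x = node (ord (Suc t)) e'" "e' < e"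
      using x unfolding L(2) by blast
    then show ?thesis
    proof cases
      case (2 v e') then show ?thesis using node_le(2)[of v e'] by simp
    next
      case (3 e')
      then have "ord (Suc t) < n" using assms(3) inn_ord[of "Suc t"] by auto
      then show ?thesis using 3 assms(4) node_le(2)[of "ord (Suc t)" e'] by simp
    qed simp
  qed
  obtain as bs where xs: "xs = as @ a # bs" using split_list[OF assms(2)] by blast
  have "nx a = (case bs of [] \<Rightarrow> 0 | c # _ \<Rightarrow> c)" using linked_nth L(1) xs by metis
  then show ?thesis using le xs by (cases bs) auto
qed

lemma wp_insert:
  assumes R: "dp_regs s d R" "R 2 = n"
    and Q: "\<And>R' A' xs. dp_regs s d R' \<Longrightarrow> R' 2 = n \<Longrightarrow> (\<And>a. a \<noteq> 12 \<Longrightarrow> A' a = A0 a) \<Longrightarrow> list_inv n 0 (A' 12) xs \<Longrightarrow>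
      Q (\<tau> + n * (2 * d + 1)) R' A'"
  shows "wp insert_com Q \<tau> R A0"
  unfolding insert_com_def
proof (rule wp_Sq, rule wp_Put, simp, rule wp_For[where N = n and I = "\<lambda>t \<tau>' R' A'. \<tau>' = \<tau> + t * (2 * d + 1) \<and>
    dp_regs s d R' \<and> R' 2 = n \<and> (\<forall>a. a \<noteq> 12 \<longrightarrow> A' a = A0 a) \<and> (\<exists>xs. list_inv t 0 (A' 12) xs)"], goal_cases)
  case 1
  show ?case using R list_inv_init[of "(A0 12)(0 := 0)"] by (auto simp: dp_regs_def)
next
  case 2 then show ?case using m_bounds by (simp add: small_def)
next
  case 3 then show ?case by simp
next
  case (5 \<tau>' R' A')
  then obtain xs where "list_inv n 0 (A' 12) xs" by blast
  then have "Q (\<tau> + n * (2 * d + 1)) R' A'" using 5 by (intro Q) auto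
  then show ?case using 5 by simp
next
  case (4 t \<tau>1 R1 A1)
  let ?w = "ord (Suc t)"
  obtain xs1 where xs1: "list_inv t 0 (A1 12) xs1" using 4 by blast
  have fr: "dp_regs s d R1" "R1 2 = n" "\<And>a. a \<noteq> 12 \<Longrightarrow> A1 a = A0 a" using 4 by auto
  have A4: "A0 4 = ord" using base0 by (simp add: base_def)
  have w: "?w < n" using inn_ord[of "Suc t"] 4(1) by simp
  have z: "A0 8 ?w < s" using slot_invD(1)[OF inv0] w by blast
  have d1: "2 * d \<le> b"
  proof -
    have "2 * d * 1 \<le> 2 * d * s" using s_pos by (intro mult_le_mono2)
    moreover have "2 * d * s = 2 * s * d" by simp
    ultimately show ?thesis using D_le(2)[OF d_le] by linarith
  qed
  have c: "A0 11 (Suc t) < states d" using states0[of "Suc t"] 4(1) by simp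
  have cb: "A0 11 (Suc t) \<le> b" using c power_le_b[OF d_le order_refl] by linarith
  let ?R = "R1(3 := Suc t, 6 := ?w, 9 := A0 8 ?w, 56 := A0 11 (Suc t))"
  have wp2: "wp (For 51 (Var 53) (Sq (Asg 10 predecessorE) (Sq (Asg 11 (nodeE (Var 6) (Var 51)))
         (Sq (Put 12 (Var 11) (Arr 12 (Var 10))) (Put 12 (Var 10) (Var 11))))))
      (\<lambda>\<tau>' R' A'. R' 12 = t \<and> Suc \<tau>' = \<tau> + Suc t * (2 * d + 1) \<and>
    dp_regs s d (R'(12 := Suc t)) \<and> (R'(12 := Suc t)) 2 = n \<and> (\<forall>a. a \<noteq> 12 \<longrightarrow> A' a = A0 a) \<and> (\<exists>xs. list_inv (Suc t) 0 (A' 12) xs))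
      \<tau>1 ?R A1"
  proof (rule wp_For[where N = "2 * d" and I = "\<lambda>e \<tau>' R' A'. \<tau>' = \<tau>1 + e \<and> (\<forall>x. x \<notin> {10, 11, 51} \<longrightarrow> R' x = ?R x) \<and>
      (\<forall>a. a \<noteq> 12 \<longrightarrow> A' a = A0 a) \<and> (\<exists>xs. list_inv t e (A' 12) xs)"], goal_cases)
    case 1 show ?case using fr xs1 by auto
  next
    case 2 show ?case using d1 by (simp add: small_def)
  next
    case (3 i \<tau>' R' A') then show ?case using fr(1) by (simp add: dp_regs_def)
  next
    case (5 \<tau>' R' A')
    then obtain xs where "list_inv t (2 * d) (A' 12) xs" by blast
    then have "list_inv (Suc t) 0 (A' 12) xs" using list_inv_Suc 4(1) by blast
    moreover have "dp_regs s d (R'(12 := Suc t))" using 5(2) fr(1) by (simp add: dp_regs_def)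
    ultimately show ?case using 5 4 by auto
  next
    case (4 e \<tau>2 R2 A2)
    then obtain xs where xs: "list_inv t e (A2 12) xs" by blast
    have R2: "dp_regs s d R2" "R2 3 = Suc t" "R2 9 = A0 8 ?w" "R2 56 = A0 11 (Suc t)" "R2 51 = e" "R2 6 = ?w"
      using 4(2,3) fr(1) by (simp_all add: dp_regs_def)
    have A2: "\<And>a. a < 12 \<Longrightarrow> A2 a = A0 a" using 4(3) by simp
    have pre: "ev R2 A2 (\<lambda>_. 0) predecessorE = predecessor t e"
      by (rule ev_predecessorE[OF \<open>t < n\<close> 4(1) R2(1-5) A2])
    have nd: "ev (R2(10 := predecessor t e)) A2 (\<lambda>_. 0) (nodeE (Var 6) (Var 51)) = node ?w e"
      using ev_nodeE[of "R2(10 := predecessor t e)" A2 "\<lambda>_. 0" "Var 6" "Var 51"] R2 by (simp add: dp_regs_def)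
    have nle: "node ?w e \<le> m" using node_le(2)[OF w, of e] 4(1) by simp
    have nxle: "A2 12 (predecessor t e) \<le> m"
    proof (cases "predecessor t e \<in> set xs")
      case True then show ?thesis using linked_le[OF xs] \<open>t < n\<close> 4(1) by simp
    next
      case False
      have "predecessor t e \<in> set xs"
      proof (cases "\<exists>v e'. best t e v e'")
        case True
        then obtain v e' where v: "best t e v e'" by blast
        then have c: "v \<in> bag (Suc t)" "e' < 2 * d" "v = ?w \<longrightarrow> e' < e" by (auto simp: best_def candidate_def)
        have "node v e' \<in> set xs"
        proof (cases "v = ?w")
          case True then show ?thesis using c(3) xs unfolding list_inv_def by auto
        next
          case False
          then have "v < n" "inn v \<le> t" using c(1) bag_Suc[OF \<open>t < n\<close>] by (auto simp: bag_def)
          then show ?thesis using c(2) xs unfolding list_inv_def by auto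
        qed
        then show ?thesis using predecessor_best[OF \<open>t < n\<close> v] by simp
      next
        case False then show ?thesis using xs unfolding list_inv_def by (simp add: predecessor_def)
      qed
      then show ?thesis using False by blast
    qed
    obtain xs' where xs': "list_inv t (Suc e) ((A2 12)(node ?w e := A2 12 (predecessor t e), predecessor t e := node ?w e)) xs'"
      using list_inv_insert[OF xs \<open>t < n\<close> 4(1)] by blast
    show ?case
      apply (rule wp_Sq, rule wp_Asg, unfold pre)
      using predecessor_le[OF \<open>t < n\<close>] apply (simp add: small_def)
      apply (rule wp_Sq, rule wp_Asg, unfold nd)
      using nle apply (simp add: small_def)
      apply (rule wp_Sq, rule wp_Put)
      using nxle apply simp
      apply (rule wp_Put)
      using nle apply simp
      using 4 xs' by auto
  qed
  show ?case
    apply (rule wp_Sq, rule wp_Asg)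
    using 4 m_bounds apply (simp add: small_def)
    apply (rule wp_Sq, rule wp_Asg)
    using 4 fr(3)[of 4] A4 w m_bounds apply (simp add: small_def)
    apply (rule wp_Sq, rule wp_Asg)
    using 4 fr(3)[of 4] fr(3)[of 8] A4 z s_le b_le apply (simp add: small_def)
    apply (rule wp_Sq, rule wp_Asg)
    using 4(2) fr(3)[of 11] cb apply (simp add: small_def)
    using wp2 4(2) fr(3)[of 4] fr(3)[of 8] fr(3)[of 11] A4 by simp
qed

lemma list_length:
  assumes "list_inv n 0 nx xs"
  shows "length xs \<le> n * (2 * d + 2) + 1" "\<And>a. a \<in> set xs \<Longrightarrow> a \<le> m"
proof -
  have sx: "set xs = insert 0 {node v e' | v e'. v < n \<and> inn v \<le> n \<and> e' < 2 * d}" "distinct xs"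
    using assms unfolding list_inv_def by auto
  have "set xs \<subseteq> {..n * (2 * d + 2)}" unfolding sx using node_le(1) by fastforce
  then have "card (set xs) \<le> card {..n * (2 * d + 2)}" by (intro card_mono) auto
  then show "length xs \<le> n * (2 * d + 2) + 1" using sx(2) by (simp add: distinct_card)
  show "a \<le> m" if "a \<in> set xs" for a using that unfolding sx using node_le(2) by fastforce
qed

lemma nodes_le_m: "n * (2 * d + 2) \<le> m"
proof -
  have "n * (2 * d + 2) \<le> (n + 2) * (2 * b + 8)" using d_le s_le by (intro mult_le_mono) auto
  then show ?thesis using m_large by linarith
qed

lemma wp_number:
  assumes R: "dp_regs s d R" "R 2 = n" and A: "\<And>a. a \<noteq> 12 \<Longrightarrow> A a = A0 a" and xs: "list_inv n 0 (A 12) xs"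
    and Q: "\<And>\<tau>' R' A'. \<tau>' \<le> \<tau> + n * (2 * d + 2) \<Longrightarrow> dp_regs s d R' \<Longrightarrow> R' 2 = n \<Longrightarrow> (\<And>a. a \<noteq> 12 \<Longrightarrow> a \<noteq> 13 \<Longrightarrow> A' a = A0 a) \<Longrightarrow>
      (\<And>i. 1 \<le> i \<Longrightarrow> i < length xs \<Longrightarrow> A' 13 (xs ! i - 1) = i - 1) \<Longrightarrow> Q \<tau>' R' A'"
  shows "wp number_com Q \<tau> R A"
proof -
  have L: "linked (A 12) xs" "distinct xs" "xs \<noteq> []" "hd xs = 0"
    "set xs = insert 0 {node v e' | v e'. v < n \<and> inn v \<le> n \<and> e' < 2 * d}"
    using xs unfolding list_inv_def by auto
  have pos: "xs ! i \<noteq> 0" if "1 \<le> i" "i < length xs" for i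
  proof -
    have "xs ! i \<noteq> xs ! 0" using nth_eq_iff_index_eq[OF L(2), of i 0] that L(3) by auto
    then show ?thesis using L(3,4) by (simp add: hd_conv_nth)
  qed
  have next_nth: "A 12 (xs ! i) = (if Suc i < length xs then xs ! Suc i else 0)" if "i < length xs" for i
  proof -
    have "xs = take i xs @ xs ! i # drop (Suc i) xs" using id_take_nth_drop[OF that] .
    then have "A 12 (xs ! i) = (case drop (Suc i) xs of [] \<Rightarrow> 0 | c # _ \<Rightarrow> c)" using linked_nth L(1) by metis
    also have "\<dots> = (if Suc i < length xs then xs ! Suc i else 0)"
      by (cases "drop (Suc i) xs") (auto simp: hd_drop_conv_nth[symmetric] dest: arg_cong[of _ _ hd])
    finally show ?thesis .
  qed
  have len: "length xs \<le> n * (2 * d + 2) + 1" "0 < length xs" using list_length(1)[OF xs] L(3) by auto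
  have xm: "xs ! i \<le> m" if "i < length xs" for i using list_length(2)[OF xs] that by simp
  \<comment> \<open>Continuing the list by 0 makes the value that stops the loop an ordinary
    successor.\<close>
  define elt where "elt i = (if i < length xs then xs ! i else 0)" for i
  have n12: "A 12 (elt i) = elt (Suc i)" if "i < length xs" for i using next_nth[OF that] that by (simp add: elt_def)
  have "wp (Loop (Var 10) (Sq (Put 13 (ESub (Var 10) (Num 1)) (Var 11)) (Sq (Asg 11 (EAdd (Var 11) (Num 1)))
       (Asg 10 (Arr 12 (Var 10)))))) Q \<tau> (R(10 := A 12 0, 11 := 0)) A"
  proof (rule wp_Loop[where f = "\<lambda>R' A'. length xs - R' 11" and I = "\<lambda>\<tau>' R' A'. \<exists>i<length xs. \<tau>' = \<tau> + i \<and>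
      R' 10 = elt (Suc i) \<and> R' 11 = i \<and> (\<forall>x. x \<notin> {10, 11} \<longrightarrow> R' x = R x) \<and> (\<forall>a. a \<noteq> 13 \<longrightarrow> A' a = A a) \<and>
      (\<forall>l. 1 \<le> l \<and> l \<le> i \<longrightarrow> A' 13 (xs ! l - 1) = l - 1)"], goal_cases)
    case 1
    show ?case using n12[of 0] L(3,4) len by (intro exI[of _ 0]) (auto simp: elt_def hd_conv_nth)
  next
    case (2 \<tau>' R' A')
    then obtain i where i: "i < length xs" "\<tau>' = \<tau> + i" "R' 10 = elt (Suc i)"
      "\<forall>x. x \<notin> {10, 11} \<longrightarrow> R' x = R x" "\<forall>a. a \<noteq> 13 \<longrightarrow> A' a = A a"
      "\<forall>l. 1 \<le> l \<and> l \<le> i \<longrightarrow> A' 13 (xs ! l - 1) = l - 1" by blast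
    have "elt (Suc i) = 0" using 2(2) i(3) by simp
    then have il: "length xs = Suc i" using pos[of "Suc i"] i(1) by (auto simp: elt_def split: if_splits)
    show ?case
    proof (rule Q)
      show "\<tau>' \<le> \<tau> + n * (2 * d + 2)" using i(2) il len by simp
      show "dp_regs s d R'" "R' 2 = n" using R i(4) by (simp_all add: dp_regs_def)
    qed (use i(5,6) A il in auto)
  next
    case (3 \<tau>' R' A')
    then obtain i where i: "i < length xs" "\<tau>' = \<tau> + i" "R' 10 = elt (Suc i)" "R' 11 = i"
      "\<forall>x. x \<notin> {10, 11} \<longrightarrow> R' x = R x" "\<forall>a. a \<noteq> 13 \<longrightarrow> A' a = A a"
      "\<forall>l. 1 \<le> l \<and> l \<le> i \<longrightarrow> A' 13 (xs ! l - 1) = l - 1" by blast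
    have si: "Suc i < length xs" using 3(2) i(3) by (auto simp: elt_def split: if_splits)
    have im: "i \<le> m" "Suc i \<le> m" using si len nodes_le_m by linarith+
    have at2: "A 12 (elt (Suc i)) = elt (Suc (Suc i))" "elt (Suc (Suc i)) \<le> m"
      using n12[OF si] xm by (auto simp: elt_def)
    have ats: "elt (Suc i) = xs ! Suc i" using si by (simp add: elt_def)
    let ?A = "A'(13 := (A' 13)(elt (Suc i) - 1 := i))"
    have res: "\<forall>l. 1 \<le> l \<and> l \<le> Suc i \<longrightarrow> ?A 13 (xs ! l - 1) = l - 1"
    proof (intro allI impI)
      fix l assume l: "1 \<le> l \<and> l \<le> Suc i"
      show "?A 13 (xs ! l - 1) = l - 1"
      proof (cases "l = Suc i")
        case True then show ?thesis using ats by simp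
      next
        case False
        then have "xs ! l \<noteq> xs ! Suc i" using nth_eq_iff_index_eq[OF L(2), of l "Suc i"] l si by auto
        then have "xs ! l - 1 \<noteq> xs ! Suc i - 1" using pos[of l] pos[of "Suc i"] l si by auto
        then show ?thesis using i(7) l False ats by simp
      qed
    qed
    have "\<exists>i'<length xs. Suc \<tau>' = \<tau> + i' \<and> (R'(11 := Suc i, 10 := elt (Suc (Suc i)))) 10 = elt (Suc i') \<and>
        (R'(11 := Suc i, 10 := elt (Suc (Suc i)))) 11 = i' \<and> (\<forall>x. x \<notin> {10, 11} \<longrightarrow> (R'(11 := Suc i, 10 := elt (Suc (Suc i)))) x = R x) \<and>
        (\<forall>a. a \<noteq> 13 \<longrightarrow> ?A a = A a) \<and> (\<forall>l. 1 \<le> l \<and> l \<le> i' \<longrightarrow> ?A 13 (xs ! l - 1) = l - 1)"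
      using si i res by (intro exI[of _ "Suc i"] conjI) simp_all
    then show ?case
      apply -
      apply (rule wp_Sq, rule wp_Put)
      using i im apply simp
      apply (rule wp_Sq, rule wp_Asg)
      using i im apply (simp add: small_def)
      apply (rule wp_Asg)
      using i at2 apply (simp add: small_def)
      using i at2 si by simp
  qed
  moreover have "A 12 0 \<le> m" using n12[of 0] len L(3,4) xm by (auto simp: elt_def hd_conv_nth)
  ultimately show ?thesis unfolding number_com_def by (intro wp_Sq wp_Asg) (auto simp: small_def)
qed

lemma wp_times:
  assumes R: "dp_regs s d R" "R 2 = n" and A: "A 0 = inn" "A 1 = out"
    and Q: "\<And>R' A'. dp_regs s d R' \<Longrightarrow> R' 2 = n \<Longrightarrow>
      (\<And>v e. v < n \<Longrightarrow> e < 2 * d \<Longrightarrow> A' 13 (node v e - 1) = A 13 (node v e - 1)) \<Longrightarrow>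
      (\<And>v. v < n \<Longrightarrow> A' 13 (node v (2 * d) - 1) = inn v) \<Longrightarrow>
      (\<And>v. v < n \<Longrightarrow> A' 13 (node v (2 * d + 1) - 1) = (if out v \<noteq> 0 then out v else n)) \<Longrightarrow> Q (\<tau> + n) R' A'"
  shows "wp times_com Q \<tau> R A"
  unfolding times_com_def
proof (rule wp_For[where N = n and I = "\<lambda>i \<tau>' R' A'. \<tau>' = \<tau> + i \<and> (\<forall>x. x \<noteq> 12 \<longrightarrow> R' x = R x) \<and>
    (\<forall>a. a \<noteq> 13 \<longrightarrow> A' a = A a) \<and> (\<forall>v e. e < 2 * d \<longrightarrow> A' 13 (node v e - 1) = A 13 (node v e - 1)) \<and>
    (\<forall>v<i. A' 13 (node v (2 * d) - 1) = inn v \<and> A' 13 (node v (2 * d + 1) - 1) = (if out v \<noteq> 0 then out v else n))"], goal_cases)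
  case (4 i \<tau>' R' A')
  have fr: "R' 12 = i" "R' 53 = 2 * d" "R' 2 = n" "A' 0 = inn" "A' 1 = out" using 4 R A by (auto simp: dp_regs_def)
  have nd: "ev R' A'' (\<lambda>_. 0) (nodeE (Var 12) (Var 53)) = node i (2 * d)" for A''
    using ev_nodeE[of R' A'' "\<lambda>_. 0" "Var 12" "Var 53"] fr by simp
  have nm: "node i (2 * d + 1) - 1 = node i (2 * d)" by (simp add: node_def)
  have ne: "node v e - 1 \<noteq> node i e' - 1" if "e < 2 * d + 2" "e' < 2 * d + 2" "v \<noteq> i \<or> e \<noteq> e'" for v e e'
    using node_inj[of e e' v i] that node_pos[of v e] node_pos[of i e'] by auto
  have b: "inn i \<le> m" "(if out i \<noteq> 0 then out i else n) \<le> m"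
    using ord_inn[OF 4(1)] out_bounds[OF 4(1)] m_bounds by auto
  let ?A = "A'(13 := (A' 13)(node i (2 * d) - 1 := inn i, node i (2 * d + 1) - 1 := (if out i \<noteq> 0 then out i else n)))"
  have e1: "ev R' A' (\<lambda>_. 0) (ESub (nodeE (Var 12) (Var 53)) (Num 1)) = node i (2 * d) - 1"
    "ev R' A' (\<lambda>_. 0) (Arr 0 (Var 12)) = inn i" using nd fr by simp_all
  let ?A1 = "A'(13 := (A' 13)(node i (2 * d) - 1 := inn i))"
  have e2: "ev R' ?A1 (\<lambda>_. 0) (nodeE (Var 12) (Var 53)) = node i (2 * d + 1) - 1"
    "ev R' ?A1 (\<lambda>_. 0) (Ite (Arr 1 (Var 12)) (Arr 1 (Var 12)) (Var 2)) = (if out i \<noteq> 0 then out i else n)"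
    using nd nm fr by simp_all
  have upd: "?A1(13 := (?A1 13)(node i (2 * d + 1) - 1 := (if out i \<noteq> 0 then out i else n))) = ?A" by simp
  have fin: "(\<forall>a. a \<noteq> 13 \<longrightarrow> ?A a = A a) \<and> (\<forall>v e. e < 2 * d \<longrightarrow> ?A 13 (node v e - 1) = A 13 (node v e - 1)) \<and>
    (\<forall>v<Suc i. ?A 13 (node v (2 * d) - 1) = inn v \<and> ?A 13 (node v (2 * d + 1) - 1) = (if out v \<noteq> 0 then out v else n))"
  proof (intro conjI allI impI)
    fix v e assume "e < 2 * d"
    then show "?A 13 (node v e - 1) = A 13 (node v e - 1)"
      using 4(3) ne[of e "2 * d" v] ne[of e "2 * d + 1" v] by simp
  next
    fix v assume v: "v < Suc i"
    show "?A 13 (node v (2 * d) - 1) = inn v" "?A 13 (node v (2 * d + 1) - 1) = (if out v \<noteq> 0 then out v else n)"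
      using 4(3) v ne[of "2 * d" "2 * d" v] ne[of "2 * d" "2 * d + 1" v] ne[of "2 * d + 1" "2 * d" v] ne[of "2 * d + 1" "2 * d + 1" v]
      by (cases "v = i"; simp)+
  qed (use 4(3) in simp)
  show ?case
    apply (rule wp_Sq, rule wp_Put, unfold e1, rule b(1))
    apply (rule wp_Put, unfold e2, rule b(2))
    unfolding upd using fin 4(2,3) by (intro conjI) simp_all
next
  case (5 \<tau>' R' A')
  have "dp_regs s d R'" "R' 2 = n" using 5 R by (simp_all add: dp_regs_def)
  then have "Q (\<tau> + n) R' A'" using 5 by (intro Q) auto
  then show ?case using 5 by simp
qed (use R m_bounds in \<open>auto simp: small_def\<close>)

text \<open>In the last dimension, two vertices meet iff they share a bag. For such a pair, the
  other dimensions express adjacency by the ranks in the bag where the later one enters; all other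
  pairs are nonadjacent.\<close>

lemma output_okI:
  assumes xs: "list_inv n 0 nx xs"
    and X1: "\<And>i. 1 \<le> i \<Longrightarrow> i < length xs \<Longrightarrow> X (xs ! i - 1) = i - 1"
    and X2: "\<And>v. v < n \<Longrightarrow> X (node v (2 * d) - 1) = inn v"
    and X3: "\<And>v. v < n \<Longrightarrow> X (node v (2 * d + 1) - 1) = (if out v \<noteq> 0 then out v else n)"
  shows "output_ok E n d X"
proof -
  have L: "distinct xs" "xs \<noteq> []" "hd xs = 0"
    "set xs = insert 0 {node v e' | v e'. v < n \<and> inn v \<le> n \<and> e' < 2 * d}"
    "\<And>j. j \<le> n \<Longrightarrow> sorted_on (nodes j) (node_rank j) xs"
    using xs unfolding list_inv_def by auto
  have idx: "\<exists>i. 1 \<le> i \<and> i < length xs \<and> xs ! i = node v e \<and> X (node v e - 1) = i - 1"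
    if v: "v < n" "e < 2 * d" for v e
  proof -
    have "node v e \<in> set xs" unfolding L(4) using v ord_inn[of v] by blast
    then obtain i where i: "i < length xs" "xs ! i = node v e" unfolding in_set_conv_nth by blast
    have "i \<noteq> 0" using i node_pos[of v e] L(2,3) by (cases i) (auto simp: hd_conv_nth)
    then show ?thesis using i X1[of i] by (intro exI[of _ i]) auto
  qed
  \<comment> \<open>Different endpoints have different coordinates, so the comparison of closed
    intervals coincides with the strict comparison of ranks.\<close>
  have cmp: "X (node u e - 1) \<le> X (node v e' - 1) \<longleftrightarrow> rank j u e < rank j v e'"
    if j: "j \<le> n" "u \<in> bag j" "v \<in> bag j" "e < 2 * d" "e' < 2 * d" "(u, e) \<noteq> (v, e')" for j u v e e'
  proof -
    obtain i where i: "1 \<le> i" "i < length xs" "xs ! i = node u e" "X (node u e - 1) = i - 1"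
      using idx[OF bag_n[OF j(2)] j(4)] by blast
    obtain l where l: "1 \<le> l" "l < length xs" "xs ! l = node v e'" "X (node v e' - 1) = l - 1"
      using idx[OF bag_n[OF j(3)] j(5)] by blast
    have il: "i \<noteq> l" using i(3) l(3) node_inj[of e e' u v] j by auto
    have "rank j u e \<noteq> rank j v e'" by (rule rank_inj[OF j])
    then have "node_rank j (xs ! i) < node_rank j (xs ! l) \<longleftrightarrow> i < l"
      by (intro sorted_on_nth[OF L(5)[OF j(1)] i(2) l(2)])
        (use i l j node_in_nodes node_rank_node in auto)
    then have "rank j u e < rank j v e' \<longleftrightarrow> i < l" using i l j node_rank_node by simp
    then show ?thesis using i l il by auto
  qed
  \<comment> \<open>The numbering of the nodes is chosen so that, lowered by one, they are exactly
    the offsets of the output format.\<close>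
  have addr: "2 * ((d + 1) * v + i) = node v (2 * i) - 1" "2 * ((d + 1) * v + i) + 1 = node v (2 * i + 1) - 1" for v i
    by (simp_all add: node_def algebra_simps)
  define last where "last v = (if out v \<noteq> 0 then out v else n)" for v
  have last: "inn v \<le> last v" "last v \<le> n" if "v < n" for v
    using ord_inn[OF that] out_bounds[OF that] by (auto simp: last_def)
  have bag_last: "v \<in> bag j \<longleftrightarrow> v < n \<and> inn v \<le> j \<and> j \<le> last v" if "j \<le> n" for j v
    using that by (auto simp: bag_def last_def)
  have lohi: "X (2 * ((d + 1) * v + i)) \<le> X (2 * ((d + 1) * v + i) + 1)" if v: "v < n" "i < d + 1" for v i
  proof (cases "i = d")
    case True
    then show ?thesis unfolding addr(2) unfolding addr(1) using X2[OF v(1)] X3[OF v(1)] last[OF v(1)] by (simp add: last_def)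
  next
    case False
    then have i: "i < d" using v by simp
    define j where "j = inn v - 1"
    have j: "j < n" "Suc j = inn v" "ord (Suc j) = v" using ord_inn[OF v(1)] by (auto simp: j_def)
    have b: "v \<in> bag (Suc j)" using bag_Suc[OF j(1)] j(3) by simp
    have "rank (Suc j) v (2 * i) < rank (Suc j) v (2 * i + 1)" using rank_own[OF j(1) i] j(3) by simp
    then show ?thesis unfolding addr(2) unfolding addr(1) using cmp[of "Suc j" v v "2 * i" "2 * i + 1"] b j i by simp
  qed
  have adj: "E u v \<longleftrightarrow> (\<forall>i<d+1. X (2 * ((d + 1) * u + i)) \<le> X (2 * ((d + 1) * v + i) + 1) \<and>
        X (2 * ((d + 1) * v + i)) \<le> X (2 * ((d + 1) * u + i) + 1))"
    if uv: "u < n" "v < n" "u \<noteq> v" "inn u \<le> inn v" for u v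
  proof -
    have split: "(\<forall>i<d+1. X (2 * ((d + 1) * u + i)) \<le> X (2 * ((d + 1) * v + i) + 1) \<and>
        X (2 * ((d + 1) * v + i)) \<le> X (2 * ((d + 1) * u + i) + 1)) \<longleftrightarrow>
      (\<forall>i<d. X (node u (2 * i) - 1) \<le> X (node v (2 * i + 1) - 1) \<and> X (node v (2 * i) - 1) \<le> X (node u (2 * i + 1) - 1)) \<and>
      inn u \<le> last v \<and> inn v \<le> last u"
      unfolding addr(2) unfolding addr(1) using X2 X3 uv by (auto simp: less_Suc_eq last_def)
    define j where "j = inn v - 1"
    have j: "j < n" "Suc j = inn v" "ord (Suc j) = v" using ord_inn[OF uv(2)] by (auto simp: j_def)
    show ?thesis
    proof (cases "inn v \<le> last u")
      case False
      have "\<not> E u v"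
      proof
        assume "E u v"
        then have "u \<in> bag (inn v)" using edge_bag uv(4) by blast
        then show False using False bag_last[of "inn v" u] ord_inn[OF uv(2)] by simp
      qed
      then show ?thesis unfolding split using False by blast
    next
      case True
      have b: "u \<in> bag (Suc j)" "v \<in> bag (Suc j)"
        using bag_last[of "Suc j"] True uv j last[OF uv(2)] by auto
      have "E v u \<longleftrightarrow> (\<forall>i<d. rank (Suc j) v (2 * i) < rank (Suc j) u (2 * i + 1) \<and>
         rank (Suc j) u (2 * i) < rank (Suc j) v (2 * i + 1))"
        using rank_adjacent[OF j(1) b(1)] j(3) uv(3) by simp
      also have "\<dots> \<longleftrightarrow> (\<forall>i<d. X (node v (2 * i) - 1) \<le> X (node u (2 * i + 1) - 1) \<and>
         X (node u (2 * i) - 1) \<le> X (node v (2 * i + 1) - 1))"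
        using cmp[of "Suc j" v u] cmp[of "Suc j" u v] b j uv(3) by simp
      finally have "E v u \<longleftrightarrow> (\<forall>i<d. X (node v (2 * i) - 1) \<le> X (node u (2 * i + 1) - 1) \<and>
         X (node u (2 * i) - 1) \<le> X (node v (2 * i + 1) - 1))" .
      moreover have "E u v \<longleftrightarrow> E v u" using E_sym by blast
      moreover have "inn u \<le> last v" using uv(4) last[OF uv(2)] by linarith
      ultimately show ?thesis unfolding split using True by blast
    qed
  qed
  show ?thesis
    unfolding output_ok_def
  proof (intro conjI allI impI)
    fix v i assume "v < n" "i < d + 1"
    then show "X (2 * ((d + 1) * v + i)) \<le> X (2 * ((d + 1) * v + i) + 1)" by (rule lohi)
  next
    fix u v assume uv: "u < n" "v < n" "u \<noteq> v"
    show "E u v \<longleftrightarrow> (\<forall>i<d+1. X (2 * ((d + 1) * u + i)) \<le> X (2 * ((d + 1) * v + i) + 1) \<and>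
        X (2 * ((d + 1) * v + i)) \<le> X (2 * ((d + 1) * u + i) + 1))"
    proof (cases "inn u \<le> inn v")
      case True
      then show ?thesis by (rule adj[OF uv])
    next
      case False
      have "E u v \<longleftrightarrow> E v u" using E_sym by blast
      also have "\<dots> \<longleftrightarrow> (\<forall>i<d+1. X (2 * ((d + 1) * v + i)) \<le> X (2 * ((d + 1) * u + i) + 1) \<and>
        X (2 * ((d + 1) * u + i)) \<le> X (2 * ((d + 1) * v + i) + 1))"
        by (rule adj) (use uv False in auto)
      finally show ?thesis by blast
    qed
  qed
qed

end

section \<open>The complete algorithm\<close>

definition interval_rep :: "(nat \<Rightarrow> nat \<Rightarrow> bool) \<Rightarrow> nat \<Rightarrow> nat \<Rightarrow> (nat \<Rightarrow> nat \<Rightarrow> real) \<Rightarrow> (nat \<Rightarrow> nat \<Rightarrow> real) \<Rightarrow> bool" where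
  "interval_rep E n d lo hi \<longleftrightarrow> (\<forall>v<n. \<forall>i<d. lo v i \<le> hi v i) \<and>
     (\<forall>u<n. \<forall>v<n. u \<noteq> v \<longrightarrow> (E u v \<longleftrightarrow> (\<forall>i<d. lo u i \<le> hi v i \<and> lo v i \<le> hi u i)))"

text \<open>The summands are the shares per vertex of decomposition, slots, search, backtracking,
  insertion, numbering and bag times, with \<open>H\<close>, \<open>s\<close> and
  \<open>2 * d\<close> replaced by \<open>b\<close>.\<close>

definition iterations :: "nat \<Rightarrow> nat \<Rightarrow> nat" where
  "iterations k b = (2 * k + 2) * (b + 1) + (b + 1) + 2 * k + (b + 1) * (3 * (b + 1) + 1) + 1 + (b + 1) + (b + 2) + 1"

context algorithm
begin

text \<open>The bound \<open>hi\<close> on the occupied positions becomes the number of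
  slots.\<close>

lemma bags_of_tokens:
  assumes inv: "token_inv inn out cur T ord n r hi"
  shows "bags E n inn out ord hi" "j \<le> n \<Longrightarrow> card (bags.bag n inn out j) \<le> hi"
proof -
  have nz: "inn v \<noteq> 0" if "v < n" for v by (rule token_inv_complete[OF inv that])
  show B: "bags E n inn out ord hi"
  proof
    fix j assume "1 \<le> j" "j \<le> n"
    then show "ord j < n \<and> inn (ord j) = j" by (rule token_inv_ord[OF inv])
  next
    fix v assume v: "v < n"
    show "1 \<le> inn v \<and> inn v \<le> n \<and> ord (inn v) = v" using token_inv_inn[OF inv v nz[OF v]] nz[OF v] by simp
  next
    fix v assume "v < n" "out v \<noteq> 0"
    then show "inn v \<le> out v \<and> out v \<le> n" using token_inv_out[OF inv] by blast
  next
    fix u v assume e: "E u v"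
    then have "u < n" "v < n" using E_less by auto
    moreover have "u \<noteq> v" using e E_irrefl by blast
    ultimately show "u < n \<and> v < n \<and> u \<noteq> v \<and> (out u = 0 \<or> inn v \<le> out u)"
      using token_inv_out[OF inv, of u] e by blast
  next
    show "1 \<le> hi" by (rule token_invD(3)[OF inv])
  qed
  assume "j \<le> n"
  moreover have "bags.bag n inn out j = alive inn out j"
    unfolding bags.bag_def[OF B] alive_def using nz by blast
  ultimately show "card (bags.bag n inn out j) \<le> hi" using token_inv_card[OF inv] by simp
qed

lemma iterations_bound:
  assumes "H \<le> b" "s \<le> b" "2 * d \<le> b"
    "\<tau> \<le> (2 * (k * n) + 2 * n) * (H + 1) + (n * (s + 1) + 2 * (k * n)) + (s + 1) * ((n + 2) * (b + 1) + 1) + n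
      + n * (2 * d + 1) + n * (2 * d + 2) + n"
  shows "\<tau> \<le> n * iterations k b"
proof -
  have "(2 * (k * n) + 2 * n) * (H + 1) \<le> n * ((2 * k + 2) * (b + 1))"
  proof -
    have "(2 * (k * n) + 2 * n) * (H + 1) = n * ((2 * k + 2) * (H + 1))" by (simp add: algebra_simps)
    also have "\<dots> \<le> n * ((2 * k + 2) * (b + 1))" using assms(1) by (intro mult_le_mono2) simp
    finally show ?thesis .
  qed
  moreover have "n * (s + 1) + 2 * (k * n) \<le> n * ((b + 1) + 2 * k)"
  proof -
    have "n * (s + 1) \<le> n * (b + 1)" using assms(2) by (intro mult_le_mono2) simp
    then show ?thesis by (simp add: algebra_simps)
  qed
  moreover have "(s + 1) * ((n + 2) * (b + 1) + 1) \<le> n * ((b + 1) * (3 * (b + 1) + 1))"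
  proof -
    \<comment> \<open>As \<open>n\<close> is positive, \<open>n + 2\<close> is at most
      \<open>3 * n\<close>; this is the factor 3 in \<open>iterations\<close>.\<close>
    have "(n + 2) * (b + 1) + 1 \<le> (3 * n) * (b + 1) + n" using n_pos by (intro add_mono mult_le_mono1) auto
    also have "\<dots> = n * (3 * (b + 1) + 1)" by (simp add: algebra_simps)
    finally have "(s + 1) * ((n + 2) * (b + 1) + 1) \<le> (b + 1) * (n * (3 * (b + 1) + 1))"
      using assms(2) by (intro mult_le_mono) auto
    then show ?thesis by (simp only: mult.left_commute)
  qed
  moreover have "n * (2 * d + 1) \<le> n * (b + 1)" "n * (2 * d + 2) \<le> n * (b + 2)"
    using assms(3) by (auto intro!: mult_le_mono2)
  ultimately have "\<tau> \<le> n * ((2 * k + 2) * (b + 1)) + n * ((b + 1) + 2 * k) + n * ((b + 1) * (3 * (b + 1) + 1)) + n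
      + n * (b + 1) + n * (b + 2) + n"
    using assms(4) by linarith
  also have "\<dots> = n * iterations k b" unfolding iterations_def by (simp only: add_mult_distrib2 mult_1_right)
  finally show ?thesis .
qed

lemma wp_main:
  assumes b_huge: "(2 * H * H + 1) ^ (2 * H * H) + 2 * H * H \<le> b"
  shows "wp main_com (\<lambda>\<tau> R A. \<tau> \<le> n * iterations k b \<and> (\<exists>d. R 0 = Suc d \<and> R 1 = 0 \<and> R 10 = n * (2 * d + 2) \<and>
    n * (2 * d + 2) \<le> m \<and> output_ok E n d (A 13) \<and> (\<forall>d0 lo hi. interval_rep E n d0 lo hi \<longrightarrow> d \<le> d0)))
    0 (\<lambda>_. 0) (\<lambda>_ _. 0)"
  unfolding main_com_def
proof (rule wp_Sq, rule wp_mono[OF wp_decompose], goal_cases)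
  case (4 \<tau>1 R1 A1)
  let ?inn = "A1 0" and ?out = "A1 1" and ?ord = "A1 4" and ?s = "R1 50"
  have tau1: "\<tau>1 \<le> (2 * (k * n) + 2 * n) * (H + 1)" and R12: "R1 2 = n"
    and inv: "token_inv ?inn ?out (A1 2) (A1 3) ?ord n (R1 4) ?s"
    and zero: "\<forall>a\<ge>5. a \<noteq> 14 \<longrightarrow> A1 a = (\<lambda>_. 0)" using 4 by auto
  have sH: "?s \<le> H" by (rule token_invD(4)[OF inv])
  have ss: "2 * ?s * ?s \<le> 2 * H * H" using sH by (intro mult_le_mono) auto
  have "(2 * ?s * ?s + 1) ^ (2 * ?s * ?s) \<le> (2 * H * H + 1) ^ (2 * ?s * ?s)"
    using ss by (intro power_mono) auto
  also have "\<dots> \<le> (2 * H * H + 1) ^ (2 * H * H)" by (rule power_increasing[OF ss]) simp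
  finally have large: "(2 * ?s * ?s + 1) ^ (2 * ?s * ?s) + 2 * ?s * ?s \<le> b" using ss b_huge by linarith
  interpret B0: bags E n ?inn ?out ?ord ?s by (rule bags_of_tokens(1)[OF inv])
  interpret B: dp_algorithm E n k Ws adj F m b inp ?inn ?out ?ord ?s
  proof
    show "?s \<le> b" using sH pow_le_b by linarith
    show "card (B0.bag j) \<le> ?s" if "j \<le> n" for j by (rule bags_of_tokens(2)[OF inv that])
  qed (rule large)
  show ?case
  proof (rule wp_Sq, rule B.wp_slots, goal_cases)
    case (9 \<tau>2 R2 A2)
    have base2: "B.base A2" unfolding B.base_def using 9 by simp
    show ?case
    proof (rule wp_Sq, rule B.wp_search[OF 9(3,2) base2], goal_cases)
      case (1 \<tau>3 R3 A3 d)
      have T: "d \<le> ?s" "dp_regs ?s d R3" "R3 2 = n" "\<forall>a<9. A3 a = A2 a" "powers ?s d A3"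
        "\<forall>d0<d. \<not> B.feasible A2 d0" using 1(2) by (auto simp: B.tried_def)
      \<comment> \<open>A representation of the whole graph is also a local one and yields a
        sequence of states. With fewer than \<open>d\<close> dimensions, it would contradict the
        failure of that earlier attempt.\<close>
      have minimal: "d \<le> d0" if rep: "interval_rep E n d0 lo hi" for d0 lo hi
      proof (rule ccontr)
        assume "\<not> d \<le> d0"
        then have nf: "\<not> B.feasible A2 d0" using T(6) by simp
        have "B0.local_rep d0 lo hi"
          unfolding B0.local_rep_def
        proof (intro conjI allI impI ballI)
          fix v i assume "v < n" "i < d0"
          then show "lo v i \<le> hi v i" using rep unfolding interval_rep_def by blast
        next
          fix j u v assume "j \<le> n" "u \<in> B0.bag j" "v \<in> B0.bag j" "u \<noteq> v"
          moreover from this have "u < n" "v < n" unfolding B0.bag_def by blast+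
          ultimately show "E u v \<longleftrightarrow> (\<forall>i<d0. lo u i \<le> hi v i \<and> lo v i \<le> hi u i)"
            using rep unfolding interval_rep_def by blast
        qed
        then have "B.feasible A2 d0"
          using B0.local_rep_states[of A2 d0 lo hi] base2 B.card_bag unfolding B.base_def B.feasible_def by blast
        then show False using nf by blast
      qed
      show ?case
      proof (rule wp_Sq, rule B.wp_backtrack[OF 1(2,3)], goal_cases)
        case (1 R4 A4)
        have A42: "A4 a = A2 a" if "a < 9" for a using 1(2)[of a] T(4) that by simp
        have trc: "B0.transition A4 d j c c' = B0.transition A2 d j c c'" for j c c'
          by (rule B.transition_cong) (rule A42)
        interpret S: solution E n k Ws adj F m b inp ?inn ?out ?ord ?s A4 d
        proof
          show "B.base A4" by (rule B.base_cong[OF base2 A42])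
          show "powers ?s d A4" using T(5) 1(2) by (simp add: powers_def)
          show "A4 11 j < B.states d" if "j \<le> n" for j using 1(3)[OF that] .
          show "B0.transition A4 d j (A4 11 j) (A4 11 (Suc j))" if "j < n" for j using 1(4)[OF that] trc by simp
        qed (rule T(1))
        have R4: "dp_regs ?s d R4" "R4 2 = n" using T(2,3) 1(1) by (simp_all add: dp_regs_def)
        have d2: "2 * d \<le> b"
        proof -
          have "2 * d * 1 \<le> 2 * d * ?s" using B0.s_pos by (intro mult_le_mono2)
          moreover have "2 * d * ?s = 2 * ?s * d" by simp
          ultimately show ?thesis using B.D_le(2)[OF T(1)] by linarith
        qed
        show ?case
        proof (rule wp_Sq, rule S.wp_insert[OF R4], goal_cases)
          case (1 R5 A5 xs)
          note I5 = 1
          show ?case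
          proof (rule wp_Sq, rule S.wp_number[OF I5(1,2,3,4)], goal_cases)
            case (2 \<tau>6 R6 A6)
            have A601: "A6 0 = ?inn" "A6 1 = ?out" using S.base0[unfolded B.base_def] 2(4)[of 0] 2(4)[of 1] by simp_all
            show ?case
            proof (rule wp_Sq, rule S.wp_times[OF 2(2,3) A601], goal_cases)
              case (1 R7 A7)
              have X1: "A7 13 (xs ! i - 1) = i - 1" if i: "1 \<le> i" "i < length xs" for i
              proof -
                have L: "distinct xs" "xs \<noteq> []" "hd xs = 0"
                  "set xs = insert 0 {S.node v e' | v e'. v < n \<and> ?inn v \<le> n \<and> e' < 2 * d}"
                  using I5(4) unfolding S.list_inv_def by auto
                have "xs ! i \<noteq> xs ! 0" using nth_eq_iff_index_eq[OF L(1), of i 0] i L(2) by auto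
                then have "xs ! i \<noteq> 0" using L(2,3) by (simp add: hd_conv_nth)
                moreover have "xs ! i \<in> set xs" using i by simp
                ultimately obtain v e where v: "xs ! i = S.node v e" "v < n" "e < 2 * d" unfolding L(4) by (elim insertE CollectE exE conjE) simp_all
                show ?thesis using 1(3)[OF v(2,3)] 2(5)[OF i] v(1) by simp
              qed
              have ok: "output_ok E n d (A7 13)"
                by (rule S.output_okI[OF I5(4) X1]) (use 1(4,5) in auto)
              have R7: "R7 2 = n" "R7 52 = d" "R7 53 = 2 * d" using 1(1,2) by (auto simp: dp_regs_def)
              have tau: "\<tau>6 + n \<le> n * iterations k b"
              proof (rule iterations_bound[OF pow_le_b B.s_le d2])
                show "\<tau>6 + n \<le> (2 * (k * n) + 2 * n) * (H + 1) + (n * (?s + 1) + 2 * (k * n))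
                  + (?s + 1) * ((n + 2) * (b + 1) + 1) + n + n * (2 * d + 1) + n * (2 * d + 2) + n"
                  using tau1 9(1) \<open>\<tau>3 \<le> _\<close> 2(1) by linarith
              qed
              have d1m: "d + 1 \<le> m" using d2 m_bounds n_pos by linarith
              have e: "ev R (A7) (\<lambda>_. 0) (EAdd (Mul 0 53 (Var 2)) (EAdd (Var 2) (Var 2))) = n * (2 * d + 2)"
                if "R 2 = n" "R 53 = 2 * d" for R using that by (simp add: algebra_simps)
              show ?case
                unfolding finish_com_def
              proof (rule wp_Sq, rule wp_Asg, goal_cases)
                case 1 then show ?case using d1m R7 by (simp add: small_def)
              next
                case 2
                show ?case
                proof (rule wp_Sq, rule wp_Asg, simp, rule wp_Asg, goal_cases)
                  case 1 then show ?case by (subst e) (use R7 S.nodes_le_m in \<open>auto simp: small_def\<close>)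
                next
                  case 2
                  show ?case
                    apply (subst e)
                    using R7 apply (simp, simp)
                    using tau ok minimal S.nodes_le_m R7 by (auto intro!: exI[of _ d])
                qed
              qed
            qed
          qed
        qed
      qed
    qed
  qed (use R12 zero in auto)
qed auto

end

text \<open>The pointer at address \<open>n + 1\<close> marks the end of the last adjacency list,
  which is the first free address \<open>F\<close>.\<close>

definition prologue :: prog where
  "prologue = Seq (Const 200 0) (Seq (Load 201 200) (Seq (Const 202 1) (Seq (Add 201 201 202) (Load 100 201))))"

text \<open>Array 13 is compacted in place: the cell \<open>i\<close> of the output lies at or before the cell \<open>i\<close> of the
  array, so that no cell is overwritten before it is read.\<close>

definition copy_body :: prog where
  "copy_body = Seq (move 302 300) (Seq (array_address 13 302) (Seq (Load 303 302) (Seq (Store 300 303)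
     (Seq (Add 300 300 301) (Sub 10 10 301)))))"

definition epilogue :: prog where
  "epilogue = Seq (Const 300 0) (Seq (Const 301 1) (While 10 copy_body))"

lemma exec_copy:
  assumes "Rr 10 = p" "Rr 300 = i" "Rr 301 = 1" "Rr 100 = F"
    and "\<forall>a<i. M a = X a" "\<forall>a\<ge>i. M (F + 16 * a + 13) = X a" "\<forall>a. X a \<le> W" "F + 16 * (i + p) + 13 \<le> W"
  shows "\<exists>Rr' M'. exec W (While 10 copy_body) (Rr, M) (14 * p + 1) (Rr', M') \<and> Rr' 0 = Rr 0 \<and> Rr' 1 = Rr 1 \<and>
    (\<forall>a<i + p. M' a = X a)"
  using assms
proof (induction p arbitrary: Rr i M)
  case 0
  have "exec W (While 10 copy_body) (Rr, M) 1 (Rr, M)" by (rule exec.WhileFalse) (use 0 in simp)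
  then show ?case using 0 by (intro exI[of _ Rr] exI[of _ M]) simp
next
  case (Suc p)
  define R1 where "R1 = Rr(302 := F + 16 * i + 13, 303 := 13)"
  define R2 where "R2 = Rr(302 := F + 16 * i + 13, 303 := X i, 300 := Suc i, 10 := p)"
  define M2 where "M2 = M(i := X i)"
  have "F + 16 * i + 16 * p + 29 \<le> W" using Suc.prems(8) by (simp add: algebra_simps)
  then have iW: "F + 16 * i + 13 \<le> W" "Suc i \<le> W" by simp_all
  have Mi: "M (F + 16 * i + 13) = X i" using Suc.prems(6) by blast
  have e1: "exec W (move 302 300) (Rr, M) 2 (Rr(302 := i), M)"
    using exec_move[of 302 300 "(Rr, M)" W] Suc.prems(2) iW by simp
  have e2: "exec W (array_address 13 302) (Rr(302 := i), M) 7 (R1, M)"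
    using exec_array_address[of 302 "(Rr(302 := i), M)" 13 W] Suc.prems(4) iW by (simp add: R1_def)
  have e3: "exec W (Load 303 302) (R1, M) 1 (R1(303 := X i), M)"
    using exec_Load'[of "(R1, M)" 302 W 303] Mi Suc.prems(7) by (simp add: R1_def)
  have e4: "exec W (Store 300 303) (R1(303 := X i), M) 1 (R1(303 := X i), M2)"
    using exec_Store'[of W 300 303 "(R1(303 := X i), M)"] Suc.prems(2) by (simp add: R1_def M2_def)
  have e5: "exec W (Add 300 300 301) (R1(303 := X i), M2) 1 (R1(303 := X i, 300 := Suc i), M2)"
    using exec_Add'[of "(R1(303 := X i), M2)" 300 301 W 300] Suc.prems(2,3) iW by (simp add: R1_def)
  have R2: "R1(303 := X i, 300 := Suc i, 10 := p) = R2" by (auto simp: R1_def R2_def fun_eq_iff)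
  have e6: "exec W (Sub 10 10 301) (R1(303 := X i, 300 := Suc i), M2) 1 (R2, M2)"
    using exec_Sub'[of W 10 10 301 "(R1(303 := X i, 300 := Suc i), M2)"] Suc.prems(1,3) R2 by (simp add: R1_def)
  have body: "exec W copy_body (Rr, M) (2 + (7 + (1 + (1 + (1 + 1))))) (R2, M2)"
    unfolding copy_body_def by (intro exec.Seq[OF e1] exec.Seq[OF e2] exec.Seq[OF e3] exec.Seq[OF e4] exec.Seq[OF e5] e6)
  have "\<exists>Rr' M'. exec W (While 10 copy_body) (R2, M2) (14 * p + 1) (Rr', M') \<and> Rr' 0 = R2 0 \<and> Rr' 1 = R2 1 \<and>
    (\<forall>a<Suc i + p. M' a = X a)"
  proof (rule Suc.IH)
    show "\<forall>a<Suc i. M2 a = X a" using Suc.prems(5) by (auto simp: M2_def less_Suc_eq)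
    show "\<forall>a\<ge>Suc i. M2 (F + 16 * a + 13) = X a" using Suc.prems(6) by (auto simp: M2_def)
  qed (use Suc.prems in \<open>auto simp: R2_def\<close>)
  then obtain Rr' M' where *: "exec W (While 10 copy_body) (R2, M2) (14 * p + 1) (Rr', M')"
    "Rr' 0 = R2 0" "Rr' 1 = R2 1" "\<forall>a<Suc i + p. M' a = X a" by blast
  have "exec W (While 10 copy_body) (Rr, M) (Suc ((2 + (7 + (1 + (1 + (1 + 1))))) + (14 * p + 1))) (Rr', M')"
    by (rule exec.WhileTrue[OF _ body *(1)]) (use Suc.prems in simp)
  then show ?case using * by (intro exI[of _ Rr'] exI[of _ M']) (auto simp: R2_def)
qed

definition algorithm_prog :: prog where
  "algorithm_prog = Seq prologue (Seq (compile main_com) epilogue)"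

section \<open>Explicit bounds and the connection with boxes\<close>

definition height_bound :: "nat \<Rightarrow> nat" where "height_bound k = 2 ^ (2 * k + 1)"

text \<open>The power covers the number of states and the next summand the base
  \<open>2 * s * d\<close>, for all \<open>d\<close> up to the number \<open>s\<close> of slots,
  itself at most \<open>h\<close>. The last summand covers the tree positions.\<close>

definition small_bound :: "nat \<Rightarrow> nat" where
  "small_bound k = (let h = height_bound k in (2 * h * h + 1) ^ (2 * h * h) + 2 * h * h + h)"

text \<open>Obtained from the choice of \<open>m\<close> by \<open>n + 2 \<le> 3 * n\<close> and by
  the bound \<open>2 * k * n\<close> on the total length of the adjacency lists.\<close>

definition number_bound :: "nat \<Rightarrow> nat" where
  "number_bound k = 3 + 2 * k + 3 * (2 * small_bound k + 8)"

text \<open>The first summand makes the word large enough for all intermediate values and for the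
  addresses of the final copy. The others pay for the main program, the copying at 14 steps per
  cell, and the constant overhead.\<close>

definition time_bound :: "nat \<Rightarrow> nat" where
  "time_bound k = (cost (small_bound k) main_com + 30) * number_bound k
     + cost (small_bound k) main_com * (1 + iterations k (small_bound k)) + 14 * number_bound k + 20"

lemma PiE_interval_Int_nonempty:
  fixes lo hi lo' hi' :: "nat \<Rightarrow> real"
  assumes "\<forall>i<d. lo i \<le> hi i" "\<forall>i<d. lo' i \<le> hi' i"
  shows "(\<Pi>\<^sub>E i\<in>{..<d}. {lo i..hi i}) \<inter> (\<Pi>\<^sub>E i\<in>{..<d}. {lo' i..hi' i}) \<noteq> {} \<longleftrightarrow>
    (\<forall>i<d. lo i \<le> hi' i \<and> lo' i \<le> hi i)"
proof
  assume "(\<Pi>\<^sub>E i\<in>{..<d}. {lo i..hi i}) \<inter> (\<Pi>\<^sub>E i\<in>{..<d}. {lo' i..hi' i}) \<noteq> {}"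
  then obtain x where x: "x \<in> (\<Pi>\<^sub>E i\<in>{..<d}. {lo i..hi i})" "x \<in> (\<Pi>\<^sub>E i\<in>{..<d}. {lo' i..hi' i})" by blast
  have "lo i \<le> x i" "x i \<le> hi i" "lo' i \<le> x i" "x i \<le> hi' i" if "i < d" for i
    using x that by (auto simp: PiE_iff)
  then show "\<forall>i<d. lo i \<le> hi' i \<and> lo' i \<le> hi i" by (meson order_trans)
next
  assume *: "\<forall>i<d. lo i \<le> hi' i \<and> lo' i \<le> hi i"
  define x where "x = restrict (\<lambda>i. max (lo i) (lo' i)) {..<d}"
  have "x \<in> (\<Pi>\<^sub>E i\<in>{..<d}. {lo i..hi i}) \<inter> (\<Pi>\<^sub>E i\<in>{..<d}. {lo' i..hi' i})"
    using * assms by (auto simp: x_def)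
  then show "(\<Pi>\<^sub>E i\<in>{..<d}. {lo i..hi i}) \<inter> (\<Pi>\<^sub>E i\<in>{..<d}. {lo' i..hi' i}) \<noteq> {}" by blast
qed

lemma box_representation_interval_rep:
  assumes "box_representation G d B" "pverts G = {..<n}"
  shows "\<exists>lo hi. interval_rep (\<lambda>u v. (u, v) \<in> parcs G) n d lo hi"
proof -
  have "\<exists>l u. (\<forall>i<d. l i \<le> u i) \<and> B v = (\<Pi>\<^sub>E i\<in>{..<d}. {l i..u i})" if "v < n" for v
    using assms that unfolding box_representation_def is_box_def by simp
  then obtain lo hi where B: "\<And>v. v < n \<Longrightarrow> (\<forall>i<d. lo v i \<le> hi v i) \<and> B v = (\<Pi>\<^sub>E i\<in>{..<d}. {lo v i..hi v i})"
    by metis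
  have "interval_rep (\<lambda>u v. (u, v) \<in> parcs G) n d lo hi"
    unfolding interval_rep_def
  proof (intro conjI allI impI)
    fix v i assume "v < n" "i < d" then show "lo v i \<le> hi v i" using B by blast
  next
    fix u v assume uv: "u < n" "v < n" "u \<noteq> v"
    have "(u, v) \<in> parcs G \<longleftrightarrow> B u \<inter> B v \<noteq> {}"
      using assms uv unfolding box_representation_def by simp
    then show "(u, v) \<in> parcs G \<longleftrightarrow> (\<forall>i<d. lo u i \<le> hi v i \<and> lo v i \<le> hi u i)"
      using B[OF uv(1)] B[OF uv(2)] PiE_interval_Int_nonempty[of d "lo u" "hi u" "lo v" "hi v"] by simp
  qed
  then show ?thesis by blast
qed

lemma output_ok_box_representation:
  assumes ok: "output_ok (\<lambda>u v. (u, v) \<in> parcs G) n d X" and G: "pverts G = {..<n}"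
    and s: "R 0 = d + 1" "R 1 = 0" "\<And>a. a < n * (2 * d + 2) \<Longrightarrow> M a = X a"
  shows "box_representation G (d + 1) (output_box (R, M))"
proof -
  have addr: "2 * ((d + 1) * v + i) < n * (2 * d + 2)" "2 * ((d + 1) * v + i) + 1 < n * (2 * d + 2)"
    if "v < n" "i < d + 1" for v i
  proof -
    have "(d + 1) * v + i < (d + 1) * Suc v" using that by simp
    also have "\<dots> \<le> (d + 1) * n" using that by (intro mult_le_mono2) simp
    finally have less: "(d + 1) * v + i < (d + 1) * n" .
    have "2 * x + 2 \<le> 2 * y" if "x < y" for x y :: nat using that by simp
    from this[OF less] have "2 * ((d + 1) * v + i) + 2 \<le> 2 * ((d + 1) * n)" .
    moreover have "2 * ((d + 1) * n) = n * (2 * d + 2)" by (simp add: algebra_simps)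
    ultimately show "2 * ((d + 1) * v + i) < n * (2 * d + 2)" "2 * ((d + 1) * v + i) + 1 < n * (2 * d + 2)"
      by linarith+
  qed
  define lo hi where "lo v i = real (X (2 * ((d + 1) * v + i)))" and "hi v i = real (X (2 * ((d + 1) * v + i) + 1))" for v i
  have box: "output_box (R, M) v = (\<Pi>\<^sub>E i\<in>{..<d + 1}. {lo v i..hi v i})" if "v < n" for v
    unfolding output_box.simps s(1,2) using s(3) addr[OF that] by (intro PiE_cong) (simp add: lo_def hi_def)
  have le: "\<forall>i<d + 1. lo v i \<le> hi v i" if "v < n" for v
    using ok that unfolding output_ok_def lo_def hi_def by simp
  have adj: "(u, v) \<in> parcs G \<longleftrightarrow> (\<forall>i<d + 1. lo u i \<le> hi v i \<and> lo v i \<le> hi u i)" if "u < n" "v < n" "u \<noteq> v" for u v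
    using ok that unfolding output_ok_def lo_def hi_def by simp
  show ?thesis
    unfolding box_representation_def G
  proof (intro conjI ballI impI)
    fix v assume "v \<in> {..<n}"
    then show "is_box (d + 1) (output_box (R, M) v)" unfolding is_box_def using box le by blast
  next
    fix u v assume uv: "u \<in> {..<n}" "v \<in> {..<n}" "u \<noteq> v"
    then show "(u, v) \<in> parcs G \<longleftrightarrow> output_box (R, M) u \<inter> output_box (R, M) v \<noteq> {}"
      using adj[of u v] box[of u] box[of v] PiE_interval_Int_nonempty[OF le[of u] le[of v]] by simp
  qed
qed

lemma path_dec_of_graph:
  assumes G: "pair_graph G" "pverts G = {..<n}"
    and Ws: "path_decomposition G Ws" "pd_width Ws = w"
  shows "path_dec (\<lambda>u v. (u, v) \<in> parcs G) n (w + 1) Ws"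
proof
  interpret pair_graph G by fact
  show "(u, v) \<in> parcs G \<Longrightarrow> (v, u) \<in> parcs G" for u v
    using pair_sym_arcs by (auto simp: symmetric_def dest: symD)
  have U: "\<Union> (set Ws) = {..<n}" using Ws G unfolding path_decomposition_def by simp
  show "finite (Ws ! i) \<and> card (Ws ! i) \<le> w + 1" if "i < length Ws" for i
  proof
    have "Ws ! i \<subseteq> {..<n}" using U nth_mem[OF that] by blast
    then show "finite (Ws ! i)" by (rule finite_subset) simp
    have "card (Ws ! i) \<le> Max (card ` set Ws)" using that by (intro Max_ge) auto
    then show "card (Ws ! i) \<le> w + 1" using Ws(2) unfolding pd_width_def by linarith
  qed
  show "v < n \<longleftrightarrow> (\<exists>i<length Ws. v \<in> Ws ! i)" for v
    using U unfolding set_conv_nth by (auto simp: set_eq_iff)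
  show "\<exists>i<length Ws. u \<in> Ws ! i \<and> v \<in> Ws ! i" if "(u, v) \<in> parcs G" for u v
  proof -
    have "\<exists>W\<in>set Ws. u \<in> W \<and> v \<in> W" using Ws(1) that unfolding path_decomposition_def by blast
    then show ?thesis by (auto simp: in_set_conv_nth)
  qed
  show "v \<in> Ws ! j" if "i \<le> j" "j \<le> l" "l < length Ws" "v \<in> Ws ! i" "v \<in> Ws ! l" for i j l v
    using Ws(1) that unfolding path_decomposition_def by blast
qed

theorem theorem2:
  shows "\<exists>(f :: nat \<Rightarrow> nat) (alg :: prog).
    \<forall>(G :: nat pair_pre_digraph) (adj :: nat list list).
      pair_graph G \<and> pverts G \<noteq> {} \<and> adjacency_lists G adj \<longrightarrow>
      (\<exists>t s. exec (f (pathwidth G) * card (pverts G)) alg (initial_state adj) t s \<and>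
             t \<le> f (pathwidth G) * card (pverts G) \<and>
             output_dim s \<le> boxicity G + 1 \<and>
             box_representation G (output_dim s) (output_box s))"
\<comment> \<open>The bounds refer to the size of a bag, which is at most the width plus
  one.\<close>
proof (rule exI[of _ "\<lambda>w. time_bound (w + 1)"], rule exI[of _ algorithm_prog], intro allI impI, elim conjE)
  fix G :: "nat pair_pre_digraph" and adj :: "nat list list"
  assume G: "pair_graph G" "pverts G \<noteq> {}" and adj: "adjacency_lists G adj"
  interpret G: pair_graph G by fact
  define n where "n = length adj"
  define k where "k = pathwidth G + 1"
  define b where "b = small_bound k"
  define E where "E = (\<lambda>u v. (u, v) \<in> parcs G)"
  have V: "pverts G = {..<n}" using adj by (simp add: adjacency_lists_def n_def)
  have n: "n \<ge> 1" using G(2) V by (cases n) auto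
  obtain Ws where Ws: "path_decomposition G Ws" "pd_width Ws = pathwidth G" using pathwidth_attained[OF G(1)] by blast
  define F where "F = n + 2 + length (concat adj)"
  define m where "m = F + (n + 2) * (2 * b + 8)"
  define inp where "inp = snd (initial_state adj)"
  interpret P: path_dec E n k Ws unfolding E_def k_def by (rule path_dec_of_graph[OF G(1) V Ws])
  interpret GI: graph_input E n k Ws adj
  proof
    show "set (adj ! v) = {w. E v w}" "distinct (adj ! v)" if "v < n" for v
      using adj that unfolding adjacency_lists_def n_def E_def by auto
    show "\<not> E v v" for v unfolding E_def using G.pair_no_loops[of "(v, v)"] by auto
  qed (use n in \<open>simp_all add: n_def\<close>)
  have len: "length (input_words adj) = F" by (simp add: input_words_def F_def n_def)
  have inp_eq: "inp a = (if a < F then input_words adj ! a else 0)" for a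
    unfolding inp_def initial_state_def using len by simp
  have pow: "2 ^ (2 * k + 1) \<le> b" by (simp add: b_def small_bound_def height_bound_def Let_def)
  interpret A: algorithm E n k Ws adj F m b inp
  proof
    show "F \<le> m" "1 \<le> m" by (simp_all add: m_def)
    have "2 * b + 8 \<le> (n + 2) * (2 * b + 8)" by simp
    then show "b \<le> m" unfolding m_def by linarith
    show "inp 0 = n" by (simp add: inp_eq F_def input_words_def n_def)
    show "inp (Suc v) = n + 2 + length (concat (take v adj))" if "v \<le> n" for v
      using that by (simp add: inp_eq F_def input_words_def n_def nth_append del: upt_Suc)
    show "inp (n + 2 + i) = concat adj ! i" if "i < length (concat adj)" for i
      using that by (simp add: inp_eq F_def input_words_def n_def nth_append del: upt_Suc)
    show "F = n + 2 + length (concat adj)" by (rule F_def)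
    show "2 ^ (2 * k + 1) \<le> b" by (rule pow)
    show "F + (n + 2) * (2 * b + 8) \<le> m" by (simp add: m_def)
  qed
  \<comment> \<open>The statement uses the same function as word bound and as time bound, so
    \<open>W\<close> has to be large enough for both purposes.\<close>
  define W where "W = time_bound k * n"
  have m_le: "m \<le> number_bound k * n"
  proof -
    have "length (concat adj) = (\<Sum>v<n. length (adj ! v))"
      by (simp add: length_concat sum_list_sum_nth n_def atLeast0LessThan)
    then have "length (concat adj) \<le> 2 * (k * n)" using GI.sum_deg by simp
    moreover have "(n + 2) * (2 * b + 8) \<le> (3 * n) * (2 * b + 8)" using n by (intro mult_le_mono1) simp
    moreover have "number_bound k * n = 3 * n + 2 * (k * n) + (3 * n) * (2 * b + 8)"
      by (simp add: number_bound_def b_def algebra_simps)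
    ultimately show ?thesis unfolding m_def F_def using n by linarith
  qed
  let ?c = "cost b main_com"
  have W_eq: "W = (?c + 30) * (number_bound k * n) + ?c * (1 + iterations k b) * n + 14 * (number_bound k * n) + 20 * n"
    unfolding W_def time_bound_def b_def by (simp add: algebra_simps)
  have cm: "(?c + 30) * m \<le> (?c + 30) * (number_bound k * n)" by (rule mult_le_mono2[OF m_le])
  have W_c: "?c * m \<le> W" and W_m: "30 * m \<le> W"
    using cm unfolding W_eq add_mult_distrib by linarith+
  have huge: "(2 * A.H * A.H + 1) ^ (2 * A.H * A.H) + 2 * A.H * A.H \<le> b"
    by (simp add: b_def small_bound_def height_bound_def Let_def)
  obtain \<tau> R1 A1 where bs: "A.bs main_com (\<lambda>_. 0, \<lambda>_ _. 0) \<tau> (R1, A1)"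
    and post: "0 + \<tau> \<le> n * iterations k b" "\<exists>d. R1 0 = Suc d \<and> R1 1 = 0 \<and> R1 10 = n * (2 * d + 2) \<and>
      n * (2 * d + 2) \<le> m \<and> output_ok E n d (A1 13) \<and> (\<forall>d0 lo hi. interval_rep E n d0 lo hi \<longrightarrow> d \<le> d0)"
    using A.wp_main[OF huge] unfolding A.wp_def by blast
  then have tau: "\<tau> \<le> n * iterations k b" by simp
  obtain d where R1: "R1 0 = Suc d" "R1 1 = 0" "R1 10 = n * (2 * d + 2)"
    and Jm: "n * (2 * d + 2) \<le> m" and ok: "output_ok E n d (A1 13)"
    and minimal: "\<And>d0 lo hi. interval_rep E n d0 lo hi \<Longrightarrow> d \<le> d0"
    using post(2) by blast
  define M0 where "M0 = inp"
  define R0 :: "nat \<Rightarrow> nat" where "R0 = (\<lambda>_. 0)(200 := 0, 201 := Suc n, 202 := 1, 100 := F)"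
  have init: "initial_state adj = (\<lambda>_. 0, M0)" by (simp add: M0_def inp_def initial_state_def)
  have mW: "1 \<le> m" "n + 2 \<le> m" "F \<le> m" using A.m_bounds A.m_pos A.F_le by auto
  have i1: "inp (Suc n) = F" using A.inp_ptr[of n] by (simp add: F_def n_def)
  have pro: "exec W prologue (initial_state adj) (1 + (1 + (1 + (1 + 1)))) (R0, M0)"
    unfolding prologue_def init
    apply (rule exec.Seq, rule exec_Const', simp)
    apply (rule exec.Seq, rule exec_Load')
    using W_m mW A.inp_n apply (simp add: M0_def)
    apply (rule exec.Seq, rule exec_Const')
    using W_m mW apply simp
    apply (rule exec.Seq, rule exec_Add')
    using W_m mW A.inp_n apply (simp add: M0_def)
    apply (rule back_subst[of "exec W _ _ _"], rule exec_Load')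
    using W_m mW A.inp_n i1 by (auto simp: M0_def R0_def fun_eq_iff)
  \<comment> \<open>Behind the input the memory is 0, so all arrays start as zero functions.\<close>
  have rel0: "A.rel (\<lambda>_. 0, \<lambda>_ _. 0) (R0, M0)"
    unfolding A.rel_def by (auto simp: R0_def M0_def array_view_def inp_eq)
  obtain t1 \<sigma>1 where t1: "exec W (compile main_com) (R0, M0) t1 \<sigma>1" "t1 \<le> ?c * (1 + \<tau>)" "A.rel (R1, A1) \<sigma>1"
    using A.compile_correct[OF bs wf_main W_c rel0] by blast
  obtain Rr M1 where \<sigma>1: "\<sigma>1 = (Rr, M1)" by (cases \<sigma>1)
  have rel: "\<forall>x<100. Rr x = R1 x" "Rr 100 = F" "\<forall>i. array_view F M1 13 i = A1 13 i \<and> A1 13 i \<le> m"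
    using t1(3) unfolding \<sigma>1 A.rel_def by auto
  let ?J = "n * (2 * d + 2)"
  \<comment> \<open>The constant 30 in \<open>time_bound\<close> consists of 1 for \<open>F\<close>,
    16 for the stride of the arrays and 13 for the array number.\<close>
  have addr: "F + 16 * (0 + j) + 13 \<le> W" if "j \<le> m" for j
  proof -
    have "F + 16 * j + 13 \<le> m + 16 * m + 13 * m" using mW(1,3) that by simp
    also have "\<dots> = 30 * m" by simp
    finally show ?thesis using W_m by simp
  qed
  let ?Rr = "Rr(300 := 0, 301 := 1)"
  have "\<exists>Rr' M'. exec W (While 10 copy_body) (?Rr, M1) (14 * ?J + 1) (Rr', M') \<and> Rr' 0 = ?Rr 0 \<and> Rr' 1 = ?Rr 1 \<and>
    (\<forall>a<0 + ?J. M' a = A1 13 a)"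
  proof (rule exec_copy[where F = F])
    show "\<forall>a\<ge>0. M1 (F + 16 * a + 13) = A1 13 a" using rel(3) by (simp add: array_view_def)
    show "\<forall>a. A1 13 a \<le> W"
    proof
      fix a show "A1 13 a \<le> W" using rel(3)[THEN spec, of a] W_m by linarith
    qed
    show "F + 16 * (0 + ?J) + 13 \<le> W" by (rule addr[OF Jm])
  qed (use rel R1 in auto)
  then obtain R2 M2 where copy: "exec W (While 10 copy_body) (?Rr, M1) (14 * ?J + 1) (R2, M2)"
    "R2 0 = Suc d" "R2 1 = 0" "\<And>a. a < ?J \<Longrightarrow> M2 a = A1 13 a" using rel(1) R1 by auto
  have epi: "exec W epilogue (Rr, M1) (1 + (1 + (14 * ?J + 1))) (R2, M2)"
    unfolding epilogue_def
    apply (rule exec.Seq, rule exec_Const', simp)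
    apply (rule exec.Seq, rule exec_Const')
    using W_m mW copy(1) by auto
  let ?t = "(1 + (1 + (1 + (1 + 1)))) + (t1 + (1 + (1 + (14 * ?J + 1))))"
  have run: "exec W algorithm_prog (initial_state adj) ?t (R2, M2)"
    unfolding algorithm_prog_def by (rule exec.Seq[OF pro exec.Seq[OF t1(1)[unfolded \<sigma>1] epi]])
  have "?t \<le> W"
  proof -
    have "?c * (1 + \<tau>) \<le> ?c * (n + n * iterations k b)" using tau n by (intro mult_le_mono2) simp
    also have "\<dots> = ?c * (1 + iterations k b) * n" by (simp add: algebra_simps)
    finally have "t1 \<le> ?c * (1 + iterations k b) * n" using t1(2) by linarith
    moreover have "?J \<le> number_bound k * n" using Jm m_le by linarith
    ultimately show ?thesis unfolding W_eq using n by linarith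
  qed
  moreover have "d \<le> boxicity G"
  proof -
    obtain B where "box_representation G (boxicity G) B" using boxicity_attained[OF G(1)] by blast
    then obtain lo hi where "interval_rep E n (boxicity G) lo hi"
      using box_representation_interval_rep[OF _ V] unfolding E_def by blast
    then show ?thesis by (rule minimal)
  qed
  moreover have "box_representation G (d + 1) (output_box (R2, M2))"
    by (rule output_ok_box_representation[OF ok[unfolded E_def] V]) (use copy in auto)
  ultimately show "\<exists>t s. exec (time_bound (pathwidth G + 1) * card (pverts G)) algorithm_prog (initial_state adj) t s \<and>
      t \<le> time_bound (pathwidth G + 1) * card (pverts G) \<and> output_dim s \<le> boxicity G + 1 \<and>
      box_representation G (output_dim s) (output_box s)"
    using run copy(2) V unfolding W_def k_def[symmetric]
    by (intro exI[of _ ?t] exI[of _ "(R2, M2)"]) simp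
qed

end
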